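(* Let $(X(t),\alpha(t))$ be the regime-switching jump diffusion with state-dependent switching described in the context. Assume that: (1) for each $i\in\mathcal M$ there is $V_0(\cdot,i)\in C^2(\mathbb R^r;\mathbb R_+)$ and there exists $\beta>0$ with $\mathcal GV_0(x,i)\le-\beta V_0(x,i)$ for all $x\in\mathbb R^r$, $i\in\mathcal M$, and $\inf_{|x|\ge R,\,i\in\mathcal M}V_0(x,i)\to\infty$ as $R\to\infty$; (2) with $V(z)=z'z$ for $z\in\mathbb R^{mr}$, there exists $\tilde\beta>0$ such that $$\tilde{\mathcal G}V(\tilde x^i-\tilde y^j)\le-\tilde\beta\,V(\tilde x^i-\tilde y^j)\quad\text{for all }x,y\in\mathbb R^r,\ i,j\in\mathcal M.$$ Then the following hold. (P1) For every $(x,\alpha)\in\mathbb R^r\times\mathcal M$ and $\varepsilon>0$ there is $R>0$ such that $P\{|X^{x,\alpha}(t)|\ge R\}<\varepsilon$ for all $t\ge0$. (P2') For every $\varepsilon>0$ and every compact $C\subset\mathbb R^r$ there is $T=T(\varepsilon,C)>0$ such that $E|\tilde X^{x_0,i_0}(t)-\tilde X^{y_0,j_0}(t)|<\varepsilon$ for all $t\ge T$ whenever $(x_0,i_0,y_0,j_0)\in C\times\mathcal M\times C\times\mathcal M$.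
   Context: Setting. $\mathcal M=\{1,\dots,m\}$, $\Gamma\subset\mathbb R^r\setminus\{0\}$. $b:\mathbb R^r\times\mathcal M\to\mathbb R^r$, $\sigma:\mathbb R^r\times\mathcal M\to\mathbb R^{r\times d}$, $g:\mathbb R^r\times\mathcal M\times\Gamma\to\mathbb R^r$ grow at most linearly in $x$ and are Lipschitz in $x$: $|b(x,i)-b(y,i)|+|\sigma(x,i)-\sigma(y,i)|\le K_0|x-y|$, $|g(x,i,\gamma)-g(y,i,\gamma)|\le K_0|x-y|$ for all $x,y,i,\gamma$ and some $K_0>0$. It is not assumed that $0$ is an equilibrium point. $w$ is a $d$-dimensional standard Brownian motion; $N(dt,d\gamma)$ is a Poisson random measure on $[0,\infty)\times\Gamma$ with intensity $\lambda\,dt\,\pi(d\gamma)$, $0<\lambda<\infty$, $\pi$ a probability measure; $N_1(dt,dz)$ is a Poisson random measure on $[0,\infty)\times\mathbb R$ with intensity $dt\times\tilde m(dz)$, $\tilde m$ Lebesgue measure; $w,N,N_1$ are independent. $Q(x)=(q_{ij}(x))$ has Borel measurable, uniformly bounded entries, $q_{ij}(x)\ge0$ for $i\ne j$, $q_{ii}(x)=-\sum_{j\ne i}q_{ij}(x)$. For $i\ne j$, $\Delta_{ij}(x)$ are consecutive (lexicographic order of $(i,j)$, starting from $0$) left-closed right-open intervals of length $q_{ij}(x)$; $h(x,i,z)=\sum_{j\ne i}(j-i)I_{\{z\in\Delta_{ij}(x)\}}$. The process $(X,\alpha)=(X^{x,\alpha},\alpha^{x,\alpha})$ solves $$dX(t)=b(X(t),\alpha(t))dt+\sigma(X(t),\alpha(t))dw(t)+\int_\Gamma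 g(X(t^-),\alpha(t^-),\gamma)N(dt,d\gamma),\quad d\alpha(t)=\int_{\mathbb R}h(X(t),\alpha(t^-),z)N_1(dt,dz),$$ $X(0)=x$, $\alpha(0)=\alpha$; processes with different initial data are driven by the same $w,N,N_1$. Generator of $(X,\alpha)$: $$\mathcal Gf(x,i)=\tfrac12\mathrm{tr}(\sigma\sigma'(x,i)Hf(x,i))+b'(x,i)\nabla f(x,i)+\sum_{j\in\mathcal M}q_{ij}(x)f(x,j)+\lambda\int_\Gamma[f(x+g(x,i,\gamma),i)-f(x,i)]\pi(d\gamma).$$ Embedding. For $x\in\mathbb R^r$, $i\in\mathcal M$, let $\tilde x^i\in\mathbb R^{mr}$ be the vector consisting of $m$ blocks of size $r$ whose $i$-th block is $x$ and whose other blocks are $0$. Similarly $\tilde b(x,i)\in\mathbb R^{mr}$, $\tilde g(x,i,\gamma)\in\mathbb R^{mr}$, $\tilde\sigma(x,i)\in\mathbb R^{mr\times d}$ have $b(x,i)$, $g(x,i,\gamma)$, $\sigma(x,i)$ as $i$-th ($r$-row) block and zeros elsewhere. Set $\tilde X(t)=[X'(t)I_{\{\alpha(t)=1\}},\dots,X'(t)I_{\{\alpha(t)=m\}}]'\in\mathbb R^{mr}$, written $\tilde X^{x,\alpha}(t)$ for initial data $(x,\alpha)$. Let $\tilde a(\tilde x^i,\tilde y^j)=(\tilde\sigma(x,i)-\tilde\sigma(y,j))(\tilde\sigma(x,i)-\tilde\sigma(y,j))'$. For $f\in C^2(\mathbb R^{mr})$, $$\tilde{\mathcal G}f(\tilde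 x^i-\tilde y^j)=\tilde{\mathcal L}f(\tilde x^i-\tilde y^j)+\lambda\int_\Gamma[f(\tilde x^i+\tilde g(x,i,\gamma)-\tilde y^j-\tilde g(y,j,\gamma))-f(\tilde x^i-\tilde y^j)]\pi(d\gamma),$$ $$\begin{aligned}\tilde{\mathcal L}f(\tilde x^i-\tilde y^j)=&\tfrac12\mathrm{tr}(\tilde a(\tilde x^i,\tilde y^j)Hf(\tilde x^i-\tilde y^j))+(\tilde b(x,i)-\tilde b(y,j))'\nabla f(\tilde x^i-\tilde y^j)\\&+\sum_{k=1}^mq_{ik}(x)f(\tilde x^k-\tilde y^j)+\sum_{k=1}^mq_{jk}(y)f(\tilde x^i-\tilde y^k)\\&+\sum_{k\ne i}\sum_{l\ne j}\tilde m(\Delta_{ik}(x)\cap\Delta_{jl}(y))\,[f(\tilde x^k-\tilde y^l)-f(\tilde x^i-\tilde y^l)-f(\tilde x^k-\tilde y^j)+f(\tilde x^i-\tilde y^j)].\end{aligned}$$ Here $\nabla,H$ denote gradient and Hessian and $'$ is transpose. *)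

theory Defs
  imports "HOL-Probability.Probability"
begin

section \<open>Differential calculus\<close>

definition gradient :: "(real^'n \<Rightarrow> real) \<Rightarrow> real^'n \<Rightarrow> real^'n" where
  "gradient f x = (\<chi> k. frechet_derivative f (at x) (axis k 1))"

definition hessian :: "(real^'n \<Rightarrow> real) \<Rightarrow> real^'n \<Rightarrow> real^'n^'n" where
  "hessian f x = (\<chi> k l. frechet_derivative (\<lambda>y. gradient f y $ k) (at x) (axis l 1))"

definition C2 :: "(real^'n \<Rightarrow> real) \<Rightarrow> bool" where
  "C2 f \<longleftrightarrow> (\<forall>x. f differentiable (at x)) \<and> (\<forall>x. gradient f differentiable (at x))
     \<and> continuous_on UNIV (hessian f)"


section \<open>Driving noise\<close>

text \<open>A filtration indexed by \<open>[0,\<infinity>)\<close> is represented by the library locale \<open>filtration\<close>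
  over all real times; only the members with nonnegative index are ever used.\<close>

definition filtered_prob_space :: "'w measure \<Rightarrow> (real \<Rightarrow> 'w measure) \<Rightarrow> bool" where
  "filtered_prob_space M F \<longleftrightarrow>
     prob_space M \<and> filtration (space M) F \<and> (\<forall>t\<ge>0. subalgebra M (F t))"

definition standard_brownian_motion ::
  "'w measure \<Rightarrow> (real \<Rightarrow> 'w measure) \<Rightarrow> (real \<Rightarrow> 'w \<Rightarrow> real^'d) \<Rightarrow> bool" where
  "standard_brownian_motion M F w \<longleftrightarrow>
     (\<forall>t\<ge>0. w t \<in> borel_measurable (F t)) \<and>
     (AE \<omega> in M. w 0 \<omega> = 0) \<and>
     (AE \<omega> in M. continuous_on {0..} (\<lambda>t. w t \<omega>)) \<and>
     (\<forall>s t. 0 \<le> s \<and> s < t \<longrightarrow>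
        prob_space.indep_set M (sets (F s))
          {(\<lambda>\<omega>. w t \<omega> - w s \<omega>) -` B \<inter> space M | B. B \<in> sets borel} \<and>
        prob_space.indep_vars M (\<lambda>_. borel) (\<lambda>k \<omega>. (w t \<omega> - w s \<omega>) $ k) UNIV \<and>
        (\<forall>k. distributed M lborel (\<lambda>\<omega>. (w t \<omega> - w s \<omega>) $ k) (normal_density 0 (sqrt (t - s)))))"

definition brownian_events :: "'w measure \<Rightarrow> (real \<Rightarrow> 'w \<Rightarrow> real^'d) \<Rightarrow> 'w set set" where
  "brownian_events M w =
     sigma_sets (space M) {w t -` B \<inter> space M | t B. 0 \<le> t \<and> B \<in> sets borel}"

text \<open>\<open>prm_intensity \<nu>\<close> is the measure \<open>dt \<times> \<nu>(de)\<close> on \<open>[0,\<infinity>) \<times> space \<nu>\<close>.\<close>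

definition prm_intensity :: "'e measure \<Rightarrow> (real \<times> 'e) measure" where
  "prm_intensity \<nu> = restrict_space lborel {0..} \<Otimes>\<^sub>M \<nu>"

text \<open>The sigma-algebra generated by a random measure \<open>N\<close> during the time set \<open>T\<close>.\<close>

definition prm_events ::
  "'w measure \<Rightarrow> 'e measure \<Rightarrow> ('w \<Rightarrow> (real \<times> 'e) measure) \<Rightarrow> real set \<Rightarrow> 'w set set" where
  "prm_events M \<nu> N T =
     sigma_sets (space M) {(\<lambda>\<omega>. emeasure (N \<omega>) A) -` B \<inter> space M | A B.
       A \<in> sets (prm_intensity \<nu>) \<and> A \<subseteq> T \<times> space \<nu> \<and> B \<in> sets borel}"

definition poisson_random_measure ::
  "'w measure \<Rightarrow> (real \<Rightarrow> 'w measure) \<Rightarrow> 'e measure \<Rightarrow> ('w \<Rightarrow> (real \<times> 'e) measure) \<Rightarrow> bool" where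
  "poisson_random_measure M F \<nu> N \<longleftrightarrow>
     (\<forall>\<omega>\<in>space M. sets (N \<omega>) = sets (prm_intensity \<nu>)) \<and>
     (\<forall>\<omega>\<in>space M. \<forall>A\<in>sets (prm_intensity \<nu>).
        emeasure (N \<omega>) A \<in> insert \<infinity> (range of_nat)) \<and>
     (\<forall>A\<in>sets (prm_intensity \<nu>). (\<lambda>\<omega>. emeasure (N \<omega>) A) \<in> borel_measurable M) \<and>
     (\<forall>A\<in>sets (prm_intensity \<nu>). emeasure (prm_intensity \<nu>) A < \<infinity> \<longrightarrow>
        (\<forall>n. measure M {\<omega>\<in>space M. emeasure (N \<omega>) A = of_nat n}
             = exp (- measure (prm_intensity \<nu>) A) * measure (prm_intensity \<nu>) A ^ n / fact n)) \<and>
     (\<forall>(A :: nat \<Rightarrow> (real \<times> 'e) set) I. finite I \<and> disjoint_family_on A I \<and>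
        (\<forall>k\<in>I. A k \<in> sets (prm_intensity \<nu>)) \<longrightarrow>
        prob_space.indep_vars M (\<lambda>_. borel) (\<lambda>k \<omega>. emeasure (N \<omega>) (A k)) I) \<and>
     (\<forall>t\<ge>0. prm_events M \<nu> N {0..t} \<subseteq> sets (F t)) \<and>
     (\<forall>t\<ge>0. prob_space.indep_set M (sets (F t)) (prm_events M \<nu> N {t<..}))"

definition independent_noise ::
  "'w measure \<Rightarrow> (real \<Rightarrow> 'w \<Rightarrow> real^'d) \<Rightarrow> 'e measure \<Rightarrow> ('w \<Rightarrow> (real \<times> 'e) measure)
     \<Rightarrow> 'f measure \<Rightarrow> ('w \<Rightarrow> (real \<times> 'f) measure) \<Rightarrow> bool" where
  "independent_noise M w \<nu> N \<nu>1 N1 \<longleftrightarrow>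
     prob_space.indep_sets M
       (\<lambda>k::nat. [brownian_events M w, prm_events M \<nu> N {0..}, prm_events M \<nu>1 N1 {0..}] ! k)
       {0, 1, 2}"


section \<open>Brownian stochastic integral\<close>

text \<open>Convergence to zero in probability. Measurability is demanded because \<open>measure M A = 0\<close>
  for sets \<open>A\<close> that are not measurable.\<close>

definition tendsto_zero_in_prob :: "'w measure \<Rightarrow> (nat \<Rightarrow> 'w \<Rightarrow> ennreal) \<Rightarrow> bool" where
  "tendsto_zero_in_prob M Z \<longleftrightarrow>
     (\<forall>p. Z p \<in> borel_measurable M) \<and>
     (\<forall>\<epsilon>>0. (\<lambda>p. measure M {\<omega>\<in>space M. ennreal \<epsilon> < Z p \<omega>}) \<longlonglongrightarrow> 0)"

text \<open>The triple \<open>n\<close>, \<open>\<tau>\<close>, \<open>\<xi>\<close> represents the elementary integrand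
  \<open>\<Sum>k<n. \<xi>\<^sub>k 1\<^bsub>(\<tau>\<^sub>k, \<tau>\<^sub>k\<^sub>+\<^sub>1]\<^esub>\<close> with bounded \<open>F (\<tau>\<^sub>k)\<close>-measurable coefficients.\<close>

definition elementary_integrand ::
  "'w measure \<Rightarrow> (real \<Rightarrow> 'w measure) \<Rightarrow> nat \<Rightarrow> (nat \<Rightarrow> real) \<Rightarrow> (nat \<Rightarrow> 'w \<Rightarrow> real^'d^'r) \<Rightarrow> bool"
  where
  "elementary_integrand M F n \<tau> \<xi> \<longleftrightarrow>
     0 \<le> \<tau> 0 \<and> (\<forall>k<n. \<tau> k \<le> \<tau> (Suc k)) \<and>
     (\<forall>k<n. \<xi> k \<in> borel_measurable (F (\<tau> k))) \<and>
     (\<exists>c. \<forall>k<n. \<forall>\<omega>\<in>space M. norm (\<xi> k \<omega>) \<le> c)"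

definition elementary_value ::
  "nat \<Rightarrow> (nat \<Rightarrow> real) \<Rightarrow> (nat \<Rightarrow> 'w \<Rightarrow> real^'d^'r) \<Rightarrow> real \<Rightarrow> 'w \<Rightarrow> real^'d^'r" where
  "elementary_value n \<tau> \<xi> s \<omega> = (\<Sum>k<n. indicator {\<tau> k<..\<tau> (Suc k)} s *\<^sub>R \<xi> k \<omega>)"

definition elementary_integral ::
  "(real \<Rightarrow> 'w \<Rightarrow> real^'d) \<Rightarrow> nat \<Rightarrow> (nat \<Rightarrow> real) \<Rightarrow> (nat \<Rightarrow> 'w \<Rightarrow> real^'d^'r)
     \<Rightarrow> real \<Rightarrow> 'w \<Rightarrow> real^'r" where
  "elementary_integral w n \<tau> \<xi> t \<omega> =
     (\<Sum>k<n. \<xi> k \<omega> *v (w (min (\<tau> (Suc k)) t) \<omega> - w (min (\<tau> k) t) \<omega>))"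

text \<open>\<open>has_ito_integral M F w H t J\<close>: the random variable \<open>J\<close> is (a version of)
  \<open>\<integral>\<^sub>0\<^sup>t H(s) dw(s)\<close>, the limit in probability of the elementary integrals of elementary
  integrands \<open>H\<^sub>p\<close> such that \<open>\<integral>\<^sub>0\<^sup>t |H\<^sub>p(s) - H(s)|\<^sup>2 ds\<close> tends to zero in probability.\<close>

definition has_ito_integral ::
  "'w measure \<Rightarrow> (real \<Rightarrow> 'w measure) \<Rightarrow> (real \<Rightarrow> 'w \<Rightarrow> real^'d) \<Rightarrow> (real \<Rightarrow> 'w \<Rightarrow> real^'d^'r)
     \<Rightarrow> real \<Rightarrow> ('w \<Rightarrow> real^'r) \<Rightarrow> bool" where
  "has_ito_integral M F w H t J \<longleftrightarrow>
     J \<in> borel_measurable M \<and>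
     (\<exists>n \<tau> \<xi>. (\<forall>p. elementary_integrand M F (n p) (\<tau> p) (\<xi> p)) \<and>
        tendsto_zero_in_prob M (\<lambda>p \<omega>.
          \<integral>\<^sup>+s\<in>{0..t}. ennreal ((norm (elementary_value (n p) (\<tau> p) (\<xi> p) s \<omega> - H s \<omega>))\<^sup>2) \<partial>lborel) \<and>
        tendsto_zero_in_prob M (\<lambda>p \<omega>.
          ennreal (norm (elementary_integral w (n p) (\<tau> p) (\<xi> p) t \<omega> - J \<omega>))))"


section \<open>Regime-switching jump diffusions\<close>

text \<open>The set of regimes is an arbitrary finite linearly ordered type; \<open>state_number\<close> is its
  order isomorphism onto \<open>{1,\<dots>,m}\<close>, \<open>m\<close> being the cardinality of the type.\<close>

definition state_number :: "'m::{finite,linorder} \<Rightarrow> real" where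
  "state_number i = real (card {k. k \<le> i})"

definition switch_interval ::
  "(real^'r \<Rightarrow> 'm::{finite,linorder} \<Rightarrow> 'm \<Rightarrow> real) \<Rightarrow> real^'r \<Rightarrow> 'm \<Rightarrow> 'm \<Rightarrow> real set" where
  "switch_interval q x i j =
     (let a = (\<Sum>(k, l)\<in>{(k, l). k \<noteq> l \<and> (k < i \<or> (k = i \<and> l < j))}. q x k l)
      in {a ..< a + q x i j})"

definition switch_h ::
  "(real^'r \<Rightarrow> 'm::{finite,linorder} \<Rightarrow> 'm \<Rightarrow> real) \<Rightarrow> real^'r \<Rightarrow> 'm \<Rightarrow> real \<Rightarrow> real" where
  "switch_h q x i z =
     (\<Sum>j\<in>UNIV - {i}. (state_number j - state_number i) * indicator (switch_interval q x i j) z)"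

definition switching_rates :: "(real^'r \<Rightarrow> 'm::finite \<Rightarrow> 'm \<Rightarrow> real) \<Rightarrow> bool" where
  "switching_rates q \<longleftrightarrow>
     (\<forall>i j. (\<lambda>x. q x i j) \<in> borel_measurable borel) \<and>
     (\<exists>c. \<forall>x i j. \<bar>q x i j\<bar> \<le> c) \<and>
     (\<forall>x i j. i \<noteq> j \<longrightarrow> 0 \<le> q x i j) \<and>
     (\<forall>x i. q x i i = - (\<Sum>j\<in>UNIV - {i}. q x i j))"

text \<open>Left limits, with the convention \<open>f(0-) = f(0)\<close>.\<close>

definition left_limit :: "(real \<Rightarrow> 'b::t2_space) \<Rightarrow> real \<Rightarrow> 'b" where
  "left_limit f t = (if t \<le> 0 then f 0 else Lim (at_left t) f)"

definition left_state :: "(real \<Rightarrow> 'm) \<Rightarrow> real \<Rightarrow> 'm" where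
  "left_state a t = (if t \<le> 0 then a 0 else (THE i. \<forall>\<^sub>F s in at_left t. a s = i))"

definition cadlag :: "(real \<Rightarrow> 'b::t2_space) \<Rightarrow> bool" where
  "cadlag f \<longleftrightarrow>
     (\<forall>t\<ge>0. (f \<longlongrightarrow> f t) (at_right t)) \<and> (\<forall>t>0. \<exists>l. (f \<longlongrightarrow> l) (at_left t))"

text \<open>The same notion for the discrete topology on the set of regimes.\<close>

definition cadlag_state :: "(real \<Rightarrow> 'm) \<Rightarrow> bool" where
  "cadlag_state a \<longleftrightarrow>
     (\<forall>t\<ge>0. \<forall>\<^sub>F s in at_right t. a s = a t) \<and> (\<forall>t>0. \<exists>i. \<forall>\<^sub>F s in at_left t. a s = i)"

text \<open>The integrals against \<open>N\<close> and \<open>N1\<close> are Lebesgue integrals with respect to the realized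
  measures \<open>N \<omega>\<close> and \<open>N1 \<omega>\<close>; for bounded rates and \<open>\<gamma>\<close>-uniform linear growth
  the integrands are almost surely bounded and nonzero only on a set of finite realized measure.\<close>

definition regime_switching_solution ::
  "'w measure \<Rightarrow> (real \<Rightarrow> 'w measure) \<Rightarrow> (real \<Rightarrow> 'w \<Rightarrow> real^'d)
     \<Rightarrow> ('w \<Rightarrow> (real \<times> (real^'r)) measure) \<Rightarrow> ('w \<Rightarrow> (real \<times> real) measure)
     \<Rightarrow> (real^'r) set
     \<Rightarrow> (real^'r \<Rightarrow> 'm::{finite,linorder} \<Rightarrow> real^'r) \<Rightarrow> (real^'r \<Rightarrow> 'm \<Rightarrow> real^'d^'r)
     \<Rightarrow> (real^'r \<Rightarrow> 'm \<Rightarrow> real^'r \<Rightarrow> real^'r) \<Rightarrow> (real^'r \<Rightarrow> 'm \<Rightarrow> 'm \<Rightarrow> real)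
     \<Rightarrow> real^'r \<Rightarrow> 'm \<Rightarrow> (real \<Rightarrow> 'w \<Rightarrow> real^'r) \<Rightarrow> (real \<Rightarrow> 'w \<Rightarrow> 'm) \<Rightarrow> bool" where
  "regime_switching_solution M F w N N1 \<Gamma> b \<sigma> g q x i X \<alpha> \<longleftrightarrow>
     (\<forall>t\<ge>0. X t \<in> borel_measurable (F t)) \<and>
     (\<forall>t\<ge>0. \<alpha> t \<in> measurable (F t) (count_space UNIV)) \<and>
     (\<forall>\<omega>\<in>space M. cadlag (\<lambda>t. X t \<omega>) \<and> cadlag_state (\<lambda>t. \<alpha> t \<omega>)) \<and>
     (AE \<omega> in M. X 0 \<omega> = x \<and> \<alpha> 0 \<omega> = i) \<and>
     (\<forall>t\<ge>0. \<exists>J. has_ito_integral M F w (\<lambda>s \<omega>. \<sigma> (X s \<omega>) (\<alpha> s \<omega>)) t J \<and>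
        (AE \<omega> in M. X t \<omega> =
           x + (LINT s:{0..t}|lborel. b (X s \<omega>) (\<alpha> s \<omega>)) + J \<omega> +
           (LINT p:({0..t} \<times> \<Gamma>)|N \<omega>.
              g (left_limit (\<lambda>s. X s \<omega>) (fst p)) (left_state (\<lambda>s. \<alpha> s \<omega>) (fst p)) (snd p)))) \<and>
     (\<forall>t\<ge>0. AE \<omega> in M. state_number (\<alpha> t \<omega>) =
        state_number i +
        (LINT p:({0..t} \<times> UNIV)|N1 \<omega>.
           switch_h q (X (fst p) \<omega>) (left_state (\<lambda>s. \<alpha> s \<omega>) (fst p)) (snd p)))"

definition rs_generator ::
  "(real^'r \<Rightarrow> 'm::finite \<Rightarrow> real^'r) \<Rightarrow> (real^'r \<Rightarrow> 'm \<Rightarrow> real^'d^'r)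
     \<Rightarrow> (real^'r \<Rightarrow> 'm \<Rightarrow> real^'r \<Rightarrow> real^'r) \<Rightarrow> (real^'r \<Rightarrow> 'm \<Rightarrow> 'm \<Rightarrow> real)
     \<Rightarrow> real \<Rightarrow> (real^'r) measure \<Rightarrow> (real^'r \<Rightarrow> 'm \<Rightarrow> real) \<Rightarrow> real^'r \<Rightarrow> 'm \<Rightarrow> real" where
  "rs_generator b \<sigma> g q lam \<pi> f x i =
     1/2 * trace (\<sigma> x i ** transpose (\<sigma> x i) ** hessian (\<lambda>y. f y i) x)
     + b x i \<bullet> gradient (\<lambda>y. f y i) x
     + (\<Sum>j\<in>UNIV. q x i j * f x j)
     + lam * (\<integral>\<gamma>. f (x + g x i \<gamma>) i - f x i \<partial>\<pi>)"


section \<open>Block embedding\<close>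

text \<open>The coordinates of \<open>\<real>\<^sup>m\<^sup>r\<close> are indexed by pairs (block, position within the block).\<close>

definition embed_vec :: "'m \<Rightarrow> real^'r \<Rightarrow> real^('m::finite \<times> 'r)" where
  "embed_vec i v = (\<chi> p. if fst p = i then v $ snd p else 0)"

definition embed_mat :: "'m \<Rightarrow> real^'d^'r \<Rightarrow> real^'d^('m::finite \<times> 'r)" where
  "embed_mat i A = (\<chi> p. if fst p = i then A $ snd p else 0)"

text \<open>\<open>coupled_L \<dots> f x i y j\<close> and \<open>coupled_generator \<dots> f x i y j\<close> are the values written
  \<open>\<L>f(x\<^sup>i - y\<^sup>j)\<close> and \<open>\<G>f(x\<^sup>i - y\<^sup>j)\<close>; they depend on \<open>(x, i, y, j)\<close> and
  not only on the difference of the embedded vectors.\<close>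

definition coupled_L ::
  "(real^'r \<Rightarrow> 'm::{finite,linorder} \<Rightarrow> real^'r) \<Rightarrow> (real^'r \<Rightarrow> 'm \<Rightarrow> real^'d^'r)
     \<Rightarrow> (real^'r \<Rightarrow> 'm \<Rightarrow> 'm \<Rightarrow> real) \<Rightarrow> (real^('m \<times> 'r) \<Rightarrow> real)
     \<Rightarrow> real^'r \<Rightarrow> 'm \<Rightarrow> real^'r \<Rightarrow> 'm \<Rightarrow> real" where
  "coupled_L b \<sigma> q f x i y j =
     (let z = embed_vec i x - embed_vec j y;
          D = embed_mat i (\<sigma> x i) - embed_mat j (\<sigma> y j);
          a = D ** transpose D
      in 1/2 * trace (a ** hessian f z)
         + (embed_vec i (b x i) - embed_vec j (b y j)) \<bullet> gradient f z
         + (\<Sum>k\<in>UNIV. q x i k * f (embed_vec k x - embed_vec j y))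
         + (\<Sum>k\<in>UNIV. q y j k * f (embed_vec i x - embed_vec k y))
         + (\<Sum>k\<in>UNIV - {i}. \<Sum>l\<in>UNIV - {j}.
              measure lborel (switch_interval q x i k \<inter> switch_interval q y j l) *
              (f (embed_vec k x - embed_vec l y) - f (embed_vec i x - embed_vec l y)
               - f (embed_vec k x - embed_vec j y) + f (embed_vec i x - embed_vec j y))))"

definition coupled_generator ::
  "(real^'r \<Rightarrow> 'm::{finite,linorder} \<Rightarrow> real^'r) \<Rightarrow> (real^'r \<Rightarrow> 'm \<Rightarrow> real^'d^'r)
     \<Rightarrow> (real^'r \<Rightarrow> 'm \<Rightarrow> real^'r \<Rightarrow> real^'r) \<Rightarrow> (real^'r \<Rightarrow> 'm \<Rightarrow> 'm \<Rightarrow> real)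
     \<Rightarrow> real \<Rightarrow> (real^'r) measure \<Rightarrow> (real^('m \<times> 'r) \<Rightarrow> real)
     \<Rightarrow> real^'r \<Rightarrow> 'm \<Rightarrow> real^'r \<Rightarrow> 'm \<Rightarrow> real" where
  "coupled_generator b \<sigma> g q lam \<pi> f x i y j =
     coupled_L b \<sigma> q f x i y j
     + lam * (\<integral>\<gamma>. f (embed_vec i x + embed_vec i (g x i \<gamma>)
                        - embed_vec j y - embed_vec j (g y j \<gamma>))
                 - f (embed_vec i x - embed_vec j y) \<partial>\<pi>)"

end

theory Submission
  imports Defs
begin

text \<open>Hypothesis (2) is used mainly at \<open>y = 0\<close>, where the switching terms cancel. For
  \<open>i \<noteq> j\<close> it says that \<open>|x|\<^sup>2\<close> is a Lyapunov function, \<open>\<G>|x|\<^sup>2 \<le> - \<beta>' |x|\<^sup>2\<close>, so that with at least two regimes every solution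
  tends to the origin in mean square and (P2') follows from the triangle inequality; with a single
  regime (2) is the same bound for the difference of two solutions. For \<open>i = j\<close> the Lipschitz and
  growth conditions turn it into \<open>\<G>|x|\<^sup>2 \<le> - \<beta>'/2 |x|\<^sup>2 + C\<close>, whence second moments are bounded and
  (P1) follows from Chebyshev's inequality.

  Ito's formula for \<open>|x|\<^sup>2\<close> is replaced by its discrete version. The solution is the limit in
  probability of the sums of Euler increments frozen at grid values of the solution itself: the
  stochastic integrals are compared by Lenglart's inequality, the other two integrals path by path.
  Closeness in probability does not control second moments, so the moment estimate is carried out for
  an auxiliary scheme with the same increments which is stopped on leaving a ball and pulled towards
  the solution; it then passes to the limit by Fatou's lemma.\<close>

section \<open>Poisson random measures\<close>

text \<open>Dissipativity is known at the solution, while the computable second moments are those of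
  an Euler sum, which is close to the solution only in probability. Comparing the two in mean square
  would presuppose the moment bound that is sought. The pull breaks this circle: the energy of the
  scheme is governed by the generator at the solution plus a term linear in the distance, and a
  distance in mean follows from closeness in probability and a crude Gronwall bound that may depend
  on the ball. Hence the order of limits: with the ball fixed the mesh tends to zero, then the
  tolerances, and the truncation level of the solution is removed last. Grid values are rounded to a
  lattice so that the state takes finitely many values in a ball. Conditioning on the past becomes a
  finite sum over events with constant coefficients, and the product rule for independent variables
  replaces conditional expectations. Independence of the past is available for the two noises
  separately, so the mixed Brownian and jump term is estimated rather than cancelled; this is the
  origin of \<open>step_error\<close>.\<close>

lemma sigma_sets_measurable_sigma:
  assumes "E \<subseteq> Pow \<Omega>"
  shows "sets (sigma \<Omega> (sigma_sets \<Omega> E)) = sigma_sets \<Omega> E"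
  by (subst sets_measure_of)
     (use assms sigma_sets_into_sp[OF assms] in \<open>auto simp: sigma_sets_sigma_sets_eq\<close>)

text \<open>The mark measure \<nu> is any finite measure, not a probability: in the application it
  is \<open>lam\<close> times \<pi>, so that the jump intensity is its total mass.\<close>

locale driving_noise = prob_space M for M :: "'w measure" +
  fixes F :: "real \<Rightarrow> 'w measure" and w :: "real \<Rightarrow> 'w \<Rightarrow> real^'d"
    and \<nu> :: "'e measure" and N :: "'w \<Rightarrow> (real \<times> 'e) measure"
  assumes filtration: "filtration (space M) F"
    and subalgebra: "\<And>t. 0 \<le> t \<Longrightarrow> subalgebra M (F t)"
    and brownian: "standard_brownian_motion M F w"
    and finite_marks: "finite_measure \<nu>"
    and poisson: "poisson_random_measure M F \<nu> N"
begin

lemma space_F [simp]: "space (F t) = space M"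
  using filtration by (rule filtration.space_F)

lemma sets_F_mono: "s \<le> t \<Longrightarrow> sets (F s) \<subseteq> sets (F t)"
  using filtration.sets_F_mono[OF filtration] by simp

lemma measurable_F_mono: "f \<in> measurable (F s) A \<Longrightarrow> s \<le> t \<Longrightarrow> f \<in> measurable (F t) A"
  using sets_F_mono[of s t] by (auto simp: measurable_def)

lemma measurable_F_M: "f \<in> measurable (F s) A \<Longrightarrow> 0 \<le> s \<Longrightarrow> f \<in> measurable M A"
  using subalgebra[of s] by (auto simp: measurable_def subalgebra_def)

lemma sets_F_M: "A \<in> sets (F s) \<Longrightarrow> 0 \<le> s \<Longrightarrow> A \<in> sets M"
  using subalgebra[of s] by (auto simp: subalgebra_def)

abbreviation marks :: "'e set" where "marks \<equiv> space \<nu>"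

lemma sets_N [measurable_cong]: "\<omega> \<in> space M \<Longrightarrow> sets (N \<omega>) = sets (prm_intensity \<nu>)"
  using poisson by (simp add: poisson_random_measure_def)

lemma measurable_N: "\<omega> \<in> space M \<Longrightarrow> measurable (N \<omega>) A = measurable (prm_intensity \<nu>) A"
  by (rule measurable_cong_sets[OF sets_N refl])

lemma space_prm: "space (prm_intensity \<nu>) = {0..} \<times> marks"
  by (simp add: prm_intensity_def space_pair_measure space_restrict_space)

lemma space_N: "\<omega> \<in> space M \<Longrightarrow> space (N \<omega>) = {0..} \<times> marks"
  using sets_eq_imp_space_eq[OF sets_N] by (simp add: space_prm)

lemma sets_slab: "T \<in> sets borel \<Longrightarrow> T \<subseteq> {0..} \<Longrightarrow> B \<in> sets \<nu> \<Longrightarrow> T \<times> B \<in> sets (prm_intensity \<nu>)"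
  unfolding prm_intensity_def
  by (intro pair_measureI) (auto simp: sets_restrict_space image_iff intro!: bexI[of _ T])

text \<open>\<open>prm_events\<close> packaged as a measure space, so that dependence on the noise
  during T can be expressed through measurable functions.\<close>

definition noise_events :: "real set \<Rightarrow> 'w measure" where
  "noise_events T = sigma (space M) (prm_events M \<nu> N T)"

lemma space_noise_events [simp]: "space (noise_events T) = space M"
  by (simp add: noise_events_def space_measure_of_conv)

lemma sets_noise_events: "sets (noise_events T) = prm_events M \<nu> N T"
  unfolding noise_events_def prm_events_def by (rule sigma_sets_measurable_sigma) auto

lemma emeasure_N_events:
  assumes "A \<in> sets (prm_intensity \<nu>)" "A \<subseteq> T \<times> marks"
  shows "(\<lambda>\<omega>. emeasure (N \<omega>) A) \<in> borel_measurable (noise_events T)"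
  by (rule measurableI) (use assms in \<open>auto simp: sets_noise_events prm_events_def intro!: sigma_sets.Basic\<close>)

text \<open>Monotone class argument starting from the counts of sets. The indicator confines the
  integral to the time set T; this is what later separates the noise up to time s from the noise
  after s.\<close>

lemma nn_integral_N_events:
  assumes f: "f \<in> borel_measurable (prm_intensity \<nu>)"
    and T: "T \<in> sets borel" "T \<subseteq> {0..}"
  shows "(\<lambda>\<omega>. \<integral>\<^sup>+p. f p * indicator (T \<times> marks) p \<partial>N \<omega>) \<in> borel_measurable (noise_events T)"
  using f
proof (induction rule: borel_measurable_induct)
  case (cong f g)
  have "(\<integral>\<^sup>+p. f p * indicator (T \<times> marks) p \<partial>N \<omega>) = (\<integral>\<^sup>+p. g p * indicator (T \<times> marks) p \<partial>N \<omega>)"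
    if "\<omega> \<in> space M" for \<omega>
    using cong that by (intro nn_integral_cong) (simp add: space_N space_prm)
  then show ?case using cong by (subst measurable_cong[where g = "\<lambda>\<omega>. \<integral>\<^sup>+p. g p * indicator (T \<times> marks) p \<partial>N \<omega>"]) auto
next
  case (set A)
  have A: "A \<inter> T \<times> marks \<in> sets (prm_intensity \<nu>)" using set sets_slab[OF T sets.top] by auto
  have "(\<integral>\<^sup>+p. indicator A p * indicator (T \<times> marks) p \<partial>N \<omega>) = emeasure (N \<omega>) (A \<inter> T \<times> marks)"
    if "\<omega> \<in> space M" for \<omega>
    using A sets_N[OF that] by (subst indicator_inter_arith[symmetric]) simp
  then show ?case using emeasure_N_events[OF A, of T]
    by (subst measurable_cong[where g = "\<lambda>\<omega>. emeasure (N \<omega>) (A \<inter> T \<times> marks)"]) auto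
next
  case (mult u c)
  have "(\<integral>\<^sup>+p. c * u p * indicator (T \<times> marks) p \<partial>N \<omega>) = c * (\<integral>\<^sup>+p. u p * indicator (T \<times> marks) p \<partial>N \<omega>)"
    if "\<omega> \<in> space M" for \<omega>
    using mult sets_slab[OF T sets.top] sets_N[OF that]
    by (subst nn_integral_cmult[symmetric]) (auto simp: mult.assoc measurable_N[OF that])
  then show ?case using mult
    by (subst measurable_cong[where g = "\<lambda>\<omega>. c * (\<integral>\<^sup>+p. u p * indicator (T \<times> marks) p \<partial>N \<omega>)"]) auto
next
  case (add u v)
  have "(\<integral>\<^sup>+p. (v p + u p) * indicator (T \<times> marks) p \<partial>N \<omega>) =
      (\<integral>\<^sup>+p. v p * indicator (T \<times> marks) p \<partial>N \<omega>) + (\<integral>\<^sup>+p. u p * indicator (T \<times> marks) p \<partial>N \<omega>)"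
    if "\<omega> \<in> space M" for \<omega>
    using add sets_slab[OF T sets.top] sets_N[OF that]
    by (subst nn_integral_add[symmetric]) (auto simp: distrib_right measurable_N[OF that])
  then show ?case using add
    by (subst measurable_cong[where g = "\<lambda>\<omega>. (\<integral>\<^sup>+p. v p * indicator (T \<times> marks) p \<partial>N \<omega>) + (\<integral>\<^sup>+p. u p * indicator (T \<times> marks) p \<partial>N \<omega>)"]) auto
next
  case (seq U)
  have "(\<integral>\<^sup>+p. (SUP i. U i) p * indicator (T \<times> marks) p \<partial>N \<omega>) =
      (SUP i. \<integral>\<^sup>+p. U i p * indicator (T \<times> marks) p \<partial>N \<omega>)"
    if "\<omega> \<in> space M" for \<omega>
  proof -
    have "(\<integral>\<^sup>+p. (SUP i. U i) p * indicator (T \<times> marks) p \<partial>N \<omega>) =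
      (\<integral>\<^sup>+p. (SUP i. U i p * indicator (T \<times> marks) p) \<partial>N \<omega>)"
      by (intro nn_integral_cong) (simp add: SUP_mult_right_ennreal image_comp)
    also have "\<dots> = (SUP i. \<integral>\<^sup>+p. U i p * indicator (T \<times> marks) p \<partial>N \<omega>)"
      using seq sets_slab[OF T sets.top] sets_N[OF that]
      by (intro nn_integral_monotone_convergence_SUP)
         (auto simp: incseq_def le_fun_def mult_right_mono measurable_N[OF that])
    finally show ?thesis .
  qed
  then show ?case using seq
    by (subst measurable_cong[where g = "\<lambda>\<omega>. SUP i. \<integral>\<^sup>+p. U i p * indicator (T \<times> marks) p \<partial>N \<omega>"]) auto
qed

lemma noise_events_measurable_M:
  "f \<in> measurable (noise_events T) A \<Longrightarrow> T \<in> sets borel \<Longrightarrow> T \<subseteq> {0..} \<Longrightarrow> f \<in> measurable M A"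
proof -
  assume f: "f \<in> measurable (noise_events T) A" and T: "T \<in> sets borel" "T \<subseteq> {0..}"
  have "prm_events M \<nu> N T \<subseteq> sets M"
    unfolding prm_events_def
  proof (rule sets.sigma_sets_subset, safe)
    fix A and B :: "ennreal set" assume "A \<in> sets (prm_intensity \<nu>)" "B \<in> sets borel"
    then show "(\<lambda>\<omega>. emeasure (N \<omega>) A) -` B \<inter> space M \<in> sets M"
      using poisson unfolding poisson_random_measure_def by (auto intro: measurable_sets)
  qed
  then show ?thesis using f by (auto simp: measurable_def sets_noise_events)
qed

end

section \<open>Products of independent variables and Poisson moments\<close>

lemma borel_measurable_vecI:
  fixes f :: "'a \<Rightarrow> real^'n"
  assumes "\<And>a. (\<lambda>x. f x $ a) \<in> borel_measurable M"
  shows "f \<in> borel_measurable M"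
  by (subst borel_measurable_euclidean_space)
     (auto simp: Basis_vec_def inner_axis intro!: assms)

text \<open>The noise axioms state independence through families of events; this turns it into the
  product rule for expectations. Only the preimages under U and V have to lie in the families, which
  need not be given as sigma-algebras.\<close>

lemma (in prob_space) indep_set_expectation_mult:
  fixes U V :: "'a \<Rightarrow> real"
  assumes "indep_set G H"
    and "integrable M U" "integrable M V"
    and "\<And>A. A \<in> sets borel \<Longrightarrow> U -` A \<inter> space M \<in> G"
    and "\<And>A. A \<in> sets borel \<Longrightarrow> V -` A \<inter> space M \<in> H"
  shows "integrable M (\<lambda>x. U x * V x)"
    and "expectation (\<lambda>x. U x * V x) = expectation U * expectation V"
proof -
  have "indep_var borel U borel V"
    unfolding indep_var_def indep_vars_def2
  proof (intro conjI ballI)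
    fix i show "random_variable (case i of True \<Rightarrow> borel | False \<Rightarrow> borel) (case i of True \<Rightarrow> U | False \<Rightarrow> V)"
      using assms(2,3) by (cases i) auto
  next
    show "indep_sets (\<lambda>i. {(case i of True \<Rightarrow> U | False \<Rightarrow> V) -` A \<inter> space M |A.
        A \<in> sets (case i of True \<Rightarrow> borel | False \<Rightarrow> borel)}) UNIV"
      using assms(1) unfolding indep_set_def
      by (rule indep_sets_mono_sets) (use assms(4,5) in \<open>auto split: bool.splits\<close>)
  qed
  from indep_var_integrable[OF this assms(2,3)] indep_var_lebesgue_integral[OF this assms(2,3)]
  show "integrable M (\<lambda>x. U x * V x)" "expectation (\<lambda>x. U x * V x) = expectation U * expectation V"
    by auto
qed

lemma poisson_weights_sums: "(\<lambda>n. exp (- x) * x ^ n / fact n) sums (1::real)"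
proof -
  have "(\<lambda>n. exp (- x) * (x ^ n /\<^sub>R fact n)) sums (exp (- x) * exp x)"
    by (intro sums_mult exp_converges)
  then show ?thesis by (simp add: exp_minus field_simps)
qed

lemma poisson_mean_sums: "(\<lambda>n. real n * (exp (- x) * x ^ n / fact n)) sums (x::real)"
proof -
  have "(\<lambda>n. x * (exp (- x) * x ^ n / fact n)) sums (x * 1)"
    by (intro sums_mult poisson_weights_sums)
  moreover have "real (Suc n) * (exp (- x) * x ^ Suc n / fact (Suc n)) = x * (exp (- x) * x ^ n / fact n)" for n
    by (simp add: field_simps del: of_nat_Suc)
  ultimately show ?thesis
    by - (rule sums_Suc_imp, simp_all only: of_nat_0 mult_zero_left mult_1_right)
qed

text \<open>One factor n cancels against the factorial, and shifting the index leaves x times the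
  mean of n + 1, that is x (x + 1).\<close>

lemma poisson_square_sums: "(\<lambda>n. (real n)\<^sup>2 * (exp (- x) * x ^ n / fact n)) sums (x + x\<^sup>2 :: real)"
proof -
  have "(\<lambda>n. x * (real n * (exp (- x) * x ^ n / fact n) + exp (- x) * x ^ n / fact n)) sums (x * (x + 1))"
    by (intro sums_mult sums_add poisson_weights_sums poisson_mean_sums)
  moreover have "(real (Suc n))\<^sup>2 * (exp (- x) * x ^ Suc n / fact (Suc n)) =
      x * (real n * (exp (- x) * x ^ n / fact n) + exp (- x) * x ^ n / fact n)" for n
  proof -
    have "(real (Suc n))\<^sup>2 * (exp (- x) * x ^ Suc n / fact (Suc n)) =
       real (Suc n) * (real (Suc n) * (exp (- x) * x ^ Suc n / (real (Suc n) * fact n)))"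
      by (simp add: power2_eq_square)
    also have "\<dots> = real (Suc n) * (exp (- x) * x ^ Suc n / fact n)"
      by (simp del: of_nat_Suc)
    finally show ?thesis by (simp add: field_simps)
  qed
  moreover have "x * (x + 1) = x + x\<^sup>2" by (simp add: power2_eq_square distrib_left)
  ultimately show ?thesis
    by - (rule sums_Suc_imp, simp_all only: of_nat_0 mult_zero_left zero_power2)
qed

section \<open>Counts of points and Campbell's formula\<close>

context driving_noise
begin

lemma N_measurable: "A \<in> sets (prm_intensity \<nu>) \<Longrightarrow> (\<lambda>\<omega>. emeasure (N \<omega>) A) \<in> borel_measurable M"
  using poisson by (auto simp: poisson_random_measure_def)

lemma poisson_prob:
  assumes "A \<in> sets (prm_intensity \<nu>)" "emeasure (prm_intensity \<nu>) A = ennreal x" "0 \<le> x"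
  shows "prob {\<omega>\<in>space M. emeasure (N \<omega>) A = of_nat n} = exp (- x) * x ^ n / fact n"
  using poisson assms by (auto simp: poisson_random_measure_def measure_def)

text \<open>The Poisson weights already sum to one, which leaves no probability for the value
  infinity.\<close>

lemma count_AE:
  assumes A: "A \<in> sets (prm_intensity \<nu>)" "emeasure (prm_intensity \<nu>) A = ennreal x" "0 \<le> x"
  shows "AE \<omega> in M. emeasure (N \<omega>) A \<in> range of_nat"
proof -
  note [measurable] = N_measurable[OF A(1)]
  have d: "disjoint_family (\<lambda>n. {\<omega>\<in>space M. emeasure (N \<omega>) A = of_nat n})"
    by (auto simp: disjoint_family_on_def)
  have "(\<lambda>n. prob {\<omega>\<in>space M. emeasure (N \<omega>) A = of_nat n}) sums
      prob (\<Union>n. {\<omega>\<in>space M. emeasure (N \<omega>) A = of_nat n})"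
    by (intro finite_measure_UNION d) auto
  then have "prob (\<Union>n. {\<omega>\<in>space M. emeasure (N \<omega>) A = of_nat n}) = 1"
    using poisson_weights_sums[of x] unfolding poisson_prob[OF A] by (rule sums_unique2)
  moreover have "(\<Union>n. {\<omega>\<in>space M. emeasure (N \<omega>) A = of_nat n}) \<in> events" by measurable
  ultimately have "AE \<omega> in M. \<omega> \<in> (\<Union>n. {\<omega>\<in>space M. emeasure (N \<omega>) A = of_nat n})"
    by (simp add: prob_eq_1)
  then show ?thesis by eventually_elim auto
qed

text \<open>The expectation is expanded over the integer values of the count, which exhaust the
  space up to a null set; \<open>g\<close> is \<open>f\<close> read off at the integers.\<close>

lemma count_nn_integral:
  assumes A: "A \<in> sets (prm_intensity \<nu>)" "emeasure (prm_intensity \<nu>) A = ennreal x" "0 \<le> x"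
    and g: "\<And>n. 0 \<le> g n" "(\<lambda>n. g n * (exp (- x) * x ^ n / fact n)) sums y"
    and f: "\<And>n. f (of_nat n) = ennreal (g n)"
  shows "(\<integral>\<^sup>+\<omega>. f (emeasure (N \<omega>) A) \<partial>M) = ennreal y"
proof -
  note [measurable] = N_measurable[OF A(1)]
  let ?E = "\<lambda>n. {\<omega>\<in>space M. emeasure (N \<omega>) A = of_nat n}"
  have "(\<integral>\<^sup>+\<omega>. f (emeasure (N \<omega>) A) \<partial>M) = (\<integral>\<^sup>+\<omega>. (\<Sum>n. ennreal (g n) * indicator (?E n) \<omega>) \<partial>M)"
  proof (rule nn_integral_cong_AE, use count_AE[OF A] AE_space in eventually_elim)
    case (elim \<omega>)
    then obtain k where k: "emeasure (N \<omega>) A = of_nat k" by auto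
    have "(\<lambda>n. ennreal (g n) * indicator (?E n) \<omega>) sums (\<Sum>n\<in>{k}. ennreal (g n) * indicator (?E n) \<omega>)"
      by (rule sums_finite) (use k in \<open>auto simp: indicator_def\<close>)
    then show ?case using k elim by (simp add: f sums_iff)
  qed
  also have "\<dots> = (\<Sum>n. \<integral>\<^sup>+\<omega>. ennreal (g n) * indicator (?E n) \<omega> \<partial>M)"
    by (rule nn_integral_suminf) measurable
  also have "\<dots> = (\<Sum>n. ennreal (g n * (exp (- x) * x ^ n / fact n)))"
    using g(1) A(3) by (intro suminf_cong) (simp add: nn_integral_cmult_indicator emeasure_eq_measure poisson_prob[OF A] ennreal_mult[symmetric])
  also have "\<dots> = ennreal y"
    using g A(3) by (subst suminf_ennreal2) (auto simp: sums_iff)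
  finally show ?thesis .
qed

lemma count_mean:
  assumes A: "A \<in> sets (prm_intensity \<nu>)" "emeasure (prm_intensity \<nu>) A = ennreal x" "0 \<le> x"
  shows "(\<integral>\<^sup>+\<omega>. emeasure (N \<omega>) A \<partial>M) = ennreal x"
  by (rule count_nn_integral[OF A _ poisson_mean_sums, of "\<lambda>x. x"]) (auto simp: ennreal_of_nat_eq_real_of_nat)

lemma count_square:
  assumes A: "A \<in> sets (prm_intensity \<nu>)" "emeasure (prm_intensity \<nu>) A = ennreal x" "0 \<le> x"
  shows "(\<integral>\<^sup>+\<omega>. (emeasure (N \<omega>) A)\<^sup>2 \<partial>M) = ennreal (x + x\<^sup>2)"
  by (rule count_nn_integral[OF A _ poisson_square_sums, of "\<lambda>x. x\<^sup>2"])
     (auto simp: ennreal_of_nat_eq_real_of_nat ennreal_power)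

lemma intensity_slab:
  assumes "0 \<le> s" "s \<le> t" "B \<in> sets \<nu>"
  shows "emeasure (prm_intensity \<nu>) ({s<..t} \<times> B) = ennreal ((t - s) * measure \<nu> B)"
proof -
  interpret nu: finite_measure \<nu> by (rule finite_marks)
  have "{s<..t} \<in> sets (restrict_space lborel {0..})"
    using assms by (auto simp: sets_restrict_space image_iff intro!: bexI[of _ "{s<..t}"])
  then have "emeasure (prm_intensity \<nu>) ({s<..t} \<times> B) = emeasure (restrict_space lborel {0..}) {s<..t} * emeasure \<nu> B"
    unfolding prm_intensity_def using assms by (intro nu.emeasure_pair_measure_Times) auto
  also have "emeasure (restrict_space lborel {0..}) {s<..t} = ennreal (t - s)"
    using assms by (subst emeasure_restrict_space) auto
  finally show ?thesis using assms by (simp add: nu.emeasure_eq_measure ennreal_mult)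
qed

lemma intensity_slab_finite:
  assumes A: "A \<in> sets (prm_intensity \<nu>)" and T: "T \<in> sets borel" "T \<subseteq> {0..}"
    and fin: "emeasure (prm_intensity \<nu>) (T \<times> marks) < \<infinity>"
  obtains x where "0 \<le> x" "emeasure (prm_intensity \<nu>) (A \<inter> T \<times> marks) = ennreal x"
proof -
  have "emeasure (prm_intensity \<nu>) (A \<inter> T \<times> marks) < \<infinity>"
    using fin sets_slab[OF T sets.top] by (intro le_less_trans[OF emeasure_mono fin]) auto
  then show ?thesis using that by (cases "emeasure (prm_intensity \<nu>) (A \<inter> T \<times> marks)") auto
qed

lemma nn_integral_N_measurable:
  assumes "f \<in> borel_measurable (prm_intensity \<nu>)" "T \<in> sets borel" "T \<subseteq> {0..}"
  shows "(\<lambda>\<omega>. \<integral>\<^sup>+p. f p * indicator (T \<times> marks) p \<partial>N \<omega>) \<in> borel_measurable M"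
  using nn_integral_N_events[OF assms] assms(2,3) by (rule noise_events_measurable_M)

text \<open>Both sides are additive in f and continuous from below, and for indicators the claim is
  the Poisson mean. The slab has finite intensity, so that every count inside it is Poisson
  distributed.\<close>

lemma campbell_nn:
  assumes f: "f \<in> borel_measurable (prm_intensity \<nu>)"
    and T: "T \<in> sets borel" "T \<subseteq> {0..}" "emeasure (prm_intensity \<nu>) (T \<times> marks) < \<infinity>"
  shows "(\<integral>\<^sup>+\<omega>. (\<integral>\<^sup>+p. f p * indicator (T \<times> marks) p \<partial>N \<omega>) \<partial>M) =
    (\<integral>\<^sup>+p. f p * indicator (T \<times> marks) p \<partial>prm_intensity \<nu>)"
  using f
proof (induction rule: borel_measurable_induct)
  case (cong f g)
  have "(\<integral>\<^sup>+\<omega>. (\<integral>\<^sup>+p. f p * indicator (T \<times> marks) p \<partial>N \<omega>) \<partial>M) = (\<integral>\<^sup>+\<omega>. (\<integral>\<^sup>+p. g p * indicator (T \<times> marks) p \<partial>N \<omega>) \<partial>M)"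
    using cong by (intro nn_integral_cong) (simp add: space_N space_prm)
  moreover have "(\<integral>\<^sup>+p. f p * indicator (T \<times> marks) p \<partial>prm_intensity \<nu>) = (\<integral>\<^sup>+p. g p * indicator (T \<times> marks) p \<partial>prm_intensity \<nu>)"
    using cong by (intro nn_integral_cong) simp
  ultimately show ?case using cong by simp
next
  case (set A)
  have A: "A \<inter> T \<times> marks \<in> sets (prm_intensity \<nu>)" using set sets_slab[OF T(1,2) sets.top] by auto
  from intensity_slab_finite[OF set T] obtain x where
    x: "0 \<le> x" "emeasure (prm_intensity \<nu>) (A \<inter> T \<times> marks) = ennreal x" by blast
  have "(\<integral>\<^sup>+\<omega>. (\<integral>\<^sup>+p. indicator A p * indicator (T \<times> marks) p \<partial>N \<omega>) \<partial>M) = (\<integral>\<^sup>+\<omega>. emeasure (N \<omega>) (A \<inter> T \<times> marks) \<partial>M)"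
    using A by (intro nn_integral_cong) (subst indicator_inter_arith[symmetric], simp add: sets_N)
  also have "\<dots> = emeasure (prm_intensity \<nu>) (A \<inter> T \<times> marks)"
    using count_mean[OF A x(2,1)] x by simp
  also have "\<dots> = (\<integral>\<^sup>+p. indicator A p * indicator (T \<times> marks) p \<partial>prm_intensity \<nu>)"
    using A by (subst indicator_inter_arith[symmetric]) simp
  finally show ?case .
next
  case (mult u c)
  have "(\<integral>\<^sup>+p. c * u p * indicator (T \<times> marks) p \<partial>N \<omega>) = c * (\<integral>\<^sup>+p. u p * indicator (T \<times> marks) p \<partial>N \<omega>)"
    if "\<omega> \<in> space M" for \<omega>
    using mult sets_slab[OF T(1,2) sets.top] sets_N[OF that]
    by (subst nn_integral_cmult[symmetric]) (auto simp: mult.assoc measurable_N[OF that])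
  then have "(\<integral>\<^sup>+\<omega>. (\<integral>\<^sup>+p. c * u p * indicator (T \<times> marks) p \<partial>N \<omega>) \<partial>M) =
     (\<integral>\<^sup>+\<omega>. c * (\<integral>\<^sup>+p. u p * indicator (T \<times> marks) p \<partial>N \<omega>) \<partial>M)"
    by (intro nn_integral_cong) simp
  also have "\<dots> = c * (\<integral>\<^sup>+\<omega>. (\<integral>\<^sup>+p. u p * indicator (T \<times> marks) p \<partial>N \<omega>) \<partial>M)"
    using nn_integral_N_measurable[OF mult(2) T(1,2)] by (intro nn_integral_cmult) auto
  also have "\<dots> = (\<integral>\<^sup>+p. c * u p * indicator (T \<times> marks) p \<partial>prm_intensity \<nu>)"
    using mult sets_slab[OF T(1,2) sets.top] by (simp add: nn_integral_cmult[symmetric] mult.assoc)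
  finally show ?case .
next
  case (add u v)
  have "(\<integral>\<^sup>+p. (v p + u p) * indicator (T \<times> marks) p \<partial>N \<omega>) =
      (\<integral>\<^sup>+p. v p * indicator (T \<times> marks) p \<partial>N \<omega>) + (\<integral>\<^sup>+p. u p * indicator (T \<times> marks) p \<partial>N \<omega>)"
    if "\<omega> \<in> space M" for \<omega>
    using add sets_slab[OF T(1,2) sets.top] sets_N[OF that]
    by (subst nn_integral_add[symmetric]) (auto simp: distrib_right measurable_N[OF that])
  then have "(\<integral>\<^sup>+\<omega>. (\<integral>\<^sup>+p. (v p + u p) * indicator (T \<times> marks) p \<partial>N \<omega>) \<partial>M) =
     (\<integral>\<^sup>+\<omega>. (\<integral>\<^sup>+p. v p * indicator (T \<times> marks) p \<partial>N \<omega>) + (\<integral>\<^sup>+p. u p * indicator (T \<times> marks) p \<partial>N \<omega>) \<partial>M)"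
    by (intro nn_integral_cong) simp
  also have "\<dots> = (\<integral>\<^sup>+\<omega>. (\<integral>\<^sup>+p. v p * indicator (T \<times> marks) p \<partial>N \<omega>) \<partial>M) + (\<integral>\<^sup>+\<omega>. (\<integral>\<^sup>+p. u p * indicator (T \<times> marks) p \<partial>N \<omega>) \<partial>M)"
    using add nn_integral_N_measurable[OF _ T(1,2)] by (intro nn_integral_add) auto
  also have "\<dots> = (\<integral>\<^sup>+p. v p * indicator (T \<times> marks) p + u p * indicator (T \<times> marks) p \<partial>prm_intensity \<nu>)"
    using add sets_slab[OF T(1,2) sets.top] by (subst nn_integral_add) auto
  finally show ?case by (simp add: distrib_right)
next
  case (seq U)
  have eq: "(\<integral>\<^sup>+p. (SUP i. U i) p * indicator (T \<times> marks) p \<partial>Q) =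
      (SUP i. \<integral>\<^sup>+p. U i p * indicator (T \<times> marks) p \<partial>Q)"
    if "sets Q = sets (prm_intensity \<nu>)" for Q
  proof -
    have m: "borel_measurable Q = borel_measurable (prm_intensity \<nu>)"
      by (rule measurable_cong_sets[OF that refl])
    have "(\<integral>\<^sup>+p. (SUP i. U i) p * indicator (T \<times> marks) p \<partial>Q) =
      (\<integral>\<^sup>+p. (SUP i. U i p * indicator (T \<times> marks) p) \<partial>Q)"
      by (intro nn_integral_cong) (simp add: SUP_mult_right_ennreal image_comp)
    also have "\<dots> = (SUP i. \<integral>\<^sup>+p. U i p * indicator (T \<times> marks) p \<partial>Q)"
      using seq sets_slab[OF T(1,2) sets.top]
      by (intro nn_integral_monotone_convergence_SUP)
         (auto simp: incseq_def le_fun_def mult_right_mono m)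
    finally show ?thesis .
  qed
  have "(\<integral>\<^sup>+\<omega>. (\<integral>\<^sup>+p. (SUP i. U i) p * indicator (T \<times> marks) p \<partial>N \<omega>) \<partial>M) =
     (\<integral>\<^sup>+\<omega>. (SUP i. \<integral>\<^sup>+p. U i p * indicator (T \<times> marks) p \<partial>N \<omega>) \<partial>M)"
    by (intro nn_integral_cong eq sets_N)
  also have "\<dots> = (SUP i. \<integral>\<^sup>+\<omega>. (\<integral>\<^sup>+p. U i p * indicator (T \<times> marks) p \<partial>N \<omega>) \<partial>M)"
    using seq nn_integral_N_measurable[OF _ T(1,2)]
    by (intro nn_integral_monotone_convergence_SUP)
       (auto simp: incseq_def le_fun_def intro!: nn_integral_mono mult_right_mono)
  also have "\<dots> = (SUP i. \<integral>\<^sup>+p. U i p * indicator (T \<times> marks) p \<partial>prm_intensity \<nu>)"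
    using seq by simp
  also have "\<dots> = (\<integral>\<^sup>+p. (SUP i. U i) p * indicator (T \<times> marks) p \<partial>prm_intensity \<nu>)"
    by (rule eq[OF refl, symmetric])
  finally show ?case .
qed

end

section \<open>Jump sums over a time slab\<close>

context driving_noise
begin

definition mass :: real where "mass = measure \<nu> marks"

text \<open>The slab is open on the left, so that the sum depends only on the noise after s and is
  independent of \<open>F s\<close>.\<close>

definition jump :: "('e \<Rightarrow> 'b::{banach,second_countable_topology}) \<Rightarrow> real \<Rightarrow> real \<Rightarrow> 'w \<Rightarrow> 'b" where
  "jump \<phi> s t \<omega> = (\<integral>p. indicator ({s<..t} \<times> marks) p *\<^sub>R \<phi> (snd p) \<partial>N \<omega>)"

definition jump_count :: "real \<Rightarrow> real \<Rightarrow> 'w \<Rightarrow> real" where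
  "jump_count s t \<omega> = measure (N \<omega>) ({s<..t} \<times> marks)"

lemma mass_nonneg [simp]: "0 \<le> mass"
  by (simp add: mass_def)

text \<open>The Bochner integral is zero on paths where f is not integrable. Integrability is itself
  an event of the noise during T, so a case split on it keeps measurability.\<close>

lemma integral_N_events_real:
  fixes f :: "real \<times> 'e \<Rightarrow> real"
  assumes f: "f \<in> borel_measurable (prm_intensity \<nu>)"
    and T: "T \<in> sets borel" "T \<subseteq> {0..}" and zero: "\<And>p. p \<notin> T \<times> marks \<Longrightarrow> f p = 0"
  shows "(\<lambda>\<omega>. \<integral>p. f p \<partial>N \<omega>) \<in> borel_measurable (noise_events T)"
proof -
  have ind: "ennreal (h p) * indicator (T \<times> marks) p = ennreal (h p)" if "\<And>p. p \<notin> T \<times> marks \<Longrightarrow> h p = 0" for h :: "real \<times> 'e \<Rightarrow> real" and p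
    using that[of p] by (cases "p \<in> T \<times> marks") (auto split: split_indicator)
  have m: "(\<lambda>\<omega>. \<integral>\<^sup>+p. ennreal (h p) \<partial>N \<omega>) \<in> borel_measurable (noise_events T)"
    if "h \<in> borel_measurable (prm_intensity \<nu>)" "\<And>p. p \<notin> T \<times> marks \<Longrightarrow> h p = 0" for h :: "real \<times> 'e \<Rightarrow> real"
    using nn_integral_N_events[OF measurable_compose[OF that(1) measurable_ennreal] T] by (simp add: ind that(2))
  have "(\<integral>p. f p \<partial>N \<omega>) = (if (\<integral>\<^sup>+p. ennreal \<bar>f p\<bar> \<partial>N \<omega>) < \<infinity> then
      enn2real (\<integral>\<^sup>+p. ennreal (f p) \<partial>N \<omega>) - enn2real (\<integral>\<^sup>+p. ennreal (- f p) \<partial>N \<omega>) else 0)"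
    if "\<omega> \<in> space M" for \<omega>
  proof (cases "(\<integral>\<^sup>+p. ennreal \<bar>f p\<bar> \<partial>N \<omega>) < \<infinity>")
    case True
    then have "integrable (N \<omega>) f" using f by (auto simp: integrable_iff_bounded measurable_N[OF that])
    then show ?thesis using True by (simp add: real_lebesgue_integral_def)
  next
    case False
    then have "\<not> integrable (N \<omega>) f" by (auto simp: integrable_iff_bounded)
    then show ?thesis using False by (simp add: not_integrable_integral_eq)
  qed
  moreover have "(\<lambda>\<omega>. if (\<integral>\<^sup>+p. ennreal \<bar>f p\<bar> \<partial>N \<omega>) < \<infinity> then
      enn2real (\<integral>\<^sup>+p. ennreal (f p) \<partial>N \<omega>) - enn2real (\<integral>\<^sup>+p. ennreal (- f p) \<partial>N \<omega>) else 0)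
    \<in> borel_measurable (noise_events T)"
  proof -
    have [measurable]: "(\<lambda>\<omega>. \<integral>\<^sup>+p. ennreal \<bar>f p\<bar> \<partial>N \<omega>) \<in> borel_measurable (noise_events T)"
      "(\<lambda>\<omega>. \<integral>\<^sup>+p. ennreal (f p) \<partial>N \<omega>) \<in> borel_measurable (noise_events T)"
      "(\<lambda>\<omega>. \<integral>\<^sup>+p. ennreal (- f p) \<partial>N \<omega>) \<in> borel_measurable (noise_events T)"
      using f by (intro m; simp add: zero)+
    show ?thesis by measurable
  qed
  ultimately show ?thesis
    by (subst measurable_cong[where g = "\<lambda>\<omega>. if (\<integral>\<^sup>+p. ennreal \<bar>f p\<bar> \<partial>N \<omega>) < \<infinity> then
      enn2real (\<integral>\<^sup>+p. ennreal (f p) \<partial>N \<omega>) - enn2real (\<integral>\<^sup>+p. ennreal (- f p) \<partial>N \<omega>) else 0"]) auto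
qed

lemma integral_N_events:
  fixes f :: "real \<times> 'e \<Rightarrow> real^'n"
  assumes f: "f \<in> borel_measurable (prm_intensity \<nu>)"
    and T: "T \<in> sets borel" "T \<subseteq> {0..}" and zero: "\<And>p. p \<notin> T \<times> marks \<Longrightarrow> f p = 0"
  shows "(\<lambda>\<omega>. \<integral>p. f p \<partial>N \<omega>) \<in> borel_measurable (noise_events T)"
proof (rule borel_measurable_vecI)
  fix a :: 'n
  let ?n = "\<lambda>\<omega>. \<integral>\<^sup>+p. ennreal (norm (f p)) \<partial>N \<omega>"
  have n: "?n \<in> borel_measurable (noise_events T)"
  proof -
    have "ennreal (norm (f p)) * indicator (T \<times> marks) p = ennreal (norm (f p))" for p
      using zero[of p] by (cases "p \<in> T \<times> marks") (auto split: split_indicator)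
    then show ?thesis
      using nn_integral_N_events[OF _ T, of "\<lambda>p. ennreal (norm (f p))"] f by simp
  qed
  \<comment> \<open>The condition is on the norm of f and not on its component: a component may be
    integrable on a path where f is not, and there the vector integral is zero.\<close>
  have "(\<integral>p. f p \<partial>N \<omega>) $ a = (if ?n \<omega> < \<infinity> then \<integral>p. f p $ a \<partial>N \<omega> else 0)" if "\<omega> \<in> space M" for \<omega>
  proof (cases "?n \<omega> < \<infinity>")
    case True
    then have "integrable (N \<omega>) f" using f by (auto simp: integrable_iff_bounded measurable_N[OF that])
    then show ?thesis using True by (simp add: integral_bounded_linear[OF bounded_linear_vec_nth])
  next
    case False
    then have "\<not> integrable (N \<omega>) f" by (auto simp: integrable_iff_bounded)
    then show ?thesis using False by (simp add: not_integrable_integral_eq)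
  qed
  moreover have "(\<lambda>\<omega>. if ?n \<omega> < \<infinity> then \<integral>p. f p $ a \<partial>N \<omega> else 0) \<in> borel_measurable (noise_events T)"
  proof -
    have fa: "(\<lambda>p. f p $ a) \<in> borel_measurable (prm_intensity \<nu>)"
      by (intro measurable_compose[OF f borel_measurable_continuous_onI] continuous_intros)
    have [measurable]: "(\<lambda>\<omega>. \<integral>p. f p $ a \<partial>N \<omega>) \<in> borel_measurable (noise_events T)"
      using zero by (intro integral_N_events_real[OF fa T]) simp
    note n [measurable]
    show ?thesis by measurable
  qed
  ultimately show "(\<lambda>\<omega>. (\<integral>p. f p \<partial>N \<omega>) $ a) \<in> borel_measurable (noise_events T)"
    by (subst measurable_cong[where g = "\<lambda>\<omega>. if ?n \<omega> < \<infinity> then \<integral>p. f p $ a \<partial>N \<omega> else 0"]) auto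
qed

lemma snd_prm: "snd \<in> measurable (prm_intensity \<nu>) \<nu>"
  unfolding prm_intensity_def by simp

lemma slab_measurable:
  fixes \<phi> :: "'e \<Rightarrow> 'b::{banach,second_countable_topology}"
  assumes "\<phi> \<in> borel_measurable \<nu>" "0 \<le> s"
  shows "(\<lambda>p. indicator ({s<..t} \<times> marks) p *\<^sub>R \<phi> (snd p)) \<in> borel_measurable (prm_intensity \<nu>)"
proof -
  have "{s<..t} \<times> marks \<in> sets (prm_intensity \<nu>)" using assms(2) by (intro sets_slab) auto
  then show ?thesis using measurable_compose[OF snd_prm assms(1)] by measurable
qed

lemma jump_events_real:
  fixes \<phi> :: "'e \<Rightarrow> real"
  assumes "\<phi> \<in> borel_measurable \<nu>" "0 \<le> s"
  shows "jump \<phi> s t \<in> borel_measurable (noise_events {s<..})"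
  unfolding jump_def[abs_def] using slab_measurable[OF assms] assms(2)
  by (intro integral_N_events_real) (auto split: split_indicator)

lemma jump_events:
  fixes \<phi> :: "'e \<Rightarrow> real^'n"
  assumes "\<phi> \<in> borel_measurable \<nu>" "0 \<le> s"
  shows "jump \<phi> s t \<in> borel_measurable (noise_events {s<..})"
  unfolding jump_def[abs_def] using slab_measurable[OF assms] assms(2)
  by (intro integral_N_events) (auto split: split_indicator)

lemma jump_count_events:
  assumes "0 \<le> s"
  shows "jump_count s t \<in> borel_measurable (noise_events {s<..})"
  unfolding jump_count_def[abs_def] measure_def
  using assms by (intro measurable_compose[OF emeasure_N_events]) (auto intro!: sets_slab)

lemma jump_measurable:
  fixes \<phi> :: "'e \<Rightarrow> real^'n"
  assumes "\<phi> \<in> borel_measurable \<nu>" "0 \<le> s"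
  shows "jump \<phi> s t \<in> borel_measurable M"
  by (rule noise_events_measurable_M[OF jump_events[OF assms]]) (use assms(2) in auto)

lemma slab_sets: "0 \<le> s \<Longrightarrow> {s<..t} \<times> marks \<in> sets (prm_intensity \<nu>)"
  by (intro sets_slab) auto

lemma AE_slab:
  assumes "0 \<le> s" "s \<le> t"
  shows "AE \<omega> in M. \<exists>n. emeasure (N \<omega>) ({s<..t} \<times> marks) = of_nat n"
proof -
  have "AE \<omega> in M. emeasure (N \<omega>) ({s<..t} \<times> marks) \<in> range of_nat"
    using count_AE[OF slab_sets intensity_slab[OF _ _ sets.top]] assms by simp
  then show ?thesis by eventually_elim auto
qed

lemma jump_integrable_N:
  fixes \<phi> :: "'e \<Rightarrow> 'b::{banach,second_countable_topology}"
  assumes \<phi>: "\<phi> \<in> borel_measurable \<nu>" "\<And>\<gamma>. \<gamma> \<in> marks \<Longrightarrow> norm (\<phi> \<gamma>) \<le> L" and s: "0 \<le> s"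
    and \<omega>: "\<omega> \<in> space M" and fin: "emeasure (N \<omega>) ({s<..t} \<times> marks) < \<infinity>"
  shows "integrable (N \<omega>) (\<lambda>p. indicator ({s<..t} \<times> marks) p *\<^sub>R \<phi> (snd p))"
proof (rule Bochner_Integration.integrable_bound)
  show "integrable (N \<omega>) (\<lambda>p. L * indicator ({s<..t} \<times> marks) p)"
    using fin s \<omega> by (intro integrable_mult_right integrable_real_indicator) (auto simp: sets_N intro!: sets_slab)
  show "(\<lambda>p. indicator ({s<..t} \<times> marks) p *\<^sub>R \<phi> (snd p)) \<in> borel_measurable (N \<omega>)"
    using slab_measurable[OF \<phi>(1) s] \<omega> by (simp add: measurable_N)
  show "AE p in N \<omega>. norm (indicator ({s<..t} \<times> marks) p *\<^sub>R \<phi> (snd p)) \<le> norm (L * indicator ({s<..t} \<times> marks) p)"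
    using \<phi>(2) by (intro AE_I2) (auto split: split_indicator intro: order_trans[OF _ abs_ge_self])
qed

lemma integral_slab_const:
  assumes "0 \<le> s" "\<omega> \<in> space M"
  shows "(\<integral>p. c * indicator ({s<..t} \<times> marks) p \<partial>N \<omega>) = c * jump_count s t \<omega>"
proof -
  have "{s<..t} \<times> marks \<inter> space (N \<omega>) = {s<..t} \<times> marks"
    using assms by (auto simp: space_N)
  then show ?thesis by (simp add: jump_count_def)
qed

lemma jump_norm_le:
  fixes \<phi> :: "'e \<Rightarrow> 'b::{banach,second_countable_topology}"
  assumes \<phi>: "\<phi> \<in> borel_measurable \<nu>" "\<And>\<gamma>. \<gamma> \<in> marks \<Longrightarrow> norm (\<phi> \<gamma>) \<le> L" and s: "0 \<le> s"
    and \<omega>: "\<omega> \<in> space M" and fin: "emeasure (N \<omega>) ({s<..t} \<times> marks) < \<infinity>"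
  shows "norm (jump \<phi> s t \<omega>) \<le> L * jump_count s t \<omega>"
proof -
  have i: "integrable (N \<omega>) (\<lambda>p. indicator ({s<..t} \<times> marks) p *\<^sub>R \<phi> (snd p))"
    by (rule jump_integrable_N[OF assms])
  have "norm (jump \<phi> s t \<omega>) \<le> (\<integral>p. norm (indicator ({s<..t} \<times> marks) p *\<^sub>R \<phi> (snd p)) \<partial>N \<omega>)"
    unfolding jump_def by (rule Bochner_Integration.integral_norm_bound)
  also have "\<dots> \<le> (\<integral>p. L * indicator ({s<..t} \<times> marks) p \<partial>N \<omega>)"
  proof (rule Bochner_Integration.integral_mono)
    show "integrable (N \<omega>) (\<lambda>p. L * indicator ({s<..t} \<times> marks) p)"
      using fin s \<omega> by (intro integrable_mult_right integrable_real_indicator) (auto simp: sets_N intro!: sets_slab)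
    show "integrable (N \<omega>) (\<lambda>p. norm (indicator ({s<..t} \<times> marks) p *\<^sub>R \<phi> (snd p)))"
      using i by (rule integrable_norm)
  qed (use \<phi>(2) in \<open>auto split: split_indicator\<close>)
  finally have "norm (jump \<phi> s t \<omega>) \<le> (\<integral>p. L * indicator ({s<..t} \<times> marks) p \<partial>N \<omega>)" .
  then show ?thesis unfolding integral_slab_const[OF s \<omega>] .
qed

text \<open>For an integer-valued measure the off-diagonal part of the double integral is supported
  where there are at least two points, hence the factor \<open>n\<^sup>2 - n\<close>.\<close>

lemma jump_norm_square_le:
  fixes \<phi> :: "'e \<Rightarrow> real^'n"
  assumes \<phi>: "\<phi> \<in> borel_measurable \<nu>" "\<And>\<gamma>. \<gamma> \<in> marks \<Longrightarrow> norm (\<phi> \<gamma>) \<le> L" and s: "0 \<le> s"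
    and \<omega>: "\<omega> \<in> space M" and n: "emeasure (N \<omega>) ({s<..t} \<times> marks) = of_nat n"
  shows "(norm (jump \<phi> s t \<omega>))\<^sup>2 \<le> jump (\<lambda>\<gamma>. (norm (\<phi> \<gamma>))\<^sup>2) s t \<omega> + L\<^sup>2 * ((jump_count s t \<omega>)\<^sup>2 - jump_count s t \<omega>)"
proof -
  have fin: "emeasure (N \<omega>) ({s<..t} \<times> marks) < \<infinity>" using n by (simp add: of_nat_less_top)
  have cn: "jump_count s t \<omega> = real n" using n by (simp add: jump_count_def measure_def)
  let ?\<psi> = "\<lambda>\<gamma>. norm (\<phi> \<gamma>)" and ?J = "indicator ({s<..t} \<times> marks) :: real \<times> 'e \<Rightarrow> real"
  have m\<psi>: "?\<psi> \<in> borel_measurable \<nu>" and m\<psi>2: "(\<lambda>\<gamma>. (?\<psi> \<gamma>)\<^sup>2) \<in> borel_measurable \<nu>" using \<phi>(1) by auto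
  have b2: "norm ((?\<psi> \<gamma>)\<^sup>2) \<le> L\<^sup>2" if "\<gamma> \<in> marks" for \<gamma>
    using power_mono[OF \<phi>(2)[OF that] norm_ge_zero, of 2] by simp
  have i1: "integrable (N \<omega>) (\<lambda>p. ?J p *\<^sub>R ?\<psi> (snd p))"
    using \<phi>(2) by (intro jump_integrable_N[OF m\<psi> _ s \<omega> fin]) auto
  have i2: "integrable (N \<omega>) (\<lambda>p. ?J p *\<^sub>R (?\<psi> (snd p))\<^sup>2)"
    using b2 by (intro jump_integrable_N[OF m\<psi>2 _ s \<omega> fin]) auto
  have i0: "integrable (N \<omega>) (\<lambda>p. c * ?J p)" for c
    using fin s \<omega> by (intro integrable_mult_right integrable_real_indicator) (auto simp: sets_N intro!: sets_slab)
  define I Q where "I = jump ?\<psi> s t \<omega>" and "Q = jump (\<lambda>\<gamma>. (?\<psi> \<gamma>)\<^sup>2) s t \<omega>"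
  have le: "norm (jump \<phi> s t \<omega>) \<le> I"
  proof -
    have eq: "norm (?J p *\<^sub>R \<phi> (snd p)) = ?J p *\<^sub>R ?\<psi> (snd p)" for p by simp
    show ?thesis unfolding I_def jump_def
      using integral_norm_bound[of "N \<omega>" "\<lambda>p. ?J p *\<^sub>R \<phi> (snd p)"] unfolding eq .
  qed
  have Q: "Q \<le> L\<^sup>2 * real n"
    using jump_norm_le[OF m\<psi>2 b2 s \<omega> fin] cn unfolding Q_def by auto
  have I0: "0 \<le> I" using le norm_ge_zero order_trans by blast
  show ?thesis
  proof (cases "n = 0")
    case True
    then have "norm (jump \<phi> s t \<omega>) \<le> 0" using jump_norm_le[OF \<phi> s \<omega> fin] cn by simp
    moreover have "0 \<le> Q" unfolding Q_def jump_def by (rule Bochner_Integration.integral_nonneg) simp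
    ultimately show ?thesis using True cn by (simp add: Q_def)
  next
    case False
    \<comment> \<open>Cauchy-Schwarz in the form of a nonnegative variance: \<open>I / n\<close> is
      the mean of the norms over the n points, and the outcome is
      \<open>I\<^sup>2 \<le> n * Q\<close>.\<close>
    have "0 \<le> (\<integral>p. ?J p * (?\<psi> (snd p) - I / n)\<^sup>2 \<partial>N \<omega>)"
      by (rule Bochner_Integration.integral_nonneg) simp
    also have "\<dots> = (\<integral>p. ?J p *\<^sub>R (?\<psi> (snd p))\<^sup>2 - 2 * (I / n) * (?J p *\<^sub>R ?\<psi> (snd p)) + (I / n)\<^sup>2 * ?J p \<partial>N \<omega>)"
      by (rule Bochner_Integration.integral_cong) (auto simp: power2_diff algebra_simps)
    also have "\<dots> = Q - 2 * (I / n) * I + (I / n)\<^sup>2 * real n"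
      using i1 i2 i0[of "(I / n)\<^sup>2"] integral_slab_const[OF s \<omega>, of "(I / n)\<^sup>2" t]
      unfolding Q_def I_def jump_def cn[symmetric] by (subst Bochner_Integration.integral_add; simp)
    also have "\<dots> = Q - I\<^sup>2 / n"
      using False by (simp add: power2_eq_square field_simps)
    finally have "I\<^sup>2 \<le> n * Q" using False by (simp add: field_simps)
    \<comment> \<open>One copy of \<open>Q\<close> stays exact, because its mean enters the
      generator. Only the other n - 1 copies are bounded; the resulting n^2 - n has a mean of second
      order in the length of the slab.\<close>
    also have "\<dots> = Q + (real n - 1) * Q" by (simp add: algebra_simps)
    also have "\<dots> \<le> Q + (real n - 1) * (L\<^sup>2 * real n)"
      using Q False by (intro add_left_mono mult_left_mono) auto
    finally have "I\<^sup>2 \<le> Q + L\<^sup>2 * ((real n)\<^sup>2 - real n)" by (simp add: algebra_simps power2_eq_square)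
    moreover have "(norm (jump \<phi> s t \<omega>))\<^sup>2 \<le> I\<^sup>2" using le by (intro power_mono) auto
    ultimately show ?thesis by (simp add: cn Q_def)
  qed
qed

lemma nn_integral_slab:
  assumes "0 \<le> s" "s \<le> t" "f \<in> borel_measurable \<nu>"
  shows "(\<integral>\<^sup>+p. f (snd p) * indicator ({s<..t} \<times> marks) p \<partial>prm_intensity \<nu>) = ennreal (t - s) * (\<integral>\<^sup>+\<gamma>. f \<gamma> \<partial>\<nu>)"
proof -
  interpret nu: finite_measure \<nu> by (rule finite_marks)
  have S: "{s<..t} \<in> sets (restrict_space lborel {0..})"
    using assms by (auto simp: sets_restrict_space image_iff intro!: bexI[of _ "{s<..t}"])
  have "(\<integral>\<^sup>+p. f (snd p) * indicator ({s<..t} \<times> marks) p \<partial>prm_intensity \<nu>) =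
     (\<integral>\<^sup>+p. f (snd p) * indicator {s<..t} (fst p) \<partial>prm_intensity \<nu>)"
    by (rule nn_integral_cong) (auto simp: space_prm split: split_indicator)
  also have "\<dots> = (\<integral>\<^sup>+u. \<integral>\<^sup>+\<gamma>. f \<gamma> * indicator {s<..t} u \<partial>\<nu> \<partial>restrict_space lborel {0..})"
    unfolding prm_intensity_def using assms(3) S by (subst nu.nn_integral_fst[symmetric]) simp_all
  also have "\<dots> = (\<integral>\<^sup>+u. (\<integral>\<^sup>+\<gamma>. f \<gamma> \<partial>\<nu>) * indicator {s<..t} u \<partial>restrict_space lborel {0..})"
    using assms(3) by (simp add: nn_integral_multc)
  also have "\<dots> = (\<integral>\<^sup>+\<gamma>. f \<gamma> \<partial>\<nu>) * emeasure (restrict_space lborel {0..}) {s<..t}"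
    using S by (subst nn_integral_cmult_indicator) auto
  also have "emeasure (restrict_space lborel {0..}) {s<..t} = ennreal (t - s)"
    using assms by (subst emeasure_restrict_space) auto
  finally show ?thesis by (simp add: mult.commute)
qed

lemma jump_count_moments:
  assumes "0 \<le> s" "s \<le> t"
  shows "integrable M (jump_count s t)" "expectation (jump_count s t) = (t - s) * mass"
    and "integrable M (\<lambda>\<omega>. (jump_count s t \<omega>)\<^sup>2)"
    and "expectation (\<lambda>\<omega>. (jump_count s t \<omega>)\<^sup>2) = (t - s) * mass + ((t - s) * mass)\<^sup>2"
proof -
  let ?A = "{s<..t} \<times> marks"
  have A: "?A \<in> sets (prm_intensity \<nu>)" "emeasure (prm_intensity \<nu>) ?A = ennreal ((t - s) * mass)" "0 \<le> (t - s) * mass"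
    using assms intensity_slab[OF assms sets.top] slab_sets by (auto simp: mass_def)
  have m: "jump_count s t \<in> borel_measurable M"
    by (rule noise_events_measurable_M[OF jump_count_events]) (use assms in auto)
  have e1: "(\<integral>\<^sup>+\<omega>. ennreal (jump_count s t \<omega>) \<partial>M) = ennreal ((t - s) * mass)"
    unfolding count_mean[OF A, symmetric]
    by (rule nn_integral_cong_AE, use AE_slab[OF assms] in eventually_elim)
       (auto simp: jump_count_def measure_def ennreal_of_nat_eq_real_of_nat)
  have e2: "(\<integral>\<^sup>+\<omega>. ennreal ((jump_count s t \<omega>)\<^sup>2) \<partial>M) = ennreal ((t - s) * mass + ((t - s) * mass)\<^sup>2)"
    unfolding count_square[OF A, symmetric]
    by (rule nn_integral_cong_AE, use AE_slab[OF assms] in eventually_elim)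
       (auto simp: jump_count_def measure_def ennreal_of_nat_eq_real_of_nat ennreal_power)
  have nn: "0 \<le> jump_count s t \<omega>" for \<omega> by (simp add: jump_count_def)
  show "integrable M (jump_count s t)" "expectation (jump_count s t) = (t - s) * mass"
    using e1 m nn A(3) by (auto intro: integrableI_nn_integral_finite simp: integral_eq_nn_integral)
  show "integrable M (\<lambda>\<omega>. (jump_count s t \<omega>)\<^sup>2)"
    "expectation (\<lambda>\<omega>. (jump_count s t \<omega>)\<^sup>2) = (t - s) * mass + ((t - s) * mass)\<^sup>2"
    using e2 m A(3) by (auto intro: integrableI_nn_integral_finite simp: integral_eq_nn_integral simp del: ennreal_plus)
qed

lemma jump_mean_nonneg:
  fixes \<phi> :: "'e \<Rightarrow> real"
  assumes \<phi>: "\<phi> \<in> borel_measurable \<nu>" "\<And>\<gamma>. \<gamma> \<in> marks \<Longrightarrow> 0 \<le> \<phi> \<gamma>" "\<And>\<gamma>. \<gamma> \<in> marks \<Longrightarrow> \<phi> \<gamma> \<le> L" and s: "0 \<le> s" "s \<le> t"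
  shows "integrable M (jump \<phi> s t) \<and> expectation (jump \<phi> s t) = (t - s) * (\<integral>\<gamma>. \<phi> \<gamma> \<partial>\<nu>)"
proof -
  interpret nu: finite_measure \<nu> by (rule finite_marks)
  have b: "norm (\<phi> \<gamma>) \<le> L" if "\<gamma> \<in> marks" for \<gamma> using \<phi>(2,3)[OF that] by auto
  have i: "integrable \<nu> \<phi>" using b \<phi>(1) by (intro nu.integrable_const_bound[of _ L]) auto
  have m: "jump \<phi> s t \<in> borel_measurable M"
    by (rule noise_events_measurable_M[OF jump_events_real[OF \<phi>(1) s(1)]]) (use s in auto)
  have pos: "0 \<le> indicator ({s<..t} \<times> marks) p *\<^sub>R \<phi> (snd p)" for p
    using \<phi>(2) by (auto split: split_indicator)
  have nn: "0 \<le> jump \<phi> s t \<omega>" for \<omega>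
    unfolding jump_def using pos by (intro Bochner_Integration.integral_nonneg)
  \<comment> \<open>The indicator appears twice: once inside the integrand, once as the restriction
    to the slab that \<open>campbell_nn\<close> works with.\<close>
  have "(\<integral>\<^sup>+\<omega>. ennreal (jump \<phi> s t \<omega>) \<partial>M) = (\<integral>\<^sup>+\<omega>. (\<integral>\<^sup>+p. (ennreal (\<phi> (snd p)) * indicator ({s<..t} \<times> marks) p) * indicator ({s<..t} \<times> marks) p \<partial>N \<omega>) \<partial>M)"
  proof (rule nn_integral_cong_AE, use AE_slab[OF s] AE_space in eventually_elim)
    case (elim \<omega>)
    then have fin: "emeasure (N \<omega>) ({s<..t} \<times> marks) < \<infinity>" by (auto simp: of_nat_less_top)
    have "ennreal (jump \<phi> s t \<omega>) = (\<integral>\<^sup>+p. ennreal (indicator ({s<..t} \<times> marks) p *\<^sub>R \<phi> (snd p)) \<partial>N \<omega>)"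
      unfolding jump_def using jump_integrable_N[OF \<phi>(1) b s(1) elim(2) fin] pos
      by (subst nn_integral_eq_integral) auto
    also have "\<dots> = (\<integral>\<^sup>+p. (ennreal (\<phi> (snd p)) * indicator ({s<..t} \<times> marks) p) * indicator ({s<..t} \<times> marks) p \<partial>N \<omega>)"
      by (rule nn_integral_cong) (auto split: split_indicator)
    finally show ?case .
  qed
  also have "\<dots> = (\<integral>\<^sup>+p. (ennreal (\<phi> (snd p)) * indicator ({s<..t} \<times> marks) p) * indicator ({s<..t} \<times> marks) p \<partial>prm_intensity \<nu>)"
  proof (rule campbell_nn)
    have "{s<..t} \<times> marks \<in> sets (prm_intensity \<nu>)" using s by (intro sets_slab) auto
    then show "(\<lambda>p. ennreal (\<phi> (snd p)) * indicator ({s<..t} \<times> marks) p) \<in> borel_measurable (prm_intensity \<nu>)"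
      using measurable_compose[OF snd_prm \<phi>(1)] by measurable
    show "emeasure (prm_intensity \<nu>) ({s<..t} \<times> marks) < \<infinity>"
      using intensity_slab[OF s sets.top] by simp
  qed (use s in auto)
  also have "\<dots> = (\<integral>\<^sup>+p. ennreal (\<phi> (snd p)) * indicator ({s<..t} \<times> marks) p \<partial>prm_intensity \<nu>)"
    by (rule nn_integral_cong) (auto split: split_indicator)
  also have "\<dots> = ennreal (t - s) * (\<integral>\<^sup>+\<gamma>. ennreal (\<phi> \<gamma>) \<partial>\<nu>)"
    using \<phi>(1) s by (intro nn_integral_slab) auto
  also have "\<dots> = ennreal ((t - s) * (\<integral>\<gamma>. \<phi> \<gamma> \<partial>\<nu>))"
    using i \<phi>(2) s by (subst nn_integral_eq_integral) (auto simp: ennreal_mult integral_nonneg_AE)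
  finally have e: "(\<integral>\<^sup>+\<omega>. ennreal (jump \<phi> s t \<omega>) \<partial>M) = ennreal ((t - s) * (\<integral>\<gamma>. \<phi> \<gamma> \<partial>\<nu>))" .
  have "0 \<le> (t - s) * (\<integral>\<gamma>. \<phi> \<gamma> \<partial>\<nu>)" using s \<phi>(2) by (intro mult_nonneg_nonneg Bochner_Integration.integral_nonneg_AE) auto
  with e m nn show ?thesis
    by (auto intro: integrableI_nn_integral_finite simp: integral_eq_nn_integral)
qed

text \<open>Adding the bound L makes the integrand nonnegative; the contribution of the constant L
  is then removed with the known mean of the count.\<close>

lemma jump_mean_real:
  fixes \<phi> :: "'e \<Rightarrow> real"
  assumes \<phi>: "\<phi> \<in> borel_measurable \<nu>" "\<And>\<gamma>. \<gamma> \<in> marks \<Longrightarrow> norm (\<phi> \<gamma>) \<le> L" and s: "0 \<le> s" "s \<le> t"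
  shows "integrable M (jump \<phi> s t)" "expectation (jump \<phi> s t) = (t - s) * (\<integral>\<gamma>. \<phi> \<gamma> \<partial>\<nu>)"
proof -
  interpret nu: finite_measure \<nu> by (rule finite_marks)
  have m: "(\<lambda>\<gamma>. \<phi> \<gamma> + L) \<in> borel_measurable \<nu>" using \<phi>(1) by simp
  have pos: "0 \<le> \<phi> \<gamma> + L" "\<phi> \<gamma> + L \<le> 2 * L" if "\<gamma> \<in> marks" for \<gamma> using \<phi>(2)[OF that] by auto
  note P = jump_mean_nonneg[OF m pos s]
  have i: "integrable \<nu> \<phi>" using \<phi> by (intro nu.integrable_const_bound[of _ L]) auto
  have ae: "AE \<omega> in M. jump \<phi> s t \<omega> = jump (\<lambda>\<gamma>. \<phi> \<gamma> + L) s t \<omega> - L * jump_count s t \<omega>"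
    using AE_slab[OF s] AE_space
  proof eventually_elim
    case (elim \<omega>)
    then have fin: "emeasure (N \<omega>) ({s<..t} \<times> marks) < \<infinity>" by (auto simp: of_nat_less_top)
    have i0: "integrable (N \<omega>) (\<lambda>p. L * indicator ({s<..t} \<times> marks) p)"
      using fin s elim by (intro integrable_mult_right integrable_real_indicator) (auto simp: sets_N intro!: sets_slab)
    have "jump (\<lambda>\<gamma>. \<phi> \<gamma> + L) s t \<omega> = (\<integral>p. indicator ({s<..t} \<times> marks) p *\<^sub>R \<phi> (snd p) + L * indicator ({s<..t} \<times> marks) p \<partial>N \<omega>)"
      unfolding jump_def by (rule Bochner_Integration.integral_cong) (auto simp: algebra_simps)
    also have "\<dots> = jump \<phi> s t \<omega> + L * jump_count s t \<omega>"
      unfolding jump_def integral_slab_const[OF s(1) elim(2), symmetric]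
      using jump_integrable_N[OF \<phi> s(1) elim(2) fin] i0 by (rule Bochner_Integration.integral_add)
    finally show ?case by simp
  qed
  have mj: "jump \<phi> s t \<in> borel_measurable M"
    by (rule noise_events_measurable_M[OF jump_events_real[OF \<phi>(1) s(1)]]) (use s in auto)
  have i': "integrable M (\<lambda>\<omega>. jump (\<lambda>\<gamma>. \<phi> \<gamma> + L) s t \<omega> - L * jump_count s t \<omega>)"
    using P jump_count_moments[OF s] by auto
  show "integrable M (jump \<phi> s t)"
    using integrable_cong_AE[OF mj borel_measurable_integrable[OF i'] ae] i' by simp
  have "expectation (jump \<phi> s t) = expectation (\<lambda>\<omega>. jump (\<lambda>\<gamma>. \<phi> \<gamma> + L) s t \<omega> - L * jump_count s t \<omega>)"
    by (rule integral_cong_AE[OF mj borel_measurable_integrable[OF i'] ae])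
  also have "\<dots> = (t - s) * (\<integral>\<gamma>. \<phi> \<gamma> + L \<partial>\<nu>) - L * ((t - s) * mass)"
    using P jump_count_moments[OF s] by simp
  also have "(\<integral>\<gamma>. \<phi> \<gamma> + L \<partial>\<nu>) = (\<integral>\<gamma>. \<phi> \<gamma> \<partial>\<nu>) + L * mass"
    using i by (subst Bochner_Integration.integral_add) (auto simp: mass_def)
  finally show "expectation (jump \<phi> s t) = (t - s) * (\<integral>\<gamma>. \<phi> \<gamma> \<partial>\<nu>)" by (simp add: algebra_simps)
qed

lemma jump_component:
  fixes \<phi> :: "'e \<Rightarrow> real^'n"
  assumes \<phi>: "\<phi> \<in> borel_measurable \<nu>" "\<And>\<gamma>. \<gamma> \<in> marks \<Longrightarrow> norm (\<phi> \<gamma>) \<le> L" and s: "0 \<le> s" "s \<le> t"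
  shows "AE \<omega> in M. jump \<phi> s t \<omega> $ a = jump (\<lambda>\<gamma>. \<phi> \<gamma> $ a) s t \<omega>"
  using AE_slab[OF s] AE_space
proof eventually_elim
  case (elim \<omega>)
  then have fin: "emeasure (N \<omega>) ({s<..t} \<times> marks) < \<infinity>" by (auto simp: of_nat_less_top)
  show ?case unfolding jump_def
    using integral_bounded_linear[OF bounded_linear_vec_nth jump_integrable_N[OF \<phi> s(1) elim(2) fin], of a] by simp
qed

lemma jump_mean:
  fixes \<phi> :: "'e \<Rightarrow> real^'n"
  assumes \<phi>: "\<phi> \<in> borel_measurable \<nu>" "\<And>\<gamma>. \<gamma> \<in> marks \<Longrightarrow> norm (\<phi> \<gamma>) \<le> L" and s: "0 \<le> s" "s \<le> t"
  shows "integrable M (\<lambda>\<omega>. jump \<phi> s t \<omega> $ a)" "expectation (\<lambda>\<omega>. jump \<phi> s t \<omega> $ a) = (t - s) * (\<integral>\<gamma>. \<phi> \<gamma> \<partial>\<nu>) $ a"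
proof -
  interpret nu: finite_measure \<nu> by (rule finite_marks)
  have c: "(\<lambda>\<gamma>. \<phi> \<gamma> $ a) \<in> borel_measurable \<nu>" "\<And>\<gamma>. \<gamma> \<in> marks \<Longrightarrow> norm (\<phi> \<gamma> $ a) \<le> L"
    using \<phi> by (auto intro: order_trans[OF component_le_norm_cart] intro!: measurable_compose[OF \<phi>(1) borel_measurable_continuous_onI] continuous_intros)
  have i: "integrable \<nu> \<phi>" using \<phi> by (intro nu.integrable_const_bound[of _ L]) auto
  have m: "(\<lambda>\<omega>. jump \<phi> s t \<omega> $ a) \<in> borel_measurable M"
    by (intro measurable_compose[OF jump_measurable[OF \<phi>(1) s(1)] borel_measurable_continuous_onI] continuous_intros)
  note J = jump_mean_real[OF c s]
  show "integrable M (\<lambda>\<omega>. jump \<phi> s t \<omega> $ a)"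
    using integrable_cong_AE[OF m borel_measurable_integrable[OF J(1)] jump_component[OF \<phi> s]] J(1) by simp
  have "expectation (\<lambda>\<omega>. jump \<phi> s t \<omega> $ a) = expectation (jump (\<lambda>\<gamma>. \<phi> \<gamma> $ a) s t)"
    by (rule integral_cong_AE[OF m borel_measurable_integrable[OF J(1)] jump_component[OF \<phi> s]])
  also have "\<dots> = (t - s) * (\<integral>\<gamma>. \<phi> \<gamma> \<partial>\<nu>) $ a"
    using J(2) integral_bounded_linear[OF bounded_linear_vec_nth i, of a] by simp
  finally show "expectation (\<lambda>\<omega>. jump \<phi> s t \<omega> $ a) = (t - s) * (\<integral>\<gamma>. \<phi> \<gamma> \<partial>\<nu>) $ a" .
qed

lemma noise_events_expectation_mult:
  fixes U V :: "'w \<Rightarrow> real"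
  assumes "0 \<le> s" "U \<in> borel_measurable (F s)" "integrable M U"
    and "V \<in> borel_measurable (noise_events {s<..})" "integrable M V"
  shows "integrable M (\<lambda>\<omega>. U \<omega> * V \<omega>)" "expectation (\<lambda>\<omega>. U \<omega> * V \<omega>) = expectation U * expectation V"
proof -
  have 1: "indep_set (sets (F s)) (prm_events M \<nu> N {s<..})"
    using poisson assms(1) by (auto simp: poisson_random_measure_def)
  have 2: "U -` A \<inter> space M \<in> sets (F s)" if "A \<in> sets borel" for A
    using measurable_sets[OF assms(2) that] by simp
  have 3: "V -` A \<inter> space M \<in> prm_events M \<nu> N {s<..}" if "A \<in> sets borel" for A
    using measurable_sets[OF assms(4) that] by (simp add: sets_noise_events)
  show "integrable M (\<lambda>\<omega>. U \<omega> * V \<omega>)" "expectation (\<lambda>\<omega>. U \<omega> * V \<omega>) = expectation U * expectation V"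
    by (rule indep_set_expectation_mult[OF 1 assms(3,5) 2 3]; assumption)+
qed

end

section \<open>One Euler step\<close>

lemma (in prob_space) square_integrable_imp_integrable:
  fixes Y :: "'a \<Rightarrow> 'b::{banach,second_countable_topology}"
  assumes "Y \<in> borel_measurable M" "integrable M (\<lambda>x. (norm (Y x))\<^sup>2)"
  shows "integrable M Y"
proof (rule Bochner_Integration.integrable_bound)
  show "integrable M (\<lambda>x. 1 + (norm (Y x))\<^sup>2)" using assms(2) by auto
  have "y \<le> 1 + y\<^sup>2" if "0 \<le> y" for y :: real
    using zero_le_power2[of "y - 1"] that by (simp add: power2_diff)
  then show "AE x in M. norm (Y x) \<le> norm (1 + (norm (Y x))\<^sup>2)"
    by (intro AE_I2) (auto intro: order_trans[OF _ abs_ge_self])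
qed (rule assms(1))

lemma borel_measurable_vec_nth:
  fixes f :: "'a \<Rightarrow> 'b::{second_countable_topology,t2_space}^'n"
  assumes "f \<in> borel_measurable M"
  shows "(\<lambda>x. f x $ a) \<in> borel_measurable M"
  by (intro measurable_compose[OF assms borel_measurable_continuous_onI] continuous_intros)

lemma borel_measurable_matrix_vector_mult:
  fixes f :: "'a \<Rightarrow> real^'n^'m" and g :: "'a \<Rightarrow> real^'n"
  assumes "f \<in> borel_measurable M" "g \<in> borel_measurable M"
  shows "(\<lambda>x. f x *v g x) \<in> borel_measurable M"
proof (rule borel_measurable_vecI)
  fix a :: 'm
  have "(\<lambda>x. \<Sum>b\<in>UNIV. f x $ a $ b * g x $ b) \<in> borel_measurable M"
    using assms by (intro borel_measurable_sum borel_measurable_times borel_measurable_vec_nth)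
  then show "(\<lambda>x. (f x *v g x) $ a) \<in> borel_measurable M"
    by (simp add: matrix_vector_mult_def)
qed

lemma norm_matrix_square: "(norm (A :: real^'n^'m))\<^sup>2 = (\<Sum>a\<in>UNIV. \<Sum>b\<in>UNIV. (A $ a $ b)\<^sup>2)"
  unfolding power2_norm_eq_inner by (simp add: inner_vec_def power2_eq_square)

lemma norm_matrix_vector_mult_le: "norm ((A :: real^'n^'m) *v x) \<le> norm A * norm x"
proof -
  have "(norm (A *v x))\<^sup>2 = (\<Sum>a\<in>UNIV. (A $ a \<bullet> x)\<^sup>2)"
    unfolding power2_norm_eq_inner by (simp add: inner_vec_def matrix_vector_mult_def power2_eq_square)
  also have "\<dots> \<le> (\<Sum>a\<in>UNIV. (norm (A $ a))\<^sup>2 * (norm x)\<^sup>2)"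
    using Cauchy_Schwarz_ineq by (intro sum_mono) (simp add: power2_norm_eq_inner)
  also have "\<dots> = (norm A * norm x)\<^sup>2"
    by (simp add: power_mult_distrib sum_distrib_right power2_norm_eq_inner inner_vec_def[of A A])
  finally show ?thesis by (rule power2_le_imp_le) simp
qed

context driving_noise
begin

definition incr :: "real \<Rightarrow> real \<Rightarrow> 'w \<Rightarrow> real^'d" where
  "incr s t \<omega> = w t \<omega> - w s \<omega>"

lemma w_measurable: "0 \<le> t \<Longrightarrow> w t \<in> borel_measurable (F t)"
  using brownian by (auto simp: standard_brownian_motion_def)

lemma incr_measurable: "0 \<le> s \<Longrightarrow> 0 \<le> t \<Longrightarrow> incr s t \<in> borel_measurable M"
  unfolding incr_def[abs_def]
  using measurable_F_M[OF w_measurable] by (intro borel_measurable_diff) auto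

lemma incr_measurable_F: "0 \<le> s \<Longrightarrow> s \<le> u \<Longrightarrow> 0 \<le> t \<Longrightarrow> t \<le> u \<Longrightarrow> incr s t \<in> borel_measurable (F u)"
  unfolding incr_def[abs_def]
  using measurable_F_mono[OF w_measurable] by (intro borel_measurable_diff) auto

lemma incr_distributed:
  assumes "0 \<le> s" "s < t"
  shows "distributed M lborel (\<lambda>\<omega>. incr s t \<omega> $ a) (normal_density 0 (sqrt (t - s)))"
  using brownian assms by (auto simp: standard_brownian_motion_def incr_def)

lemma incr_moments:
  assumes "0 \<le> s" "s < t"
  shows "integrable M (\<lambda>\<omega>. (incr s t \<omega> $ a) ^ k)"
    and "expectation (\<lambda>\<omega>. incr s t \<omega> $ a) = 0"
    and "expectation (\<lambda>\<omega>. (incr s t \<omega> $ a)\<^sup>2) = t - s"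
    and "expectation (\<lambda>\<omega>. (incr s t \<omega> $ a) ^ 4) = 3 * (t - s)\<^sup>2"
proof -
  have p: "0 < sqrt (t - s)" using assms by simp
  note D = incr_distributed[OF assms, of a]
  show "integrable M (\<lambda>\<omega>. (incr s t \<omega> $ a) ^ k)"
    using distributed_integrable[OF D, of "\<lambda>x. x ^ k"] integrable_normal_moment[OF p, of 0 k] by simp
  have e: "expectation (\<lambda>\<omega>. (incr s t \<omega> $ a) ^ n) = (\<integral>x. normal_density 0 (sqrt (t - s)) x * (x - 0) ^ n \<partial>lborel)" for n
    using distributed_integral[OF D, of "\<lambda>x. x ^ n"] by simp
  show "expectation (\<lambda>\<omega>. incr s t \<omega> $ a) = 0"
    using e[of 1] integral_normal_moment_odd[OF p, of 0 0] by simp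
  show "expectation (\<lambda>\<omega>. (incr s t \<omega> $ a)\<^sup>2) = t - s"
    using e[of 2] integral_normal_moment_even[OF p, of 0 1] assms by simp
  have "expectation (\<lambda>\<omega>. (incr s t \<omega> $ a) ^ 4) = fact 4 / ((2 / (sqrt (t - s))\<^sup>2)\<^sup>2 * fact 2)"
    using e[of 4] integral_normal_moment_even[OF p, of 0 2] by simp
  also have "\<dots> = 3 * (t - s)\<^sup>2" using assms by (simp add: fact_numeral power_divide)
  finally show "expectation (\<lambda>\<omega>. (incr s t \<omega> $ a) ^ 4) = 3 * (t - s)\<^sup>2" .
qed

lemma incr_cross:
  assumes "0 \<le> s" "s < t"
  shows "integrable M (\<lambda>\<omega>. incr s t \<omega> $ a * incr s t \<omega> $ b)"
    and "expectation (\<lambda>\<omega>. incr s t \<omega> $ a * incr s t \<omega> $ b) = (if a = b then t - s else 0)"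
proof -
  have "integrable M (\<lambda>\<omega>. incr s t \<omega> $ a * incr s t \<omega> $ b) \<and>
    expectation (\<lambda>\<omega>. incr s t \<omega> $ a * incr s t \<omega> $ b) = (if a = b then t - s else 0)"
  proof (cases "a = b")
    case True
    then show ?thesis using incr_moments(1)[OF assms, of a 2] incr_moments(3)[OF assms, of a]
      by (simp add: power2_eq_square)
  next
    case False
    have "indep_vars (\<lambda>_. borel) (\<lambda>k \<omega>. incr s t \<omega> $ k) {a, b}"
    proof (rule indep_vars_subset)
      show "indep_vars (\<lambda>_. borel) (\<lambda>k \<omega>. incr s t \<omega> $ k) UNIV"
        using brownian assms unfolding standard_brownian_motion_def incr_def by blast
    qed simp
    note I = indep_vars_integrable[OF _ this] indep_vars_lebesgue_integral[OF _ this]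
    have "integrable M (\<lambda>\<omega>. incr s t \<omega> $ i)" for i
      using incr_moments(1)[OF assms, of i 1] by simp
    with I False incr_moments(2)[OF assms] show ?thesis by simp
  qed
  then show "integrable M (\<lambda>\<omega>. incr s t \<omega> $ a * incr s t \<omega> $ b)"
    and "expectation (\<lambda>\<omega>. incr s t \<omega> $ a * incr s t \<omega> $ b) = (if a = b then t - s else 0)"
    by auto
qed

lemma incr_expectation_mult:
  fixes U :: "'w \<Rightarrow> real" and f :: "real^'d \<Rightarrow> real"
  assumes "0 \<le> s" "s < t" "U \<in> borel_measurable (F s)" "integrable M U"
    and f: "f \<in> borel_measurable borel" "integrable M (\<lambda>\<omega>. f (incr s t \<omega>))"
  shows "integrable M (\<lambda>\<omega>. U \<omega> * f (incr s t \<omega>))"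
    and "expectation (\<lambda>\<omega>. U \<omega> * f (incr s t \<omega>)) = expectation U * expectation (\<lambda>\<omega>. f (incr s t \<omega>))"
proof -
  have 1: "indep_set (sets (F s)) {(\<lambda>\<omega>. w t \<omega> - w s \<omega>) -` B \<inter> space M | B. B \<in> sets borel}"
    using brownian assms by (auto simp: standard_brownian_motion_def)
  have 2: "U -` A \<inter> space M \<in> sets (F s)" if "A \<in> sets borel" for A
    using measurable_sets[OF assms(3) that] by simp
  have 3: "(\<lambda>\<omega>. f (incr s t \<omega>)) -` A \<inter> space M \<in> {(\<lambda>\<omega>. w t \<omega> - w s \<omega>) -` B \<inter> space M | B. B \<in> sets borel}"
    if "A \<in> sets borel" for A
    using measurable_sets[OF f(1) that] by (auto simp: incr_def intro!: exI[of _ "f -` A"])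
  show "integrable M (\<lambda>\<omega>. U \<omega> * f (incr s t \<omega>))"
    "expectation (\<lambda>\<omega>. U \<omega> * f (incr s t \<omega>)) = expectation U * expectation (\<lambda>\<omega>. f (incr s t \<omega>))"
    by (rule indep_set_expectation_mult[OF 1 assms(4) f(2) 2 3]; assumption)+
qed

text \<open>In coordinates every summand is a factor known at time s times a polynomial in the
  increment, so independence factors its expectation. The first two claims are orthogonality of the
  increment to the past, the last two the isometry.\<close>

lemma ito_step:
  fixes Y :: "'w \<Rightarrow> real^'n" and H :: "'w \<Rightarrow> real^'d^'n"
  assumes st: "0 \<le> s" "s < t"
    and Y: "Y \<in> borel_measurable (F s)" "integrable M (\<lambda>\<omega>. (norm (Y \<omega>))\<^sup>2)"
    and H: "H \<in> borel_measurable (F s)" "\<And>\<omega>. \<omega> \<in> space M \<Longrightarrow> norm (H \<omega>) \<le> B"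
  shows "integrable M (\<lambda>\<omega>. Y \<omega> \<bullet> (H \<omega> *v incr s t \<omega>))"
    and "expectation (\<lambda>\<omega>. Y \<omega> \<bullet> (H \<omega> *v incr s t \<omega>)) = 0"
    and "integrable M (\<lambda>\<omega>. (norm (H \<omega> *v incr s t \<omega>))\<^sup>2)"
    and "expectation (\<lambda>\<omega>. (norm (H \<omega> *v incr s t \<omega>))\<^sup>2) = (t - s) * expectation (\<lambda>\<omega>. (norm (H \<omega>))\<^sup>2)"
proof -
  have iY: "integrable M Y"
    using measurable_F_M[OF Y(1) st(1)] Y(2) by (rule square_integrable_imp_integrable)
  have mH: "(\<lambda>\<omega>. H \<omega> $ a $ b) \<in> borel_measurable (F s)" for a b
    by (intro borel_measurable_vec_nth H(1))
  have mY: "(\<lambda>\<omega>. Y \<omega> $ a) \<in> borel_measurable (F s)" for a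
    by (intro borel_measurable_vec_nth Y(1))
  have bH: "\<bar>H \<omega> $ a $ b\<bar> \<le> B" if "\<omega> \<in> space M" for \<omega> a b
    using component_le_norm_cart[of "H \<omega> $ a" b] Finite_Cartesian_Product.norm_nth_le[of "H \<omega>" a] H(2)[OF that] by linarith
  have iH: "integrable M (\<lambda>\<omega>. H \<omega> $ a $ b * H \<omega> $ c $ e)" for a b c e
  proof (rule integrable_const_bound[of _ "B * B"])
    show "AE \<omega> in M. norm (H \<omega> $ a $ b * H \<omega> $ c $ e) \<le> B * B"
      using bH by (intro AE_I2) (auto simp: abs_mult intro!: mult_mono intro: order_trans[OF abs_ge_zero])
  qed (use measurable_F_M[OF mH st(1)] in auto)
  have iYH: "integrable M (\<lambda>\<omega>. Y \<omega> $ a * H \<omega> $ a $ b)" for a b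
  proof (rule Bochner_Integration.integrable_bound)
    show "integrable M (\<lambda>\<omega>. B * norm (Y \<omega>))" using iY by auto
    show "AE \<omega> in M. norm (Y \<omega> $ a * H \<omega> $ a $ b) \<le> norm (B * norm (Y \<omega>))"
    proof (rule AE_I2)
      fix \<omega> assume "\<omega> \<in> space M"
      then have "\<bar>Y \<omega> $ a\<bar> * \<bar>H \<omega> $ a $ b\<bar> \<le> norm (Y \<omega>) * B"
        using bH component_le_norm_cart by (intro mult_mono) auto
      then show "norm (Y \<omega> $ a * H \<omega> $ a $ b) \<le> norm (B * norm (Y \<omega>))"
        by (auto simp: abs_mult mult.commute intro: order_trans[OF _ mult_right_mono[OF abs_ge_self]])
    qed
  qed (use measurable_F_M[OF mH st(1)] measurable_F_M[OF mY st(1)] in auto)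
  have fst: "(\<lambda>x::real^'d. x $ b) \<in> borel_measurable borel" for b
    by (intro borel_measurable_continuous_onI continuous_intros)
  have snd: "(\<lambda>x::real^'d. x $ b * x $ c) \<in> borel_measurable borel" for b c
    by (intro borel_measurable_continuous_onI continuous_intros)
  have i1: "integrable M (\<lambda>\<omega>. incr s t \<omega> $ b)" for b using incr_moments(1)[OF st, of b 1] by simp
  have 1: "Y \<omega> \<bullet> (H \<omega> *v incr s t \<omega>) = (\<Sum>a\<in>UNIV. \<Sum>b\<in>UNIV. (Y \<omega> $ a * H \<omega> $ a $ b) * incr s t \<omega> $ b)" for \<omega>
    by (simp add: inner_vec_def matrix_vector_mult_def sum_distrib_left mult.assoc)
  have 2: "(norm (H \<omega> *v incr s t \<omega>))\<^sup>2 = (\<Sum>a\<in>UNIV. \<Sum>b\<in>UNIV. \<Sum>c\<in>UNIV. (H \<omega> $ a $ b * H \<omega> $ a $ c) * (incr s t \<omega> $ b * incr s t \<omega> $ c))" for \<omega>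
    by (simp add: power2_norm_eq_inner inner_vec_def matrix_vector_mult_def sum_product mult_ac)
  note E1 = incr_expectation_mult[OF st _ iYH fst i1] and E2 = incr_expectation_mult[OF st _ iH snd incr_cross(1)[OF st]]
  have m1: "(\<lambda>\<omega>. Y \<omega> $ a * H \<omega> $ a $ b) \<in> borel_measurable (F s)" for a b using mY mH by auto
  have m2: "(\<lambda>\<omega>. H \<omega> $ a $ b * H \<omega> $ c $ e) \<in> borel_measurable (F s)" for a b c e using mH by auto
  show "integrable M (\<lambda>\<omega>. Y \<omega> \<bullet> (H \<omega> *v incr s t \<omega>))"
    unfolding 1 by (intro Bochner_Integration.integrable_sum E1(1) m1)
  show "expectation (\<lambda>\<omega>. Y \<omega> \<bullet> (H \<omega> *v incr s t \<omega>)) = 0"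
    unfolding 1 using E1[OF m1] by (simp add: integral_sum incr_moments(2)[OF st])
  show "integrable M (\<lambda>\<omega>. (norm (H \<omega> *v incr s t \<omega>))\<^sup>2)"
    unfolding 2 by (intro Bochner_Integration.integrable_sum E2(1) m2)
  have "expectation (\<lambda>\<omega>. (norm (H \<omega> *v incr s t \<omega>))\<^sup>2) = (\<Sum>a\<in>UNIV. \<Sum>b\<in>UNIV. \<Sum>c\<in>UNIV.
      expectation (\<lambda>\<omega>. H \<omega> $ a $ b * H \<omega> $ a $ c) * (if b = c then t - s else 0))"
    unfolding 2 using E2[OF m2] by (simp add: integral_sum incr_cross(2)[OF st])
  also have "\<dots> = (t - s) * (\<Sum>a\<in>UNIV. \<Sum>b\<in>UNIV. expectation (\<lambda>\<omega>. (H \<omega> $ a $ b)\<^sup>2))"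
    by (simp add: sum_distrib_left power2_eq_square if_distrib mult.commute cong: if_cong)
  also have "(\<Sum>a\<in>UNIV. \<Sum>b\<in>UNIV. expectation (\<lambda>\<omega>. (H \<omega> $ a $ b)\<^sup>2)) = expectation (\<lambda>\<omega>. (norm (H \<omega>))\<^sup>2)"
    unfolding norm_matrix_square using iH by (simp add: integral_sum power2_eq_square)
  finally show "expectation (\<lambda>\<omega>. (norm (H \<omega> *v incr s t \<omega>))\<^sup>2) = (t - s) * expectation (\<lambda>\<omega>. (norm (H \<omega>))\<^sup>2)" .
qed

text \<open>Of the two factors \<open>CARD('d)\<close> one comes from Cauchy-Schwarz over the
  coordinates, the other from summing their Gaussian fourth moments. The bound serves the mixed term
  of Brownian and jump increments.\<close>

lemma incr_fourth:
  assumes st: "0 \<le> s" "s < t"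
  shows "integrable M (\<lambda>\<omega>. (norm (incr s t \<omega>)) ^ 4)"
    and "expectation (\<lambda>\<omega>. (norm (incr s t \<omega>)) ^ 4) \<le> 3 * (real CARD('d))\<^sup>2 * (t - s)\<^sup>2"
proof -
  have le: "(norm (incr s t \<omega>)) ^ 4 \<le> real CARD('d) * (\<Sum>a\<in>UNIV. (incr s t \<omega> $ a) ^ 4)" for \<omega>
  proof -
    have "(norm (incr s t \<omega>)) ^ 4 = ((norm (incr s t \<omega>))\<^sup>2)\<^sup>2" by simp
    also have "\<dots> = (\<Sum>a\<in>UNIV. (incr s t \<omega> $ a)\<^sup>2)\<^sup>2"
      by (simp only: power2_norm_eq_inner inner_vec_def) (simp add: power2_eq_square)
    also have "\<dots> \<le> real CARD('d) * (\<Sum>a\<in>UNIV. ((incr s t \<omega> $ a)\<^sup>2)\<^sup>2)"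
      using sum_squared_le_sum_of_squares[of "\<lambda>a. (incr s t \<omega> $ a)\<^sup>2" UNIV] by (simp add: mult.commute)
    finally show ?thesis by simp
  qed
  have i: "integrable M (\<lambda>\<omega>. real CARD('d) * (\<Sum>a\<in>UNIV. (incr s t \<omega> $ a) ^ 4))"
    using incr_moments(1)[OF st] by auto
  show int: "integrable M (\<lambda>\<omega>. (norm (incr s t \<omega>)) ^ 4)"
    by (rule Bochner_Integration.integrable_bound[OF i])
       (use le incr_measurable st in \<open>auto intro: order_trans[OF _ abs_ge_self]\<close>)
  have "expectation (\<lambda>\<omega>. (norm (incr s t \<omega>)) ^ 4) \<le> expectation (\<lambda>\<omega>. real CARD('d) * (\<Sum>a\<in>UNIV. (incr s t \<omega> $ a) ^ 4))"
    using le by (intro integral_mono int i) auto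
  also have "\<dots> = 3 * (real CARD('d))\<^sup>2 * (t - s)\<^sup>2"
    using incr_moments(1)[OF st] by (simp add: integral_sum incr_moments(4)[OF st] power2_eq_square)
  finally show "expectation (\<lambda>\<omega>. (norm (incr s t \<omega>)) ^ 4) \<le> 3 * (real CARD('d))\<^sup>2 * (t - s)\<^sup>2" .
qed

end

text \<open>If x > \<epsilon> n with n at least 1, then x \<ge> \<epsilon>, hence x n \<le> x^2 /
  \<epsilon> \<le> x^4 / \<epsilon>^3; this is where integrality of n enters. For the norm x of a
  Brownian increment and the number n of jumps during time h the right side has a mean of order
  \<epsilon> h + h^2 / \<epsilon>^3, whereas Cauchy-Schwarz would only give order h, the order of
  the generator itself.\<close>

lemma mult_le_square_plus_fourth:
  fixes x \<epsilon> :: real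
  assumes "0 \<le> x" "0 < \<epsilon>"
  shows "x * real n \<le> \<epsilon> * (real n)\<^sup>2 + x ^ 4 / \<epsilon> ^ 3"
proof (cases "n = 0")
  case False
  show ?thesis
  proof (cases "x \<le> \<epsilon> * n")
    case True
    then have "x * n \<le> \<epsilon> * n * n" by (intro mult_right_mono) auto
    moreover have "0 \<le> x ^ 4 / \<epsilon> ^ 3" using assms by simp
    ultimately show ?thesis by (simp add: power2_eq_square mult.assoc)
  next
    case n: False
    have e: "\<epsilon> \<le> \<epsilon> * real n" using False assms(2) by simp
    then have ex: "\<epsilon> \<le> x" using n by simp
    have "x * real n \<le> x * (x / \<epsilon>)"
      using n assms by (intro mult_left_mono) (auto simp: field_simps)
    also have "\<dots> = x\<^sup>2 * \<epsilon>\<^sup>2 / \<epsilon> ^ 3" using assms by (simp add: field_simps power2_eq_square power3_eq_cube)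
    also have "\<dots> \<le> x\<^sup>2 * x\<^sup>2 / \<epsilon> ^ 3"
      using assms ex by (intro divide_right_mono mult_left_mono power_mono) auto
    also have "\<dots> = x ^ 4 / \<epsilon> ^ 3" by (simp add: power_add[symmetric])
    finally show ?thesis using assms by (simp add: add_increasing)
  qed
qed (use assms in simp)

context driving_noise
begin

text \<open>Collects, per unit of L^2, what a step contributes beyond the generator: the squared
  drift, the drift against the mean jump and pairs of jumps in the first summand, the mixed Brownian
  and jump term in the second. Divided by h it tends to 2 \<epsilon> \<open>mass\<close> as h tends
  to 0.\<close>

definition step_error :: "real \<Rightarrow> real \<Rightarrow> real" where
  "step_error \<epsilon> h = h\<^sup>2 * (1 + 2 * mass + mass\<^sup>2)
    + 2 * (\<epsilon> * (h * mass + (h * mass)\<^sup>2) + 3 * (real CARD('d))\<^sup>2 * h\<^sup>2 / \<epsilon> ^ 3)"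

lemma integral_marks_le:
  fixes \<phi> :: "'e \<Rightarrow> real^'n"
  assumes \<phi>: "\<phi> \<in> borel_measurable \<nu>" "\<And>\<gamma>. \<gamma> \<in> marks \<Longrightarrow> norm (\<phi> \<gamma>) \<le> L"
  shows "norm (\<integral>\<gamma>. \<phi> \<gamma> \<partial>\<nu>) \<le> L * mass" "integrable \<nu> \<phi>" "integrable \<nu> (\<lambda>\<gamma>. (norm (\<phi> \<gamma>))\<^sup>2)"
    "(\<integral>\<gamma>. (norm (\<phi> \<gamma>))\<^sup>2 \<partial>\<nu>) \<le> L\<^sup>2 * mass"
proof -
  interpret nu: finite_measure \<nu> by (rule finite_marks)
  show i: "integrable \<nu> \<phi>" using \<phi> by (intro nu.integrable_const_bound[of _ L]) auto
  have b2: "(norm (\<phi> \<gamma>))\<^sup>2 \<le> L\<^sup>2" if "\<gamma> \<in> marks" for \<gamma>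
    using power_mono[OF \<phi>(2)[OF that] norm_ge_zero, of 2] .
  show i2: "integrable \<nu> (\<lambda>\<gamma>. (norm (\<phi> \<gamma>))\<^sup>2)"
    using \<phi>(1) b2 by (intro nu.integrable_const_bound[of _ "L\<^sup>2"]) auto
  have "norm (\<integral>\<gamma>. \<phi> \<gamma> \<partial>\<nu>) \<le> (\<integral>\<gamma>. norm (\<phi> \<gamma>) \<partial>\<nu>)" by (rule Bochner_Integration.integral_norm_bound)
  also have "\<dots> \<le> (\<integral>\<gamma>. L \<partial>\<nu>)" using i \<phi>(2) by (intro integral_mono) auto
  finally show "norm (\<integral>\<gamma>. \<phi> \<gamma> \<partial>\<nu>) \<le> L * mass" by (simp add: mass_def mult.commute)
  have "(\<integral>\<gamma>. (norm (\<phi> \<gamma>))\<^sup>2 \<partial>\<nu>) \<le> (\<integral>\<gamma>. L\<^sup>2 \<partial>\<nu>)" using i2 b2 by (intro integral_mono) auto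
  then show "(\<integral>\<gamma>. (norm (\<phi> \<gamma>))\<^sup>2 \<partial>\<nu>) \<le> L\<^sup>2 * mass" by (simp add: mass_def mult.commute)
qed

text \<open>The product of the Brownian increment and the number of jumps is not centred given
  the past, but it is of smaller order than the step size.\<close>

lemma one_step:
  fixes Y :: "'w \<Rightarrow> real^'n" and S :: "real^'d^'n" and \<phi> :: "'e \<Rightarrow> real^'n" and a :: real
  assumes s: "0 \<le> s" and h: "0 < h" and e: "0 < \<epsilon>"
    and C: "C \<in> sets (F s)"
    and Y: "Y \<in> borel_measurable (F s)" "integrable M (\<lambda>\<omega>. (norm (Y \<omega>))\<^sup>2)"
    and \<phi>: "\<phi> \<in> borel_measurable \<nu>" "\<And>\<gamma>. \<gamma> \<in> marks \<Longrightarrow> norm (\<phi> \<gamma>) \<le> L"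
    and b: "norm b \<le> L" and S: "norm S \<le> L"
  defines "Z \<equiv> \<lambda>\<omega>. a *\<^sub>R Y \<omega> + (h *\<^sub>R b + S *v incr s (s + h) \<omega> + jump \<phi> s (s + h) \<omega>)"
  shows "integrable M (\<lambda>\<omega>. indicator C \<omega> * (norm (Z \<omega>))\<^sup>2)"
    and "expectation (\<lambda>\<omega>. indicator C \<omega> * (norm (Z \<omega>))\<^sup>2) \<le>
      a\<^sup>2 * expectation (\<lambda>\<omega>. indicator C \<omega> * (norm (Y \<omega>))\<^sup>2)
      + 2 * a * h * expectation (\<lambda>\<omega>. indicator C \<omega> * (Y \<omega> \<bullet> (b + (\<integral>\<gamma>. \<phi> \<gamma> \<partial>\<nu>))))
      + prob C * (h * ((norm S)\<^sup>2 + (\<integral>\<gamma>. (norm (\<phi> \<gamma>))\<^sup>2 \<partial>\<nu>)) + L\<^sup>2 * step_error \<epsilon> h)"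
proof -
  let ?t = "s + h" and ?I = "\<lambda>\<omega>. indicator C \<omega> :: real"
  define m where "m = (\<integral>\<gamma>. \<phi> \<gamma> \<partial>\<nu>)"
  define q where "q = (\<integral>\<gamma>. (norm (\<phi> \<gamma>))\<^sup>2 \<partial>\<nu>)"
  define V where "V \<omega> = ?I \<omega> *\<^sub>R (a *\<^sub>R Y \<omega> + h *\<^sub>R b)" for \<omega>
  define W where "W \<omega> = (?I \<omega> *\<^sub>R S) *v incr s ?t \<omega>" for \<omega>
  define Q where "Q \<omega> = jump \<phi> s ?t \<omega>" for \<omega>
  define n where "n \<omega> = jump_count s ?t \<omega>" for \<omega>
  define J where "J \<omega> = jump (\<lambda>\<gamma>. (norm (\<phi> \<gamma>))\<^sup>2) s ?t \<omega>" for \<omega>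
  \<comment> \<open>An integrable majorant for the square of \<open>V + W + Q\<close> on C. The
    square of \<open>Q\<close> is replaced by the bound of \<open>jump_norm_square_le\<close> and
    \<open>W \<bullet> Q\<close> by that of \<open>mult_le_square_plus_fourth\<close>, so that every
    term pairs factors known at time s with a function of only one of the two noises.\<close>
  define R where "R \<omega> = (norm (V \<omega>))\<^sup>2 + 2 * (V \<omega> \<bullet> W \<omega>) + (norm (W \<omega>))\<^sup>2 + 2 * (V \<omega> \<bullet> Q \<omega>)
      + ?I \<omega> * J \<omega> + L\<^sup>2 * (?I \<omega> * (n \<omega>)\<^sup>2 - ?I \<omega> * n \<omega>)
      + 2 * L\<^sup>2 * (\<epsilon> * (?I \<omega> * (n \<omega>)\<^sup>2) + (?I \<omega> * norm (incr s ?t \<omega>) ^ 4) / \<epsilon> ^ 3)" for \<omega>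
  have t: "s < ?t" "s \<le> ?t" using h by auto
  have L0: "0 \<le> L" using b norm_ge_zero order_trans by blast
  have CM: "C \<in> events" using sets_F_M[OF C s] .
  have mI: "?I \<in> borel_measurable (F s)" using C by simp
  have iI: "integrable M ?I" using CM by (simp add: integrable_indicator_iff less_top[symmetric])
  have YM: "Y \<in> borel_measurable M" using measurable_F_M[OF Y(1) s] .
  have iY: "integrable M Y" by (rule square_integrable_imp_integrable[OF YM Y(2)])
  have V_F: "V \<in> borel_measurable (F s)" unfolding V_def[abs_def] using mI Y(1) by simp
  have iCY: "integrable M (\<lambda>\<omega>. ?I \<omega> * (norm (Y \<omega>))\<^sup>2)"
    using integrable_real_mult_indicator[OF CM Y(2)] by (simp add: mult.commute)
  have iCYc: "integrable M (\<lambda>\<omega>. ?I \<omega> * (Y \<omega> \<bullet> c))" for c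
    using integrable_real_mult_indicator[OF CM integrable_inner_left[OF iY, of c]] by (simp add: mult.commute)
  have V2: "(norm (V \<omega>))\<^sup>2 = a\<^sup>2 * (?I \<omega> * (norm (Y \<omega>))\<^sup>2) + 2 * a * h * (?I \<omega> * (Y \<omega> \<bullet> b)) + h\<^sup>2 * (norm b)\<^sup>2 * ?I \<omega>" for \<omega>
    unfolding V_def power2_norm_eq_inner
    by (auto simp: indicator_def inner_add_left inner_add_right inner_commute power2_eq_square algebra_simps)
  have iV2: "integrable M (\<lambda>\<omega>. (norm (V \<omega>))\<^sup>2)"
    unfolding V2 using iCY iCYc iI by auto
  have EV2: "expectation (\<lambda>\<omega>. (norm (V \<omega>))\<^sup>2) = a\<^sup>2 * expectation (\<lambda>\<omega>. ?I \<omega> * (norm (Y \<omega>))\<^sup>2)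
     + 2 * a * h * expectation (\<lambda>\<omega>. ?I \<omega> * (Y \<omega> \<bullet> b)) + h\<^sup>2 * (norm b)\<^sup>2 * prob C"
    unfolding V2 using iCY iCYc iI CM by simp
  have H: "(\<lambda>\<omega>. ?I \<omega> *\<^sub>R S) \<in> borel_measurable (F s)" using mI by simp
  have HB: "norm (?I \<omega> *\<^sub>R S) \<le> L" if "\<omega> \<in> space M" for \<omega>
    using S L0 by (auto simp: indicator_def)
  note ito = ito_step[OF s t(1) V_F iV2 H HB, folded W_def]
  have EH: "expectation (\<lambda>\<omega>. (norm (?I \<omega> *\<^sub>R S))\<^sup>2) = prob C * (norm S)\<^sup>2"
  proof -
    have "(norm (?I \<omega> *\<^sub>R S))\<^sup>2 = (norm S)\<^sup>2 * ?I \<omega>" for \<omega> by (auto simp: indicator_def)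
    then show ?thesis using CM by simp
  qed
  have VQ: "integrable M (\<lambda>\<omega>. V \<omega> \<bullet> Q \<omega>) \<and> expectation (\<lambda>\<omega>. V \<omega> \<bullet> Q \<omega>) = h * expectation (\<lambda>\<omega>. V \<omega> \<bullet> m)"
  proof -
    have iVa: "integrable M (\<lambda>\<omega>. V \<omega> $ i)" for i
    proof -
      have iV: "integrable M V" using square_integrable_imp_integrable[OF measurable_F_M[OF V_F s] iV2] .
      show ?thesis using integrable_bounded_linear[OF bounded_linear_vec_nth iV] .
    qed
    note P = noise_events_expectation_mult[OF s borel_measurable_vec_nth[OF V_F] iVa
        borel_measurable_vec_nth[OF jump_events[OF \<phi>(1) s]] jump_mean(1)[OF \<phi> s t(2)], folded Q_def]
    have Qa: "expectation (\<lambda>\<omega>. Q \<omega> $ i) = h * m $ i" for i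
      using jump_mean(2)[OF \<phi> s t(2), of i] by (simp add: Q_def m_def)
    have "integrable M (\<lambda>\<omega>. V \<omega> \<bullet> Q \<omega>)"
      unfolding inner_vec_def inner_real_def by (intro Bochner_Integration.integrable_sum P(1))
    moreover have "expectation (\<lambda>\<omega>. V \<omega> \<bullet> Q \<omega>) = (\<Sum>i\<in>UNIV. expectation (\<lambda>\<omega>. V \<omega> $ i) * (h * m $ i))"
      unfolding inner_vec_def inner_real_def using P by (simp add: integral_sum Qa)
    moreover have "expectation (\<lambda>\<omega>. V \<omega> \<bullet> m) = (\<Sum>i\<in>UNIV. expectation (\<lambda>\<omega>. V \<omega> $ i) * m $ i)"
      unfolding inner_vec_def inner_real_def using iVa by (simp add: integral_sum)
    ultimately show ?thesis by (simp add: sum_distrib_left mult_ac)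
  qed
  have EVm: "expectation (\<lambda>\<omega>. V \<omega> \<bullet> m) = a * expectation (\<lambda>\<omega>. ?I \<omega> * (Y \<omega> \<bullet> m)) + h * prob C * (b \<bullet> m)"
  proof -
    have "V \<omega> \<bullet> m = a * (?I \<omega> * (Y \<omega> \<bullet> m)) + h * (b \<bullet> m) * ?I \<omega>" for \<omega>
      by (auto simp: V_def indicator_def inner_add_left)
    then show ?thesis using iCYc iI CM by simp
  qed
  have \<phi>2: "(\<lambda>\<gamma>. (norm (\<phi> \<gamma>))\<^sup>2) \<in> borel_measurable \<nu>" "norm ((norm (\<phi> \<gamma>))\<^sup>2) \<le> L\<^sup>2" if "\<gamma> \<in> marks" for \<gamma>
    using \<phi>(1) power_mono[OF \<phi>(2)[OF that] norm_ge_zero, of 2] by auto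
  have \<phi>2m: "(\<lambda>\<gamma>. (norm (\<phi> \<gamma>))\<^sup>2) \<in> borel_measurable \<nu>" using \<phi>(1) by auto
  note jm = jump_mean_real[OF \<phi>2m \<phi>2(2) s t(2)]
  note JE = noise_events_expectation_mult[OF s mI iI jump_events_real[OF \<phi>2m s] jm(1), folded J_def[abs_def]]
  note cm = jump_count_moments[OF s t(2), folded n_def]
  have n_ev: "n \<in> borel_measurable (noise_events {s<..})"
    unfolding n_def[abs_def] using jump_count_events[OF s] .
  have n2_ev: "(\<lambda>\<omega>. (n \<omega>)\<^sup>2) \<in> borel_measurable (noise_events {s<..})" using n_ev by simp
  note nE = noise_events_expectation_mult[OF s mI iI n_ev cm(1)[folded n_def[abs_def]]]
  note n2E = noise_events_expectation_mult[OF s mI iI n2_ev cm(3)]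
  have f4: "(\<lambda>x::real^'d. norm x ^ 4) \<in> borel_measurable borel" by simp
  note fE = incr_expectation_mult[OF s t(1) mI iI f4 incr_fourth(1)[OF s t(1)]]
  have iR: "integrable M R"
    unfolding R_def[abs_def]
    by (intro Bochner_Integration.integrable_add Bochner_Integration.integrable_diff integrable_mult_right
        integrable_divide iV2 ito(1,3) VQ[THEN conjunct1] JE(1) nE(1) n2E(1) fE(1))
  have ER: "expectation R = expectation (\<lambda>\<omega>. (norm (V \<omega>))\<^sup>2) + h * (prob C * (norm S)\<^sup>2) + 2 * (h * expectation (\<lambda>\<omega>. V \<omega> \<bullet> m))
     + prob C * (h * q) + L\<^sup>2 * (prob C * (h * mass + (h * mass)\<^sup>2) - prob C * (h * mass))
     + 2 * L\<^sup>2 * (\<epsilon> * (prob C * (h * mass + (h * mass)\<^sup>2)) + prob C * expectation (\<lambda>\<omega>. norm (incr s ?t \<omega>) ^ 4) / \<epsilon> ^ 3)"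
  proof -
    have "expectation ?I = prob C" using CM by simp
    moreover have "expectation n = h * mass" using cm(2) by (simp add: n_def[abs_def])
    moreover have "expectation (\<lambda>\<omega>. (n \<omega>)\<^sup>2) = h * mass + (h * mass)\<^sup>2" using cm(4) by simp
    moreover have "expectation J = h * q" using jm(2) by (simp add: J_def[abs_def] q_def)
    ultimately show ?thesis
      unfolding R_def[abs_def]
      using iV2 ito VQ JE nE n2E fE EH
      by simp
  qed
  have le: "AE \<omega> in M. ?I \<omega> * (norm (Z \<omega>))\<^sup>2 \<le> R \<omega>"
    using AE_slab[OF s t(2)] AE_space
  proof eventually_elim
    case (elim \<omega>)
    then obtain k where k: "emeasure (N \<omega>) ({s<..?t} \<times> marks) = of_nat k" and \<omega>: "\<omega> \<in> space M" by auto
    have nk: "n \<omega> = real k" using k by (simp add: n_def jump_count_def measure_def)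
    have fin: "emeasure (N \<omega>) ({s<..?t} \<times> marks) < \<infinity>" using k by (simp add: of_nat_less_top)
    have Q2: "(norm (Q \<omega>))\<^sup>2 \<le> J \<omega> + L\<^sup>2 * ((n \<omega>)\<^sup>2 - n \<omega>)"
      using jump_norm_square_le[OF \<phi> s \<omega> k] by (simp add: Q_def J_def n_def)
    have Q1: "norm (Q \<omega>) \<le> L * n \<omega>"
      using jump_norm_le[OF \<phi> s \<omega> fin] by (simp add: Q_def n_def)
    show ?case
    proof (cases "\<omega> \<in> C")
      case True
      let ?x = "norm (incr s ?t \<omega>)"
      have Zeq: "Z \<omega> = V \<omega> + W \<omega> + Q \<omega>" using True by (simp add: Z_def V_def W_def Q_def)
      have "W \<omega> \<bullet> Q \<omega> \<le> norm (W \<omega>) * norm (Q \<omega>)" by (rule norm_cauchy_schwarz)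
      also have "\<dots> \<le> (L * ?x) * (L * n \<omega>)"
      proof (rule mult_mono)
        have "norm (W \<omega>) \<le> norm S * ?x" using True norm_matrix_vector_mult_le by (simp add: W_def)
        then show "norm (W \<omega>) \<le> L * ?x" using S by (meson mult_right_mono norm_ge_zero order_trans)
      qed (use Q1 L0 in auto)
      also have "\<dots> = L\<^sup>2 * (?x * n \<omega>)" by (simp add: power2_eq_square)
      also have "\<dots> \<le> L\<^sup>2 * (\<epsilon> * (n \<omega>)\<^sup>2 + ?x ^ 4 / \<epsilon> ^ 3)"
        unfolding nk by (intro mult_left_mono mult_le_square_plus_fourth e) auto
      finally have WQ: "W \<omega> \<bullet> Q \<omega> \<le> L\<^sup>2 * (\<epsilon> * (n \<omega>)\<^sup>2 + ?x ^ 4 / \<epsilon> ^ 3)" .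
      have "(norm (Z \<omega>))\<^sup>2 = (norm (V \<omega>))\<^sup>2 + 2 * (V \<omega> \<bullet> W \<omega>) + (norm (W \<omega>))\<^sup>2 + 2 * (V \<omega> \<bullet> Q \<omega>) + (norm (Q \<omega>))\<^sup>2 + 2 * (W \<omega> \<bullet> Q \<omega>)"
        unfolding Zeq power2_norm_eq_inner by (simp add: inner_add_left inner_add_right inner_commute)
      then show ?thesis using Q2 WQ True by (simp add: R_def algebra_simps)
    next
      case False
      then show ?thesis by (simp add: R_def V_def W_def)
    qed
  qed
  have ZM: "Z \<in> borel_measurable M"
    unfolding Z_def using YM incr_measurable[OF s, of ?t] s h jump_measurable[OF \<phi>(1) s]
    by (intro borel_measurable_add borel_measurable_scaleR borel_measurable_matrix_vector_mult) auto
  show iZ: "integrable M (\<lambda>\<omega>. ?I \<omega> * (norm (Z \<omega>))\<^sup>2)"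
  proof (rule Bochner_Integration.integrable_bound[OF iR])
    show "AE \<omega> in M. norm (?I \<omega> * (norm (Z \<omega>))\<^sup>2) \<le> norm (R \<omega>)"
      using le by eventually_elim (auto intro: order_trans[OF _ abs_ge_self])
  qed (use ZM CM in auto)
  have "expectation (\<lambda>\<omega>. ?I \<omega> * (norm (Z \<omega>))\<^sup>2) \<le> expectation R"
    using le by (intro integral_mono_AE iZ iR)
  also have "\<dots> \<le> a\<^sup>2 * expectation (\<lambda>\<omega>. ?I \<omega> * (norm (Y \<omega>))\<^sup>2)
      + 2 * a * h * expectation (\<lambda>\<omega>. ?I \<omega> * (Y \<omega> \<bullet> (b + m)))
      + prob C * (h * ((norm S)\<^sup>2 + q) + L\<^sup>2 * step_error \<epsilon> h)"
  proof -
    have E1: "expectation (\<lambda>\<omega>. ?I \<omega> * (Y \<omega> \<bullet> (b + m))) = expectation (\<lambda>\<omega>. ?I \<omega> * (Y \<omega> \<bullet> b)) + expectation (\<lambda>\<omega>. ?I \<omega> * (Y \<omega> \<bullet> m))"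
      using iCYc by (simp add: inner_add_right distrib_left)
    \<comment> \<open>The three estimates account for the entries 1, 2 \<open>mass\<close> and the
      Brownian fourth moment of \<open>step_error\<close>; the entry \<open>mass\<^sup>2\<close>
      stems from the pairs of jumps in \<open>R\<close>.\<close>
    have b1: "h\<^sup>2 * (norm b)\<^sup>2 * prob C \<le> L\<^sup>2 * h\<^sup>2 * prob C"
    proof -
      have "(norm b)\<^sup>2 \<le> L\<^sup>2" using b by (intro power_mono) auto
      then have "h\<^sup>2 * (norm b)\<^sup>2 \<le> h\<^sup>2 * L\<^sup>2" by (intro mult_left_mono) auto
      then show ?thesis by (intro mult_right_mono) (auto simp: mult.commute)
    qed
    have "b \<bullet> m \<le> norm b * norm m" by (rule norm_cauchy_schwarz)
    also have "\<dots> \<le> L * (L * mass)" using b integral_marks_le(1)[OF \<phi>] L0 by (intro mult_mono) (auto simp: m_def)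
    finally have b2: "2 * (h * (h * prob C * (b \<bullet> m))) \<le> 2 * (h * (h * prob C * (L * (L * mass))))"
      using h by (intro mult_left_mono) auto
    have b3: "2 * L\<^sup>2 * (prob C * expectation (\<lambda>\<omega>. norm (incr s ?t \<omega>) ^ 4) / \<epsilon> ^ 3)
      \<le> 2 * L\<^sup>2 * (prob C * (3 * (real CARD('d))\<^sup>2 * h\<^sup>2) / \<epsilon> ^ 3)"
      using incr_fourth(2)[OF s t(1)] e by (intro mult_left_mono divide_right_mono) auto
    show ?thesis
      unfolding ER EV2 EVm E1 step_error_def using b1 b2 b3
      by (simp add: algebra_simps power2_eq_square add_divide_distrib)
  qed
  finally show "expectation (\<lambda>\<omega>. indicator C \<omega> * (norm (Z \<omega>))\<^sup>2) \<le>
      a\<^sup>2 * expectation (\<lambda>\<omega>. indicator C \<omega> * (norm (Y \<omega>))\<^sup>2)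
      + 2 * a * h * expectation (\<lambda>\<omega>. indicator C \<omega> * (Y \<omega> \<bullet> (b + (\<integral>\<gamma>. \<phi> \<gamma> \<partial>\<nu>))))
      + prob C * (h * ((norm S)\<^sup>2 + (\<integral>\<gamma>. (norm (\<phi> \<gamma>))\<^sup>2 \<partial>\<nu>)) + L\<^sup>2 * step_error \<epsilon> h)"
    unfolding m_def q_def .
qed

end

section \<open>The pulled Euler scheme\<close>

context driving_noise
begin

lemma jump_measurable_F:
  fixes \<phi> :: "'e \<Rightarrow> real^'n"
  assumes "\<phi> \<in> borel_measurable \<nu>" "0 \<le> s" "s \<le> t"
  shows "jump \<phi> s t \<in> borel_measurable (F t)"
proof -
  have "jump \<phi> s t \<in> borel_measurable (noise_events {0..t})"
    unfolding jump_def[abs_def] using slab_measurable[OF assms(1,2)] assms(2,3)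
    by (intro integral_N_events) (auto split: split_indicator)
  moreover have "prm_events M \<nu> N {0..t} \<subseteq> sets (F t)"
    using poisson assms by (auto simp: poisson_random_measure_def)
  ultimately show ?thesis by (auto simp: measurable_def sets_noise_events)
qed

end

text \<open>Discrete Gronwall: u + 1 absorbs the additive constant and grows per step by at most the
  factor 1 + c \<le> exp c.\<close>

lemma le_exp_recursion:
  fixes u :: "nat \<Rightarrow> real"
  assumes "\<And>k. u (Suc k) \<le> (1 + c) * u k + c" "0 \<le> c" "0 \<le> u 0"
  shows "u k + 1 \<le> exp (c * real k) * (u 0 + 1)"
proof (induction k)
  case (Suc k)
  have "u (Suc k) + 1 \<le> (1 + c) * (u k + 1)" using assms(1)[of k] by (simp add: algebra_simps)
  also have "\<dots> \<le> (1 + c) * (exp (c * real k) * (u 0 + 1))" using Suc assms(2) by (intro mult_left_mono) auto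
  also have "\<dots> \<le> exp c * (exp (c * real k) * (u 0 + 1))" using assms by (intro mult_right_mono exp_ge_add_one_self) auto
  also have "\<dots> = exp (c * real (Suc k)) * (u 0 + 1)" by (simp add: exp_add[symmetric] algebra_simps)
  finally show ?case .
qed simp

text \<open>\<open>g / (1 - r)\<close> is the fixed point of the affine map. The recursion is
  assumed only below K, because closeness to the solution is known only up to a time
  horizon.\<close>

lemma affine_recursion_le:
  fixes u :: "nat \<Rightarrow> real"
  assumes "\<And>k. k < K \<Longrightarrow> u (Suc k) \<le> r * u k + g" "0 \<le> r" "r < 1" "0 \<le> g" "k \<le> K"
  shows "u k \<le> r ^ k * u 0 + g / (1 - r)"
  using \<open>k \<le> K\<close>
proof (induction k)
  case 0
  then show ?case using assms by simp
next
  case (Suc k)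
  have "u (Suc k) \<le> r * u k + g" using assms(1)[of k] Suc.prems by simp
  also have "\<dots> \<le> r * (r ^ k * u 0 + g / (1 - r)) + g" using Suc assms(2) by (intro add_right_mono mult_left_mono) auto
  also have "\<dots> = r ^ Suc k * u 0 + g / (1 - r)" using assms(3) by (simp add: field_simps)
  finally show ?case .
qed

text \<open>The state is abstract so that it can later be a pair of grid states of two solutions.
  Finiteness of \<open>D\<close> turns conditioning on the state into a finite sum over events with
  constant coefficients; \<open>z\<close> is the point that the scheme should follow, and L a common
  bound on \<open>D\<close>.\<close>

locale euler_scheme = driving_noise M F w \<nu> N
  for M :: "'w measure" and F :: "real \<Rightarrow> 'w measure" and w :: "real \<Rightarrow> 'w \<Rightarrow> real^'d"
    and \<nu> :: "'e measure" and N :: "'w \<Rightarrow> (real \<times> 'e) measure" +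
  fixes h :: real and state :: "nat \<Rightarrow> 'w \<Rightarrow> 's" and D :: "'s set"
    and z b :: "'s \<Rightarrow> real^'n" and S :: "'s \<Rightarrow> real^'d^'n" and \<phi> :: "'s \<Rightarrow> 'e \<Rightarrow> real^'n"
    and z0 :: "real^'n" and L :: real
  assumes h: "0 < h" and finite_D: "finite D"
    and state: "\<And>k c. c \<in> D \<Longrightarrow> {\<omega>\<in>space M. state k \<omega> = c} \<in> sets (F (real k * h))"
    and L: "0 \<le> L"
    and z_le: "\<And>c. c \<in> D \<Longrightarrow> norm (z c) \<le> L"
    and b_le: "\<And>c. c \<in> D \<Longrightarrow> norm (b c) \<le> L"
    and S_le: "\<And>c. c \<in> D \<Longrightarrow> norm (S c) \<le> L"
    and \<phi>_le: "\<And>c \<gamma>. c \<in> D \<Longrightarrow> \<gamma> \<in> marks \<Longrightarrow> norm (\<phi> c \<gamma>) \<le> L"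
    and \<phi>_measurable: "\<And>c. c \<in> D \<Longrightarrow> \<phi> c \<in> borel_measurable \<nu>"
begin

text \<open>Demanding all earlier states to be in \<open>D\<close> makes the events decrease in k:
  after the first exit no further increments are added.\<close>

definition good :: "nat \<Rightarrow> 'w set" where
  "good k = {\<omega>\<in>space M. \<forall>j\<le>k. state j \<omega> \<in> D}"

definition cell :: "nat \<Rightarrow> 's \<Rightarrow> 'w set" where
  "cell k c = {\<omega>\<in>good k. state k \<omega> = c}"

definition step :: "nat \<Rightarrow> 's \<Rightarrow> 'w \<Rightarrow> real^'n" where
  "step k c \<omega> = h *\<^sub>R b c + S c *v incr (real k * h) (real k * h + h) \<omega> + jump (\<phi> c) (real k * h) (real k * h + h) \<omega>"

text \<open>For \<open>\<theta> = 0\<close> this is the Euler scheme stopped when the state leaves \<open>D\<close>; for \<open>\<theta> > 0\<close> it is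
  additionally pulled towards \<open>z\<close>, which turns the dissipativity at \<open>z\<close> into the factor
  \<open>(1 - \<theta> h)\<^sup>2\<close> while only \<open>L\<^sup>1\<close>-closeness to \<open>z\<close> is required.\<close>

primrec scheme :: "real \<Rightarrow> nat \<Rightarrow> 'w \<Rightarrow> real^'n" where
  "scheme \<theta> 0 \<omega> = z0"
| "scheme \<theta> (Suc k) \<omega> = (1 - \<theta> * h) *\<^sub>R scheme \<theta> k \<omega>
    + (if \<omega> \<in> good k then step k (state k \<omega>) \<omega> + (\<theta> * h) *\<^sub>R z (state k \<omega>) else 0)"

lemma time_nonneg [simp]: "0 \<le> real k * h"
  using h by simp

lemma good_F: "good k \<in> sets (F (real k * h))"
proof -
  have "{\<omega>\<in>space M. state j \<omega> \<in> D} \<in> sets (F (real k * h))" if "j \<le> k" for j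
  proof -
    have "{\<omega>\<in>space M. state j \<omega> \<in> D} = (\<Union>c\<in>D. {\<omega>\<in>space M. state j \<omega> = c})" by auto
    also have "\<dots> \<in> sets (F (real j * h))" using state finite_D by auto
    finally show ?thesis using sets_F_mono[of "real j * h" "real k * h"] that h by auto
  qed
  then have "(\<Inter>j\<in>{..k}. {\<omega>\<in>space M. state j \<omega> \<in> D}) \<in> sets (F (real k * h))"
    by (intro sets.finite_INT) auto
  also have "(\<Inter>j\<in>{..k}. {\<omega>\<in>space M. state j \<omega> \<in> D}) = good k" by (auto simp: good_def)
  finally show ?thesis .
qed

lemma cell_F: "c \<in> D \<Longrightarrow> cell k c \<in> sets (F (real k * h))"
proof -
  assume "c \<in> D"
  moreover have "cell k c = good k \<inter> {\<omega>\<in>space M. state k \<omega> = c}" by (auto simp: cell_def good_def)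
  ultimately show ?thesis using good_F state by auto
qed

lemma good_M: "good k \<in> events" using sets_F_M[OF good_F] by simp
lemma cell_M: "c \<in> D \<Longrightarrow> cell k c \<in> events" using sets_F_M[OF cell_F] by simp

lemma good_mono: "j \<le> k \<Longrightarrow> good k \<subseteq> good j" by (auto simp: good_def)

text \<open>On \<open>good k\<close> exactly one cell contains \<omega>, off it none; in this way
  functions of the random state become finite sums with deterministic coefficients.\<close>

lemma good_sum:
  fixes f :: "'s \<Rightarrow> 'c::real_vector"
  shows "indicator (good k) \<omega> *\<^sub>R f (state k \<omega>) = (\<Sum>c\<in>D. indicator (cell k c) \<omega> *\<^sub>R f c)"
proof (cases "\<omega> \<in> good k")
  case True
  then have D: "state k \<omega> \<in> D" by (auto simp: good_def)
  have "(\<Sum>c\<in>D. indicator (cell k c) \<omega> *\<^sub>R f c) = (\<Sum>c\<in>D. if c = state k \<omega> then f c else 0)"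
    using True by (intro sum.cong) (auto simp: cell_def indicator_def)
  then show ?thesis using D True finite_D by simp
qed (auto simp: cell_def)

lemma sum_prob_cell: "(\<Sum>c\<in>D. prob (cell k c)) \<le> 1"
proof -
  have "(\<Sum>c\<in>D. prob (cell k c)) = prob (\<Union>c\<in>D. cell k c)"
    using cell_M finite_D by (intro finite_measure_finite_Union[symmetric]) (auto simp: disjoint_family_on_def cell_def)
  then show ?thesis by simp
qed

lemma scheme_Suc_sum:
  "scheme \<theta> (Suc k) \<omega> = (1 - \<theta> * h) *\<^sub>R scheme \<theta> k \<omega> + (\<Sum>c\<in>D. indicator (cell k c) \<omega> *\<^sub>R (step k c \<omega> + (\<theta> * h) *\<^sub>R z c))"
  by (subst good_sum[of k \<omega> "\<lambda>c. step k c \<omega> + (\<theta> * h) *\<^sub>R z c", symmetric]) simp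

lemma step_F: "c \<in> D \<Longrightarrow> step k c \<in> borel_measurable (F (real k * h + h))"
  unfolding step_def[abs_def] using h
  by (intro borel_measurable_add borel_measurable_matrix_vector_mult jump_measurable_F \<phi>_measurable incr_measurable_F) auto

lemma scheme_F: "scheme \<theta> k \<in> borel_measurable (F (real k * h))"
proof (induction k)
  case (Suc k)
  have eq: "real (Suc k) * h = real k * h + h" by (simp add: algebra_simps)
  have 1: "scheme \<theta> k \<in> borel_measurable (F (real k * h + h))"
    using measurable_F_mono[OF Suc] h by simp
  have 2: "cell k c \<in> sets (F (real k * h + h))" if "c \<in> D" for c
    using cell_F[OF that] sets_F_mono[of "real k * h" "real k * h + h"] h by auto
  show ?case unfolding eq scheme_Suc_sum[abs_def]
    using 1 2 step_F
    by (intro borel_measurable_add borel_measurable_sum borel_measurable_scaleR borel_measurable_indicator) auto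
qed simp

lemma scheme_M: "scheme \<theta> k \<in> borel_measurable M"
  using measurable_F_M[OF scheme_F] by simp

text \<open>\<open>one_step\<close> is applied on each cell with drift
  \<open>b c + \<theta> *\<^sub>R z c\<close>, whence the bound \<open>L * (1 + \<theta>)\<close>;
  off \<open>good k\<close> the scheme only shrinks by the factor 1 - \<theta> h. The cells and the
  complement of \<open>good k\<close> together restore the full second moment of the previous
  step.\<close>

lemma scheme_step:
  assumes \<theta>: "0 \<le> \<theta>" and e: "0 < \<epsilon>" and int: "integrable M (\<lambda>\<omega>. (norm (scheme \<theta> k \<omega>))\<^sup>2)"
  shows "integrable M (\<lambda>\<omega>. (norm (scheme \<theta> (Suc k) \<omega>))\<^sup>2)"
    and "expectation (\<lambda>\<omega>. (norm (scheme \<theta> (Suc k) \<omega>))\<^sup>2) \<le>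
      (1 - \<theta> * h)\<^sup>2 * expectation (\<lambda>\<omega>. (norm (scheme \<theta> k \<omega>))\<^sup>2)
      + (\<Sum>c\<in>D. 2 * (1 - \<theta> * h) * h * expectation (\<lambda>\<omega>. indicator (cell k c) \<omega> * (scheme \<theta> k \<omega> \<bullet> (b c + \<theta> *\<^sub>R z c + (\<integral>\<gamma>. \<phi> c \<gamma> \<partial>\<nu>))))
         + prob (cell k c) * (h * ((norm (S c))\<^sup>2 + (\<integral>\<gamma>. (norm (\<phi> c \<gamma>))\<^sup>2 \<partial>\<nu>)) + (L * (1 + \<theta>))\<^sup>2 * step_error \<epsilon> h))"
proof -
  let ?a = "1 - \<theta> * h" and ?s = "real k * h" and ?Y = "scheme \<theta> k"
  define Z where "Z c \<omega> = ?a *\<^sub>R ?Y \<omega> + (h *\<^sub>R (b c + \<theta> *\<^sub>R z c) + S c *v incr ?s (?s + h) \<omega> + jump (\<phi> c) ?s (?s + h) \<omega>)" for c \<omega>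
  have LL: "L \<le> L * (1 + \<theta>)" using L \<theta> by (simp add: algebra_simps)
  have bz: "norm (b c + \<theta> *\<^sub>R z c) \<le> L * (1 + \<theta>)" if "c \<in> D" for c
  proof -
    have "norm (b c + \<theta> *\<^sub>R z c) \<le> norm (b c) + \<theta> * norm (z c)" using \<theta> norm_triangle_ineq[of "b c" "\<theta> *\<^sub>R z c"] by simp
    also have "\<dots> \<le> L + \<theta> * L" using b_le[OF that] z_le[OF that] \<theta> by (intro add_mono mult_left_mono) auto
    finally show ?thesis by (simp add: algebra_simps)
  qed
  have os: "integrable M (\<lambda>\<omega>. indicator (cell k c) \<omega> * (norm (Z c \<omega>))\<^sup>2)"
    "expectation (\<lambda>\<omega>. indicator (cell k c) \<omega> * (norm (Z c \<omega>))\<^sup>2) \<le>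
      ?a\<^sup>2 * expectation (\<lambda>\<omega>. indicator (cell k c) \<omega> * (norm (?Y \<omega>))\<^sup>2)
      + 2 * ?a * h * expectation (\<lambda>\<omega>. indicator (cell k c) \<omega> * (?Y \<omega> \<bullet> (b c + \<theta> *\<^sub>R z c + (\<integral>\<gamma>. \<phi> c \<gamma> \<partial>\<nu>))))
      + prob (cell k c) * (h * ((norm (S c))\<^sup>2 + (\<integral>\<gamma>. (norm (\<phi> c \<gamma>))\<^sup>2 \<partial>\<nu>)) + (L * (1 + \<theta>))\<^sup>2 * step_error \<epsilon> h)"
    if c: "c \<in> D" for c
  proof -
    have 1: "norm (\<phi> c \<gamma>) \<le> L * (1 + \<theta>)" if "\<gamma> \<in> marks" for \<gamma> using \<phi>_le[OF c that] LL by linarith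
    have 2: "norm (S c) \<le> L * (1 + \<theta>)" using S_le[OF c] LL by linarith
    note O = one_step[OF time_nonneg h e cell_F[OF c] scheme_F int \<phi>_measurable[OF c] 1 bz[OF c] 2, where a = ?a, folded Z_def]
    show "integrable M (\<lambda>\<omega>. indicator (cell k c) \<omega> * (norm (Z c \<omega>))\<^sup>2)" using O(1) by simp
    show "expectation (\<lambda>\<omega>. indicator (cell k c) \<omega> * (norm (Z c \<omega>))\<^sup>2) \<le>
      ?a\<^sup>2 * expectation (\<lambda>\<omega>. indicator (cell k c) \<omega> * (norm (?Y \<omega>))\<^sup>2)
      + 2 * ?a * h * expectation (\<lambda>\<omega>. indicator (cell k c) \<omega> * (?Y \<omega> \<bullet> (b c + \<theta> *\<^sub>R z c + (\<integral>\<gamma>. \<phi> c \<gamma> \<partial>\<nu>))))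
      + prob (cell k c) * (h * ((norm (S c))\<^sup>2 + (\<integral>\<gamma>. (norm (\<phi> c \<gamma>))\<^sup>2 \<partial>\<nu>)) + (L * (1 + \<theta>))\<^sup>2 * step_error \<epsilon> h)"
      using O(2) by simp
  qed
  have iC: "integrable M (\<lambda>\<omega>. indicator C \<omega> * (norm (?Y \<omega>))\<^sup>2)" if "C \<in> events" for C
    using integrable_real_mult_indicator[OF that int] by (simp add: mult.commute)
  have iG: "integrable M (\<lambda>\<omega>. (1 - indicator (good k) \<omega>) * (norm (?Y \<omega>))\<^sup>2)"
    using iC[OF good_M] int by (simp add: left_diff_distrib)
  have eq: "(norm (scheme \<theta> (Suc k) \<omega>))\<^sup>2 = ?a\<^sup>2 * ((1 - indicator (good k) \<omega>) * (norm (?Y \<omega>))\<^sup>2)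
      + (\<Sum>c\<in>D. indicator (cell k c) \<omega> * (norm (Z c \<omega>))\<^sup>2)" for \<omega>
  proof -
    have "(\<Sum>c\<in>D. indicator (cell k c) \<omega> * (norm (Z c \<omega>))\<^sup>2) = indicator (good k) \<omega> * (norm (Z (state k \<omega>) \<omega>))\<^sup>2"
      using good_sum[of k \<omega> "\<lambda>c. (norm (Z c \<omega>))\<^sup>2"] by simp
    then show ?thesis
      by (cases "\<omega> \<in> good k") (simp_all add: Z_def step_def scaleR_add_right power_mult_distrib add_ac mult.commute)
  qed
  show "integrable M (\<lambda>\<omega>. (norm (scheme \<theta> (Suc k) \<omega>))\<^sup>2)"
    unfolding eq using iG os by auto
  have sum: "(\<Sum>c\<in>D. expectation (\<lambda>\<omega>. indicator (cell k c) \<omega> * (norm (?Y \<omega>))\<^sup>2)) = expectation (\<lambda>\<omega>. indicator (good k) \<omega> * (norm (?Y \<omega>))\<^sup>2)"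
  proof -
    have "indicator (good k) \<omega> * (norm (?Y \<omega>))\<^sup>2 = (\<Sum>c\<in>D. indicator (cell k c) \<omega> * (norm (?Y \<omega>))\<^sup>2)" for \<omega>
      using good_sum[of k \<omega> "\<lambda>c. (norm (?Y \<omega>))\<^sup>2"] by simp
    then show ?thesis using iC cell_M by (simp add: integral_sum)
  qed
  have "expectation (\<lambda>\<omega>. (norm (scheme \<theta> (Suc k) \<omega>))\<^sup>2) =
     ?a\<^sup>2 * (expectation (\<lambda>\<omega>. (norm (?Y \<omega>))\<^sup>2) - expectation (\<lambda>\<omega>. indicator (good k) \<omega> * (norm (?Y \<omega>))\<^sup>2))
      + (\<Sum>c\<in>D. expectation (\<lambda>\<omega>. indicator (cell k c) \<omega> * (norm (Z c \<omega>))\<^sup>2))"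
  proof -
    have "expectation (\<lambda>\<omega>. (1 - indicator (good k) \<omega>) * (norm (?Y \<omega>))\<^sup>2) =
       expectation (\<lambda>\<omega>. (norm (?Y \<omega>))\<^sup>2) - expectation (\<lambda>\<omega>. indicator (good k) \<omega> * (norm (?Y \<omega>))\<^sup>2)"
      using iC[OF good_M] int by (simp add: left_diff_distrib)
    then show ?thesis unfolding eq using iG os by (simp add: integral_sum)
  qed
  also have "\<dots> \<le> ?a\<^sup>2 * (expectation (\<lambda>\<omega>. (norm (?Y \<omega>))\<^sup>2) - expectation (\<lambda>\<omega>. indicator (good k) \<omega> * (norm (?Y \<omega>))\<^sup>2))
      + (\<Sum>c\<in>D. ?a\<^sup>2 * expectation (\<lambda>\<omega>. indicator (cell k c) \<omega> * (norm (?Y \<omega>))\<^sup>2)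
      + (2 * ?a * h * expectation (\<lambda>\<omega>. indicator (cell k c) \<omega> * (?Y \<omega> \<bullet> (b c + \<theta> *\<^sub>R z c + (\<integral>\<gamma>. \<phi> c \<gamma> \<partial>\<nu>))))
      + prob (cell k c) * (h * ((norm (S c))\<^sup>2 + (\<integral>\<gamma>. (norm (\<phi> c \<gamma>))\<^sup>2 \<partial>\<nu>)) + (L * (1 + \<theta>))\<^sup>2 * step_error \<epsilon> h)))"
    using os(2) by (intro add_left_mono sum_mono) (simp add: add.assoc)
  also have "\<dots> = ?a\<^sup>2 * expectation (\<lambda>\<omega>. (norm (?Y \<omega>))\<^sup>2)
      + (\<Sum>c\<in>D. (2 * ?a * h * expectation (\<lambda>\<omega>. indicator (cell k c) \<omega> * (?Y \<omega> \<bullet> (b c + \<theta> *\<^sub>R z c + (\<integral>\<gamma>. \<phi> c \<gamma> \<partial>\<nu>))))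
      + prob (cell k c) * (h * ((norm (S c))\<^sup>2 + (\<integral>\<gamma>. (norm (\<phi> c \<gamma>))\<^sup>2 \<partial>\<nu>)) + (L * (1 + \<theta>))\<^sup>2 * step_error \<epsilon> h)))"
    unfolding sum.distrib sum_distrib_left[symmetric] sum by (simp add: algebra_simps)
  finally show "expectation (\<lambda>\<omega>. (norm (scheme \<theta> (Suc k) \<omega>))\<^sup>2) \<le>
      (1 - \<theta> * h)\<^sup>2 * expectation (\<lambda>\<omega>. (norm (scheme \<theta> k \<omega>))\<^sup>2)
      + (\<Sum>c\<in>D. 2 * (1 - \<theta> * h) * h * expectation (\<lambda>\<omega>. indicator (cell k c) \<omega> * (scheme \<theta> k \<omega> \<bullet> (b c + \<theta> *\<^sub>R z c + (\<integral>\<gamma>. \<phi> c \<gamma> \<partial>\<nu>))))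
         + prob (cell k c) * (h * ((norm (S c))\<^sup>2 + (\<integral>\<gamma>. (norm (\<phi> c \<gamma>))\<^sup>2 \<partial>\<nu>)) + (L * (1 + \<theta>))\<^sup>2 * step_error \<epsilon> h))" .
qed

lemma scheme_square_integrable:
  assumes "0 \<le> \<theta>"
  shows "integrable M (\<lambda>\<omega>. (norm (scheme \<theta> k \<omega>))\<^sup>2)"
proof (induction k)
  case (Suc k)
  then show ?case using scheme_step(1)[OF assms zero_less_one] by blast
qed simp

lemma drift_le:
  assumes "c \<in> D" "0 \<le> \<theta>"
  shows "norm (b c + \<theta> *\<^sub>R z c + (\<integral>\<gamma>. \<phi> c \<gamma> \<partial>\<nu>)) \<le> L * (1 + \<theta> + mass)"
proof -
  have "norm (b c + \<theta> *\<^sub>R z c + (\<integral>\<gamma>. \<phi> c \<gamma> \<partial>\<nu>)) \<le> norm (b c) + \<theta> * norm (z c) + norm (\<integral>\<gamma>. \<phi> c \<gamma> \<partial>\<nu>)"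
    using assms norm_triangle_ineq[of "b c" "\<theta> *\<^sub>R z c"] norm_triangle_ineq[of "b c + \<theta> *\<^sub>R z c" "\<integral>\<gamma>. \<phi> c \<gamma> \<partial>\<nu>"] by simp
  also have "\<dots> \<le> L + \<theta> * L + L * mass"
    using assms b_le z_le integral_marks_le(1)[OF \<phi>_measurable[OF assms(1)] \<phi>_le] by (intro add_mono mult_left_mono) auto
  finally show ?thesis by (simp add: algebra_simps)
qed

text \<open>The coefficients of h, for h at most 1, in the drift term, in the diffusion and jump
  squares and in \<open>step_error 1 h\<close>.\<close>

definition growth_rate :: real where
  "growth_rate = L * (1 + mass) + L\<^sup>2 * (1 + mass) + L\<^sup>2 * ((1 + 2 * mass + mass\<^sup>2) + 2 * (mass + mass\<^sup>2 + 3 * (real CARD('d))\<^sup>2))"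

lemma growth_rate_nonneg: "0 \<le> growth_rate"
  unfolding growth_rate_def using L by simp

text \<open>A crude Gronwall bound that depends on the ball through L. It only has to make the
  unpulled schemes uniformly integrable, so that closeness in probability becomes closeness in
  mean.\<close>

lemma scheme_bounded:
  assumes "h \<le> 1"
  shows "expectation (\<lambda>\<omega>. (norm (scheme 0 k \<omega>))\<^sup>2) \<le> exp (growth_rate * (real k * h)) * ((norm z0)\<^sup>2 + 1)"
proof -
  define u where "u k = expectation (\<lambda>\<omega>. (norm (scheme 0 k \<omega>))\<^sup>2)" for k
  note int = scheme_square_integrable[of 0, simplified]
  have err: "step_error 1 h \<le> h * ((1 + 2 * mass + mass\<^sup>2) + 2 * (mass + mass\<^sup>2 + 3 * (real CARD('d))\<^sup>2))"
  proof -
    have hh: "h\<^sup>2 \<le> h" using assms h by (simp add: power2_eq_square mult_left_le)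
    have 1: "h\<^sup>2 * (1 + 2 * mass + mass\<^sup>2) \<le> h * (1 + 2 * mass + mass\<^sup>2)" using hh by (intro mult_right_mono) auto
    have 2: "(h * mass)\<^sup>2 \<le> h * mass\<^sup>2" using hh by (simp add: power_mult_distrib mult_right_mono)
    have 3: "3 * (real CARD('d))\<^sup>2 * h\<^sup>2 \<le> 3 * (real CARD('d))\<^sup>2 * h" using hh by (intro mult_left_mono) auto
    have eq: "h * ((1 + 2 * mass + mass\<^sup>2) + 2 * (mass + mass\<^sup>2 + 3 * (real CARD('d))\<^sup>2)) =
      h * (1 + 2 * mass + mass\<^sup>2) + 2 * (h * mass + h * mass\<^sup>2 + 3 * (real CARD('d))\<^sup>2 * h)"
      by (simp add: algebra_simps)
    show ?thesis unfolding eq step_error_def mult_1 power_one div_by_1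
      by (intro add_mono mult_left_mono 1 2 3 order_refl) simp
  qed
  have "u (Suc k) \<le> (1 + h * growth_rate) * u k + h * growth_rate" for k
  proof -
    have Eg: "expectation (\<lambda>\<omega>. 1 + (norm (scheme 0 k \<omega>))\<^sup>2) = 1 + u k" using int[of k] by (simp add: u_def prob_space)
    have t1: "(\<Sum>c\<in>D. 2 * h * expectation (\<lambda>\<omega>. indicator (cell k c) \<omega> * (scheme 0 k \<omega> \<bullet> (b c + (\<integral>\<gamma>. \<phi> c \<gamma> \<partial>\<nu>))))) \<le> h * (L * (1 + mass)) * (1 + u k)"
    proof -
      have i1: "integrable M (\<lambda>\<omega>. indicator (cell k c) \<omega> * (scheme 0 k \<omega> \<bullet> v))" if "c \<in> D" for c v
        using integrable_real_mult_indicator[OF cell_M[OF that] integrable_inner_left[OF square_integrable_imp_integrable[OF scheme_M int], of k v]]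
        by (simp add: mult.commute)
      have i2: "integrable M (\<lambda>\<omega>. indicator (cell k c) \<omega> * (1 + (norm (scheme 0 k \<omega>))\<^sup>2))" if "c \<in> D" for c
        using integrable_real_mult_indicator[OF cell_M[OF that], of "\<lambda>\<omega>. 1 + (norm (scheme 0 k \<omega>))\<^sup>2" k] int[of k]
        by (simp add: mult.commute)
      have i3: "integrable M (\<lambda>\<omega>. indicator (good k) \<omega> * (1 + (norm (scheme 0 k \<omega>))\<^sup>2))"
        using integrable_real_mult_indicator[OF good_M, of "\<lambda>\<omega>. 1 + (norm (scheme 0 k \<omega>))\<^sup>2" k] int[of k]
        by (simp add: mult.commute)
      have "2 * expectation (\<lambda>\<omega>. indicator (cell k c) \<omega> * (scheme 0 k \<omega> \<bullet> (b c + (\<integral>\<gamma>. \<phi> c \<gamma> \<partial>\<nu>))))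
         \<le> (L * (1 + mass)) * expectation (\<lambda>\<omega>. indicator (cell k c) \<omega> * (1 + (norm (scheme 0 k \<omega>))\<^sup>2))" if c: "c \<in> D" for c
      proof -
        have "2 * (x \<bullet> (b c + (\<integral>\<gamma>. \<phi> c \<gamma> \<partial>\<nu>))) \<le> (L * (1 + mass)) * (1 + (norm x)\<^sup>2)" for x
        proof -
          have "2 * (x \<bullet> (b c + (\<integral>\<gamma>. \<phi> c \<gamma> \<partial>\<nu>))) \<le> 2 * (norm x * (L * (1 + mass)))"
            using drift_le[OF c, of 0] norm_cauchy_schwarz[of x "b c + (\<integral>\<gamma>. \<phi> c \<gamma> \<partial>\<nu>)"]
              mult_left_mono[of "norm (b c + (\<integral>\<gamma>. \<phi> c \<gamma> \<partial>\<nu>))" "L * (1 + mass)" "norm x"] by simp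
          also have "\<dots> = (L * (1 + mass)) * (2 * norm x)" by simp
          also have "\<dots> \<le> (L * (1 + mass)) * (1 + (norm x)\<^sup>2)"
            using L zero_le_power2[of "norm x - 1"] by (intro mult_left_mono) (auto simp: power2_diff)
          finally show ?thesis .
        qed
        then have "expectation (\<lambda>\<omega>. 2 * (indicator (cell k c) \<omega> * (scheme 0 k \<omega> \<bullet> (b c + (\<integral>\<gamma>. \<phi> c \<gamma> \<partial>\<nu>)))))
          \<le> expectation (\<lambda>\<omega>. (L * (1 + mass)) * (indicator (cell k c) \<omega> * (1 + (norm (scheme 0 k \<omega>))\<^sup>2)))"
          using i1[OF c] i2[OF c] by (intro integral_mono integrable_mult_right) (auto simp: indicator_def)
        then show ?thesis by simp
      qed
      then have "(\<Sum>c\<in>D. 2 * h * expectation (\<lambda>\<omega>. indicator (cell k c) \<omega> * (scheme 0 k \<omega> \<bullet> (b c + (\<integral>\<gamma>. \<phi> c \<gamma> \<partial>\<nu>)))))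
         \<le> (\<Sum>c\<in>D. h * ((L * (1 + mass)) * expectation (\<lambda>\<omega>. indicator (cell k c) \<omega> * (1 + (norm (scheme 0 k \<omega>))\<^sup>2))))"
        using h by (intro sum_mono) (simp add: mult.left_commute mult.assoc)
      also have "\<dots> = h * (L * (1 + mass)) * (\<Sum>c\<in>D. expectation (\<lambda>\<omega>. indicator (cell k c) \<omega> * (1 + (norm (scheme 0 k \<omega>))\<^sup>2)))"
        by (simp add: sum_distrib_left mult.assoc)
      also have "(\<Sum>c\<in>D. expectation (\<lambda>\<omega>. indicator (cell k c) \<omega> * (1 + (norm (scheme 0 k \<omega>))\<^sup>2))) =
         expectation (\<lambda>\<omega>. indicator (good k) \<omega> * (1 + (norm (scheme 0 k \<omega>))\<^sup>2))"
      proof -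
        have "indicator (good k) \<omega> * (1 + (norm (scheme 0 k \<omega>))\<^sup>2) = (\<Sum>c\<in>D. indicator (cell k c) \<omega> * (1 + (norm (scheme 0 k \<omega>))\<^sup>2))" for \<omega>
          using good_sum[of k \<omega> "\<lambda>c. 1 + (norm (scheme 0 k \<omega>))\<^sup>2"] by simp
        then show ?thesis using i2 by (simp add: integral_sum)
      qed
      also have "\<dots> \<le> expectation (\<lambda>\<omega>. 1 + (norm (scheme 0 k \<omega>))\<^sup>2)"
        using int[of k] i3 by (intro integral_mono) (auto simp: indicator_def)
      finally show ?thesis using Eg L h by (simp add: mult_left_mono)
    qed
    have t2: "(\<Sum>c\<in>D. prob (cell k c) * (h * ((norm (S c))\<^sup>2 + (\<integral>\<gamma>. (norm (\<phi> c \<gamma>))\<^sup>2 \<partial>\<nu>)) + L\<^sup>2 * step_error 1 h))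
       \<le> h * (L\<^sup>2 * (1 + mass)) + L\<^sup>2 * (h * ((1 + 2 * mass + mass\<^sup>2) + 2 * (mass + mass\<^sup>2 + 3 * (real CARD('d))\<^sup>2)))" (is "_ \<le> ?B")
    proof -
      have B0: "0 \<le> ?B" using L h by simp
      have "(\<Sum>c\<in>D. prob (cell k c) * (h * ((norm (S c))\<^sup>2 + (\<integral>\<gamma>. (norm (\<phi> c \<gamma>))\<^sup>2 \<partial>\<nu>)) + L\<^sup>2 * step_error 1 h)) \<le> (\<Sum>c\<in>D. prob (cell k c) * ?B)"
      proof (intro sum_mono mult_left_mono add_mono)
        fix c assume c: "c \<in> D"
        have "(norm (S c))\<^sup>2 \<le> L\<^sup>2" using S_le[OF c] by (intro power_mono) auto
        moreover have "(\<integral>\<gamma>. (norm (\<phi> c \<gamma>))\<^sup>2 \<partial>\<nu>) \<le> L\<^sup>2 * mass" using integral_marks_le(4)[OF \<phi>_measurable[OF c] \<phi>_le[OF c]] .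
        ultimately show "(norm (S c))\<^sup>2 + (\<integral>\<gamma>. (norm (\<phi> c \<gamma>))\<^sup>2 \<partial>\<nu>) \<le> L\<^sup>2 * (1 + mass)" by (simp add: algebra_simps)
      qed (use h err in auto)
      also have "\<dots> = (\<Sum>c\<in>D. prob (cell k c)) * ?B" by (simp add: sum_distrib_right)
      also have "\<dots> \<le> 1 * ?B" using sum_prob_cell B0 by (rule mult_right_mono)
      finally show ?thesis by simp
    qed
    have "u (Suc k) \<le> u k + ((\<Sum>c\<in>D. 2 * h * expectation (\<lambda>\<omega>. indicator (cell k c) \<omega> * (scheme 0 k \<omega> \<bullet> (b c + (\<integral>\<gamma>. \<phi> c \<gamma> \<partial>\<nu>)))))
      + (\<Sum>c\<in>D. prob (cell k c) * (h * ((norm (S c))\<^sup>2 + (\<integral>\<gamma>. (norm (\<phi> c \<gamma>))\<^sup>2 \<partial>\<nu>)) + L\<^sup>2 * step_error 1 h)))"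
      using scheme_step(2)[OF order_refl zero_less_one int, of k] by (simp add: u_def sum.distrib)
    also have "\<dots> \<le> u k + (h * (L * (1 + mass)) * (1 + u k) + ?B)" using t1 t2 by linarith
    also have "\<dots> \<le> (1 + h * growth_rate) * u k + h * growth_rate"
    proof -
      have "0 \<le> u k" unfolding u_def by simp
      then have "0 \<le> h * (L\<^sup>2 * (1 + mass) + L\<^sup>2 * ((1 + 2 * mass + mass\<^sup>2) + 2 * (mass + mass\<^sup>2 + 3 * (real CARD('d))\<^sup>2))) * u k"
        using h by (intro mult_nonneg_nonneg add_nonneg_nonneg) auto
      then show ?thesis unfolding growth_rate_def by (simp add: algebra_simps)
    qed
    finally show ?thesis .
  qed
  from le_exp_recursion[of u "h * growth_rate" k, OF this] h growth_rate_nonneg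
  have "u k + 1 \<le> exp (h * growth_rate * real k) * ((norm z0)\<^sup>2 + 1)"
    by (simp add: u_def prob_space)
  then show ?thesis by (simp add: u_def mult_ac)
qed

end

section \<open>Distance to the target and decay of the energy\<close>

context euler_scheme
begin

definition gap :: "real \<Rightarrow> nat \<Rightarrow> 'w \<Rightarrow> real" where
  "gap \<theta> k \<omega> = indicator (good k) \<omega> * norm (scheme \<theta> k \<omega> - z (state k \<omega>))"

lemma gap_nonneg: "0 \<le> gap \<theta> k \<omega>"
  by (simp add: gap_def)

lemma gap_sum: "gap \<theta> k \<omega> = (\<Sum>c\<in>D. indicator (cell k c) \<omega> * norm (scheme \<theta> k \<omega> - z c))"
  using good_sum[of k \<omega> "\<lambda>c. norm (scheme \<theta> k \<omega> - z c)"] by (simp add: gap_def)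

lemma cell_gap_integrable:
  assumes "0 \<le> \<theta>" "c \<in> D"
  shows "integrable M (\<lambda>\<omega>. indicator (cell k c) \<omega> * norm (scheme \<theta> k \<omega> - v))"
proof -
  have "integrable M (\<lambda>\<omega>. norm (scheme \<theta> k \<omega> - v))"
    using square_integrable_imp_integrable[OF scheme_M scheme_square_integrable[OF assms(1)]] by auto
  from integrable_real_mult_indicator[OF cell_M[OF assms(2)] this] show ?thesis by (simp add: mult.commute)
qed

lemma gap_integrable: "0 \<le> \<theta> \<Longrightarrow> integrable M (gap \<theta> k)"
  unfolding gap_sum[abs_def] using cell_gap_integrable by auto

text \<open>Both schemes use the same increments, so their distance after a step is at most a convex
  combination, with weight \<theta> h, of the previous distance and the gap of the unpulled scheme;
  it never exceeds \<rho>. The second \<rho> comes from the triangle inequality.\<close>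

lemma pulled_gap_le:
  assumes \<theta>: "0 \<le> \<theta>" "\<theta> * h \<le> 1" and \<rho>: "\<And>k. k \<le> K \<Longrightarrow> expectation (gap 0 k) \<le> \<rho>" and k: "k \<le> K"
  shows "expectation (gap \<theta> k) \<le> 2 * \<rho>"
proof -
  let ?d = "\<lambda>k \<omega>. indicator (good k) \<omega> * norm (scheme \<theta> k \<omega> - scheme 0 k \<omega>)"
  have id: "integrable M (?d k)" for k
  proof -
    have "integrable M (\<lambda>\<omega>. norm (scheme \<theta> k \<omega> - scheme 0 k \<omega>))"
      using square_integrable_imp_integrable[OF scheme_M scheme_square_integrable[OF \<theta>(1)]]
        square_integrable_imp_integrable[OF scheme_M scheme_square_integrable[OF order_refl]] by auto
    from integrable_real_mult_indicator[OF good_M this] show ?thesis by (simp add: mult.commute)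
  qed
  have "expectation (?d k) \<le> \<rho>" if "k \<le> K" for k
    using that
  proof (induction k)
    case 0
    have "0 \<le> expectation (gap 0 0)" using gap_nonneg by simp
    then show ?case using \<rho>[of 0] by simp
  next
    case (Suc k)
    have "expectation (?d (Suc k)) \<le> expectation (\<lambda>\<omega>. (1 - \<theta> * h) * ?d k \<omega> + \<theta> * h * gap 0 k \<omega>)"
    proof (intro integral_mono id Bochner_Integration.integrable_add integrable_mult_right gap_integrable order_refl)
      fix \<omega>
      show "?d (Suc k) \<omega> \<le> (1 - \<theta> * h) * ?d k \<omega> + \<theta> * h * gap 0 k \<omega>"
      proof (cases "\<omega> \<in> good (Suc k)")
        case True
        then have g: "\<omega> \<in> good k" using good_mono[of k "Suc k"] by auto
        have eq: "scheme \<theta> (Suc k) \<omega> - scheme 0 (Suc k) \<omega> =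
          (1 - \<theta> * h) *\<^sub>R (scheme \<theta> k \<omega> - scheme 0 k \<omega>) + (\<theta> * h) *\<^sub>R (z (state k \<omega>) - scheme 0 k \<omega>)"
          using g by (simp add: algebra_simps)
        have "norm (scheme \<theta> (Suc k) \<omega> - scheme 0 (Suc k) \<omega>) \<le> norm ((1 - \<theta> * h) *\<^sub>R (scheme \<theta> k \<omega> - scheme 0 k \<omega>)) + norm ((\<theta> * h) *\<^sub>R (z (state k \<omega>) - scheme 0 k \<omega>))"
          unfolding eq by (rule norm_triangle_ineq)
        also have "\<dots> = (1 - \<theta> * h) * norm (scheme \<theta> k \<omega> - scheme 0 k \<omega>) + \<theta> * h * norm (scheme 0 k \<omega> - z (state k \<omega>))"
        proof -
          have "\<bar>1 - \<theta> * h\<bar> = 1 - \<theta> * h" using \<theta> by simp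
          moreover have "\<bar>\<theta> * h\<bar> = \<theta> * h" using \<theta> h by simp
          ultimately show ?thesis unfolding norm_scaleR norm_minus_commute[of "z (state k \<omega>)"] by simp
        qed
        finally show ?thesis using True g by (simp add: gap_def del: scheme.simps)
      next
        case False
        then show ?thesis using \<theta> h gap_nonneg[of 0 k \<omega>] by (simp add: indicator_def)
      qed
    qed
    also have "\<dots> = (1 - \<theta> * h) * expectation (?d k) + \<theta> * h * expectation (gap 0 k)"
      using id gap_integrable[of 0 k] by simp
    also have "\<dots> \<le> (1 - \<theta> * h) * \<rho> + \<theta> * h * \<rho>"
      using Suc \<rho>[of k] \<theta> h by (intro add_mono mult_left_mono) auto
    finally show ?case by (simp add: algebra_simps)
  qed
  then have "expectation (?d k) + expectation (gap 0 k) \<le> 2 * \<rho>" using k \<rho>[OF k] by fastforce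
  moreover have "expectation (gap \<theta> k) \<le> expectation (\<lambda>\<omega>. ?d k \<omega> + gap 0 k \<omega>)"
  proof (intro integral_mono Bochner_Integration.integrable_add id gap_integrable \<theta> order_refl)
    fix \<omega>
    show "gap \<theta> k \<omega> \<le> ?d k \<omega> + gap 0 k \<omega>"
      using norm_triangle_ineq[of "scheme \<theta> k \<omega> - scheme 0 k \<omega>" "scheme 0 k \<omega> - z (state k \<omega>)"]
      by (simp add: gap_def indicator_def)
  qed
  ultimately show ?thesis using id gap_integrable[of 0 k] by simp
qed

text \<open>Uniform integrability from the second moment: off the exceptional event the gap is at
  most e, on it at most L plus the norm y of the scheme, and y \<le> 1 / \<eta> + \<eta>
  y^2.\<close>

lemma gap_le:
  assumes e: "0 \<le> e" and p: "prob {\<omega>\<in>good k. e < norm (scheme 0 k \<omega> - z (state k \<omega>))} \<le> \<delta>"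
    and \<eta>: "0 < \<eta>" and B: "expectation (\<lambda>\<omega>. (norm (scheme 0 k \<omega>))\<^sup>2) \<le> B"
  shows "expectation (gap 0 k) \<le> e + \<delta> * (L + 1 / \<eta>) + \<eta> * B"
proof -
  let ?E = "{\<omega>\<in>good k. e < norm (scheme 0 k \<omega> - z (state k \<omega>))}"
  have "?E = {\<omega>\<in>space M. e < gap 0 k \<omega>}" using e good_M[of k, THEN sets.sets_into_space]
    by (auto simp: gap_def indicator_def)
  moreover have "{\<omega>\<in>space M. e < gap 0 k \<omega>} \<in> events"
    using borel_measurable_integrable[OF gap_integrable[of 0 k]] by measurable
  ultimately have E: "?E \<in> events" by simp
  have int: "integrable M (\<lambda>\<omega>. (norm (scheme 0 k \<omega>))\<^sup>2)" by (rule scheme_square_integrable) simp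
  have "expectation (gap 0 k) \<le> expectation (\<lambda>\<omega>. e + (L + 1 / \<eta>) * indicator ?E \<omega> + \<eta> * (norm (scheme 0 k \<omega>))\<^sup>2)"
  proof (intro integral_mono gap_integrable)
    show "integrable M (\<lambda>\<omega>. e + (L + 1 / \<eta>) * indicator ?E \<omega> + \<eta> * (norm (scheme 0 k \<omega>))\<^sup>2)"
      using int E by (auto simp: integrable_indicator_iff less_top[symmetric])
  next
    fix \<omega>
    let ?y = "norm (scheme 0 k \<omega>)"
    show "gap 0 k \<omega> \<le> e + (L + 1 / \<eta>) * indicator ?E \<omega> + \<eta> * ?y\<^sup>2"
    proof (cases "\<omega> \<in> ?E")
      case True
      then have "norm (z (state k \<omega>)) \<le> L" using z_le by (auto simp: good_def)
      then have "gap 0 k \<omega> \<le> ?y + L" using True norm_triangle_ineq4[of "scheme 0 k \<omega>" "z (state k \<omega>)"]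
        by (simp add: gap_def)
      moreover have "?y \<le> 1 / \<eta> + \<eta> * ?y\<^sup>2"
      proof (cases "1 \<le> \<eta> * ?y")
        case True
        then have "?y * 1 \<le> ?y * (\<eta> * ?y)" by (intro mult_left_mono) auto
        also have "\<dots> = \<eta> * ?y\<^sup>2" by (simp add: power2_eq_square)
        finally show ?thesis using \<eta> by (simp add: add_increasing)
      next
        case False
        then have "?y \<le> 1 / \<eta>" using \<eta> by (simp add: field_simps)
        then show ?thesis using \<eta> by (simp add: add_increasing2)
      qed
      ultimately show ?thesis using True e by simp
    next
      case False
      then have "gap 0 k \<omega> \<le> e" using e by (auto simp: gap_def indicator_def)
      then show ?thesis using False \<eta> by (simp add: add_increasing2)
    qed
  qed simp
  also have "\<dots> = e + (L + 1 / \<eta>) * prob ?E + \<eta> * expectation (\<lambda>\<omega>. (norm (scheme 0 k \<omega>))\<^sup>2)"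
    using int E by (simp add: prob_space integrable_indicator_iff less_top[symmetric])
  also have "\<dots> \<le> e + (L + 1 / \<eta>) * \<delta> + \<eta> * B"
    using p B \<eta> L by (intro add_mono mult_left_mono) auto
  finally show ?thesis by (simp add: mult.commute)
qed

text \<open>In the inner product of the scheme with its drift the scheme is replaced by
  \<open>z\<close>, at the price of the drift bound times the gap; then \<open>gen\<close> applies
  at \<open>z\<close>. The summand with \<theta> h L is the price of dropping the factor 1 -
  \<theta> h in front of that inner product.\<close>

lemma pulled_energy:
  assumes \<theta>: "0 < \<theta>" "\<theta> * h \<le> 1" and e: "0 < \<epsilon>" and C0: "0 \<le> C0"
    and gen: "\<And>c. c \<in> D \<Longrightarrow> 2 * (z c \<bullet> (b c + (\<integral>\<gamma>. \<phi> c \<gamma> \<partial>\<nu>))) + (norm (S c))\<^sup>2 + (\<integral>\<gamma>. (norm (\<phi> c \<gamma>))\<^sup>2 \<partial>\<nu>)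
       \<le> - 2 * \<theta> * (norm (z c))\<^sup>2 + C0"
    and gap: "\<And>k. k < K \<Longrightarrow> expectation (gap \<theta> k) \<le> \<rho>" and \<rho>: "0 \<le> \<rho>"
  shows "expectation (\<lambda>\<omega>. (norm (scheme \<theta> K \<omega>))\<^sup>2) \<le> ((1 - \<theta> * h)\<^sup>2) ^ K * (norm z0)\<^sup>2
    + h * (C0 + 2 * \<theta> * h * L * (L * (1 + \<theta> + mass)) + 2 * (L * (1 + \<theta> + mass)) * \<rho> + (L * (1 + \<theta>))\<^sup>2 * (step_error \<epsilon> h / h))
      / (1 - (1 - \<theta> * h)\<^sup>2)"
proof -
  define u where "u k = expectation (\<lambda>\<omega>. (norm (scheme \<theta> k \<omega>))\<^sup>2)" for k
  define Lm where "Lm = L * (1 + \<theta> + mass)"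
  define E where "E = (L * (1 + \<theta>))\<^sup>2 * step_error \<epsilon> h"
  let ?a = "1 - \<theta> * h"
  have Lm0: "0 \<le> Lm" using L \<theta> by (simp add: Lm_def)
  have E0: "0 \<le> E" unfolding E_def step_error_def using h e by simp
  have a: "0 \<le> ?a" "?a \<le> 1" using \<theta> h by auto
  have int: "integrable M (\<lambda>\<omega>. (norm (scheme \<theta> k \<omega>))\<^sup>2)" for k using scheme_square_integrable \<theta> by simp
  have "u (Suc k) \<le> ?a\<^sup>2 * u k + h * (C0 + 2 * \<theta> * h * L * Lm + 2 * Lm * \<rho> + E / h)" if "k < K" for k
  proof -
    define m where "m c = b c + \<theta> *\<^sub>R z c + (\<integral>\<gamma>. \<phi> c \<gamma> \<partial>\<nu>)" for c
    define G where "G c = expectation (\<lambda>\<omega>. indicator (cell k c) \<omega> * norm (scheme \<theta> k \<omega> - z c))" for c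
    have ml: "norm (m c) \<le> Lm" if "c \<in> D" for c using drift_le[OF that, of \<theta>] \<theta> by (simp add: m_def Lm_def)
    have term_le: "2 * ?a * h * expectation (\<lambda>\<omega>. indicator (cell k c) \<omega> * (scheme \<theta> k \<omega> \<bullet> m c))
         + prob (cell k c) * (h * ((norm (S c))\<^sup>2 + (\<integral>\<gamma>. (norm (\<phi> c \<gamma>))\<^sup>2 \<partial>\<nu>)) + E)
       \<le> prob (cell k c) * (h * C0 + 2 * \<theta> * h * h * L * Lm + E) + 2 * h * Lm * G c" if c: "c \<in> D" for c
    proof -
      let ?P = "prob (cell k c)"
      have i1: "integrable M (\<lambda>\<omega>. indicator (cell k c) \<omega> * (scheme \<theta> k \<omega> \<bullet> m c))"
        using integrable_real_mult_indicator[OF cell_M[OF c] integrable_inner_left[OF square_integrable_imp_integrable[OF scheme_M int], of k "m c"]]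
        by (simp add: mult.commute)
      have iI: "integrable M (\<lambda>\<omega>. indicator (cell k c) \<omega> :: real)"
        using cell_M[OF c] by (simp add: integrable_indicator_iff less_top[symmetric])
      have "expectation (\<lambda>\<omega>. indicator (cell k c) \<omega> * (scheme \<theta> k \<omega> \<bullet> m c))
        \<le> expectation (\<lambda>\<omega>. (z c \<bullet> m c) * indicator (cell k c) \<omega> + Lm * (indicator (cell k c) \<omega> * norm (scheme \<theta> k \<omega> - z c)))"
      proof (intro integral_mono i1 Bochner_Integration.integrable_add integrable_mult_right iI cell_gap_integrable c)
        fix \<omega>
        have "(scheme \<theta> k \<omega> - z c) \<bullet> m c \<le> norm (scheme \<theta> k \<omega> - z c) * norm (m c)" by (rule norm_cauchy_schwarz)
        also have "\<dots> \<le> norm (scheme \<theta> k \<omega> - z c) * Lm" using ml[OF c] by (intro mult_left_mono) auto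
        finally show "indicator (cell k c) \<omega> * (scheme \<theta> k \<omega> \<bullet> m c) \<le>
          (z c \<bullet> m c) * indicator (cell k c) \<omega> + Lm * (indicator (cell k c) \<omega> * norm (scheme \<theta> k \<omega> - z c))"
          by (auto simp: indicator_def inner_diff_left mult.commute)
      qed (use \<theta> in auto)
      also have "\<dots> = (z c \<bullet> m c) * ?P + Lm * G c"
        using iI cell_gap_integrable[OF _ c, of \<theta>] \<theta> cell_M[OF c] by (simp add: G_def)
      finally have "2 * ?a * h * expectation (\<lambda>\<omega>. indicator (cell k c) \<omega> * (scheme \<theta> k \<omega> \<bullet> m c))
         \<le> 2 * ?a * h * ((z c \<bullet> m c) * ?P + Lm * G c)" using a h by (intro mult_left_mono) auto
      \<comment> \<open>The inner product may be negative, so raising its factor from 1 - \<theta> h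
        to 1 costs \<theta> h times the bound \<open>L * Lm\<close>.\<close>
      also have "\<dots> \<le> 2 * h * (z c \<bullet> m c) * ?P + 2 * \<theta> * h * h * (L * Lm) * ?P + 2 * h * Lm * G c"
      proof -
        have "- (z c \<bullet> m c) \<le> norm (z c) * norm (m c)" using norm_cauchy_schwarz[of "- z c" "m c"] by simp
        also have "\<dots> \<le> L * Lm" using z_le[OF c] ml[OF c] L by (intro mult_mono) auto
        finally have "2 * \<theta> * h * h * ?P * (- (z c \<bullet> m c)) \<le> 2 * \<theta> * h * h * ?P * (L * Lm)"
          using \<theta> h by (intro mult_left_mono) auto
        moreover have "0 \<le> G c" unfolding G_def by simp
        then have "?a * (2 * h * Lm * G c) \<le> 1 * (2 * h * Lm * G c)" using a h Lm0 by (intro mult_right_mono) auto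
        ultimately show ?thesis by (simp add: algebra_simps)
      qed
      finally have 1: "2 * ?a * h * expectation (\<lambda>\<omega>. indicator (cell k c) \<omega> * (scheme \<theta> k \<omega> \<bullet> m c)) \<le>
        2 * h * (z c \<bullet> m c) * ?P + 2 * \<theta> * h * h * (L * Lm) * ?P + 2 * h * Lm * G c" .
      \<comment> \<open>The pull inside \<open>m c\<close> adds 2 \<theta> |z c|^2, which cancels
        the dissipation in \<open>gen\<close> exactly; the decay is carried by the factor (1 -
        \<theta> h)^2 instead.\<close>
      have "2 * (z c \<bullet> m c) + (norm (S c))\<^sup>2 + (\<integral>\<gamma>. (norm (\<phi> c \<gamma>))\<^sup>2 \<partial>\<nu>) \<le> C0"
        using gen[OF c] by (simp add: m_def inner_add_right power2_norm_eq_inner)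
      then have "(h * ?P) * (2 * (z c \<bullet> m c) + (norm (S c))\<^sup>2 + (\<integral>\<gamma>. (norm (\<phi> c \<gamma>))\<^sup>2 \<partial>\<nu>)) \<le> (h * ?P) * C0"
        using h by (intro mult_left_mono) auto
      with 1 show ?thesis by (simp add: algebra_simps)
    qed
    have "u (Suc k) \<le> ?a\<^sup>2 * u k + (\<Sum>c\<in>D. 2 * ?a * h * expectation (\<lambda>\<omega>. indicator (cell k c) \<omega> * (scheme \<theta> k \<omega> \<bullet> m c))
         + prob (cell k c) * (h * ((norm (S c))\<^sup>2 + (\<integral>\<gamma>. (norm (\<phi> c \<gamma>))\<^sup>2 \<partial>\<nu>)) + E))"
      unfolding u_def m_def E_def using \<theta> e int by (intro scheme_step(2)) auto
    also have "\<dots> \<le> ?a\<^sup>2 * u k + (\<Sum>c\<in>D. prob (cell k c) * (h * C0 + 2 * \<theta> * h * h * L * Lm + E) + 2 * h * Lm * G c)"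
      using term_le by (intro add_left_mono sum_mono)
    also have "\<dots> = ?a\<^sup>2 * u k + (\<Sum>c\<in>D. prob (cell k c)) * (h * C0 + 2 * \<theta> * h * h * L * Lm + E) + 2 * h * Lm * (\<Sum>c\<in>D. G c)"
      by (simp add: sum.distrib sum_distrib_left sum_distrib_right)
    also have "(\<Sum>c\<in>D. G c) = expectation (gap \<theta> k)"
      unfolding G_def gap_sum[abs_def] using cell_gap_integrable \<theta> by (simp add: integral_sum)
    also have "?a\<^sup>2 * u k + (\<Sum>c\<in>D. prob (cell k c)) * (h * C0 + 2 * \<theta> * h * h * L * Lm + E) + 2 * h * Lm * expectation (gap \<theta> k)
      \<le> ?a\<^sup>2 * u k + 1 * (h * C0 + 2 * \<theta> * h * h * L * Lm + E) + 2 * h * Lm * \<rho>"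
      using sum_prob_cell[of k] gap[OF that] E0 C0 h \<theta> L Lm0
      by (intro add_mono mult_left_mono mult_right_mono order_refl add_nonneg_nonneg mult_nonneg_nonneg) auto
    also have "\<dots> = ?a\<^sup>2 * u k + h * (C0 + 2 * \<theta> * h * L * Lm + 2 * Lm * \<rho> + E / h)"
      using h by (simp add: algebra_simps)
    finally show ?thesis .
  qed
  moreover have "?a\<^sup>2 < 1"
  proof -
    have "?a < 1" using \<theta> h by simp
    then show ?thesis using a by (simp add: power2_eq_square mult_less_cancel_right1 mult_le_one less_le_trans[OF mult_strict_left_mono] abs_square_less_1[unfolded power2_eq_square])
  qed
  moreover have "0 \<le> h * (C0 + 2 * \<theta> * h * L * Lm + 2 * Lm * \<rho> + E / h)"
    using h C0 \<theta> L Lm0 \<rho> E0 by simp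
  ultimately have "u K \<le> (?a\<^sup>2) ^ K * u 0 + h * (C0 + 2 * \<theta> * h * L * Lm + 2 * Lm * \<rho> + E / h) / (1 - ?a\<^sup>2)"
    by (intro affine_recursion_le[of K u "?a\<^sup>2" _ K]) auto
  then show ?thesis by (simp add: u_def Lm_def E_def prob_space)
qed

end

section \<open>Passage to the limit of vanishing mesh\<close>

lemma square_add_le:
  fixes x y \<eta> :: real
  assumes "0 < \<eta>"
  shows "(x + y)\<^sup>2 \<le> (1 + \<eta>) * x\<^sup>2 + (1 + 1 / \<eta>) * y\<^sup>2"
proof -
  have "0 \<le> (\<eta> * x - y)\<^sup>2 / \<eta>" using assms by simp
  also have "\<dots> = \<eta> * x\<^sup>2 - 2 * x * y + y\<^sup>2 / \<eta>"
    using assms by (simp add: power2_eq_square field_simps)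
  finally show ?thesis by (simp add: power2_eq_square algebra_simps)
qed

context driving_noise
begin

text \<open>The increment of a step outside the locale \<open>euler_scheme\<close>, so that the
  increments of two solutions can be subtracted from each other.\<close>

definition increment :: "real \<Rightarrow> real^'n \<Rightarrow> real^'d^'n \<Rightarrow> ('e \<Rightarrow> real^'n) \<Rightarrow> nat \<Rightarrow> 'w \<Rightarrow> real^'n" where
  "increment h b S \<phi> k \<omega> = h *\<^sub>R b + S *v incr (real k * h) (real k * h + h) \<omega> + jump \<phi> (real k * h) (real k * h + h) \<omega>"

end

lemma (in euler_scheme) scheme_eq_sum:
  assumes "\<omega> \<in> good k"
  shows "scheme 0 k \<omega> = z0 + (\<Sum>j<k. increment h (b (state j \<omega>)) (S (state j \<omega>)) (\<phi> (state j \<omega>)) j \<omega>)"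
  using assms
proof (induction k)
  case (Suc k)
  have "\<omega> \<in> good k" using Suc.prems good_mono[of k "Suc k"] by auto
  with Suc.IH show ?case by (simp add: step_def increment_def)
qed simp

text \<open>The bounds \<open>Lb n\<close> grow with the ball, so n is fixed first through the exit
  probability. For this n the mesh tends to zero at gap level x, then x tends to zero, then the exit
  probability and the constant \<eta> of Young's inequality. Throughout, the norm of Z is truncated
  at R, which makes convergence in probability sufficient; R is removed by Fatou's lemma.\<close>

lemma (in driving_noise) energy_limit:
  fixes Z :: "'w \<Rightarrow> real^'n" and st :: "nat \<Rightarrow> nat \<Rightarrow> 'w \<Rightarrow> 's" and D :: "nat \<Rightarrow> nat \<Rightarrow> 's set" and Lb :: "nat \<Rightarrow> real"
    and z b :: "'s \<Rightarrow> real^'n" and S :: "'s \<Rightarrow> real^'d^'n" and \<phi> :: "'s \<Rightarrow> 'e \<Rightarrow> real^'n"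
  assumes T: "0 < T" and \<theta>: "0 < \<theta>" and C0: "0 \<le> C0"
    and sch: "\<And>n p. euler_scheme M F w \<nu> N (T / real (Suc p)) (st p) (D n p) z b S \<phi> (Lb n)"
    and gen: "\<And>c. 2 * (z c \<bullet> (b c + (\<integral>\<gamma>. \<phi> c \<gamma> \<partial>\<nu>))) + (norm (S c))\<^sup>2 + (\<integral>\<gamma>. (norm (\<phi> c \<gamma>))\<^sup>2 \<partial>\<nu>)
       \<le> - 2 * \<theta> * (norm (z c))\<^sup>2 + C0"
    and conv: "\<And>n e. 0 < e \<Longrightarrow> \<forall>\<^sub>F p in sequentially. \<forall>k\<le>Suc p. prob {\<omega>\<in>space M. (\<forall>j\<le>k. st p j \<omega> \<in> D n p) \<and>
        e < norm (z0 + (\<Sum>j<k. increment (T / real (Suc p)) (b (st p j \<omega>)) (S (st p j \<omega>)) (\<phi> (st p j \<omega>)) j \<omega>) - z (st p k \<omega>))} \<le> e"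
    and fin: "\<And>e. 0 < e \<Longrightarrow> \<forall>\<^sub>F p in sequentially. prob {\<omega>\<in>space M. e < norm (Z \<omega> - z (st p (Suc p) \<omega>))} \<le> e"
    and zm: "\<And>p k. (\<lambda>\<omega>. z (st p k \<omega>)) \<in> borel_measurable M"
    and leave: "\<And>e. 0 < e \<Longrightarrow> \<exists>n. \<forall>p. prob {\<omega>\<in>space M. \<exists>j\<le>Suc p. st p j \<omega> \<notin> D n p} \<le> e"
    and Z: "Z \<in> borel_measurable M"
  shows "integrable M (\<lambda>\<omega>. (norm (Z \<omega>))\<^sup>2)"
    and "expectation (\<lambda>\<omega>. (norm (Z \<omega>))\<^sup>2) \<le> exp (- 2 * \<theta> * T) * (norm z0)\<^sup>2 + C0 / (2 * \<theta>)"
proof -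
  let ?Bd = "exp (- 2 * \<theta> * T) * (norm z0)\<^sup>2 + C0 / (2 * \<theta>)"
  define hh where "hh p = T / real (Suc p)" for p
  have hh_pos: "0 < hh p" for p using T by (simp add: hh_def)
  have hh_T: "real (Suc p) * hh p = T" for p by (simp add: hh_def del: of_nat_Suc)
  have hh_lim: "hh \<longlonglongrightarrow> 0" unfolding hh_def[abs_def] by (rule LIMSEQ_Suc[OF lim_const_over_n])
  have gap0: "\<forall>\<^sub>F p in sequentially. \<forall>k\<le>Suc p.
      expectation (euler_scheme.gap M w \<nu> N (hh p) (st p) (D n p) z b S \<phi> z0 0 k) \<le> 2 * x" if x: "0 < x" for n x
  proof -
    \<comment> \<open>The instance at p = 0 serves to name the growth rate, which depends on n but
      not on p.\<close>
    interpret e0: euler_scheme M F w \<nu> N "T / real (Suc 0)" "st 0" "D n 0" z b S \<phi> z0 "Lb n" by (rule sch)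
    define B where "B = exp (e0.growth_rate * T) * ((norm z0)\<^sup>2 + 1)"
    have B0: "0 < B" unfolding B_def by (intro mult_pos_pos add_nonneg_pos) auto
    \<comment> \<open>With the next two choices the bound of \<open>gap_le\<close> becomes x + x:
      one x is \<open>\<eta> * B\<close>, the other is e times the denominator in its
      definition.\<close>
    define \<eta> where "\<eta> = x / B"
    have \<eta>: "0 < \<eta>" "\<eta> * B = x" using x B0 by (auto simp: \<eta>_def)
    define e where "e = x / (1 + (Lb n + 1 / \<eta>))"
    have den: "0 < 1 + (Lb n + 1 / \<eta>)" using e0.L \<eta> by (intro add_pos_nonneg) auto
    have e: "0 < e" using x den by (auto simp: e_def)
    have e2: "e + e * (Lb n + 1 / \<eta>) = x"
    proof -
      have "e * (1 + (Lb n + 1 / \<eta>)) = x" using den by (simp add: e_def)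
      then show ?thesis unfolding distrib_left[of e 1] by simp
    qed
    have "\<forall>\<^sub>F p in sequentially. hh p < 1" using hh_lim by (rule order_tendstoD) simp
    with conv[OF e, of n] show ?thesis
    proof eventually_elim
      case (elim p)
      interpret e: euler_scheme M F w \<nu> N "T / real (Suc p)" "st p" "D n p" z b S \<phi> z0 "Lb n" by (rule sch)
      show ?case
      proof (intro allI impI)
        fix k assume k: "k \<le> Suc p"
        have "{\<omega>\<in>e.good k. e < norm (e.scheme 0 k \<omega> - z (st p k \<omega>))} = {\<omega>\<in>space M. (\<forall>j\<le>k. st p j \<omega> \<in> D n p) \<and>
          e < norm (z0 + (\<Sum>j<k. increment (T / real (Suc p)) (b (st p j \<omega>)) (S (st p j \<omega>)) (\<phi> (st p j \<omega>)) j \<omega>) - z (st p k \<omega>))}"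
          using e.scheme_eq_sum[of _ k] unfolding e.good_def by auto
        then have pr: "prob {\<omega>\<in>e.good k. e < norm (e.scheme 0 k \<omega> - z (st p k \<omega>))} \<le> e"
          using elim(1) k by simp
        have "real k * (T / real (Suc p)) \<le> real (Suc p) * (T / real (Suc p))"
          using k T by (intro mult_right_mono) auto
        then have kT: "real k * (T / real (Suc p)) \<le> T" using hh_T[of p] by (simp add: hh_def)
        have "expectation (\<lambda>\<omega>. (norm (e.scheme 0 k \<omega>))\<^sup>2) \<le> exp (e.growth_rate * (real k * (T / real (Suc p)))) * ((norm z0)\<^sup>2 + 1)"
          using elim(2) by (intro e.scheme_bounded) (simp add: hh_def)
        also have "\<dots> \<le> B"
          unfolding B_def
          by (intro mult_right_mono exp_le_cancel_iff[THEN iffD2] mult_left_mono kT e.growth_rate_nonneg add_nonneg_nonneg zero_le_power2 zero_le_one)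
        finally have "expectation (e.gap 0 k) \<le> e + e * (Lb n + 1 / \<eta>) + \<eta> * B"
          using e pr \<eta> by (intro e.gap_le) auto
        then show "expectation (euler_scheme.gap M w \<nu> N (hh p) (st p) (D n p) z b S \<phi> z0 0 k) \<le> 2 * x"
          unfolding e2 \<eta>(2) hh_def by simp
      qed
    qed
  qed
  have main: "expectation (\<lambda>\<omega>. (min (norm (Z \<omega>)) R)\<^sup>2) \<le> (1 + \<eta>) * ?Bd + R\<^sup>2 * e1"
    if R: "0 < R" and \<eta>: "0 < \<eta>" and e1: "0 < e1" for R \<eta> e1
  proof -
    obtain n where n: "\<And>p. prob {\<omega>\<in>space M. \<exists>j\<le>Suc p. st p j \<omega> \<notin> D n p} \<le> e1" using leave[OF e1] by blast
    interpret e0: euler_scheme M F w \<nu> N "T / real (Suc 0)" "st 0" "D n 0" z b S \<phi> z0 "Lb n" by (rule sch)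
    define L where "L = Lb n"
    define Lm where "Lm = L * (1 + \<theta> + mass)"
    have L0: "0 \<le> L" using e0.L by (simp add: L_def)
    \<comment> \<open>The numerator in \<open>pulled_energy\<close> for \<epsilon> = x and \<rho> =
      4 x, with the division of \<open>step_error\<close> by h carried out so that h = 0 can be
      inserted. The 4 x is the unpulled gap 2 x, doubled by \<open>pulled_gap_le\<close>.\<close>
    define Q where "Q x h = C0 + 2 * \<theta> * h * L * Lm + 2 * Lm * (4 * x) + (L * (1 + \<theta>))\<^sup>2 *
       (h * (1 + 2 * mass + mass\<^sup>2) + 2 * (x * (mass + h * mass\<^sup>2) + 3 * (real CARD('d))\<^sup>2 * h / x ^ 3))" for x h
    have err: "step_error x h / h = h * (1 + 2 * mass + mass\<^sup>2) + 2 * (x * (mass + h * mass\<^sup>2) + 3 * (real CARD('d))\<^sup>2 * h / x ^ 3)"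
      if "0 < h" for x h
      using that by (simp add: step_error_def power2_eq_square add_divide_distrib distrib_left)
    have x_bound: "expectation (\<lambda>\<omega>. (min (norm (Z \<omega>)) R)\<^sup>2) \<le>
      (1 + \<eta>) * (exp (- 2 * \<theta> * T) * (norm z0)\<^sup>2 + Q x 0 / (2 * \<theta>)) + (1 + 1 / \<eta>) * (R * (x + R * x + 4 * x)) + R\<^sup>2 * e1"
      if x: "0 < x" for x
    proof (rule tendsto_lowerbound)
      show "((\<lambda>p. (1 + \<eta>) * (exp (- 2 * \<theta> * T) * (norm z0)\<^sup>2 + Q x (hh p) / (2 * \<theta> - \<theta>\<^sup>2 * hh p)) + (1 + 1 / \<eta>) * (R * (x + R * x + 4 * x)) + R\<^sup>2 * e1)
         \<longlongrightarrow> (1 + \<eta>) * (exp (- 2 * \<theta> * T) * (norm z0)\<^sup>2 + Q x 0 / (2 * \<theta>)) + (1 + 1 / \<eta>) * (R * (x + R * x + 4 * x)) + R\<^sup>2 * e1) sequentially"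
      proof -
        have "((\<lambda>p. Q x (hh p)) \<longlongrightarrow> Q x 0) sequentially"
          unfolding Q_def using x by (intro tendsto_intros hh_lim) auto
        moreover have "((\<lambda>p. 2 * \<theta> - \<theta>\<^sup>2 * hh p) \<longlongrightarrow> 2 * \<theta> - \<theta>\<^sup>2 * 0) sequentially"
          by (intro tendsto_intros hh_lim)
        ultimately show ?thesis using \<theta> by (intro tendsto_intros) auto
      qed
      have "\<forall>\<^sub>F p in sequentially. hh p < 1 / \<theta>" using hh_lim by (rule order_tendstoD) (use \<theta> in simp)
      with gap0[OF x, of n] fin[OF x]
      show "\<forall>\<^sub>F p in sequentially. expectation (\<lambda>\<omega>. (min (norm (Z \<omega>)) R)\<^sup>2) \<le>
        (1 + \<eta>) * (exp (- 2 * \<theta> * T) * (norm z0)\<^sup>2 + Q x (hh p) / (2 * \<theta> - \<theta>\<^sup>2 * hh p)) + (1 + 1 / \<eta>) * (R * (x + R * x + 4 * x)) + R\<^sup>2 * e1"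
      proof eventually_elim
        case (elim p)
        interpret e: euler_scheme M F w \<nu> N "T / real (Suc p)" "st p" "D n p" z b S \<phi> z0 "Lb n" by (rule sch)
        have hp: "hh p = T / real (Suc p)" by (simp add: hh_def)
        let ?K = "Suc p" and ?h = "T / real (Suc p)"
        have h: "0 < ?h" using hh_pos[of p] by (simp only: hp)
        have \<theta>h: "\<theta> * ?h < 1" using elim(3) \<theta> unfolding hp by (simp add: field_simps del: of_nat_Suc)
        have g: "expectation (e.gap \<theta> k) \<le> 4 * x" if "k \<le> ?K" for k
          using e.pulled_gap_le[of \<theta> ?K "2 * x" k] elim(1) \<theta> \<theta>h that by (simp add: hp)
        have W: "expectation (\<lambda>\<omega>. (norm (e.scheme \<theta> ?K \<omega>))\<^sup>2) \<le> exp (- 2 * \<theta> * T) * (norm z0)\<^sup>2 + Q x (hh p) / (2 * \<theta> - \<theta>\<^sup>2 * hh p)"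
        proof -
          have "expectation (\<lambda>\<omega>. (norm (e.scheme \<theta> ?K \<omega>))\<^sup>2) \<le> ((1 - \<theta> * ?h)\<^sup>2) ^ ?K * (norm z0)\<^sup>2
            + ?h * (C0 + 2 * \<theta> * ?h * Lb n * (Lb n * (1 + \<theta> + mass)) + 2 * (Lb n * (1 + \<theta> + mass)) * (4 * x) + (Lb n * (1 + \<theta>))\<^sup>2 * (step_error x ?h / ?h))
            / (1 - (1 - \<theta> * ?h)\<^sup>2)"
            using \<theta> \<theta>h x C0 gen g by (intro e.pulled_energy) auto
          also have "C0 + 2 * \<theta> * ?h * Lb n * (Lb n * (1 + \<theta> + mass)) + 2 * (Lb n * (1 + \<theta> + mass)) * (4 * x) + (Lb n * (1 + \<theta>))\<^sup>2 * (step_error x ?h / ?h) = Q x (hh p)"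
            unfolding Q_def err[OF h] hp Lm_def L_def by simp
          also have "?h * Q x (hh p) / (1 - (1 - \<theta> * ?h)\<^sup>2) = Q x (hh p) / (2 * \<theta> - \<theta>\<^sup>2 * hh p)"
          proof -
            have "1 - (1 - \<theta> * ?h)\<^sup>2 = ?h * (2 * \<theta> - \<theta>\<^sup>2 * ?h)" by (simp add: power2_eq_square algebra_simps)
            then show ?thesis unfolding hp using less_imp_neq[OF h]
              by (simp only:) (rule nonzero_mult_divide_mult_cancel_left, simp)
          qed
          \<comment> \<open>The exponent \<open>2 * ?K\<close> times the step \<open>?h\<close> is
            exactly 2 T, so the decay rate 2 \<theta> is reached for every mesh and not only in the
            limit.\<close>
          also have "((1 - \<theta> * ?h)\<^sup>2) ^ ?K \<le> exp (- 2 * \<theta> * T)"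
          proof -
            have "1 - \<theta> * ?h \<le> exp (- (\<theta> * ?h))" using exp_ge_add_one_self[of "- (\<theta> * ?h)"] by simp
            then have "(1 - \<theta> * ?h) ^ (2 * ?K) \<le> exp (- (\<theta> * ?h)) ^ (2 * ?K)" using \<theta>h by (intro power_mono) auto
            also have "\<dots> = exp (real (2 * ?K) * (- (\<theta> * ?h)))" by (rule exp_of_nat_mult[symmetric])
            also have "real (2 * ?K) * (- (\<theta> * ?h)) = - 2 * \<theta> * (real ?K * ?h)"
            proof -
              have "real (2 * k) * (- (\<theta> * y)) = - 2 * \<theta> * (real k * y)" for k y by simp
              then show ?thesis .
            qed
            also have "real ?K * ?h = T" using hh_T[of p] by (simp only: hp)
            finally show ?thesis by (simp only: power_mult)
          qed
          finally show ?thesis by (simp add: mult_right_mono)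
        qed
        let ?E = "{\<omega>\<in>space M. x < norm (Z \<omega> - z (st p ?K \<omega>))}"
        have E: "?E \<in> events" using Z zm[of p ?K] by measurable
        have bad: "space M - e.good ?K = {\<omega>\<in>space M. \<exists>j\<le>?K. st p j \<omega> \<notin> D n p}" by (auto simp: e.good_def)
        have badM: "space M - e.good ?K \<in> events" using e.good_M by auto
        have iW: "integrable M (\<lambda>\<omega>. (norm (e.scheme \<theta> ?K \<omega>))\<^sup>2)" using \<theta> by (intro e.scheme_square_integrable) simp
        have ig: "integrable M (e.gap \<theta> ?K)" using \<theta> by (intro e.gap_integrable) simp
        have iE: "integrable M (\<lambda>\<omega>. indicator ?E \<omega> :: real)" "integrable M (\<lambda>\<omega>. indicator (space M - e.good ?K) \<omega> :: real)"
          using E badM by (auto simp: integrable_indicator_iff less_top[symmetric])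
        have "expectation (\<lambda>\<omega>. (min (norm (Z \<omega>)) R)\<^sup>2) \<le> expectation (\<lambda>\<omega>. (1 + \<eta>) * (norm (e.scheme \<theta> ?K \<omega>))\<^sup>2
            + (1 + 1 / \<eta>) * (R * (x + R * indicator ?E \<omega> + e.gap \<theta> ?K \<omega>)) + R\<^sup>2 * indicator (space M - e.good ?K) \<omega>)"
        proof (rule integral_mono)
          show "integrable M (\<lambda>\<omega>. (min (norm (Z \<omega>)) R)\<^sup>2)"
            using Z R by (intro integrable_const_bound[of _ "R\<^sup>2"]) (auto intro!: AE_I2 power_mono)
          show "integrable M (\<lambda>\<omega>. (1 + \<eta>) * (norm (e.scheme \<theta> ?K \<omega>))\<^sup>2
            + (1 + 1 / \<eta>) * (R * (x + R * indicator ?E \<omega> + e.gap \<theta> ?K \<omega>)) + R\<^sup>2 * indicator (space M - e.good ?K) \<omega>)"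
            by (intro Bochner_Integration.integrable_add integrable_mult_right iW ig iE integrable_const)
          fix \<omega> assume \<omega>: "\<omega> \<in> space M"
          let ?W = "e.scheme \<theta> ?K \<omega>" and ?z = "z (st p ?K \<omega>)"
          show "(min (norm (Z \<omega>)) R)\<^sup>2 \<le> (1 + \<eta>) * (norm ?W)\<^sup>2
            + (1 + 1 / \<eta>) * (R * (x + R * indicator ?E \<omega> + e.gap \<theta> ?K \<omega>)) + R\<^sup>2 * indicator (space M - e.good ?K) \<omega>"
          proof (cases "\<omega> \<in> e.good ?K")
            case True
            \<comment> \<open>The distance is truncated as well: y \<le> R gives y^2 \<le> R y, so
              the squared error is linear in the gap and needs only its mean.\<close>
            define y where "y = min (norm (Z \<omega> - ?W)) R"
            have y0: "0 \<le> y" "y \<le> R" using R by (auto simp: y_def)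
            have "min (norm (Z \<omega>)) R \<le> norm ?W + y"
            proof -
              have "min a R \<le> v + min d R" if "a \<le> v + d" "0 \<le> v" for a d v using that by linarith
              then show ?thesis unfolding y_def using norm_triangle_sub[of "Z \<omega>" ?W] by (simp only: norm_ge_zero)
            qed
            then have "(min (norm (Z \<omega>)) R)\<^sup>2 \<le> (norm ?W + y)\<^sup>2" using R by (intro power_mono) auto
            also have "\<dots> \<le> (1 + \<eta>) * (norm ?W)\<^sup>2 + (1 + 1 / \<eta>) * y\<^sup>2" by (rule square_add_le[OF \<eta>])
            also have "y\<^sup>2 \<le> R * (x + R * indicator ?E \<omega> + e.gap \<theta> ?K \<omega>)"
            proof -
              have gp: "e.gap \<theta> ?K \<omega> = norm (?W - ?z)" using True unfolding e.gap_def by simp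
              have "y \<le> x + R * indicator ?E \<omega> + e.gap \<theta> ?K \<omega>"
              proof (cases "\<omega> \<in> ?E")
                case True
                then show ?thesis using y0 x e.gap_nonneg[of \<theta> ?K \<omega>] by simp
              next
                case False
                then have "norm (Z \<omega> - ?z) \<le> x" using \<omega> by auto
                moreover have "norm (Z \<omega> - ?W) \<le> norm (Z \<omega> - ?z) + norm (?W - ?z)"
                  using norm_triangle_ineq4[of "Z \<omega> - ?z" "?W - ?z"] by simp
                ultimately show ?thesis using False unfolding gp y_def by simp
              qed
              then have "y * y \<le> R * (x + R * indicator ?E \<omega> + e.gap \<theta> ?K \<omega>)" using y0 R by (intro mult_mono) auto
              then show ?thesis by (simp add: power2_eq_square)
            qed
            finally show ?thesis using True \<eta> by (simp add: mult_left_mono)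
          next
            case False
            have "(min (norm (Z \<omega>)) R)\<^sup>2 \<le> R\<^sup>2" using R by (intro power_mono) auto
            moreover have "0 \<le> (1 + \<eta>) * (norm ?W)\<^sup>2 + (1 + 1 / \<eta>) * (R * (x + R * indicator ?E \<omega> + e.gap \<theta> ?K \<omega>))"
              using \<eta> R x e.gap_nonneg[of \<theta> ?K \<omega>] by (intro add_nonneg_nonneg mult_nonneg_nonneg) auto
            ultimately show ?thesis using False \<omega> by simp
          qed
        qed
        also have "\<dots> = (1 + \<eta>) * expectation (\<lambda>\<omega>. (norm (e.scheme \<theta> ?K \<omega>))\<^sup>2)
            + (1 + 1 / \<eta>) * (R * (x + R * prob ?E + expectation (e.gap \<theta> ?K))) + R\<^sup>2 * prob (space M - e.good ?K)"
          using iW ig iE E badM by (simp add: prob_space del: e.scheme.simps)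
        also have "\<dots> \<le> (1 + \<eta>) * (exp (- 2 * \<theta> * T) * (norm z0)\<^sup>2 + Q x (hh p) / (2 * \<theta> - \<theta>\<^sup>2 * hh p))
            + (1 + 1 / \<eta>) * (R * (x + R * x + 4 * x)) + R\<^sup>2 * e1"
          using W elim(2) g[of ?K] n[of p] \<eta> R unfolding bad by (intro add_mono mult_left_mono) auto
        finally show ?case .
      qed
    qed simp
    show ?thesis
    proof (rule tendsto_lowerbound)
      show "((\<lambda>x. (1 + \<eta>) * (exp (- 2 * \<theta> * T) * (norm z0)\<^sup>2 + Q x 0 / (2 * \<theta>)) + (1 + 1 / \<eta>) * (R * (x + R * x + 4 * x)) + R\<^sup>2 * e1)
        \<longlongrightarrow> (1 + \<eta>) * ?Bd + R\<^sup>2 * e1) (at_right 0)"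
      proof -
        \<comment> \<open>At h = 0 the summand with x^3 in the denominator is gone and the errors
          are linear in x; this is why the mesh limit comes before the limit in x.\<close>
        have "((\<lambda>x. (1 + \<eta>) * (exp (- 2 * \<theta> * T) * (norm z0)\<^sup>2 + (C0 + 2 * Lm * (4 * x) + (L * (1 + \<theta>))\<^sup>2 * (2 * (x * mass))) / (2 * \<theta>)) + (1 + 1 / \<eta>) * (R * (x + R * x + 4 * x)) + R\<^sup>2 * e1)
        \<longlongrightarrow> (1 + \<eta>) * (exp (- 2 * \<theta> * T) * (norm z0)\<^sup>2 + (C0 + 2 * Lm * (4 * 0) + (L * (1 + \<theta>))\<^sup>2 * (2 * (0 * mass))) / (2 * \<theta>)) + (1 + 1 / \<eta>) * (R * (0 + R * 0 + 4 * 0)) + R\<^sup>2 * e1) (at_right 0)"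
          using \<theta> by (intro tendsto_intros) auto
        then show ?thesis by (simp add: Q_def)
      qed
      show "\<forall>\<^sub>F x in at_right 0. expectation (\<lambda>\<omega>. (min (norm (Z \<omega>)) R)\<^sup>2) \<le>
         (1 + \<eta>) * (exp (- 2 * \<theta> * T) * (norm z0)\<^sup>2 + Q x 0 / (2 * \<theta>)) + (1 + 1 / \<eta>) * (R * (x + R * x + 4 * x)) + R\<^sup>2 * e1"
        using x_bound by (intro eventually_at_right_less[THEN eventually_mono]) auto
    qed simp
  qed
  have R_bound: "expectation (\<lambda>\<omega>. (min (norm (Z \<omega>)) R)\<^sup>2) \<le> ?Bd" if R: "0 < R" for R
  proof (rule tendsto_lowerbound)
    \<comment> \<open>One variable x plays the part of both \<eta> and the exit probability.\<close>
    have "((\<lambda>x. (1 + x) * ?Bd + R\<^sup>2 * x) \<longlongrightarrow> (1 + 0) * ?Bd + R\<^sup>2 * 0) (at_right 0)"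
      by (intro tendsto_intros)
    then show "((\<lambda>x. (1 + x) * ?Bd + R\<^sup>2 * x) \<longlongrightarrow> ?Bd) (at_right 0)" by simp
    show "\<forall>\<^sub>F x in at_right 0. expectation (\<lambda>\<omega>. (min (norm (Z \<omega>)) R)\<^sup>2) \<le> (1 + x) * ?Bd + R\<^sup>2 * x"
      using main[OF R] by (intro eventually_at_right_less[THEN eventually_mono]) auto
  qed simp
  have Bd0: "0 \<le> ?Bd" using C0 \<theta> by simp
  have "(\<integral>\<^sup>+\<omega>. ennreal ((norm (Z \<omega>))\<^sup>2) \<partial>M) \<le> ennreal ?Bd"
  proof -
    have lim: "(\<lambda>i. ennreal ((min (norm (Z \<omega>)) (real (Suc i)))\<^sup>2)) \<longlonglongrightarrow> ennreal ((norm (Z \<omega>))\<^sup>2)" for \<omega>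
    proof (rule tendsto_eventually)
      obtain i0 where "norm (Z \<omega>) \<le> real i0" using real_arch_simple by blast
      then have "min (norm (Z \<omega>)) (real (Suc i)) = norm (Z \<omega>)" if "i0 \<le> i" for i using that by simp
      then show "\<forall>\<^sub>F i in sequentially. ennreal ((min (norm (Z \<omega>)) (real (Suc i)))\<^sup>2) = ennreal ((norm (Z \<omega>))\<^sup>2)"
        by (intro eventually_sequentiallyI[of i0]) simp
    qed
    have "(\<integral>\<^sup>+\<omega>. ennreal ((norm (Z \<omega>))\<^sup>2) \<partial>M) = (\<integral>\<^sup>+\<omega>. liminf (\<lambda>i. ennreal ((min (norm (Z \<omega>)) (real (Suc i)))\<^sup>2)) \<partial>M)"
      by (intro nn_integral_cong lim_imp_Liminf[symmetric] lim) simp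
    also have "\<dots> \<le> liminf (\<lambda>i. \<integral>\<^sup>+\<omega>. ennreal ((min (norm (Z \<omega>)) (real (Suc i)))\<^sup>2) \<partial>M)"
      using Z by (intro nn_integral_liminf) measurable
    also have "\<dots> \<le> ennreal ?Bd"
    proof (rule Liminf_le)
      show "\<forall>\<^sub>F i in sequentially. (\<integral>\<^sup>+\<omega>. ennreal ((min (norm (Z \<omega>)) (real (Suc i)))\<^sup>2) \<partial>M) \<le> ennreal ?Bd"
      proof (rule always_eventually, rule allI)
        fix i
        have "integrable M (\<lambda>\<omega>. (min (norm (Z \<omega>)) (real (Suc i)))\<^sup>2)"
          using Z by (intro integrable_const_bound[of _ "(real (Suc i))\<^sup>2"]) (auto intro!: AE_I2 power_mono)
        then show "(\<integral>\<^sup>+\<omega>. ennreal ((min (norm (Z \<omega>)) (real (Suc i)))\<^sup>2) \<partial>M) \<le> ennreal ?Bd"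
          using R_bound[of "real (Suc i)"] by (subst nn_integral_eq_integral) (auto intro!: ennreal_leI simp del: ennreal_plus)
      qed
    qed simp
    finally show ?thesis .
  qed
  then show int: "integrable M (\<lambda>\<omega>. (norm (Z \<omega>))\<^sup>2)"
    using Z by (intro integrableI_nonneg) (auto simp: top_unique less_top[symmetric] simp del: ennreal_plus)
  have "ennreal (expectation (\<lambda>\<omega>. (norm (Z \<omega>))\<^sup>2)) \<le> ennreal ?Bd"
    using \<open>(\<integral>\<^sup>+\<omega>. ennreal ((norm (Z \<omega>))\<^sup>2) \<partial>M) \<le> ennreal ?Bd\<close> by (subst (asm) nn_integral_eq_integral[OF int]) auto
  then show "expectation (\<lambda>\<omega>. (norm (Z \<omega>))\<^sup>2) \<le> ?Bd" using Bd0 by (simp add: ennreal_le_iff del: ennreal_plus)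
qed

section \<open>Comparison of elementary stochastic integrals\<close>

lemma finite_set_strict_enumeration:
  fixes T :: "real set"
  assumes "finite T" "T \<noteq> {}"
  shows "\<exists>(s :: nat \<Rightarrow> real) m. (\<forall>i j. i < j \<longrightarrow> j \<le> m \<longrightarrow> s i < s j) \<and> T = s ` {..m}"
proof -
  let ?l = "sorted_list_of_set T"
  define m where "m = card T - 1"
  have len: "length ?l = Suc m" using assms by (simp add: m_def card_gt_0_iff)
  have "?l ! i < ?l ! j" if "i < j" "j \<le> m" for i j
    using that len by (intro sorted_wrt_nth_less[of "(<)"]) (auto simp: strict_sorted_iff)
  moreover have "T = (\<lambda>i. ?l ! i) ` {..m}"
  proof -
    have "T = set ?l" using assms by simp
    also have "\<dots> = (\<lambda>i. ?l ! i) ` {..m}" using len by (auto simp: set_conv_nth less_Suc_eq_le)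
    finally show ?thesis .
  qed
  ultimately show ?thesis by (intro exI[of _ "\<lambda>i. ?l ! i"] exI[of _ m]) simp
qed

definition partition_value :: "(nat \<Rightarrow> real) \<Rightarrow> nat \<Rightarrow> (nat \<Rightarrow> 'b::real_vector) \<Rightarrow> real \<Rightarrow> 'b" where
  "partition_value p n \<xi> u = (\<Sum>l<n. indicator {p l<..p (Suc l)} u *\<^sub>R \<xi> l)"

definition partition_sum :: "(real \<Rightarrow> real^'d) \<Rightarrow> (nat \<Rightarrow> real) \<Rightarrow> nat \<Rightarrow> (nat \<Rightarrow> real^'d^'n) \<Rightarrow> real^'n" where
  "partition_sum W p n \<xi> = (\<Sum>l<n. \<xi> l *v (W (p (Suc l)) - W (p l)))"

text \<open>s lists the points of a common refinement of two partitions. Strictness gives every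
  refined cell positive length, which \<open>ito_step\<close> requires.\<close>

locale refinement =
  fixes s :: "nat \<Rightarrow> real" and m :: nat
  assumes strict: "\<And>i j. i < j \<Longrightarrow> j \<le> m \<Longrightarrow> s i < s j"
begin

lemma less_iff: "i \<le> m \<Longrightarrow> j \<le> m \<Longrightarrow> s i < s j \<longleftrightarrow> i < j"
  using strict[of i j] strict[of j i] by (cases i j rule: linorder_cases) auto

lemma le_iff: "i \<le> m \<Longrightarrow> j \<le> m \<Longrightarrow> s i \<le> s j \<longleftrightarrow> i \<le> j"
  using less_iff[of j i] by auto

lemma indicator_const:
  assumes "x \<in> s ` {..m}" "y \<in> s ` {..m}" "j < m" "u \<in> {s j<..s (Suc j)}"
  shows "indicator {x<..y} u = (indicator {x<..y} (s (Suc j)) :: real)"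
proof -
  obtain a c where a: "a \<le> m" "x = s a" and c: "c \<le> m" "y = s c" using assms by auto
  have "x < u \<longleftrightarrow> x < s (Suc j)"
  proof
    assume "x < s (Suc j)"
    then have "a \<le> j" using a assms(3) less_iff[of a "Suc j"] by auto
    then have "x \<le> s j" using a assms(3) le_iff[of a j] by auto
    then show "x < u" using assms by auto
  qed (use assms in auto)
  moreover have "u \<le> y \<longleftrightarrow> s (Suc j) \<le> y"
  proof
    assume "u \<le> y"
    then have "s j < s c" using assms c by auto
    then have "Suc j \<le> c" using less_iff[of j c] c assms(3) by auto
    then show "s (Suc j) \<le> y" using c assms(3) le_iff[of "Suc j" c] by auto
  qed (use assms in auto)
  ultimately show ?thesis by (auto simp: indicator_def)
qed

lemma partition_value_const:
  assumes "\<And>l. l \<le> n \<Longrightarrow> p l \<in> s ` {..m}" "j < m" "u \<in> {s j<..s (Suc j)}"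
  shows "partition_value p n \<xi> u = partition_value p n \<xi> (s (Suc j))"
  unfolding partition_value_def using assms by (intro sum.cong refl) (subst indicator_const; auto)

text \<open>The increments over the refined cells inside one cell of p telescope to the increment
  over that cell.\<close>

lemma partition_sum_refine:
  assumes p: "\<And>l. l \<le> n \<Longrightarrow> p l \<in> s ` {..m}" and mono: "\<And>l. l < n \<Longrightarrow> p l \<le> p (Suc l)"
  shows "partition_sum W p n \<xi> = (\<Sum>j<m. partition_value p n \<xi> (s (Suc j)) *v (W (s (Suc j)) - W (s j)))"
proof -
  have tel: "(\<Sum>j<m. indicator {p l<..p (Suc l)} (s (Suc j)) *\<^sub>R (W (s (Suc j)) - W (s j))) = W (p (Suc l)) - W (p l)"
    if l: "l < n" for l
  proof -
    obtain a where a: "a \<le> m" "p l = s a" using p[of l] l by auto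
    obtain c where c: "c \<le> m" "p (Suc l) = s c" using p[of "Suc l"] l by auto
    have ac: "a \<le> c" using mono[OF l] a c le_iff by auto
    have "indicator {p l<..p (Suc l)} (s (Suc j)) = (if j \<in> {a..<c} then 1 else 0 :: real)" if "j < m" for j
      using that a c less_iff[of a "Suc j"] le_iff[of "Suc j" c] by (auto simp: indicator_def)
    then have "(\<Sum>j<m. indicator {p l<..p (Suc l)} (s (Suc j)) *\<^sub>R (W (s (Suc j)) - W (s j))) =
      (\<Sum>j<m. if j \<in> {a..<c} then W (s (Suc j)) - W (s j) else 0)" by (intro sum.cong) auto
    also have "\<dots> = (\<Sum>j\<in>{a..<c}. W (s (Suc j)) - W (s j))"
      using c(1) by (subst sum.inter_restrict[symmetric]) (auto intro!: sum.cong)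
    also have "\<dots> = W (s c) - W (s a)" using ac by (rule sum_Suc_diff')
    finally show ?thesis using a c by simp
  qed
  have sv: "(c *\<^sub>R A) *v x = A *v (c *\<^sub>R x)" for c and A :: "real^'d^'n" and x
    by (simp add: scaleR_matrix_vector_assoc matrix_vector_mult_scaleR)
  have sumv: "(\<Sum>l<n. f l) *v x = (\<Sum>l<n. f l *v x)" for f :: "nat \<Rightarrow> real^'d^'n" and x n
    by (induction n) (auto simp: matrix_vector_mult_add_rdistrib)
  have vsum: "A *v (\<Sum>l<n. f l) = (\<Sum>l<n. A *v f l)" for A :: "real^'d^'n" and f :: "nat \<Rightarrow> real^'d" and n
    by (induction n) (auto simp: matrix_vector_right_distrib)
  have "(\<Sum>j<m. partition_value p n \<xi> (s (Suc j)) *v (W (s (Suc j)) - W (s j))) =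
    (\<Sum>l<n. \<Sum>j<m. \<xi> l *v (indicator {p l<..p (Suc l)} (s (Suc j)) *\<^sub>R (W (s (Suc j)) - W (s j))))"
    unfolding partition_value_def by (subst sum.swap) (simp only: sumv sv)
  also have "\<dots> = (\<Sum>l<n. \<xi> l *v (W (p (Suc l)) - W (p l)))"
    using tel by (intro sum.cong refl) (simp add: vsum[symmetric])
  finally show ?thesis by (simp add: partition_sum_def)
qed

end

context driving_noise
begin

text \<open>Isometry by induction: by \<open>ito_step\<close> each new summand is orthogonal to the
  preceding sum. The bound may depend on j, because the stopped integrand in Lenglart's inequality
  is bounded only in terms of the length of its cell.\<close>

lemma adapted_sum_square:
  fixes H :: "nat \<Rightarrow> 'w \<Rightarrow> real^'d^'n"
  assumes s: "0 \<le> s 0" "\<And>i. i < m \<Longrightarrow> s i < s (Suc i)"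
    and H: "\<And>j. j < m \<Longrightarrow> H j \<in> borel_measurable (F (s j))" "\<And>j \<omega>. j < m \<Longrightarrow> \<omega> \<in> space M \<Longrightarrow> norm (H j \<omega>) \<le> B j"
    and k: "k \<le> m"
  shows "(\<lambda>\<omega>. \<Sum>j<k. H j \<omega> *v incr (s j) (s (Suc j)) \<omega>) \<in> borel_measurable (F (s k)) \<and> 0 \<le> s k \<and>
    integrable M (\<lambda>\<omega>. (norm (\<Sum>j<k. H j \<omega> *v incr (s j) (s (Suc j)) \<omega>))\<^sup>2) \<and>
    expectation (\<lambda>\<omega>. (norm (\<Sum>j<k. H j \<omega> *v incr (s j) (s (Suc j)) \<omega>))\<^sup>2) =
      expectation (\<lambda>\<omega>. \<Sum>j<k. (norm (H j \<omega>))\<^sup>2 * (s (Suc j) - s j))"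
  using k
proof (induction k)
  case 0
  then show ?case using s by simp
next
  case (Suc k)
  define Y where "Y \<omega> = (\<Sum>j<k. H j \<omega> *v incr (s j) (s (Suc j)) \<omega>)" for \<omega>
  define X where "X \<omega> = H k \<omega> *v incr (s k) (s (Suc k)) \<omega>" for \<omega>
  have km: "k < m" using Suc.prems by simp
  have sk: "0 \<le> s k" "s k < s (Suc k)" using Suc.IH s(2)[OF km] km by auto
  have Y: "Y \<in> borel_measurable (F (s k))" "integrable M (\<lambda>\<omega>. (norm (Y \<omega>))\<^sup>2)"
    "expectation (\<lambda>\<omega>. (norm (Y \<omega>))\<^sup>2) = expectation (\<lambda>\<omega>. \<Sum>j<k. (norm (H j \<omega>))\<^sup>2 * (s (Suc j) - s j))"
    using Suc.IH km by (auto simp: Y_def[abs_def])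
  note ito = ito_step[OF sk Y(1,2) H(1)[OF km] H(2)[OF km], folded X_def]
  have iH: "integrable M (\<lambda>\<omega>. (norm (H j \<omega>))\<^sup>2 * (s (Suc j) - s j))" if "j < Suc k" for j
  proof (intro integrable_mult_left integrable_const_bound[of _ "(B j)\<^sup>2"])
    have jm: "j < m" using that km by simp
    show "AE \<omega> in M. norm ((norm (H j \<omega>))\<^sup>2) \<le> (B j)\<^sup>2"
      using H(2)[OF jm] by (intro AE_I2) (auto intro: power_mono)
    have "s 0 \<le> s j" using jm
    proof (induction j)
      case (Suc j)
      then show ?case using s(2)[of j] by simp
    qed simp
    then show "(\<lambda>\<omega>. (norm (H j \<omega>))\<^sup>2) \<in> borel_measurable M"
      using measurable_F_M[OF H(1)[OF jm]] s(1) by auto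
  qed
  have sq: "(norm (Y \<omega> + X \<omega>))\<^sup>2 = (norm (Y \<omega>))\<^sup>2 + 2 * (Y \<omega> \<bullet> X \<omega>) + (norm (X \<omega>))\<^sup>2" for \<omega>
    unfolding power2_norm_eq_inner by (simp add: inner_add_left inner_add_right inner_commute)
  have "(\<lambda>\<omega>. Y \<omega> + X \<omega>) \<in> borel_measurable (F (s (Suc k)))"
    unfolding X_def using measurable_F_mono[OF Y(1)] measurable_F_mono[OF H(1)[OF km]] sk
    by (intro borel_measurable_add borel_measurable_matrix_vector_mult incr_measurable_F) auto
  moreover have "integrable M (\<lambda>\<omega>. (norm (Y \<omega> + X \<omega>))\<^sup>2)"
    unfolding sq using Y(2) ito by auto
  moreover have "expectation (\<lambda>\<omega>. (norm (Y \<omega> + X \<omega>))\<^sup>2) = expectation (\<lambda>\<omega>. \<Sum>j<Suc k. (norm (H j \<omega>))\<^sup>2 * (s (Suc j) - s j))"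
  proof -
    have "expectation (\<lambda>\<omega>. (norm (Y \<omega> + X \<omega>))\<^sup>2) = expectation (\<lambda>\<omega>. \<Sum>j<k. (norm (H j \<omega>))\<^sup>2 * (s (Suc j) - s j))
      + (s (Suc k) - s k) * expectation (\<lambda>\<omega>. (norm (H k \<omega>))\<^sup>2)"
      unfolding sq using Y ito by simp
    also have "\<dots> = expectation (\<lambda>\<omega>. (\<Sum>j<k. (norm (H j \<omega>))\<^sup>2 * (s (Suc j) - s j)) + (norm (H k \<omega>))\<^sup>2 * (s (Suc k) - s k))"
      using iH by (subst Bochner_Integration.integral_add) auto
    finally show ?thesis by simp
  qed
  ultimately show ?case using sk by (simp add: Y_def[abs_def] X_def[abs_def])
qed

text \<open>Lenglart's inequality for elementary integrands: stop the integrand before its running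
  quadratic variation exceeds \<open>\<delta>\<close>.\<close>

lemma lenglart:
  fixes H :: "nat \<Rightarrow> 'w \<Rightarrow> real^'d^'n"
  assumes s: "0 \<le> s 0" "\<And>i. i < m \<Longrightarrow> s i < s (Suc i)"
    and H: "\<And>j. j < m \<Longrightarrow> H j \<in> borel_measurable (F (s j))" and \<epsilon>: "0 < \<epsilon>" and \<delta>: "0 < \<delta>"
  shows "prob {\<omega>\<in>space M. \<epsilon> < norm (\<Sum>j<m. H j \<omega> *v incr (s j) (s (Suc j)) \<omega>)}
    \<le> prob {\<omega>\<in>space M. \<delta> < (\<Sum>j<m. (norm (H j \<omega>))\<^sup>2 * (s (Suc j) - s j))} + \<delta> / \<epsilon>\<^sup>2"
proof -
  define q where "q k \<omega> = (\<Sum>j<k. (norm (H j \<omega>))\<^sup>2 * (s (Suc j) - s j))" for k \<omega>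
  \<comment> \<open>\<open>q (Suc j)\<close> includes cell j and is nevertheless known at its left
    end, since \<open>H j\<close> is. Switching off before the bound is exceeded keeps the quadratic
    variation of \<open>H'\<close> below \<delta> without an overshoot.\<close>
  define H' where "H' j \<omega> = (if q (Suc j) \<omega> \<le> \<delta> then H j \<omega> else 0)" for j \<omega>
  have sm: "s i \<le> s j" if "i \<le> j" "j \<le> m" for i j
    using that
  proof (induction j)
    case (Suc j)
    then show ?case using s(2)[of j] by (cases "i = Suc j") auto
  qed simp
  have s0: "0 \<le> s j" if "j \<le> m" for j using sm[of 0 j] s(1) that by auto
  have qF: "q (Suc j) \<in> borel_measurable (F (s j))" if "j < m" for j
    unfolding q_def[abs_def]
  proof (rule borel_measurable_sum)
    fix i assume "i \<in> {..<Suc j}"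
    then have "H i \<in> borel_measurable (F (s j))"
      using measurable_F_mono[OF H[of i] sm[of i j]] that by auto
    then show "(\<lambda>\<omega>. (norm (H i \<omega>))\<^sup>2 * (s (Suc i) - s i)) \<in> borel_measurable (F (s j))" by measurable
  qed
  have q_nonneg: "0 \<le> (norm (H j \<omega>))\<^sup>2 * (s (Suc j) - s j)" if "j < m" for j \<omega>
    using s(2)[OF that] by simp
  have q_mono: "q i \<omega> \<le> q k \<omega>" if "i \<le> k" "k \<le> m" for i k \<omega>
    unfolding q_def using that q_nonneg by (intro sum_mono2) auto
  have H'F: "H' j \<in> borel_measurable (F (s j))" if "j < m" for j
    unfolding H'_def[abs_def] using qF[OF that] H[OF that] by measurable
  have H'B: "norm (H' j \<omega>) \<le> sqrt (\<delta> / (s (Suc j) - s j))" if "j < m" for j \<omega>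
  proof (cases "q (Suc j) \<omega> \<le> \<delta>")
    case True
    have "0 \<le> q j \<omega>" unfolding q_def using q_nonneg that by (intro sum_nonneg) auto
    then have "(norm (H j \<omega>))\<^sup>2 * (s (Suc j) - s j) \<le> \<delta>" using True by (simp add: q_def)
    then have "(norm (H j \<omega>))\<^sup>2 \<le> \<delta> / (s (Suc j) - s j)" using s(2)[OF that] by (simp add: field_simps)
    then show ?thesis using True by (simp add: H'_def real_le_rsqrt)
  next
    case False
    then show ?thesis using \<delta> s(2)[OF that] by (simp add: H'_def)
  qed
  define Y where "Y \<omega> = (\<Sum>j<m. H' j \<omega> *v incr (s j) (s (Suc j)) \<omega>)" for \<omega>
  note A = adapted_sum_square[OF s H'F H'B order_refl, folded Y_def]
  have qle: "(\<Sum>j<k. (norm (H' j \<omega>))\<^sup>2 * (s (Suc j) - s j)) \<le> \<delta>" if "k \<le> m" for k \<omega>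
    using that
  proof (induction k)
    case (Suc k)
    show ?case
    proof (cases "q (Suc k) \<omega> \<le> \<delta>")
      case True
      have "(\<Sum>j<Suc k. (norm (H' j \<omega>))\<^sup>2 * (s (Suc j) - s j)) \<le> q (Suc k) \<omega>"
        unfolding q_def using Suc.prems s(2) by (intro sum_mono) (auto simp: H'_def intro!: mult_right_mono)
      then show ?thesis using True by simp
    next
      case False
      then show ?thesis using Suc by (simp add: H'_def)
    qed
  qed (use \<delta> in simp)
  have YM: "Y \<in> borel_measurable M" using A measurable_F_M s0 by (auto simp: Y_def[abs_def])
  have iY: "integrable M (\<lambda>\<omega>. (norm (Y \<omega>))\<^sup>2)" using A by (simp add: Y_def)
  have "expectation (\<lambda>\<omega>. (norm (Y \<omega>))\<^sup>2) = expectation (\<lambda>\<omega>. \<Sum>j<m. (norm (H' j \<omega>))\<^sup>2 * (s (Suc j) - s j))"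
    using A by (simp add: Y_def)
  also have "\<dots> \<le> \<delta>"
  proof -
    have nn: "0 \<le> (\<Sum>j<m. (norm (H' j \<omega>))\<^sup>2 * (s (Suc j) - s j))" for \<omega>
      using s(2) by (intro sum_nonneg) (auto simp: less_imp_le)
    have m: "(\<lambda>\<omega>. \<Sum>j<m. (norm (H' j \<omega>))\<^sup>2 * (s (Suc j) - s j)) \<in> borel_measurable M"
      using measurable_F_M[OF H'F] s0 by (intro borel_measurable_sum borel_measurable_times) (auto simp: less_imp_le)
    have "integrable M (\<lambda>\<omega>. \<Sum>j<m. (norm (H' j \<omega>))\<^sup>2 * (s (Suc j) - s j))"
      using qle[OF order_refl] nn m by (intro integrable_const_bound[of _ \<delta>]) auto
    then have "expectation (\<lambda>\<omega>. \<Sum>j<m. (norm (H' j \<omega>))\<^sup>2 * (s (Suc j) - s j)) \<le> expectation (\<lambda>\<omega>. \<delta>)"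
      using qle[OF order_refl] by (intro integral_mono) auto
    then show ?thesis by (simp add: prob_space)
  qed
  finally have EY: "expectation (\<lambda>\<omega>. (norm (Y \<omega>))\<^sup>2) \<le> \<delta>" .
  have PY: "prob {\<omega>\<in>space M. \<epsilon> < norm (Y \<omega>)} \<le> \<delta> / \<epsilon>\<^sup>2"
  proof -
    have "prob {\<omega>\<in>space M. \<epsilon> < norm (Y \<omega>)} \<le> prob {\<omega>\<in>space M. \<epsilon>\<^sup>2 \<le> (norm (Y \<omega>))\<^sup>2}"
      using \<epsilon> YM by (intro finite_measure_mono) (auto intro: power_mono)
    also have "\<dots> \<le> expectation (\<lambda>\<omega>. (norm (Y \<omega>))\<^sup>2) / \<epsilon>\<^sup>2"
      using iY \<epsilon> by (intro integral_Markov_inequality_measure[where A = "{}"]) auto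
    also have "\<dots> \<le> \<delta> / \<epsilon>\<^sup>2" using EY by (intro divide_right_mono) auto
    finally show ?thesis .
  qed
  have qM: "q m \<in> borel_measurable M"
    unfolding q_def[abs_def] using measurable_F_M[OF H] s0 by (intro borel_measurable_sum borel_measurable_times) (auto simp: less_imp_le)
  have "prob {\<omega>\<in>space M. \<epsilon> < norm (\<Sum>j<m. H j \<omega> *v incr (s j) (s (Suc j)) \<omega>)}
    \<le> prob ({\<omega>\<in>space M. \<delta> < q m \<omega>} \<union> {\<omega>\<in>space M. \<epsilon> < norm (Y \<omega>)})"
  proof (rule finite_measure_mono)
    show "{\<omega>\<in>space M. \<epsilon> < norm (\<Sum>j<m. H j \<omega> *v incr (s j) (s (Suc j)) \<omega>)} \<subseteq> {\<omega>\<in>space M. \<delta> < q m \<omega>} \<union> {\<omega>\<in>space M. \<epsilon> < norm (Y \<omega>)}"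
    proof clarsimp
      fix \<omega> assume \<omega>: "\<omega> \<in> space M" "\<epsilon> < norm (\<Sum>j<m. H j \<omega> *v incr (s j) (s (Suc j)) \<omega>)" "\<not> \<epsilon> < norm (Y \<omega>)"
      show "\<delta> < q m \<omega>"
      proof (rule ccontr)
        assume "\<not> \<delta> < q m \<omega>"
        then have "H' j \<omega> = H j \<omega>" if "j < m" for j
          using q_mono[of "Suc j" m \<omega>] that by (auto simp: H'_def)
        then have "Y \<omega> = (\<Sum>j<m. H j \<omega> *v incr (s j) (s (Suc j)) \<omega>)" unfolding Y_def by simp
        then show False using \<omega> by simp
      qed
    qed
  qed (use qM YM in measurable)
  also have "\<dots> \<le> prob {\<omega>\<in>space M. \<delta> < q m \<omega>} + prob {\<omega>\<in>space M. \<epsilon> < norm (Y \<omega>)}"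
    by (intro measure_Un_le; use qM YM in measurable)
  finally show ?thesis using PY unfolding q_def by simp
qed

text \<open>The value on a refined cell is \<xi> of the coarse cell containing it, whose left end is
  at most \<open>s j\<close>. Measurability is demanded for nonempty cells only: truncating a
  partition at a final time collapses the later cells, whose coefficients are not known at that
  time.\<close>

lemma partition_value_F:
  fixes \<xi> :: "nat \<Rightarrow> 'w \<Rightarrow> real^'d^'n"
  assumes ref: "refinement s m" and p: "\<And>l. l \<le> n \<Longrightarrow> p l \<in> s ` {..m}" and j: "j < m"
    and \<xi>: "\<And>l. l < n \<Longrightarrow> p l < p (Suc l) \<Longrightarrow> \<xi> l \<in> borel_measurable (F (p l))"
  shows "(\<lambda>\<omega>. partition_value p n (\<lambda>l. \<xi> l \<omega>) (s (Suc j))) \<in> borel_measurable (F (s j))"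
  unfolding partition_value_def
proof (rule borel_measurable_sum)
  interpret refinement s m by (rule ref)
  fix l assume l: "l \<in> {..<n}"
  show "(\<lambda>\<omega>. indicator {p l<..p (Suc l)} (s (Suc j)) *\<^sub>R \<xi> l \<omega>) \<in> borel_measurable (F (s j))"
  proof (cases "s (Suc j) \<in> {p l<..p (Suc l)}")
    case True
    obtain a where a: "a \<le> m" "p l = s a" using p[of l] l by auto
    have "a \<le> j" using True a j less_iff[of a "Suc j"] by auto
    then have "p l \<le> s j" using a j le_iff[of a j] by auto
    then show ?thesis using True measurable_F_mono[OF \<xi>[of l]] l by auto
  qed simp
qed

text \<open>The stochastic integral is given as the limit along some sequence of elementary
  integrands. Each of them is put on a common refinement with the grid; the difference of the two
  sums is the integral of an adapted step function with energy at most \<open>2 * Q\<close> plus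
  twice the approximation error. Lenglart's inequality applies, and the index of the sequence then
  tends to infinity.\<close>

lemma ito_compare:
  fixes H :: "real \<Rightarrow> 'w \<Rightarrow> real^'d^'n" and B :: "nat \<Rightarrow> 'w \<Rightarrow> real^'d^'n"
  assumes ito: "has_ito_integral M F w H t J" and h: "0 < h" and t: "t = real k * h"
    and B: "\<And>j. j < k \<Longrightarrow> B j \<in> borel_measurable (F (real j * h))"
    and Hm: "\<And>\<omega>. \<omega> \<in> space M \<Longrightarrow> (\<lambda>u. indicator {0..t} u *\<^sub>R H u \<omega>) \<in> borel_measurable borel"
    and \<epsilon>: "0 < \<epsilon>" and \<delta>: "0 < \<delta>"
  defines "Q \<equiv> \<lambda>\<omega>. \<integral>\<^sup>+u\<in>{0..t}. ennreal ((norm (partition_value (\<lambda>l. real l * h) k (\<lambda>l. B l \<omega>) u - H u \<omega>))\<^sup>2) \<partial>lborel"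
  assumes Q: "Q \<in> borel_measurable M"
  shows "prob {\<omega>\<in>space M. 2 * \<epsilon> < norm ((\<Sum>j<k. B j \<omega> *v incr (real j * h) (real j * h + h) \<omega>) - J \<omega>)}
    \<le> prob {\<omega>\<in>space M. ennreal \<delta> < Q \<omega>} + 4 * \<delta> / \<epsilon>\<^sup>2"
proof -
  let ?g = "\<lambda>l. real l * h"
  have J: "J \<in> borel_measurable M" using ito by (simp add: has_ito_integral_def)
  obtain n \<tau> \<xi> where el: "\<And>p. elementary_integrand M F (n p) (\<tau> p) (\<xi> p)"
    and c1: "tendsto_zero_in_prob M (\<lambda>p \<omega>.
          \<integral>\<^sup>+s\<in>{0..t}. ennreal ((norm (elementary_value (n p) (\<tau> p) (\<xi> p) s \<omega> - H s \<omega>))\<^sup>2) \<partial>lborel)"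
    and c2: "tendsto_zero_in_prob M (\<lambda>p \<omega>.
          ennreal (norm (elementary_integral w (n p) (\<tau> p) (\<xi> p) t \<omega> - J \<omega>)))"
    using ito unfolding has_ito_integral_def by blast
  define D where "D p \<omega> = (\<integral>\<^sup>+s\<in>{0..t}. ennreal ((norm (elementary_value (n p) (\<tau> p) (\<xi> p) s \<omega> - H s \<omega>))\<^sup>2) \<partial>lborel)" for p \<omega>
  define E where "E p \<omega> = ennreal (norm (elementary_integral w (n p) (\<tau> p) (\<xi> p) t \<omega> - J \<omega>))" for p \<omega>
  define U where "U \<omega> = (\<Sum>j<k. B j \<omega> *v incr (?g j) (?g j + h) \<omega>)" for \<omega>
  have DM: "D p \<in> borel_measurable M" and EM: "E p \<in> borel_measurable M" for p
    using c1 c2 by (auto simp: tendsto_zero_in_prob_def D_def[abs_def] E_def[abs_def])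
  have UM: "U \<in> borel_measurable M"
    unfolding U_def[abs_def] using measurable_F_M[OF B] h
    by (intro borel_measurable_sum borel_measurable_matrix_vector_mult incr_measurable) auto
  have t0: "0 \<le> t" using t h by simp
  have step: "prob {\<omega>\<in>space M. 2 * \<epsilon> < norm (U \<omega> - J \<omega>)} \<le>
     prob {\<omega>\<in>space M. ennreal \<delta> < Q \<omega>} + prob {\<omega>\<in>space M. ennreal \<delta> < D p \<omega>} + 4 * \<delta> / \<epsilon>\<^sup>2 + prob {\<omega>\<in>space M. ennreal \<epsilon> < E p \<omega>}" for p
  proof -
    \<comment> \<open>The elementary partition stopped at t: its sum is the elementary integral up
      to time t, and its cells beyond t are empty.\<close>
    define r where "r l = min (\<tau> p l) t" for l
    have \<tau>: "0 \<le> \<tau> p 0" "\<And>l. l < n p \<Longrightarrow> \<tau> p l \<le> \<tau> p (Suc l)" "\<And>l. l < n p \<Longrightarrow> \<xi> p l \<in> borel_measurable (F (\<tau> p l))"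
      using el[of p] by (auto simp: elementary_integrand_def)
    have \<tau>0: "0 \<le> \<tau> p l" if "l \<le> n p" for l
      using that by (induction l) (use \<tau> in \<open>auto intro: order_trans\<close>)
    define T where "T = ?g ` {..k} \<union> r ` {..n p}"
    have "finite T" "T \<noteq> {}" by (auto simp: T_def)
    then have "\<exists>(s :: nat \<Rightarrow> real) m. (\<forall>i j. i < j \<longrightarrow> j \<le> m \<longrightarrow> s i < s j) \<and> T = s ` {..m}"
      by (rule finite_set_strict_enumeration)
    then obtain s :: "nat \<Rightarrow> real" where "\<exists>m. (\<forall>i j. i < j \<longrightarrow> j \<le> m \<longrightarrow> s i < s j) \<and> T = s ` {..m}" ..
    then obtain m where sm: "(\<forall>i j. i < j \<longrightarrow> j \<le> m \<longrightarrow> s i < s j) \<and> T = s ` {..m}" ..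
    then have strict: "\<And>i j. i < j \<Longrightarrow> j \<le> m \<Longrightarrow> s i < s j" and Ts: "T = s ` {..m}" by simp_all
    interpret refinement s m using strict by unfold_locales
    have gT: "?g l \<in> s ` {..m}" if "l \<le> k" for l unfolding Ts[symmetric] T_def using that by auto
    have rT: "r l \<in> s ` {..m}" if "l \<le> n p" for l unfolding Ts[symmetric] T_def using that by auto
    have gt: "?g l \<le> t" if "l \<le> k" for l unfolding t using that h by (intro mult_right_mono) auto
    have T_range: "u \<in> {0..t}" if "u \<in> T" for u
      using that gt \<tau>0 t0 h by (auto simp: T_def r_def)
    have s_range: "s j \<in> {0..t}" if "j \<le> m" for j using T_range that Ts by auto
    have gmono: "?g l \<le> ?g (Suc l)" for l using h by (simp add: mult_right_mono)
    have rmono: "r l \<le> r (Suc l)" if "l < n p" for l using \<tau>(2)[OF that] by (auto simp: r_def min_def)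
    \<comment> \<open>Cells are left-open, so the value of a step function on a refined cell can be
      read off at the right end point.\<close>
    define V where "V j \<omega> = partition_value ?g k (\<lambda>l. B l \<omega>) (s (Suc j)) - partition_value r (n p) (\<lambda>l. \<xi> p l \<omega>) (s (Suc j))" for j \<omega>
    have VF: "V j \<in> borel_measurable (F (s j))" if "j < m" for j
      unfolding V_def[abs_def]
    proof (intro borel_measurable_diff partition_value_F[OF refinement_axioms _ that] gT rT)
      fix l assume "l < n p" "r l < r (Suc l)"
      then show "\<xi> p l \<in> borel_measurable (F (r l))" using \<tau>(3)[of l] by (auto simp: r_def min_def split: if_splits)
    qed (use B in auto)
    have Ueq: "U \<omega> = partition_sum (\<lambda>u. w u \<omega>) ?g k (\<lambda>l. B l \<omega>)" for \<omega>
      by (simp add: U_def partition_sum_def incr_def algebra_simps)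
    have Eeq: "elementary_integral w (n p) (\<tau> p) (\<xi> p) t \<omega> = partition_sum (\<lambda>u. w u \<omega>) r (n p) (\<lambda>l. \<xi> p l \<omega>)" for \<omega>
      by (simp add: elementary_integral_def partition_sum_def r_def)
    have Ur: "partition_sum (\<lambda>u. w u \<omega>) ?g k (\<lambda>l. B l \<omega>) =
        (\<Sum>j<m. partition_value ?g k (\<lambda>l. B l \<omega>) (s (Suc j)) *v (w (s (Suc j)) \<omega> - w (s j) \<omega>))" for \<omega>
      by (rule partition_sum_refine) (use gT gmono in auto)
    have Er: "partition_sum (\<lambda>u. w u \<omega>) r (n p) (\<lambda>l. \<xi> p l \<omega>) =
        (\<Sum>j<m. partition_value r (n p) (\<lambda>l. \<xi> p l \<omega>) (s (Suc j)) *v (w (s (Suc j)) \<omega> - w (s j) \<omega>))" for \<omega>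
      by (rule partition_sum_refine) (use rT rmono in auto)
    have diff: "U \<omega> - elementary_integral w (n p) (\<tau> p) (\<xi> p) t \<omega> = (\<Sum>j<m. V j \<omega> *v incr (s j) (s (Suc j)) \<omega>)" for \<omega>
      unfolding Ueq Eeq Ur Er V_def incr_def
      by (simp add: sum_subtractf matrix_vector_mult_diff_rdistrib)
    have ev: "elementary_value (n p) (\<tau> p) (\<xi> p) u \<omega> = partition_value r (n p) (\<lambda>l. \<xi> p l \<omega>) u" if "u \<in> {0..t}" for u \<omega>
      unfolding elementary_value_def partition_value_def using that
      by (intro sum.cong refl) (auto simp: r_def indicator_def)
    \<comment> \<open>On each refined cell \<open>V\<close> is the difference of the two step
      functions; both are compared with H through |a - c|^2 \<le> 2 |a - H|^2 + 2 |c - H|^2.\<close>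
    have energy: "ennreal (\<Sum>j<m. (norm (V j \<omega>))\<^sup>2 * (s (Suc j) - s j)) \<le> 2 * Q \<omega> + 2 * D p \<omega>" if \<omega>: "\<omega> \<in> space M" for \<omega>
    proof -
      let ?b = "\<lambda>u. partition_value ?g k (\<lambda>l. B l \<omega>) u" and ?e = "\<lambda>u. elementary_value (n p) (\<tau> p) (\<xi> p) u \<omega>"
      have [measurable]: "?b \<in> borel_measurable borel" "?e \<in> borel_measurable borel"
        unfolding partition_value_def elementary_value_def by measurable
      have Hm' [measurable]: "(\<lambda>u. indicator {0..t} u *\<^sub>R H u \<omega>) \<in> borel_measurable borel" using Hm[OF \<omega>] .
      have "ennreal (\<Sum>j<m. (norm (V j \<omega>))\<^sup>2 * (s (Suc j) - s j)) = (\<Sum>j<m. ennreal ((norm (V j \<omega>))\<^sup>2) * emeasure lborel {s j<..s (Suc j)})"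
        using strict by (subst sum_ennreal[symmetric]) (auto intro!: sum.cong mult_nonneg_nonneg simp: ennreal_mult less_imp_le)
      also have "\<dots> = (\<integral>\<^sup>+u. (\<Sum>j<m. ennreal ((norm (V j \<omega>))\<^sup>2) * indicator {s j<..s (Suc j)} u) \<partial>lborel)"
        by (subst nn_integral_sum) (auto simp: nn_integral_cmult_indicator)
      also have "\<dots> \<le> (\<integral>\<^sup>+u. 2 * ennreal ((norm (indicator {0..t} u *\<^sub>R ?b u - indicator {0..t} u *\<^sub>R H u \<omega>))\<^sup>2)
            + 2 * ennreal ((norm (indicator {0..t} u *\<^sub>R ?e u - indicator {0..t} u *\<^sub>R H u \<omega>))\<^sup>2) \<partial>lborel)"
      proof (rule nn_integral_mono)
        fix u :: real
        show "(\<Sum>j<m. ennreal ((norm (V j \<omega>))\<^sup>2) * indicator {s j<..s (Suc j)} u) \<le>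
          2 * ennreal ((norm (indicator {0..t} u *\<^sub>R ?b u - indicator {0..t} u *\<^sub>R H u \<omega>))\<^sup>2)
            + 2 * ennreal ((norm (indicator {0..t} u *\<^sub>R ?e u - indicator {0..t} u *\<^sub>R H u \<omega>))\<^sup>2)"
        proof (cases "\<exists>j<m. u \<in> {s j<..s (Suc j)}")
          case True
          then obtain j where j: "j < m" "u \<in> {s j<..s (Suc j)}" by auto
          have uniq: "i = j" if "i < m" "u \<in> {s i<..s (Suc i)}" for i
          proof (rule ccontr)
            assume "i \<noteq> j"
            then consider "Suc i \<le> j" | "Suc j \<le> i" by linarith
            then show False
            proof cases
              case 1 then show False using le_iff[of "Suc i" j] j that by auto
            next
              case 2 then show False using le_iff[of "Suc j" i] j that by auto
            qed
          qed
          have ind: "indicator {s i<..s (Suc i)} u = (if i = j then 1 else 0 :: ennreal)" if "i < m" for i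
          proof (cases "i = j")
            case True
            then show ?thesis using j(2) by simp
          next
            case False
            then have "u \<notin> {s i<..s (Suc i)}" using uniq that by blast
            then show ?thesis using False by simp
          qed
          have "(\<Sum>i<m. ennreal ((norm (V i \<omega>))\<^sup>2) * indicator {s i<..s (Suc i)} u) = (\<Sum>i<m. if i = j then ennreal ((norm (V i \<omega>))\<^sup>2) else 0)"
            by (intro sum.cong refl) (simp add: ind)
          also have "\<dots> = ennreal ((norm (V j \<omega>))\<^sup>2)" using j(1) by simp
          finally have sum_eq: "(\<Sum>i<m. ennreal ((norm (V i \<omega>))\<^sup>2) * indicator {s i<..s (Suc i)} u) = ennreal ((norm (V j \<omega>))\<^sup>2)" .
          have ut: "u \<in> {0..t}" using j s_range[of j] s_range[of "Suc j"] by auto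
          have "V j \<omega> = ?b u - ?e u"
            unfolding V_def ev[OF ut] by (simp only: partition_value_const[where p = ?g and n = k, OF gT j] partition_value_const[where p = r and n = "n p", OF rT j])
          then have V: "V j \<omega> = ?b u - ?e u" .
          have "(norm (V j \<omega>))\<^sup>2 \<le> 2 * (norm (?b u - H u \<omega>))\<^sup>2 + 2 * (norm (?e u - H u \<omega>))\<^sup>2"
          proof -
            have "norm (V j \<omega>) \<le> norm (?b u - H u \<omega>) + norm (?e u - H u \<omega>)"
              unfolding V using norm_triangle_ineq4[of "?b u - H u \<omega>" "?e u - H u \<omega>"] by simp
            then have "(norm (V j \<omega>))\<^sup>2 \<le> (norm (?b u - H u \<omega>) + norm (?e u - H u \<omega>))\<^sup>2" by (intro power_mono) auto
            also have "\<dots> \<le> 2 * (norm (?b u - H u \<omega>))\<^sup>2 + 2 * (norm (?e u - H u \<omega>))\<^sup>2"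
              using square_add_le[of 1 "norm (?b u - H u \<omega>)" "norm (?e u - H u \<omega>)"] by simp
            finally show ?thesis .
          qed
          then have "ennreal ((norm (V j \<omega>))\<^sup>2) \<le> ennreal (2 * (norm (?b u - H u \<omega>))\<^sup>2 + 2 * (norm (?e u - H u \<omega>))\<^sup>2)" by (rule ennreal_leI)
          also have "\<dots> = 2 * ennreal ((norm (?b u - H u \<omega>))\<^sup>2) + 2 * ennreal ((norm (?e u - H u \<omega>))\<^sup>2)"
            by (simp add: ennreal_mult)
          finally show ?thesis unfolding sum_eq using ut by simp
        next
          case False
          then have "(\<Sum>j<m. ennreal ((norm (V j \<omega>))\<^sup>2) * indicator {s j<..s (Suc j)} u) = 0"
            by (intro sum.neutral) auto
          then show ?thesis by simp
        qed
      qed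
      also have "\<dots> = 2 * (\<integral>\<^sup>+u. ennreal ((norm (indicator {0..t} u *\<^sub>R ?b u - indicator {0..t} u *\<^sub>R H u \<omega>))\<^sup>2) \<partial>lborel)
            + 2 * (\<integral>\<^sup>+u. ennreal ((norm (indicator {0..t} u *\<^sub>R ?e u - indicator {0..t} u *\<^sub>R H u \<omega>))\<^sup>2) \<partial>lborel)"
        by (subst nn_integral_add) (auto simp: nn_integral_cmult)
      also have "\<dots> = 2 * Q \<omega> + 2 * D p \<omega>"
        unfolding Q_def D_def
        by (intro arg_cong2[where f = "(+)"] arg_cong2[where f = "(*)"] refl nn_integral_cong) (auto split: split_indicator)
      finally show ?thesis .
    qed
    have sub: "{\<omega>\<in>space M. 2 * \<epsilon> < norm (U \<omega> - J \<omega>)} \<subseteq>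
       {\<omega>\<in>space M. \<epsilon> < norm (\<Sum>j<m. V j \<omega> *v incr (s j) (s (Suc j)) \<omega>)} \<union> {\<omega>\<in>space M. ennreal \<epsilon> < E p \<omega>}"
    proof clarsimp
      fix \<omega> assume \<omega>: "2 * \<epsilon> < norm (U \<omega> - J \<omega>)" "\<not> ennreal \<epsilon> < E p \<omega>"
      have "norm (elementary_integral w (n p) (\<tau> p) (\<xi> p) t \<omega> - J \<omega>) \<le> \<epsilon>"
        using \<omega>(2) \<epsilon> unfolding E_def by (simp add: not_less)
      then show "\<epsilon> < norm (\<Sum>j<m. V j \<omega> *v incr (s j) (s (Suc j)) \<omega>)"
        unfolding diff[symmetric] using \<omega>(1)
          norm_triangle_ineq[of "U \<omega> - elementary_integral w (n p) (\<tau> p) (\<xi> p) t \<omega>" "elementary_integral w (n p) (\<tau> p) (\<xi> p) t \<omega> - J \<omega>"]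
        by simp
    qed
    have s0: "0 \<le> s 0" using s_range[of 0] by auto
    have sM: "(\<lambda>\<omega>. \<Sum>j<m. V j \<omega> *v incr (s j) (s (Suc j)) \<omega>) \<in> borel_measurable M"
      using measurable_F_M[OF VF] s_range by (intro borel_measurable_sum borel_measurable_matrix_vector_mult incr_measurable) auto
    have qM: "(\<lambda>\<omega>. \<Sum>j<m. (norm (V j \<omega>))\<^sup>2 * (s (Suc j) - s j)) \<in> borel_measurable M"
      using measurable_F_M[OF VF] s_range by (intro borel_measurable_sum borel_measurable_times) auto
    have S1: "{\<omega>\<in>space M. \<epsilon> < norm (\<Sum>j<m. V j \<omega> *v incr (s j) (s (Suc j)) \<omega>)} \<in> events"
      by (rule borel_measurable_less[OF borel_measurable_const measurable_compose[OF sM borel_measurable_norm]])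
    have S2: "{\<omega>\<in>space M. ennreal \<epsilon> < E p \<omega>} \<in> events" "{\<omega>\<in>space M. ennreal \<delta> < D p \<omega>} \<in> events"
      "{\<omega>\<in>space M. ennreal \<delta> < Q \<omega>} \<in> events"
      by (intro borel_measurable_less borel_measurable_const EM DM Q)+
    have "prob {\<omega>\<in>space M. 2 * \<epsilon> < norm (U \<omega> - J \<omega>)} \<le>
      prob ({\<omega>\<in>space M. \<epsilon> < norm (\<Sum>j<m. V j \<omega> *v incr (s j) (s (Suc j)) \<omega>)} \<union> {\<omega>\<in>space M. ennreal \<epsilon> < E p \<omega>})"
      by (intro finite_measure_mono sub sets.Un S1 S2)
    also have "\<dots> \<le> prob {\<omega>\<in>space M. \<epsilon> < norm (\<Sum>j<m. V j \<omega> *v incr (s j) (s (Suc j)) \<omega>)} + prob {\<omega>\<in>space M. ennreal \<epsilon> < E p \<omega>}"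
      by (intro measure_Un_le S1 S2)
    also have "prob {\<omega>\<in>space M. \<epsilon> < norm (\<Sum>j<m. V j \<omega> *v incr (s j) (s (Suc j)) \<omega>)}
      \<le> prob {\<omega>\<in>space M. 4 * \<delta> < (\<Sum>j<m. (norm (V j \<omega>))\<^sup>2 * (s (Suc j) - s j))} + 4 * \<delta> / \<epsilon>\<^sup>2"
      using strict \<epsilon> \<delta> by (intro lenglart s0 VF) auto
    \<comment> \<open>If both errors are at most \<delta>, the energy is at most 2 \<delta> + 2
      \<delta>; this is the origin of the 4.\<close>
    also have "prob {\<omega>\<in>space M. 4 * \<delta> < (\<Sum>j<m. (norm (V j \<omega>))\<^sup>2 * (s (Suc j) - s j))}
      \<le> prob ({\<omega>\<in>space M. ennreal \<delta> < Q \<omega>} \<union> {\<omega>\<in>space M. ennreal \<delta> < D p \<omega>})"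
    proof (rule finite_measure_mono)
      show "{\<omega>\<in>space M. 4 * \<delta> < (\<Sum>j<m. (norm (V j \<omega>))\<^sup>2 * (s (Suc j) - s j))} \<subseteq> {\<omega>\<in>space M. ennreal \<delta> < Q \<omega>} \<union> {\<omega>\<in>space M. ennreal \<delta> < D p \<omega>}"
      proof clarsimp
        fix \<omega> assume \<omega>: "\<omega> \<in> space M" "4 * \<delta> < (\<Sum>j<m. (norm (V j \<omega>))\<^sup>2 * (s (Suc j) - s j))" "\<not> ennreal \<delta> < D p \<omega>"
        show "ennreal \<delta> < Q \<omega>"
        proof (rule ccontr)
          assume "\<not> ennreal \<delta> < Q \<omega>"
          then have "2 * Q \<omega> + 2 * D p \<omega> \<le> 2 * ennreal \<delta> + 2 * ennreal \<delta>"
            using \<omega>(3) by (intro add_mono mult_left_mono) auto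
          also have "\<dots> = ennreal (2 * \<delta> + 2 * \<delta>)"
          proof -
            have e2: "2 * ennreal \<delta> = ennreal (2 * \<delta>)" using \<delta> ennreal_mult[of 2 \<delta>] by simp
            show ?thesis unfolding e2 using \<delta> by (intro ennreal_plus[symmetric]) auto
          qed
          finally have "ennreal (\<Sum>j<m. (norm (V j \<omega>))\<^sup>2 * (s (Suc j) - s j)) \<le> ennreal (2 * \<delta> + 2 * \<delta>)"
            using energy[OF \<omega>(1)] by (rule order_trans[rotated])
          then have "(\<Sum>j<m. (norm (V j \<omega>))\<^sup>2 * (s (Suc j) - s j)) \<le> 2 * \<delta> + 2 * \<delta>"
            using \<delta> by (subst (asm) ennreal_le_iff) auto
          then show False using \<omega>(2) by simp
        qed
      qed
    qed (intro sets.Un S2)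
    also have "\<dots> \<le> prob {\<omega>\<in>space M. ennreal \<delta> < Q \<omega>} + prob {\<omega>\<in>space M. ennreal \<delta> < D p \<omega>}"
      by (intro measure_Un_le S2)
    finally show ?thesis by simp
  qed
  have "prob {\<omega>\<in>space M. 2 * \<epsilon> < norm (U \<omega> - J \<omega>)} \<le> prob {\<omega>\<in>space M. ennreal \<delta> < Q \<omega>} + 0 + 4 * \<delta> / \<epsilon>\<^sup>2 + 0"
  proof (rule tendsto_lowerbound)
    show "((\<lambda>p. prob {\<omega>\<in>space M. ennreal \<delta> < Q \<omega>} + prob {\<omega>\<in>space M. ennreal \<delta> < D p \<omega>} + 4 * \<delta> / \<epsilon>\<^sup>2 + prob {\<omega>\<in>space M. ennreal \<epsilon> < E p \<omega>})
      \<longlongrightarrow> prob {\<omega>\<in>space M. ennreal \<delta> < Q \<omega>} + 0 + 4 * \<delta> / \<epsilon>\<^sup>2 + 0) sequentially"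
      using c1 c2 \<epsilon> \<delta> unfolding tendsto_zero_in_prob_def D_def[abs_def, symmetric] E_def[abs_def, symmetric]
      by (intro tendsto_add tendsto_const) auto
  qed (use step in auto)
  then show ?thesis by (simp add: U_def)
qed

end

section \<open>Cadlag paths\<close>

lemma cadlag_left_limit:
  assumes "cadlag f" "0 < s"
  shows "(f \<longlongrightarrow> left_limit f s) (at_left s)"
proof -
  obtain l where l: "(f \<longlongrightarrow> l) (at_left s)" using assms by (auto simp: cadlag_def)
  then have "Lim (at_left s) f = l" by (intro tendsto_Lim) (simp add: trivial_limit_at_left_real)
  then show ?thesis using l assms by (simp add: left_limit_def)
qed

lemma cadlag_right: "cadlag f \<Longrightarrow> 0 \<le> s \<Longrightarrow> (f \<longlongrightarrow> f s) (at_right s)"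
  by (auto simp: cadlag_def)

lemma left_limit_eqI: "0 < s \<Longrightarrow> (f \<longlongrightarrow> l) (at_left s) \<Longrightarrow> left_limit f s = l"
  by (simp add: left_limit_def tendsto_Lim trivial_limit_at_left_real)

lemma cadlag_state_left:
  assumes "cadlag_state a" "0 < s"
  shows "\<forall>\<^sub>F u in at_left s. a u = left_state a s"
proof -
  obtain i where i: "\<forall>\<^sub>F u in at_left s. a u = i" using assms by (auto simp: cadlag_state_def)
  have "(THE i. \<forall>\<^sub>F u in at_left s. a u = i) = i"
  proof (rule the_equality)
    show "\<forall>\<^sub>F u in at_left s. a u = i" by (rule i)
  next
    fix j assume "\<forall>\<^sub>F u in at_left s. a u = j"
    with i have "\<forall>\<^sub>F u in at_left s. j = i" by eventually_elim simp
    then show "j = i" by (simp add: eventually_const_iff trivial_limit_at_left_real)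
  qed
  then show ?thesis using i assms by (simp add: left_state_def)
qed

text \<open>Compactness by bisection: near a point x the values to the right stay in the unit ball
  around f x, those to the left in the unit ball around the left limit.\<close>

lemma cadlag_bounded:
  fixes f :: "real \<Rightarrow> 'b::metric_space"
  assumes f: "cadlag f" and "0 \<le> T"
  shows "bounded (f ` {0..T})"
proof -
  \<comment> \<open>The bisection also visits intervals that reach below 0, where nothing is known
    about f.\<close>
  define S where "S = {0::real..}"
  have "bounded (f ` ({0..T} \<inter> S))"
    using \<open>0 \<le> T\<close>
  proof (induction rule: Bolzano)
    case (trans a b c)
    have sub: "f ` ({a..c} \<inter> S) \<subseteq> f ` ({a..b} \<inter> S) \<union> f ` ({b..c} \<inter> S)"
    proof
      fix y assume "y \<in> f ` ({a..c} \<inter> S)"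
      then obtain u where u: "y = f u" "u \<in> {a..c}" "u \<in> S" by blast
      then have "u \<in> {a..b} \<inter> S \<or> u \<in> {b..c} \<inter> S" by (cases "u \<le> b") auto
      then show "y \<in> f ` ({a..b} \<inter> S) \<union> f ` ({b..c} \<inter> S)" unfolding u(1) by blast
    qed
    have "bounded (f ` ({a..b} \<inter> S) \<union> f ` ({b..c} \<inter> S))"
      using trans(1,2) by (rule bounded_Un[THEN iffD2, OF conjI])
    then show ?case by (rule bounded_subset[OF _ sub])
  next
    case (local x)
    have "\<forall>\<^sub>F u in at_right x. dist (f u) (f x) < 1" using cadlag_right[OF f local(1)] by (rule tendstoD) simp
    then obtain b1 where b1: "x < b1" "\<And>u. x < u \<Longrightarrow> u < b1 \<Longrightarrow> dist (f u) (f x) < 1"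
      unfolding eventually_at_right_field by auto
    obtain b2 l where b2: "b2 < x" "\<And>u. b2 < u \<Longrightarrow> u < x \<Longrightarrow> 0 \<le> u \<Longrightarrow> dist (f u) l < 1"
    proof (cases "x = 0")
      case True
      then show ?thesis by (intro that[of "- 1" undefined]) auto
    next
      case False
      then have "0 < x" using local by simp
      from tendstoD[OF cadlag_left_limit[OF f this], of 1]
      have "\<forall>\<^sub>F u in at_left x. dist (f u) (left_limit f x) < 1" by simp
      then obtain b2 where "b2 < x" "\<And>u. b2 < u \<Longrightarrow> u < x \<Longrightarrow> dist (f u) (left_limit f x) < 1"
        unfolding eventually_at_left_field by auto
      then show ?thesis by (intro that[of b2 "left_limit f x"]) auto
    qed
    have "bounded (f ` ({a..b} \<inter> S))" if ab: "a \<le> x" "x \<le> b" "b - a < min (b1 - x) (x - b2)" for a b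
    proof -
      have "f ` ({a..b} \<inter> S) \<subseteq> cball (f x) 1 \<union> cball l 1"
      proof
        fix y assume "y \<in> f ` ({a..b} \<inter> S)"
        then obtain u where u: "y = f u" "a \<le> u" "u \<le> b" "0 \<le> u" by (auto simp: S_def)
        consider "u = x" | "x < u" | "u < x" by linarith
        then show "y \<in> cball (f x) 1 \<union> cball l 1"
        proof cases
          case 2 then show ?thesis using u ab b1(2)[of u] by (auto simp: dist_commute less_imp_le)
        next
          case 3 then show ?thesis using u ab b2(2)[of u] by (auto simp: dist_commute less_imp_le)
        qed (use u in auto)
      qed
      moreover have "bounded (cball (f x) 1 \<union> cball l 1)" by (simp add: bounded_Un)
      ultimately show ?thesis by (rule bounded_subset[rotated])
    qed
    then show ?case using b1(1) b2(1) by (intro exI[of _ "min (b1 - x) (x - b2)"]) auto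
  qed
  moreover have "{0..T} \<inter> S = {0..T}" by (auto simp: S_def)
  ultimately show ?thesis by simp
qed

text \<open>Jumps larger than e cannot accumulate at x: just to the right of x the path is within e
  / 2 of f x, just to the left within e / 2 of the left limit. Hence there are finitely many on
  every bounded interval, and e runs through 1 / (n + 1).\<close>

lemma cadlag_jumps_countable:
  fixes f :: "real \<Rightarrow> 'b::metric_space"
  assumes f: "cadlag f"
  shows "countable {s. 0 < s \<and> left_limit f s \<noteq> f s}"
proof -
  define J where "J e = {s. 0 < s \<and> e < dist (left_limit f s) (f s)}" for e
  have fin: "finite ({0..T} \<inter> J e)" if "0 \<le> T" "0 < e" for T e
    using \<open>0 \<le> T\<close>
  proof (induction rule: Bolzano)
    case (trans a b c)
    have "{a..c} \<inter> J e \<subseteq> ({a..b} \<inter> J e) \<union> ({b..c} \<inter> J e)" by auto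
    then show ?case using trans finite_subset by blast
  next
    case (local x)
    have half: "u \<notin> J e" if u: "0 < u" and near: "\<forall>\<^sub>F v in at_left u. dist (f v) l < e / 2" and fu: "dist (f u) l < e / 2" for u l
    proof -
      have "((\<lambda>v. dist (f v) l) \<longlongrightarrow> dist (left_limit f u) l) (at_left u)"
        by (intro tendsto_intros cadlag_left_limit[OF f u])
      then have "dist (left_limit f u) l \<le> e / 2"
        by (rule tendsto_upperbound[OF _ eventually_mono[OF near less_imp_le]]) (simp_all add: trivial_limit_at_left_real)
      then show ?thesis using fu dist_triangle2[of "left_limit f u" "f u" l] by (auto simp: J_def)
    qed
    have "\<forall>\<^sub>F u in at_right x. dist (f u) (f x) < e / 2" using cadlag_right[OF f local(1)] \<open>0 < e\<close> by (intro tendstoD) auto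
    then obtain b1 where b1: "x < b1" "\<And>u. x < u \<Longrightarrow> u < b1 \<Longrightarrow> dist (f u) (f x) < e / 2"
      unfolding eventually_at_right_field by auto
    have r: "u \<notin> J e" if "x < u" "u < b1" for u
    proof (rule half)
      show "\<forall>\<^sub>F v in at_left u. dist (f v) (f x) < e / 2"
        unfolding eventually_at_left_field using b1 that by (intro exI[of _ x]) auto
    qed (use b1 that local in auto)
    obtain b2 where b2: "b2 < x" "\<And>u. b2 < u \<Longrightarrow> u < x \<Longrightarrow> u \<notin> J e"
    proof (cases "x = 0")
      case True
      then show ?thesis by (intro that[of "- 1"]) (auto simp: J_def)
    next
      case False
      then have x: "0 < x" using local by simp
      have "\<forall>\<^sub>F u in at_left x. dist (f u) (left_limit f x) < e / 2"
        using cadlag_left_limit[OF f x] \<open>0 < e\<close> by (intro tendstoD) auto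
      then obtain b2 where b2: "b2 < x" "\<And>u. b2 < u \<Longrightarrow> u < x \<Longrightarrow> dist (f u) (left_limit f x) < e / 2"
        unfolding eventually_at_left_field by auto
      have "u \<notin> J e" if "b2 < u" "u < x" for u
      proof (cases "0 < u")
        case True
        show ?thesis
        proof (rule half[OF True])
          show "\<forall>\<^sub>F v in at_left u. dist (f v) (left_limit f x) < e / 2"
            unfolding eventually_at_left_field using b2 that by (intro exI[of _ b2]) auto
        qed (use b2 that in auto)
      qed (auto simp: J_def)
      then show ?thesis using b2(1) that by blast
    qed
    have "finite ({a..b} \<inter> J e)" if ab: "a \<le> x" "x \<le> b" "b - a < min (b1 - x) (x - b2)" for a b
    proof (rule finite_subset)
      show "{a..b} \<inter> J e \<subseteq> {x}"
      proof
        fix u assume u: "u \<in> {a..b} \<inter> J e"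
        then have "\<not> x < u" "\<not> u < x" using r[of u] b2(2)[of u] ab by auto
        then show "u \<in> {x}" by simp
      qed
    qed simp
    then show ?case using b1(1) b2(1) by (intro exI[of _ "min (b1 - x) (x - b2)"]) auto
  qed
  have "{s. 0 < s \<and> left_limit f s \<noteq> f s} \<subseteq> (\<Union>n. {0..real n} \<inter> J (1 / real (Suc n)))"
  proof
    fix s assume "s \<in> {s. 0 < s \<and> left_limit f s \<noteq> f s}"
    then have s: "0 < s" "0 < dist (left_limit f s) (f s)" by auto
    obtain n1 where n1: "s \<le> real n1" using real_arch_simple by blast
    obtain n2 where n2: "1 / real (Suc n2) < dist (left_limit f s) (f s)" using nat_approx_posE[OF s(2)] by blast
    define n where "n = max n1 n2"
    have "1 / real (Suc n) \<le> 1 / real (Suc n2)" by (intro divide_left_mono) (auto simp: n_def)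
    then have "s \<in> {0..real n} \<inter> J (1 / real (Suc n))" using s n1 n2 by (auto simp: J_def n_def)
    then show "s \<in> (\<Union>n. {0..real n} \<inter> J (1 / real (Suc n)))" by blast
  qed
  moreover have "countable (\<Union>n. {0..real n} \<inter> J (1 / real (Suc n)))"
    by (rule countable_UN[OF countableI_type], rule countable_finite, rule fin) auto
  ultimately show ?thesis by (rule countable_subset)
qed

text \<open>On either side of a time the regime is eventually constant, so continuity in x for each
  fixed regime suffices.\<close>

lemma cadlag_compose_state:
  fixes f :: "'b::metric_space \<Rightarrow> 'm \<Rightarrow> 'c::t2_space"
  assumes X: "cadlag X" and a: "cadlag_state a" and f: "\<And>i. continuous_on UNIV (\<lambda>x. f x i)"
  shows "cadlag (\<lambda>s. f (X s) (a s))"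
    and "0 < s \<Longrightarrow> left_limit (\<lambda>s. f (X s) (a s)) s = f (left_limit X s) (left_state a s)"
proof -
  have left: "((\<lambda>s. f (X s) (a s)) \<longlongrightarrow> f (left_limit X s) (left_state a s)) (at_left s)" if s: "0 < s" for s
  proof -
    have "((\<lambda>u. f (X u) (left_state a s)) \<longlongrightarrow> f (left_limit X s) (left_state a s)) (at_left s)"
      using continuous_on_tendsto_compose[OF f cadlag_left_limit[OF X s]] by simp
    then show ?thesis
      by (rule Lim_transform_eventually) (use cadlag_state_left[OF a s] in \<open>auto elim: eventually_mono\<close>)
  qed
  have right: "((\<lambda>s. f (X s) (a s)) \<longlongrightarrow> f (X s) (a s)) (at_right s)" if s: "0 \<le> s" for s
  proof -
    have "((\<lambda>u. f (X u) (a s)) \<longlongrightarrow> f (X s) (a s)) (at_right s)"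
      using continuous_on_tendsto_compose[OF f cadlag_right[OF X s]] by simp
    moreover have "\<forall>\<^sub>F u in at_right s. a u = a s" using a s by (auto simp: cadlag_state_def)
    ultimately show ?thesis by (auto elim!: Lim_transform_eventually elim: eventually_mono)
  qed
  show "cadlag (\<lambda>s. f (X s) (a s))" using left right unfolding cadlag_def by blast
  show "0 < s \<Longrightarrow> left_limit (\<lambda>s. f (X s) (a s)) s = f (left_limit X s) (left_state a s)"
    using left by (intro left_limit_eqI)
qed

text \<open>Time is approximated from the right by grid times, for which the process takes one of
  countably many measurable forms; right continuity gives the limit. Negative times are sent to
  0.\<close>

lemma cadlag_process_measurable:
  fixes f :: "real \<Rightarrow> 'w \<Rightarrow> 'b::metric_space"
  assumes f: "\<And>s. 0 \<le> s \<Longrightarrow> f s \<in> borel_measurable M"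
    and c: "\<And>\<omega>. \<omega> \<in> space M \<Longrightarrow> cadlag (\<lambda>s. f s \<omega>)"
  shows "(\<lambda>p. f (max 0 (fst p)) (snd p)) \<in> borel_measurable (borel \<Otimes>\<^sub>M M)"
proof (rule borel_measurable_LIMSEQ_metric)
  \<comment> \<open>Floor plus one keeps the grid time strictly above u, as convergence along
    \<open>at_right\<close> demands.\<close>
  define g where "g n u = max 0 (real_of_int (\<lfloor>u * real (Suc n)\<rfloor> + 1) / real (Suc n))" for n and u :: real
  show "(\<lambda>p. f (g n (fst p)) (snd p)) \<in> borel_measurable (borel \<Otimes>\<^sub>M M)" for n
  proof -
    have "(\<lambda>p. f (max 0 (real_of_int (i + 1) / real (Suc n))) (snd p)) \<in> borel_measurable (borel \<Otimes>\<^sub>M M)" for i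
      by (rule measurable_compose[OF measurable_snd f]) simp
    moreover have "(\<lambda>p. \<lfloor>fst p * real (Suc n)\<rfloor>) \<in> measurable (borel \<Otimes>\<^sub>M M) (count_space UNIV)"
      by measurable
    ultimately show ?thesis unfolding g_def by (rule measurable_compose_countable)
  qed
  fix p :: "real \<times> 'w" assume "p \<in> space (borel \<Otimes>\<^sub>M M)"
  then have \<omega>: "snd p \<in> space M" by (auto simp: space_pair_measure)
  let ?u = "fst p"
  have g: "?u < real_of_int (\<lfloor>?u * real (Suc n)\<rfloor> + 1) / real (Suc n)"
    "real_of_int (\<lfloor>?u * real (Suc n)\<rfloor> + 1) / real (Suc n) \<le> ?u + 1 / real (Suc n)" for n
  proof -
    have "?u * real (Suc n) < real_of_int (\<lfloor>?u * real (Suc n)\<rfloor> + 1)" "real_of_int (\<lfloor>?u * real (Suc n)\<rfloor> + 1) \<le> ?u * real (Suc n) + 1"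
      by linarith+
    then show "?u < real_of_int (\<lfloor>?u * real (Suc n)\<rfloor> + 1) / real (Suc n)"
      "real_of_int (\<lfloor>?u * real (Suc n)\<rfloor> + 1) / real (Suc n) \<le> ?u + 1 / real (Suc n)"
      by (simp_all add: field_simps del: of_nat_Suc of_int_add)
  qed
  show "(\<lambda>n. f (g n ?u) (snd p)) \<longlonglongrightarrow> f (max 0 ?u) (snd p)"
  proof (cases "0 \<le> ?u")
    case True
    have "(\<lambda>n. g n ?u) \<longlonglongrightarrow> ?u"
    proof (rule tendsto_sandwich)
      show "(\<lambda>n. ?u) \<longlonglongrightarrow> ?u" by simp
      show "(\<lambda>n. ?u + 1 / real (Suc n)) \<longlonglongrightarrow> ?u" using tendsto_add[OF tendsto_const LIMSEQ_Suc[OF lim_1_over_n]] by simp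
    qed (use g True in \<open>auto simp: g_def intro!: always_eventually max.coboundedI2 less_imp_le simp del: of_nat_Suc of_int_add\<close>)
    then have "filterlim (\<lambda>n. g n ?u) (at_right ?u) sequentially"
      by (rule tendsto_imp_filterlim_at_right) (use g True in \<open>auto simp: g_def less_max_iff_disj intro!: always_eventually simp del: of_nat_Suc of_int_add\<close>)
    then show ?thesis using filterlim_compose[OF cadlag_right[OF c[OF \<omega>] True]] True by simp
  next
    case False
    then have u: "?u < 0" by simp
    obtain n0 where n0: "1 / real (Suc n0) < - ?u" using nat_approx_posE[of "- ?u"] u by auto
    have "g n ?u = 0" if "n0 \<le> n" for n
    proof -
      have "1 / real (Suc n) \<le> 1 / real (Suc n0)" using that by (intro divide_left_mono) auto
      then show ?thesis using g(2)[of n] n0 by (auto simp: g_def max_def)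
    qed
    then show ?thesis using u by (intro tendsto_eventually eventually_sequentiallyI[of n0]) auto
  qed
qed

section \<open>Grid cells and rounding to a lattice\<close>

lemma grid_index:
  assumes "0 < h" "0 < s" "s \<le> real K * h"
  shows "\<exists>j<K. real j * h < s \<and> s \<le> real (Suc j) * h"
proof -
  \<comment> \<open>Ceiling minus one instead of floor: cells are left-open, so a grid point belongs
    to the cell that ends there.\<close>
  define j where "j = nat (\<lceil>s / h\<rceil> - 1)"
  have pos: "0 < \<lceil>s / h\<rceil>" using assms by simp
  have rj: "real (Suc j) = of_int \<lceil>s / h\<rceil>" "real j = of_int \<lceil>s / h\<rceil> - 1" using pos by (auto simp: j_def)
  have 1: "s / h \<le> real (Suc j)" "real j < s / h" unfolding rj by linarith+
  then have 2: "s \<le> real (Suc j) * h" "real j * h < s" using assms(1) by (simp_all add: field_simps)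
  then have "real j * h < real K * h" using assms(3) by simp
  then have "j < K" using assms(1) by simp
  then show ?thesis using 2 by blast
qed

lemma partition_value_grid:
  assumes "0 < h" "j < K" "real j * h < s" "s \<le> real (Suc j) * h"
  shows "partition_value (\<lambda>l. real l * h) K \<xi> s = \<xi> j"
proof -
  have "indicator {real l * h<..real (Suc l) * h} s = (if l = j then 1 else 0 :: real)" for l
  proof (cases "l = j")
    case False
    then consider "Suc l \<le> j" | "Suc j \<le> l" by linarith
    then have "s \<notin> {real l * h<..real (Suc l) * h}"
    proof cases
      case 1
      then have "real (Suc l) * h \<le> real j * h" using assms(1) by (intro mult_right_mono) auto
      then show ?thesis using assms unfolding greaterThanAtMost_iff by linarith
    next
      case 2
      then have "real (Suc j) * h \<le> real l * h" using assms(1) by (intro mult_right_mono) auto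
      then show ?thesis using assms unfolding greaterThanAtMost_iff by linarith
    qed
    then show ?thesis using False by simp
  qed (use assms in auto)
  then show ?thesis using assms(2) unfolding partition_value_def
    by (simp add: if_distrib[of "\<lambda>c. c *\<^sub>R _"] cong: if_cong)
qed

lemma partition_value_grid_zero:
  assumes "0 < h" "s \<le> 0"
  shows "partition_value (\<lambda>l. real l * h) K \<xi> s = 0"
proof -
  have "\<not> real l * h < s" for l using assms mult_nonneg_nonneg[of "real l" h] by linarith
  then show ?thesis unfolding partition_value_def by (intro sum.neutral) auto
qed

text \<open>The left end of the cell containing s lies strictly before s even if s is a grid point.
  Coefficients frozen there therefore converge to left limits, which is what the jump integral
  contains.\<close>

lemma grid_left_filterlim:
  assumes "h \<longlonglongrightarrow> (0::real)" "\<And>p. real (j p) * h p < s" "\<And>p. s \<le> real (Suc (j p)) * h p"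
  shows "filterlim (\<lambda>p. real (j p) * h p) (at_left s) sequentially"
proof (rule tendsto_imp_filterlim_at_left)
  show "(\<lambda>p. real (j p) * h p) \<longlonglongrightarrow> s"
  proof (rule tendsto_sandwich)
    show "(\<lambda>p. s - h p) \<longlonglongrightarrow> s" using tendsto_diff[OF tendsto_const assms(1)] by simp
    show "(\<lambda>p. s) \<longlonglongrightarrow> s" by simp
  qed (use assms in \<open>auto intro!: always_eventually simp: algebra_simps less_imp_le\<close>)
qed (use assms in auto)

text \<open>Makes the state discrete: countably many values, finitely many on a ball, with an error
  that is uniform in x and vanishes with the mesh.\<close>

definition round_vec :: "nat \<Rightarrow> real^'n \<Rightarrow> real^'n" where
  "round_vec p x = (\<chi> a. of_int \<lfloor>real (Suc p) * x $ a\<rfloor> / real (Suc p))"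

lemma round_vec_dist: "norm (round_vec p x - (x::real^'n)) \<le> real CARD('n) / real (Suc p)"
proof -
  have "\<bar>(round_vec p x - x) $ a\<bar> \<le> 1 / real (Suc p)" for a
  proof -
    let ?y = "real (Suc p) * x $ a"
    have "(round_vec p x - x) $ a = (of_int \<lfloor>?y\<rfloor> - ?y) / real (Suc p)"
      by (simp add: round_vec_def diff_divide_distrib del: of_nat_Suc)
    also have "\<bar>\<dots>\<bar> = \<bar>of_int \<lfloor>?y\<rfloor> - ?y\<bar> / real (Suc p)" by (simp add: abs_divide del: of_nat_Suc)
    also have "\<dots> \<le> 1 / real (Suc p)" by (intro divide_right_mono) (linarith, simp)
    finally show ?thesis .
  qed
  then have "norm (round_vec p x - x) \<le> (\<Sum>a\<in>(UNIV::'n set). 1 / real (Suc p))"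
    by (intro order_trans[OF norm_le_l1_cart] sum_mono)
  then show ?thesis by simp
qed

lemma round_vec_norm_le: "norm (round_vec p (x::real^'n)) \<le> norm x + real CARD('n)"
proof -
  have "real CARD('n) / real (Suc p) \<le> real CARD('n) / 1" by (intro divide_left_mono) auto
  then show ?thesis using round_vec_dist[of p x] norm_triangle_ineq2[of "round_vec p x" x] by simp
qed

lemma round_vec_finite: "finite (round_vec p ` {x::real^'n. norm x \<le> R})"
proof -
  define m where "m = \<lceil>real (Suc p) * R\<rceil> + 1"
  let ?S = "(\<lambda>v. \<chi> a. of_int (v a) / real (Suc p)) ` (PiE (UNIV :: 'n set) (\<lambda>_. {- m..m})) :: (real^'n) set"
  have "round_vec p ` {x. norm x \<le> R} \<subseteq> ?S"
  proof clarify
    fix x :: "real^'n" assume x: "norm x \<le> R"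
    have "\<lfloor>real (Suc p) * x $ a\<rfloor> \<in> {- m..m}" for a
    proof -
      have "\<bar>x $ a\<bar> \<le> R" using component_le_norm_cart[of x a] x by linarith
      then have "\<bar>real (Suc p) * x $ a\<bar> \<le> real (Suc p) * R" unfolding abs_mult by (intro mult_mono) auto
      then show ?thesis unfolding m_def by simp linarith
    qed
    then show "round_vec p x \<in> ?S"
      by (intro image_eqI[of _ _ "\<lambda>a. \<lfloor>real (Suc p) * x $ a\<rfloor>"]) (auto simp: round_vec_def)
  qed
  moreover have "finite ?S" by (intro finite_imageI finite_PiE) auto
  ultimately show ?thesis by (rule finite_subset)
qed

lemma round_vec_measurable: "(round_vec p :: real^'n \<Rightarrow> real^'n) \<in> borel_measurable borel"
proof (rule borel_measurable_vecI)
  fix a :: 'n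
  have [measurable]: "(\<lambda>x::real^'n. x $ a) \<in> borel_measurable borel"
    by (intro borel_measurable_continuous_onI continuous_intros)
  show "(\<lambda>x::real^'n. round_vec p x $ a) \<in> borel_measurable borel"
    unfolding round_vec_def vec_lambda_beta by measurable
qed

lemma round_vec_countable: "countable (range (round_vec p :: real^'n \<Rightarrow> real^'n))"
proof -
  have "range (round_vec p :: real^'n \<Rightarrow> real^'n) \<subseteq> (\<Union>R::nat. round_vec p ` {x::real^'n. norm x \<le> real R})"
    using real_arch_simple by fastforce
  then show ?thesis by (rule countable_subset) (rule countable_UN[OF countableI_type], rule countable_finite, rule round_vec_finite)
qed

lemma grid_state_tendsto:
  fixes X :: "real \<Rightarrow> real^'n" and f :: "real^'n \<Rightarrow> 'm \<Rightarrow> 'c::topological_space"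
  assumes X: "cadlag X" and a: "cadlag_state a" and f: "\<And>i. continuous_on UNIV (\<lambda>x. f x i)" and s: "0 < s"
    and lim: "filterlim \<tau> (at_left s) sequentially"
  shows "(\<lambda>p. f (round_vec p (X (\<tau> p))) (a (\<tau> p))) \<longlonglongrightarrow> f (left_limit X s) (left_state a s)"
proof -
  have X': "(\<lambda>p. X (\<tau> p)) \<longlonglongrightarrow> left_limit X s" using filterlim_compose[OF cadlag_left_limit[OF X s] lim] .
  have "(\<lambda>p. round_vec p (X (\<tau> p)) - X (\<tau> p)) \<longlonglongrightarrow> 0"
  proof (rule Lim_null_comparison)
    show "\<forall>\<^sub>F p in sequentially. norm (round_vec p (X (\<tau> p)) - X (\<tau> p)) \<le> real CARD('n) / real (Suc p)"
      by (intro always_eventually allI round_vec_dist)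
    show "(\<lambda>p. real CARD('n) / real (Suc p)) \<longlonglongrightarrow> 0" by (rule LIMSEQ_Suc[OF lim_const_over_n])
  qed
  from tendsto_add[OF this X'] have "(\<lambda>p. round_vec p (X (\<tau> p))) \<longlonglongrightarrow> left_limit X s" by simp
  from continuous_on_tendsto_compose[OF f this]
  have "(\<lambda>p. f (round_vec p (X (\<tau> p))) (left_state a s)) \<longlonglongrightarrow> f (left_limit X s) (left_state a s)" by simp
  moreover have "\<forall>\<^sub>F p in sequentially. a (\<tau> p) = left_state a s"
    using cadlag_state_left[OF a s] lim by (rule eventually_compose_filterlim)
  ultimately show ?thesis by (auto elim!: Lim_transform_eventually elim: eventually_mono)
qed

section \<open>Euler approximation of a solution\<close>

lemma (in prob_space) AE_tendsto_zero_imp_prob: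
  fixes f :: "nat \<Rightarrow> 'a \<Rightarrow> ennreal"
  assumes f: "\<And>p. f p \<in> borel_measurable M" and lim: "AE \<omega> in M. (\<lambda>p. f p \<omega>) \<longlonglongrightarrow> 0" and c: "0 < c"
  shows "(\<lambda>p. prob {\<omega>\<in>space M. c < f p \<omega>}) \<longlonglongrightarrow> 0"
proof -
  have E: "{\<omega>\<in>space M. c < f p \<omega>} \<in> events" for p using f by measurable
  have "(\<lambda>p. \<integral>\<omega>. indicator {\<omega>\<in>space M. c < f p \<omega>} \<omega> \<partial>M) \<longlonglongrightarrow> (\<integral>\<omega>. 0 \<partial>M :: real)"
  proof (rule integral_dominated_convergence[where w = "\<lambda>_. 1"])
    show "AE \<omega> in M. (\<lambda>p. indicator {\<omega>\<in>space M. c < f p \<omega>} \<omega> :: real) \<longlonglongrightarrow> 0"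
      using lim
    proof eventually_elim
      case (elim \<omega>)
      have "\<forall>\<^sub>F p in sequentially. f p \<omega> < c" using elim c by (rule order_tendstoD)
      then show ?case by (intro tendsto_eventually) (auto elim!: eventually_mono simp: indicator_def)
    qed
  qed (use E in \<open>auto simp: indicator_def\<close>)
  then show ?thesis using E by simp
qed

definition mesh :: "real \<Rightarrow> nat \<Rightarrow> real" where
  "mesh T p = T / real (Suc p)"

lemma mesh_pos: "0 < T \<Longrightarrow> 0 < mesh T p"
  by (simp add: mesh_def)

lemma mesh_total: "real (Suc p) * mesh T p = T"
  by (simp add: mesh_def del: of_nat_Suc)

lemma mesh_tendsto: "mesh T \<longlonglongrightarrow> 0"
  unfolding mesh_def[abs_def] by (rule LIMSEQ_Suc[OF lim_const_over_n])

text \<open>What the estimates use of a solution. The regime is seen as an adapted cadlag process,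
  because the moment estimates are uniform in it.\<close>

locale regime_solution = driving_noise M F w \<nu> N
  for M :: "'w measure" and F :: "real \<Rightarrow> 'w measure" and w :: "real \<Rightarrow> 'w \<Rightarrow> real^'d"
    and \<nu> :: "'e measure" and N :: "'w \<Rightarrow> (real \<times> 'e) measure" +
  fixes b :: "real^'r \<Rightarrow> 'm::finite \<Rightarrow> real^'r" and \<sigma> :: "real^'r \<Rightarrow> 'm \<Rightarrow> real^'d^'r"
    and g :: "real^'r \<Rightarrow> 'm \<Rightarrow> 'e \<Rightarrow> real^'r" and K :: real
    and x :: "real^'r" and X :: "real \<Rightarrow> 'w \<Rightarrow> real^'r" and \<alpha> :: "real \<Rightarrow> 'w \<Rightarrow> 'm"
  assumes b_cont: "\<And>i. continuous_on UNIV (\<lambda>x. b x i)"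
    and \<sigma>_cont: "\<And>i. continuous_on UNIV (\<lambda>x. \<sigma> x i)"
    and g_cont: "\<And>i \<gamma>. \<gamma> \<in> marks \<Longrightarrow> continuous_on UNIV (\<lambda>x. g x i \<gamma>)"
    and b_growth: "\<And>x i. norm (b x i) \<le> K * (1 + norm x)"
    and \<sigma>_growth: "\<And>x i. norm (\<sigma> x i) \<le> K * (1 + norm x)"
    and g_growth: "\<And>x i \<gamma>. \<gamma> \<in> marks \<Longrightarrow> norm (g x i \<gamma>) \<le> K * (1 + norm x)"
    and g_meas: "\<And>x i. g x i \<in> borel_measurable \<nu>"
    and X_F: "\<And>t. 0 \<le> t \<Longrightarrow> X t \<in> borel_measurable (F t)"
    and \<alpha>_F: "\<And>t. 0 \<le> t \<Longrightarrow> \<alpha> t \<in> measurable (F t) (count_space UNIV)"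
    and X_cadlag: "\<And>\<omega>. \<omega> \<in> space M \<Longrightarrow> cadlag (\<lambda>t. X t \<omega>)"
    and \<alpha>_cadlag: "\<And>\<omega>. \<omega> \<in> space M \<Longrightarrow> cadlag_state (\<lambda>t. \<alpha> t \<omega>)"
    and equation: "\<And>t. 0 \<le> t \<Longrightarrow> \<exists>J. has_ito_integral M F w (\<lambda>s \<omega>. \<sigma> (X s \<omega>) (\<alpha> s \<omega>)) t J \<and>
        (AE \<omega> in M. X t \<omega> = x + (LINT s:{0..t}|lborel. b (X s \<omega>) (\<alpha> s \<omega>)) + J \<omega> +
           (LINT p:({0..t} \<times> marks)|N \<omega>. g (left_limit (\<lambda>s. X s \<omega>) (fst p)) (left_state (\<lambda>s. \<alpha> s \<omega>) (fst p)) (snd p)))"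
begin

definition grid_state :: "real \<Rightarrow> nat \<Rightarrow> nat \<Rightarrow> 'w \<Rightarrow> (real^'r) \<times> 'm" where
  "grid_state T p k \<omega> = (round_vec p (X (real k * mesh T p) \<omega>), \<alpha> (real k * mesh T p) \<omega>)"

lemma grid_state_F:
  assumes "0 < T" "c \<in> range (round_vec p) \<times> UNIV"
  shows "{\<omega>\<in>space M. grid_state T p k \<omega> = c} \<in> sets (F (real k * mesh T p))"
proof -
  let ?t = "real k * mesh T p"
  have t: "0 \<le> ?t" using mesh_pos[OF assms(1), of p] by simp
  have 1: "(\<lambda>\<omega>. round_vec p (X ?t \<omega>)) \<in> borel_measurable (F ?t)"
    by (rule measurable_compose[OF X_F[OF t] round_vec_measurable])
  have "(\<lambda>\<omega>. round_vec p (X ?t \<omega>)) -` {fst c} \<inter> space (F ?t) \<in> sets (F ?t)"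
    by (rule measurable_sets[OF 1]) simp
  moreover have "\<alpha> ?t -` {snd c} \<inter> space (F ?t) \<in> sets (F ?t)"
    by (rule measurable_sets[OF \<alpha>_F[OF t]]) simp
  moreover have "{\<omega>\<in>space M. grid_state T p k \<omega> = c} =
     ((\<lambda>\<omega>. round_vec p (X ?t \<omega>)) -` {fst c} \<inter> space (F ?t)) \<inter> (\<alpha> ?t -` {snd c} \<inter> space (F ?t))"
    by (cases c) (auto simp: grid_state_def)
  ultimately show ?thesis by auto
qed

lemma grid_state_count:
  assumes "0 < T"
  shows "grid_state T p k \<in> measurable (F (real k * mesh T p)) (count_space (range (round_vec p) \<times> UNIV))"
proof -
  have c: "countable (range (round_vec p :: real^'r \<Rightarrow> real^'r) \<times> (UNIV :: 'm set))"
    by (intro countable_SIGMA round_vec_countable countable_finite) auto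
  show ?thesis
    unfolding measurable_count_space_eq_countable[OF c]
    using grid_state_F[OF assms] by (auto simp: grid_state_def vimage_def Int_def conj_commute)
qed

text \<open>The state has countably many values, so measurability of \<open>f c\<close> for every
  fixed c is enough and no joint measurability in c has to be shown.\<close>

lemma grid_state_compose:
  assumes T: "0 < T" and f: "\<And>c. f c \<in> borel_measurable (F u)" and u: "real k * mesh T p \<le> u"
  shows "(\<lambda>\<omega>. f (grid_state T p k \<omega>) \<omega>) \<in> borel_measurable (F u)"
proof (rule measurable_compose_countable'[OF f measurable_F_mono[OF grid_state_count[OF T] u]])
  show "countable (range (round_vec p :: real^'r \<Rightarrow> real^'r) \<times> (UNIV :: 'm set))"
    by (intro countable_SIGMA round_vec_countable countable_finite) auto
qed

text \<open>No recursion: the coefficients are frozen at rounded grid values of the solution itself,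
  so this is a Riemann sum for the right-hand side of the equation.\<close>

definition euler :: "real \<Rightarrow> nat \<Rightarrow> nat \<Rightarrow> 'w \<Rightarrow> real^'r" where
  "euler T p k \<omega> = x + (\<Sum>j<k. increment (mesh T p) (b (fst (grid_state T p j \<omega>)) (snd (grid_state T p j \<omega>)))
      (\<sigma> (fst (grid_state T p j \<omega>)) (snd (grid_state T p j \<omega>))) (g (fst (grid_state T p j \<omega>)) (snd (grid_state T p j \<omega>))) j \<omega>)"

lemma euler_M: "0 < T \<Longrightarrow> euler T p k \<in> borel_measurable M"
proof -
  assume T: "0 < T"
  let ?h = "mesh T p"
  have h: "0 < ?h" by (rule mesh_pos[OF T])
  have "(\<lambda>\<omega>. increment ?h (b (fst (grid_state T p j \<omega>)) (snd (grid_state T p j \<omega>)))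
      (\<sigma> (fst (grid_state T p j \<omega>)) (snd (grid_state T p j \<omega>))) (g (fst (grid_state T p j \<omega>)) (snd (grid_state T p j \<omega>))) j \<omega>)
      \<in> borel_measurable M" for j
  proof -
    have j0: "0 \<le> real j * ?h" by (intro mult_nonneg_nonneg less_imp_le[OF h]) simp
    have "(\<lambda>\<omega>. increment ?h (b (fst c) (snd c)) (\<sigma> (fst c) (snd c)) (g (fst c) (snd c)) j \<omega>) \<in> borel_measurable (F (real j * ?h + ?h))" for c
      unfolding increment_def using h j0
      by (intro borel_measurable_add borel_measurable_matrix_vector_mult jump_measurable_F g_meas incr_measurable_F) auto
    from grid_state_compose[OF T this, of j p] h
    have "(\<lambda>\<omega>. increment ?h (b (fst (grid_state T p j \<omega>)) (snd (grid_state T p j \<omega>)))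
      (\<sigma> (fst (grid_state T p j \<omega>)) (snd (grid_state T p j \<omega>))) (g (fst (grid_state T p j \<omega>)) (snd (grid_state T p j \<omega>))) j \<omega>)
      \<in> borel_measurable (F (real j * ?h + ?h))" by simp
    then show ?thesis by (rule measurable_F_M) (use h j0 in linarith)
  qed
  then show ?thesis unfolding euler_def[abs_def] by (intro borel_measurable_add borel_measurable_sum) auto
qed

lemma path_bounded:
  assumes "\<omega> \<in> space M" "0 < T"
  obtains R where "0 \<le> R" "\<And>s. 0 \<le> s \<Longrightarrow> s \<le> T \<Longrightarrow> norm (X s \<omega>) \<le> R"
proof -
  have "bounded ((\<lambda>s. X s \<omega>) ` {0..T})" using assms by (intro cadlag_bounded X_cadlag) auto
  then obtain R where R: "\<forall>y\<in>(\<lambda>s. X s \<omega>) ` {0..T}. norm y \<le> R" unfolding bounded_iff ..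
  show ?thesis
  proof (rule that)
    show "norm (X s \<omega>) \<le> max 0 R" if "0 \<le> s" "s \<le> T" for s
      using bspec[OF R, of "X s \<omega>"] that by (auto simp: le_max_iff_disj)
  qed simp
qed

lemma K_nonneg: "0 \<le> K"
proof -
  have "0 \<le> norm (b 0 undefined)" by simp
  also have "\<dots> \<le> K * (1 + norm (0::real^'r))" by (rule b_growth)
  finally show ?thesis by simp
qed

lemma grid_time_le: "0 < T \<Longrightarrow> j \<le> Suc p \<Longrightarrow> real j * mesh T p \<le> T"
proof -
  assume "0 < T" "j \<le> Suc p"
  then have "real j * mesh T p \<le> real (Suc p) * mesh T p" by (intro mult_right_mono less_imp_le[OF mesh_pos]) auto
  then show ?thesis unfolding mesh_total .
qed

lemma grid_state_norm:
  assumes "0 < T" "j \<le> Suc p" "\<And>s. 0 \<le> s \<Longrightarrow> s \<le> T \<Longrightarrow> norm (X s \<omega>) \<le> R"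
  shows "norm (fst (grid_state T p j \<omega>)) \<le> R + real CARD('r)"
  unfolding grid_state_def fst_conv
proof -
  have "0 \<le> real j * mesh T p" using mesh_pos[OF assms(1), of p] by simp
  from round_vec_norm_le[of p "X (real j * mesh T p) \<omega>"] assms(3)[OF this grid_time_le[OF assms(1,2)]]
  show "norm (round_vec p (X (real j * mesh T p) \<omega>)) \<le> R + real CARD('r)" by simp
qed

lemma growth_bound:
  assumes "norm v \<le> R"
  shows "norm (b v i) \<le> K * (1 + R)" "norm (\<sigma> v i) \<le> K * (1 + R)" "\<gamma> \<in> marks \<Longrightarrow> norm (g v i \<gamma>) \<le> K * (1 + R)"
  using b_growth[of v i] \<sigma>_growth[of v i] g_growth[of \<gamma> v i] mult_left_mono[of "1 + norm v" "1 + R" K] assms K_nonneg by linarith+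

lemma step_path_tendsto:
  fixes f :: "real^'r \<Rightarrow> 'm \<Rightarrow> 'c::real_normed_vector"
  assumes T: "0 < T" and \<omega>: "\<omega> \<in> space M" and f: "\<And>i. continuous_on UNIV (\<lambda>x. f x i)" and s: "0 < s" "s \<le> T"
  shows "(\<lambda>p. partition_value (\<lambda>l. real l * mesh T p) (Suc p) (\<lambda>l. f (fst (grid_state T p l \<omega>)) (snd (grid_state T p l \<omega>))) s)
     \<longlonglongrightarrow> f (left_limit (\<lambda>s. X s \<omega>) s) (left_state (\<lambda>s. \<alpha> s \<omega>) s)"
proof -
  let ?h = "\<lambda>p. mesh T p"
  have h: "0 < ?h p" for p by (rule mesh_pos[OF T])
  have "\<exists>j<Suc p. real j * ?h p < s \<and> s \<le> real (Suc j) * ?h p" for p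
  proof (rule grid_index[OF h s(1)])
    show "s \<le> real (Suc p) * ?h p" unfolding mesh_total by (rule s(2))
  qed
  then obtain j where j: "\<And>p. j p < Suc p" "\<And>p. real (j p) * ?h p < s" "\<And>p. s \<le> real (Suc (j p)) * ?h p" by metis
  have "filterlim (\<lambda>p. real (j p) * ?h p) (at_left s) sequentially"
    by (rule grid_left_filterlim[OF mesh_tendsto j(2,3)])
  from grid_state_tendsto[OF X_cadlag[OF \<omega>] \<alpha>_cadlag[OF \<omega>] f s(1) this]
  show ?thesis
    by (rule Lim_transform_eventually)
       (auto intro!: always_eventually simp: partition_value_grid[OF h j(1) j(2) j(3)] grid_state_def)
qed

lemma partition_value_restrict:
  assumes "0 < h" "k \<le> n" "s \<le> real k * h"
  shows "partition_value (\<lambda>l. real l * h) k \<xi> s = partition_value (\<lambda>l. real l * h) n \<xi> s"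
proof (cases "0 < s")
  case True
  obtain j where "j < k" "real j * h < s" "s \<le> real (Suc j) * h" using grid_index[OF assms(1) True assms(3)] by blast
  then show ?thesis using assms partition_value_grid[of h j k s \<xi>] partition_value_grid[of h j n s \<xi>] by simp
next
  case False
  then have "s \<le> 0" by simp
  then show ?thesis by (simp add: partition_value_grid_zero[OF assms(1)])
qed

lemma partition_value_norm_le:
  assumes "0 < h" "s \<le> real n * h" "\<And>l. l < n \<Longrightarrow> norm (\<xi> l) \<le> B" "0 \<le> B"
  shows "norm (partition_value (\<lambda>l. real l * h) n \<xi> s) \<le> B"
proof (cases "0 < s")
  case True
  obtain j where "j < n" "real j * h < s" "s \<le> real (Suc j) * h" using grid_index[OF assms(1) True assms(2)] by blast
  then show ?thesis using assms partition_value_grid[of h j n s \<xi>] by simp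
next
  case False
  then have "s \<le> 0" by simp
  then show ?thesis using assms(4) by (simp add: partition_value_grid_zero[OF assms(1)])
qed

lemma composed_cadlag:
  fixes f :: "real^'r \<Rightarrow> 'm \<Rightarrow> 'c::t2_space"
  assumes "\<omega> \<in> space M" "\<And>i. continuous_on UNIV (\<lambda>x. f x i)"
  shows "cadlag (\<lambda>s. f (X s \<omega>) (\<alpha> s \<omega>))"
  by (rule cadlag_compose_state(1)[OF X_cadlag[OF assms(1)] \<alpha>_cadlag[OF assms(1)] assms(2)])

lemma composed_joint_measurable:
  fixes f :: "real^'r \<Rightarrow> 'm \<Rightarrow> 'c::{second_countable_topology,real_normed_vector}"
  assumes f: "\<And>i. continuous_on UNIV (\<lambda>x. f x i)"
  shows "(\<lambda>p. f (X (max 0 (fst p)) (snd p)) (\<alpha> (max 0 (fst p)) (snd p))) \<in> borel_measurable (borel \<Otimes>\<^sub>M M)"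
proof (rule cadlag_process_measurable)
  fix s :: real assume s: "0 \<le> s"
  show "(\<lambda>\<omega>. f (X s \<omega>) (\<alpha> s \<omega>)) \<in> borel_measurable M"
  proof (rule measurable_compose_countable[where f = "\<lambda>i \<omega>. f (X s \<omega>) i"])
    show "(\<lambda>\<omega>. f (X s \<omega>) i) \<in> borel_measurable M" for i
      by (rule measurable_compose[OF measurable_F_M[OF X_F[OF s] s] borel_measurable_continuous_onI[OF f]])
    show "\<alpha> s \<in> measurable M (count_space UNIV)" using measurable_F_M[OF \<alpha>_F[OF s] s] .
  qed
qed (use composed_cadlag f in blast)

lemma composed_path_measurable:
  fixes f :: "real^'r \<Rightarrow> 'm \<Rightarrow> 'c::{second_countable_topology,real_normed_vector}"
  assumes f: "\<And>i. continuous_on UNIV (\<lambda>x. f x i)" and \<omega>: "\<omega> \<in> space M"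
  shows "(\<lambda>s. indicator {0..t} s *\<^sub>R f (X s \<omega>) (\<alpha> s \<omega>)) \<in> borel_measurable borel"
proof -
  have "(\<lambda>s. (s, \<omega>)) \<in> measurable borel (borel \<Otimes>\<^sub>M M)" using \<omega> by simp
  from measurable_compose[OF this composed_joint_measurable[OF f]]
  have "(\<lambda>s. f (X (max 0 s) \<omega>) (\<alpha> (max 0 s) \<omega>)) \<in> borel_measurable borel" by simp
  then have "(\<lambda>s. indicator {0..t} s *\<^sub>R f (X (max 0 s) \<omega>) (\<alpha> (max 0 s) \<omega>)) \<in> borel_measurable borel" by measurable
  then show ?thesis by (rule measurable_cong[THEN iffD1, rotated]) (auto split: split_indicator)
qed

text \<open>The error of freezing a coefficient, along one path and integrated in time: r = 1 is
  used for the drift, r = 2 for the diffusion.\<close>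

definition step_gap :: "(real^'r \<Rightarrow> 'm \<Rightarrow> 'c::real_normed_vector) \<Rightarrow> nat \<Rightarrow> real \<Rightarrow> nat \<Rightarrow> nat \<Rightarrow> 'w \<Rightarrow> ennreal" where
  "step_gap f r T p k \<omega> = (\<integral>\<^sup>+s\<in>{0..real k * mesh T p}. ennreal ((norm (partition_value (\<lambda>l. real l * mesh T p) k
      (\<lambda>l. f (fst (grid_state T p l \<omega>)) (snd (grid_state T p l \<omega>))) s - f (X s \<omega>) (\<alpha> s \<omega>))) ^ r) \<partial>lborel)"

text \<open>The error up to the final time dominates that at all earlier grid times, so one estimate
  is uniform in k.\<close>

lemma step_gap_mono:
  assumes "0 < T" "k \<le> Suc p"
  shows "step_gap f r T p k \<omega> \<le> step_gap f r T p (Suc p) \<omega>"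
  unfolding step_gap_def
proof (rule nn_integral_mono)
  fix s
  have h: "0 < mesh T p" by (rule mesh_pos[OF assms(1)])
  have le0: "real k * mesh T p \<le> real (Suc p) * mesh T p" using assms(2) h by (intro mult_right_mono) auto
  show "ennreal (norm (partition_value (\<lambda>l. real l * mesh T p) k (\<lambda>l. f (fst (grid_state T p l \<omega>)) (snd (grid_state T p l \<omega>))) s
      - f (X s \<omega>) (\<alpha> s \<omega>)) ^ r) * indicator {0..real k * mesh T p} s
    \<le> ennreal (norm (partition_value (\<lambda>l. real l * mesh T p) (Suc p) (\<lambda>l. f (fst (grid_state T p l \<omega>)) (snd (grid_state T p l \<omega>))) s
      - f (X s \<omega>) (\<alpha> s \<omega>)) ^ r) * indicator {0..real (Suc p) * mesh T p} s"
  proof (cases "s \<in> {0..real k * mesh T p}")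
    case True
    then have le: "s \<le> real k * mesh T p" "s \<in> {0..real (Suc p) * mesh T p}" using le0 by auto
    show ?thesis unfolding partition_value_restrict[OF h assms(2) le(1)] using True le(2) by (simp del: of_nat_Suc)
  qed simp
qed

lemma step_gap_measurable:
  fixes f :: "real^'r \<Rightarrow> 'm \<Rightarrow> 'c::{second_countable_topology,real_normed_vector}"
  assumes T: "0 < T" and f: "\<And>i. continuous_on UNIV (\<lambda>x. f x i)"
  shows "step_gap f r T p k \<in> borel_measurable M"
proof -
  let ?h = "mesh T p"
  have h: "0 < ?h" by (rule mesh_pos[OF T])
  have gs: "(\<lambda>\<omega>. f (fst (grid_state T p l \<omega>)) (snd (grid_state T p l \<omega>))) \<in> borel_measurable M" for l
    using grid_state_compose[OF T, of "\<lambda>c \<omega>. f (fst c) (snd c)", OF _ order_refl, of l p] h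
    by (intro measurable_F_M[where s = "real l * ?h"]) auto
  note [measurable] = measurable_compose[OF measurable_snd gs] composed_joint_measurable[OF f]
  have joint: "(\<lambda>q. ennreal ((norm (partition_value (\<lambda>l. real l * ?h) k (\<lambda>l. f (fst (grid_state T p l (snd q))) (snd (grid_state T p l (snd q)))) (fst q)
      - f (X (max 0 (fst q)) (snd q)) (\<alpha> (max 0 (fst q)) (snd q)))) ^ r) * indicator {0..real k * ?h} (fst q))
      \<in> borel_measurable (borel \<Otimes>\<^sub>M M)"
    unfolding partition_value_def by measurable
  \<comment> \<open>The Tonelli lemma used next integrates out the second coordinate, hence the
    exchange of time and \<omega>.\<close>
  have "(\<lambda>q. ennreal ((norm (partition_value (\<lambda>l. real l * ?h) k (\<lambda>l. f (fst (grid_state T p l (fst q))) (snd (grid_state T p l (fst q)))) (snd q)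
      - f (X (max 0 (snd q)) (fst q)) (\<alpha> (max 0 (snd q)) (fst q)))) ^ r) * indicator {0..real k * ?h} (snd q))
      \<in> borel_measurable (M \<Otimes>\<^sub>M borel)"
    using measurable_pair_swap[OF joint] by (simp add: split_beta)
  then have "(\<lambda>q. ennreal ((norm (partition_value (\<lambda>l. real l * ?h) k (\<lambda>l. f (fst (grid_state T p l (fst q))) (snd (grid_state T p l (fst q)))) (snd q)
      - f (X (max 0 (snd q)) (fst q)) (\<alpha> (max 0 (snd q)) (fst q)))) ^ r) * indicator {0..real k * ?h} (snd q))
      \<in> borel_measurable (M \<Otimes>\<^sub>M lborel)"
    unfolding measurable_cong_sets[OF sets_pair_measure_cong[OF refl sets_lborel] refl] .
  from lborel.borel_measurable_nn_integral_fst[OF this]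
  have "(\<lambda>\<omega>. \<integral>\<^sup>+s. ennreal ((norm (partition_value (\<lambda>l. real l * ?h) k (\<lambda>l. f (fst (grid_state T p l \<omega>)) (snd (grid_state T p l \<omega>))) s
      - f (X (max 0 s) \<omega>) (\<alpha> (max 0 s) \<omega>))) ^ r) * indicator {0..real k * ?h} s \<partial>lborel) \<in> borel_measurable M" by simp
  also have "(\<lambda>\<omega>. \<integral>\<^sup>+s. ennreal ((norm (partition_value (\<lambda>l. real l * ?h) k (\<lambda>l. f (fst (grid_state T p l \<omega>)) (snd (grid_state T p l \<omega>))) s
      - f (X (max 0 s) \<omega>) (\<alpha> (max 0 s) \<omega>))) ^ r) * indicator {0..real k * ?h} s \<partial>lborel) = step_gap f r T p k"
    unfolding step_gap_def by (intro ext nn_integral_cong) (auto split: split_indicator)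
  finally show ?thesis .
qed

lemma step_gap_tendsto:
  fixes f :: "real^'r \<Rightarrow> 'm \<Rightarrow> 'c::{second_countable_topology,real_normed_vector}"
  assumes T: "0 < T" and \<omega>: "\<omega> \<in> space M" and f: "\<And>i. continuous_on UNIV (\<lambda>x. f x i)"
    and growth: "\<And>x i. norm (f x i) \<le> K * (1 + norm x)" and r: "0 < r"
  shows "(\<lambda>p. step_gap f r T p (Suc p) \<omega>) \<longlonglongrightarrow> 0"
proof -
  obtain R where R: "0 \<le> R" "\<And>s. 0 \<le> s \<Longrightarrow> s \<le> T \<Longrightarrow> norm (X s \<omega>) \<le> R" using path_bounded[OF \<omega> T] by blast
  \<comment> \<open>Rounding enlarges the norm by at most \<open>CARD('r)\<close>.\<close>
  define B where "B = K * (1 + (R + real CARD('r)))"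
  have B0: "0 \<le> B" using K_nonneg R by (simp add: B_def)
  have fB: "norm (f v i) \<le> B" if "norm v \<le> R + real CARD('r)" for v i
    using growth[of v i] mult_left_mono[of "1 + norm v" "1 + (R + real CARD('r))" K] that K_nonneg by (simp add: B_def)
  let ?h = "\<lambda>p. mesh T p"
  let ?v = "\<lambda>p s. partition_value (\<lambda>l. real l * ?h p) (Suc p) (\<lambda>l. f (fst (grid_state T p l \<omega>)) (snd (grid_state T p l \<omega>))) s"
  let ?c = "\<lambda>s. f (X s \<omega>) (\<alpha> s \<omega>)"
  have hT: "real (Suc p) * ?h p = T" for p by (rule mesh_total)
  have "(\<lambda>p. \<integral>\<^sup>+s. ennreal (norm (indicator {0..T} s *\<^sub>R ?v p s - indicator {0..T} s *\<^sub>R ?c s) ^ r) \<partial>lborel) \<longlonglongrightarrow> (\<integral>\<^sup>+s. 0 \<partial>(lborel :: real measure))"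
  proof (rule nn_integral_dominated_convergence[where w = "\<lambda>s. ennreal ((2 * B) ^ r) * indicator {0..T} s"])
    show "(\<lambda>s. ennreal (norm (indicator {0..T} s *\<^sub>R ?v p s - indicator {0..T} s *\<^sub>R ?c s) ^ r)) \<in> borel_measurable lborel" for p
      unfolding partition_value_def using composed_path_measurable[OF f \<omega>] by measurable
    show "AE s in lborel. ennreal (norm (indicator {0..T} s *\<^sub>R ?v p s - indicator {0..T} s *\<^sub>R ?c s) ^ r) \<le> ennreal ((2 * B) ^ r) * indicator {0..T} s" for p
    proof (rule AE_I2)
      fix s :: real
      show "ennreal (norm (indicator {0..T} s *\<^sub>R ?v p s - indicator {0..T} s *\<^sub>R ?c s) ^ r) \<le> ennreal ((2 * B) ^ r) * indicator {0..T} s"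
      proof (cases "s \<in> {0..T}")
        case True
        have "norm (?v p s) \<le> B"
        proof (rule partition_value_norm_le)
          show "s \<le> real (Suc p) * ?h p" unfolding hT using True by simp
          show "norm (f (fst (grid_state T p l \<omega>)) (snd (grid_state T p l \<omega>))) \<le> B" if "l < Suc p" for l
            using that by (intro fB grid_state_norm[OF T _ R(2)]) auto
        qed (use mesh_pos[OF T] B0 in auto)
        moreover have "norm (?c s) \<le> B" using R(2)[of s] True by (intro fB) auto
        ultimately have "norm (?v p s - ?c s) \<le> 2 * B" using norm_triangle_ineq4[of "?v p s" "?c s"] by linarith
        then have "norm (?v p s - ?c s) ^ r \<le> (2 * B) ^ r" by (intro power_mono) auto
        then show ?thesis using True by (simp add: ennreal_leI)
      qed (use r in \<open>simp add: zero_power\<close>)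
    qed
    show "(\<integral>\<^sup>+s. ennreal ((2 * B) ^ r) * indicator {0..T} s \<partial>lborel) < \<infinity>"
      using T by (subst nn_integral_cmult_indicator) (auto simp: ennreal_mult_less_top)
    have "countable {s. 0 < s \<and> left_limit ?c s \<noteq> ?c s}" by (rule cadlag_jumps_countable[OF composed_cadlag[OF \<omega> f]])
    then have "countable (insert 0 {s. 0 < s \<and> left_limit ?c s \<noteq> ?c s})" by simp
    then have "insert 0 {s. 0 < s \<and> left_limit ?c s \<noteq> ?c s} \<in> null_sets lborel"
      by (rule countable_imp_null_set_lborel)
    then have "AE s in lborel. s \<notin> insert 0 {s. 0 < s \<and> left_limit ?c s \<noteq> ?c s}" by (rule AE_not_in)
    then show "AE s in lborel. (\<lambda>p. ennreal (norm (indicator {0..T} s *\<^sub>R ?v p s - indicator {0..T} s *\<^sub>R ?c s) ^ r)) \<longlonglongrightarrow> 0"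
    proof eventually_elim
      case (elim s)
      show ?case
      proof (cases "s \<in> {0..T}")
        case True
        then have s: "0 < s" "s \<le> T" and eq: "left_limit ?c s = ?c s" using elim by auto
        have e: "f (left_limit (\<lambda>s. X s \<omega>) s) (left_state (\<lambda>s. \<alpha> s \<omega>) s) = ?c s"
          using cadlag_compose_state(2)[where f = f and X = "\<lambda>s. X s \<omega>" and a = "\<lambda>s. \<alpha> s \<omega>", OF X_cadlag[OF \<omega>] \<alpha>_cadlag[OF \<omega>] f s(1)] unfolding eq by simp
        have "(\<lambda>p. ?v p s) \<longlonglongrightarrow> ?c s"
          using step_path_tendsto[where f = f, OF T \<omega> f s] unfolding e .
        then have "(\<lambda>p. norm (?v p s - ?c s) ^ r) \<longlonglongrightarrow> norm (?c s - ?c s) ^ r" by (intro tendsto_intros)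
        moreover have "norm (?c s - ?c s) ^ r = 0" using r by simp
        ultimately have "(\<lambda>p. norm (?v p s - ?c s) ^ r) \<longlonglongrightarrow> 0" by (simp only:)
        from tendsto_ennrealI[OF this] have "(\<lambda>p. ennreal (norm (?v p s - ?c s) ^ r)) \<longlonglongrightarrow> 0" unfolding ennreal_0 .
        moreover have "indicator {0..T} s = (1::real)" using True by simp
        ultimately show ?thesis by (simp only: scaleR_one)
      qed (use r in \<open>simp add: zero_power\<close>)
    qed
  qed simp_all
  moreover have "(\<integral>\<^sup>+s. ennreal (norm (indicator {0..T} s *\<^sub>R ?v p s - indicator {0..T} s *\<^sub>R ?c s) ^ r) \<partial>lborel) = step_gap f r T p (Suc p) \<omega>" for p
    unfolding step_gap_def hT using r by (intro nn_integral_cong) (auto simp: zero_power split: split_indicator)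
  ultimately show ?thesis by simp
qed

end

section \<open>Riemann sums of the drift and of the jumps\<close>

context regime_solution
begin

lemma drift_gap:
  assumes T: "0 < T" and \<omega>: "\<omega> \<in> space M" and k: "k \<le> Suc p"
  shows "ennreal (norm ((\<Sum>j<k. mesh T p *\<^sub>R b (fst (grid_state T p j \<omega>)) (snd (grid_state T p j \<omega>)))
      - (LINT s:{0..real k * mesh T p}|lborel. b (X s \<omega>) (\<alpha> s \<omega>)))) \<le> step_gap b 1 T p (Suc p) \<omega>"
proof -
  let ?h = "mesh T p" and ?\<xi> = "\<lambda>l. b (fst (grid_state T p l \<omega>)) (snd (grid_state T p l \<omega>))"
  let ?v = "partition_value (\<lambda>l. real l * ?h) k ?\<xi>" and ?I = "indicator {0..real k * ?h} :: real \<Rightarrow> real"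
  have h: "0 < ?h" by (rule mesh_pos[OF T])
  obtain R where R: "0 \<le> R" "\<And>s. 0 \<le> s \<Longrightarrow> s \<le> T \<Longrightarrow> norm (X s \<omega>) \<le> R" using path_bounded[OF \<omega> T] by blast
  have ii: "integrable lborel (\<lambda>s. indicator {real l * ?h<..real (Suc l) * ?h} s :: real)" for l
  proof -
    have "real l * ?h \<le> real (Suc l) * ?h" using h by (intro mult_right_mono) auto
    then show ?thesis by (intro integrable_real_indicator) (simp_all del: of_nat_Suc)
  qed
  have iv: "integrable lborel ?v"
    unfolding partition_value_def[abs_def] using ii by (intro Bochner_Integration.integrable_sum integrable_scaleR_left) auto
  have v: "(\<integral>s. ?v s \<partial>lborel) = (\<Sum>j<k. ?h *\<^sub>R ?\<xi> j)"
  proof -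
    have "(\<integral>s. ?v s \<partial>lborel) = (\<Sum>l<k. (\<integral>s. indicator {real l * ?h<..real (Suc l) * ?h} s \<partial>lborel) *\<^sub>R ?\<xi> l)"
      unfolding partition_value_def using ii
      by (subst Bochner_Integration.integral_sum) (auto intro!: integrable_scaleR_left sum.cong integral_scaleR_left)
    also have "\<dots> = (\<Sum>j<k. ?h *\<^sub>R ?\<xi> j)"
    proof (intro sum.cong refl arg_cong2[where f = scaleR])
      fix l
      have "real l * ?h \<le> real (Suc l) * ?h" using h by (intro mult_right_mono) auto
      then show "(\<integral>s. indicator {real l * ?h<..real (Suc l) * ?h} s \<partial>lborel) = ?h"
        by (simp add: algebra_simps)
    qed
    finally show ?thesis .
  qed
  have Iv: "?I s *\<^sub>R ?v s = ?v s" for s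
  proof (cases "s \<in> {0..real k * ?h}")
    case False
    have "s \<notin> {real l * ?h<..real (Suc l) * ?h}" if "l < k" for l
    proof -
      have "real (Suc l) * ?h \<le> real k * ?h" using that h by (intro mult_right_mono) auto
      moreover have "0 \<le> real l * ?h" using h by simp
      ultimately show ?thesis using False unfolding greaterThanAtMost_iff atLeastAtMost_iff by linarith
    qed
    then have "?v s = 0" unfolding partition_value_def by (intro sum.neutral) auto
    then show ?thesis by simp
  qed simp
  have ic: "integrable lborel (\<lambda>s. ?I s *\<^sub>R b (X s \<omega>) (\<alpha> s \<omega>))"
  proof (rule Bochner_Integration.integrable_bound)
    show "integrable lborel (\<lambda>s. K * (1 + R) * ?I s)"
      using h by (intro integrable_mult_right integrable_real_indicator) (auto simp: less_top[symmetric])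
    show "(\<lambda>s. ?I s *\<^sub>R b (X s \<omega>) (\<alpha> s \<omega>)) \<in> borel_measurable lborel"
      using composed_path_measurable[OF b_cont \<omega>] by simp
    show "AE s in lborel. norm (?I s *\<^sub>R b (X s \<omega>) (\<alpha> s \<omega>)) \<le> norm (K * (1 + R) * ?I s)"
    proof (rule AE_I2)
      fix s
      show "norm (?I s *\<^sub>R b (X s \<omega>) (\<alpha> s \<omega>)) \<le> norm (K * (1 + R) * ?I s)"
      proof (cases "s \<in> {0..real k * ?h}")
        case True
        then have "norm (b (X s \<omega>) (\<alpha> s \<omega>)) \<le> K * (1 + R)"
          using grid_time_le[OF T k] by (intro growth_bound R(2)) auto
        then show ?thesis using True K_nonneg R(1) by simp
      qed simp
    qed
  qed
  have diff: "(\<Sum>j<k. ?h *\<^sub>R ?\<xi> j) - (LINT s:{0..real k * ?h}|lborel. b (X s \<omega>) (\<alpha> s \<omega>)) = (\<integral>s. ?v s - ?I s *\<^sub>R b (X s \<omega>) (\<alpha> s \<omega>) \<partial>lborel)"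
    unfolding v[symmetric] set_lebesgue_integral_def using iv ic by simp
  have "ennreal (norm (\<integral>s. ?v s - ?I s *\<^sub>R b (X s \<omega>) (\<alpha> s \<omega>) \<partial>lborel)) \<le> (\<integral>\<^sup>+s. ennreal (norm (?v s - ?I s *\<^sub>R b (X s \<omega>) (\<alpha> s \<omega>))) \<partial>lborel)"
    using iv ic by (intro integral_norm_bound_ennreal) auto
  also have "\<dots> = step_gap b 1 T p k \<omega>"
    unfolding step_gap_def by (intro nn_integral_cong) (subst Iv[symmetric], auto split: split_indicator)
  also have "\<dots> \<le> step_gap b 1 T p (Suc p) \<omega>" by (rule step_gap_mono[OF T k])
  finally show ?thesis unfolding diff .
qed

definition past_jump :: "'w \<Rightarrow> real \<times> 'e \<Rightarrow> real^'r" where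
  "past_jump \<omega> q = g (left_limit (\<lambda>s. X s \<omega>) (fst q)) (left_state (\<lambda>s. \<alpha> s \<omega>) (fst q)) (snd q)"

definition grid_jump :: "real \<Rightarrow> nat \<Rightarrow> nat \<Rightarrow> 'w \<Rightarrow> real \<times> 'e \<Rightarrow> real^'r" where
  "grid_jump T p k \<omega> q = partition_value (\<lambda>l. real l * mesh T p) k (\<lambda>l. g (fst (grid_state T p l \<omega>)) (snd (grid_state T p l \<omega>)) (snd q)) (fst q)"

definition jump_gap :: "real \<Rightarrow> nat \<Rightarrow> 'w \<Rightarrow> ennreal" where
  "jump_gap T p \<omega> = (\<integral>\<^sup>+q. ennreal (norm (indicator ({0<..T} \<times> marks) q *\<^sub>R grid_jump T p (Suc p) \<omega> q - indicator ({0<..T} \<times> marks) q *\<^sub>R past_jump \<omega> q)) \<partial>N \<omega>)"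

lemma fst_prm: "fst \<in> measurable (prm_intensity \<nu>) borel"
proof -
  have "fst \<in> measurable (prm_intensity \<nu>) (restrict_space lborel {0..})" unfolding prm_intensity_def by simp
  then show ?thesis by (rule measurable_compose) (simp add: measurable_restrict_space1)
qed

lemma grid_jump_measurable: "grid_jump T p k \<omega> \<in> borel_measurable (prm_intensity \<nu>)"
proof -
  have "(\<lambda>q. indicator {real l * mesh T p<..real (Suc l) * mesh T p} (fst q) *\<^sub>R g (fst (grid_state T p l \<omega>)) (snd (grid_state T p l \<omega>)) (snd q))
     \<in> borel_measurable (prm_intensity \<nu>)" for l
    using fst_prm measurable_compose[OF snd_prm g_meas] by measurable
  then show ?thesis unfolding grid_jump_def[abs_def] partition_value_def by (intro borel_measurable_sum)
qed

lemma slab_indicator_measurable: "(indicator ({0<..t} \<times> marks) :: real \<times> 'e \<Rightarrow> real) \<in> borel_measurable (prm_intensity \<nu>)"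
  using slab_sets[of 0 t] by simp

text \<open>Convergence at every time and not only at almost every one is essential here, because N
  charges single times. It holds since the integrand of the equation is itself the left
  limit.\<close>

lemma grid_jump_tendsto:
  assumes T: "0 < T" and \<omega>: "\<omega> \<in> space M"
  shows "(\<lambda>p. indicator ({0<..T} \<times> marks) q *\<^sub>R grid_jump T p (Suc p) \<omega> q) \<longlonglongrightarrow> indicator ({0<..T} \<times> marks) q *\<^sub>R past_jump \<omega> q"
proof (cases "q \<in> {0<..T} \<times> marks")
  case True
  then have q: "0 < fst q" "fst q \<le> T" "snd q \<in> marks" by auto
  show ?thesis using step_path_tendsto[where f = "\<lambda>v i. g v i (snd q)", OF T \<omega> g_cont[OF q(3)] q(1,2)] True
    by (simp add: grid_jump_def past_jump_def)
qed simp

text \<open>A pointwise limit of grid jumps, which are finite sums; this settles the left-limit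
  integrand without a theory of predictable processes.\<close>

lemma past_jump_measurable:
  assumes T: "0 < T" and \<omega>: "\<omega> \<in> space M"
  shows "(\<lambda>q. indicator ({0<..T} \<times> marks) q *\<^sub>R past_jump \<omega> q) \<in> borel_measurable (prm_intensity \<nu>)"
  by (rule borel_measurable_LIMSEQ_metric[OF _ grid_jump_tendsto[OF T \<omega>]])
     (intro borel_measurable_scaleR slab_indicator_measurable grid_jump_measurable)

lemma jump_bounds:
  assumes T: "0 < T" and \<omega>: "\<omega> \<in> space M"
  obtains B where "0 \<le> B" "\<And>p q. norm (indicator ({0<..T} \<times> marks) q *\<^sub>R grid_jump T p (Suc p) \<omega> q) \<le> B * indicator ({0<..T} \<times> marks) q"
    "\<And>q. norm (indicator ({0<..T} \<times> marks) q *\<^sub>R past_jump \<omega> q) \<le> B * indicator ({0<..T} \<times> marks) q"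
proof -
  obtain R where R: "0 \<le> R" "\<And>s. 0 \<le> s \<Longrightarrow> s \<le> T \<Longrightarrow> norm (X s \<omega>) \<le> R" using path_bounded[OF \<omega> T] by blast
  define B where "B = K * (1 + (R + real CARD('r)))"
  have B0: "0 \<le> B" using K_nonneg R by (simp add: B_def)
  have 1: "norm (indicator ({0<..T} \<times> marks) q *\<^sub>R grid_jump T p (Suc p) \<omega> q) \<le> B * indicator ({0<..T} \<times> marks) q" for p q
  proof (cases "q \<in> {0<..T} \<times> marks")
    case True
    then have q: "fst q \<le> T" "snd q \<in> marks" by auto
    have "norm (grid_jump T p (Suc p) \<omega> q) \<le> B"
      unfolding grid_jump_def
    proof (rule partition_value_norm_le[OF mesh_pos[OF T]])
      show "fst q \<le> real (Suc p) * mesh T p" unfolding mesh_total by (rule q(1))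
      show "norm (g (fst (grid_state T p l \<omega>)) (snd (grid_state T p l \<omega>)) (snd q)) \<le> B" if "l < Suc p" for l
        unfolding B_def using that q(2) by (intro growth_bound grid_state_norm[OF T _ R(2)]) auto
    qed (rule B0)
    then show ?thesis using True by simp
  qed simp
  have 2: "norm (indicator ({0<..T} \<times> marks) q *\<^sub>R past_jump \<omega> q) \<le> B * indicator ({0<..T} \<times> marks) q" for q
    by (rule tendsto_upperbound[OF tendsto_norm[OF grid_jump_tendsto[OF T \<omega>]]]) (use 1 in auto)
  show ?thesis by (rule that[OF B0 1 2])
qed

lemma jump_gap_tendsto:
  assumes T: "0 < T" and \<omega>: "\<omega> \<in> space M" and fin: "emeasure (N \<omega>) ({0<..T} \<times> marks) < \<infinity>"
  shows "(\<lambda>p. jump_gap T p \<omega>) \<longlonglongrightarrow> 0"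
proof -
  obtain B where B: "0 \<le> B" "\<And>p q. norm (indicator ({0<..T} \<times> marks) q *\<^sub>R grid_jump T p (Suc p) \<omega> q) \<le> B * indicator ({0<..T} \<times> marks) q"
    "\<And>q. norm (indicator ({0<..T} \<times> marks) q *\<^sub>R past_jump \<omega> q) \<le> B * indicator ({0<..T} \<times> marks) q"
    using jump_bounds[OF T \<omega>] by blast
  have "(\<lambda>p. jump_gap T p \<omega>) \<longlonglongrightarrow> (\<integral>\<^sup>+q. 0 \<partial>N \<omega>)"
    unfolding jump_gap_def
  proof (rule nn_integral_dominated_convergence[where w = "\<lambda>q. ennreal (2 * B) * indicator ({0<..T} \<times> marks) q"])
    show "(\<lambda>q. ennreal (norm (indicator ({0<..T} \<times> marks) q *\<^sub>R grid_jump T p (Suc p) \<omega> q - indicator ({0<..T} \<times> marks) q *\<^sub>R past_jump \<omega> q))) \<in> borel_measurable (N \<omega>)" for p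
      unfolding measurable_N[OF \<omega>]
      using past_jump_measurable[OF T \<omega>] borel_measurable_scaleR[OF slab_indicator_measurable[of T] grid_jump_measurable[of T p "Suc p" \<omega>]] by measurable
    show "(\<lambda>q. ennreal (2 * B) * indicator ({0<..T} \<times> marks) q) \<in> borel_measurable (N \<omega>)"
      unfolding measurable_N[OF \<omega>] using slab_sets[of 0 T] by measurable
    show "AE q in N \<omega>. ennreal (norm (indicator ({0<..T} \<times> marks) q *\<^sub>R grid_jump T p (Suc p) \<omega> q - indicator ({0<..T} \<times> marks) q *\<^sub>R past_jump \<omega> q))
       \<le> ennreal (2 * B) * indicator ({0<..T} \<times> marks) q" for p
    proof (rule AE_I2)
      fix q
      have "norm (indicator ({0<..T} \<times> marks) q *\<^sub>R grid_jump T p (Suc p) \<omega> q - indicator ({0<..T} \<times> marks) q *\<^sub>R past_jump \<omega> q)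
        \<le> B * indicator ({0<..T} \<times> marks) q + B * indicator ({0<..T} \<times> marks) q"
        by (rule order_trans[OF norm_triangle_ineq4 add_mono[OF B(2) B(3)]])
      then have "ennreal (norm (indicator ({0<..T} \<times> marks) q *\<^sub>R grid_jump T p (Suc p) \<omega> q - indicator ({0<..T} \<times> marks) q *\<^sub>R past_jump \<omega> q))
        \<le> ennreal (B * indicator ({0<..T} \<times> marks) q + B * indicator ({0<..T} \<times> marks) q)" by (rule ennreal_leI)
      also have "\<dots> = ennreal (2 * B) * indicator ({0<..T} \<times> marks) q" by (auto split: split_indicator)
      finally show "ennreal (norm (indicator ({0<..T} \<times> marks) q *\<^sub>R grid_jump T p (Suc p) \<omega> q - indicator ({0<..T} \<times> marks) q *\<^sub>R past_jump \<omega> q))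
       \<le> ennreal (2 * B) * indicator ({0<..T} \<times> marks) q" .
    qed
    show "(\<integral>\<^sup>+q. ennreal (2 * B) * indicator ({0<..T} \<times> marks) q \<partial>N \<omega>) < \<infinity>"
      using fin slab_sets[of 0 T] sets_N[OF \<omega>] by (subst nn_integral_cmult_indicator) (auto simp: ennreal_mult_less_top)
    show "AE q in N \<omega>. (\<lambda>p. ennreal (norm (indicator ({0<..T} \<times> marks) q *\<^sub>R grid_jump T p (Suc p) \<omega> q - indicator ({0<..T} \<times> marks) q *\<^sub>R past_jump \<omega> q))) \<longlonglongrightarrow> 0"
    proof (rule AE_I2)
      fix q
      have "(\<lambda>p. norm (indicator ({0<..T} \<times> marks) q *\<^sub>R grid_jump T p (Suc p) \<omega> q - indicator ({0<..T} \<times> marks) q *\<^sub>R past_jump \<omega> q)) \<longlonglongrightarrow>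
         norm (indicator ({0<..T} \<times> marks) q *\<^sub>R past_jump \<omega> q - indicator ({0<..T} \<times> marks) q *\<^sub>R past_jump \<omega> q)"
        by (intro tendsto_norm tendsto_diff tendsto_const grid_jump_tendsto[OF T \<omega>])
      then have "(\<lambda>p. norm (indicator ({0<..T} \<times> marks) q *\<^sub>R grid_jump T p (Suc p) \<omega> q - indicator ({0<..T} \<times> marks) q *\<^sub>R past_jump \<omega> q)) \<longlonglongrightarrow> 0"
        by simp
      from tendsto_ennrealI[OF this]
      show "(\<lambda>p. ennreal (norm (indicator ({0<..T} \<times> marks) q *\<^sub>R grid_jump T p (Suc p) \<omega> q - indicator ({0<..T} \<times> marks) q *\<^sub>R past_jump \<omega> q))) \<longlonglongrightarrow> 0"
        by simp
    qed
  qed simp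
  then show ?thesis by simp
qed

lemma jump_sum_gap:
  assumes T: "0 < T" and \<omega>: "\<omega> \<in> space M" and k: "k \<le> Suc p" and fin: "emeasure (N \<omega>) ({0<..T} \<times> marks) < \<infinity>"
    and zero: "emeasure (N \<omega>) ({0} \<times> marks) = 0"
  shows "ennreal (norm ((\<Sum>j<k. jump (g (fst (grid_state T p j \<omega>)) (snd (grid_state T p j \<omega>))) (real j * mesh T p) (real j * mesh T p + mesh T p) \<omega>)
      - (LINT q:({0..real k * mesh T p} \<times> marks)|N \<omega>. past_jump \<omega> q))) \<le> jump_gap T p \<omega>"
proof -
  let ?h = "mesh T p" and ?t = "real k * mesh T p"
  let ?S = "indicator ({0<..T} \<times> marks) :: real \<times> 'e \<Rightarrow> real" and ?I = "indicator ({0<..?t} \<times> marks) :: real \<times> 'e \<Rightarrow> real"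
  have h: "0 < ?h" by (rule mesh_pos[OF T])
  have tT: "?t \<le> T" by (rule grid_time_le[OF T k])
  obtain B where B: "0 \<le> B" "\<And>p q. norm (?S q *\<^sub>R grid_jump T p (Suc p) \<omega> q) \<le> B * ?S q" "\<And>q. norm (?S q *\<^sub>R past_jump \<omega> q) \<le> B * ?S q"
    using jump_bounds[OF T \<omega>] by blast
  have mG: "(\<lambda>q. ?S q *\<^sub>R grid_jump T p (Suc p) \<omega> q) \<in> borel_measurable (N \<omega>)"
    unfolding measurable_N[OF \<omega>] by (intro borel_measurable_scaleR slab_indicator_measurable grid_jump_measurable)
  have mP: "(\<lambda>q. ?S q *\<^sub>R past_jump \<omega> q) \<in> borel_measurable (N \<omega>)"
    unfolding measurable_N[OF \<omega>] by (rule past_jump_measurable[OF T \<omega>])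
  have iS: "integrable (N \<omega>) (\<lambda>q. B * ?S q)"
    using fin slab_sets[of 0 T] sets_N[OF \<omega>] by (intro integrable_mult_right integrable_real_indicator) auto
  have iG: "integrable (N \<omega>) (\<lambda>q. ?S q *\<^sub>R grid_jump T p (Suc p) \<omega> q)"
    by (rule Bochner_Integration.integrable_bound[OF iS mG]) (use B in \<open>auto intro!: AE_I2 order_trans[OF B(2)]\<close>)
  have iP: "integrable (N \<omega>) (\<lambda>q. ?S q *\<^sub>R past_jump \<omega> q)"
    by (rule Bochner_Integration.integrable_bound[OF iS mP]) (use B in \<open>auto intro!: AE_I2 order_trans[OF B(3)]\<close>)
  have It: "{0<..?t} \<times> marks \<in> sets (N \<omega>)" using slab_sets[of 0 ?t] sets_N[OF \<omega>] by simp
  have IS: "?I q * ?S q = ?I q" for q using tT by (auto split: split_indicator)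
  have iIG: "integrable (N \<omega>) (\<lambda>q. ?I q *\<^sub>R (?S q *\<^sub>R grid_jump T p (Suc p) \<omega> q))"
    by (rule integrable_mult_indicator[OF It iG])
  have iIP: "integrable (N \<omega>) (\<lambda>q. ?I q *\<^sub>R (?S q *\<^sub>R past_jump \<omega> q))"
    by (rule integrable_mult_indicator[OF It iP])
  have term_eq: "indicator ({real l * ?h<..real l * ?h + ?h} \<times> marks) q *\<^sub>R c = ?I q *\<^sub>R (indicator {real l * ?h<..real (Suc l) * ?h} (fst q) *\<^sub>R c)"
    if "l < k" "q \<in> space (N \<omega>)" for l q and c :: "real^'r"
  proof -
    have "real (Suc l) * ?h \<le> ?t" using that h by (intro mult_right_mono) auto
    moreover have "0 \<le> real l * ?h" using h by simp
    moreover have "real (Suc l) * ?h = real l * ?h + ?h" by (simp add: algebra_simps)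
    ultimately show ?thesis using that(2) unfolding space_N[OF \<omega>] by (cases q) (auto simp: indicator_def simp del: of_nat_Suc)
  qed
  have sum_eq: "(\<Sum>j<k. indicator ({real j * ?h<..real j * ?h + ?h} \<times> marks) q *\<^sub>R g (fst (grid_state T p j \<omega>)) (snd (grid_state T p j \<omega>)) (snd q))
     = ?I q *\<^sub>R (?S q *\<^sub>R grid_jump T p (Suc p) \<omega> q)" if q: "q \<in> space (N \<omega>)" for q
  proof -
    have "(\<Sum>j<k. indicator ({real j * ?h<..real j * ?h + ?h} \<times> marks) q *\<^sub>R g (fst (grid_state T p j \<omega>)) (snd (grid_state T p j \<omega>)) (snd q))
      = ?I q *\<^sub>R grid_jump T p k \<omega> q"
      unfolding grid_jump_def partition_value_def scaleR_sum_right using q by (intro sum.cong refl term_eq) auto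
    also have "\<dots> = ?I q *\<^sub>R grid_jump T p (Suc p) \<omega> q"
    proof (cases "q \<in> {0<..?t} \<times> marks")
      case True
      then have "fst q \<le> ?t" by auto
      then show ?thesis unfolding grid_jump_def by (simp only: partition_value_restrict[OF h k])
    qed simp
    also have "\<dots> = ?I q *\<^sub>R (?S q *\<^sub>R grid_jump T p (Suc p) \<omega> q)" using IS[of q] by simp
    finally show ?thesis .
  qed
  have 1: "(\<Sum>j<k. jump (g (fst (grid_state T p j \<omega>)) (snd (grid_state T p j \<omega>))) (real j * ?h) (real j * ?h + ?h) \<omega>)
    = (\<integral>q. ?I q *\<^sub>R (?S q *\<^sub>R grid_jump T p (Suc p) \<omega> q) \<partial>N \<omega>)"
  proof -
    have int: "integrable (N \<omega>) (\<lambda>q. indicator ({real j * ?h<..real j * ?h + ?h} \<times> marks) q *\<^sub>R g (fst (grid_state T p j \<omega>)) (snd (grid_state T p j \<omega>)) (snd q))" if "j < k" for j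
    proof (rule jump_integrable_N[OF g_meas _ _ \<omega>])
      have "real (Suc j) * ?h \<le> T" using that k by (intro grid_time_le[OF T]) auto
      moreover have "0 \<le> real j * ?h" using h by simp
      moreover have "real (Suc j) * ?h = real j * ?h + ?h" by (simp add: algebra_simps)
      ultimately have "u \<in> {0<..T}" if "u \<in> {real j * ?h<..real j * ?h + ?h}" for u
        using that unfolding greaterThanAtMost_iff by linarith
      then have "{real j * ?h<..real j * ?h + ?h} \<times> marks \<subseteq> {0<..T} \<times> marks" by blast
      then have "emeasure (N \<omega>) ({real j * ?h<..real j * ?h + ?h} \<times> marks) \<le> emeasure (N \<omega>) ({0<..T} \<times> marks)"
        using slab_sets[of 0 T] sets_N[OF \<omega>] by (intro emeasure_mono) auto
      then show "emeasure (N \<omega>) ({real j * ?h<..real j * ?h + ?h} \<times> marks) < \<infinity>" using fin by (rule le_less_trans)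
    qed (use g_growth h in auto)
    have "(\<Sum>j<k. jump (g (fst (grid_state T p j \<omega>)) (snd (grid_state T p j \<omega>))) (real j * ?h) (real j * ?h + ?h) \<omega>)
      = (\<integral>q. (\<Sum>j<k. indicator ({real j * ?h<..real j * ?h + ?h} \<times> marks) q *\<^sub>R g (fst (grid_state T p j \<omega>)) (snd (grid_state T p j \<omega>)) (snd q)) \<partial>N \<omega>)"
      unfolding jump_def by (rule Bochner_Integration.integral_sum[symmetric], rule int, simp)
    also have "\<dots> = (\<integral>q. ?I q *\<^sub>R (?S q *\<^sub>R grid_jump T p (Suc p) \<omega> q) \<partial>N \<omega>)"
      by (rule Bochner_Integration.integral_cong[OF refl sum_eq])
    finally show ?thesis .
  qed
  \<comment> \<open>The equation integrates over an interval closed at 0, the grid cells are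
    left-open. The two differ by points at time 0, which \<open>zero\<close> excludes.\<close>
  have 2: "(LINT q:({0..?t} \<times> marks)|N \<omega>. past_jump \<omega> q) = (\<integral>q. ?I q *\<^sub>R (?S q *\<^sub>R past_jump \<omega> q) \<partial>N \<omega>)"
    unfolding set_lebesgue_integral_def
  proof (rule integral_cong_AE)
    have Z: "{0} \<times> marks \<in> sets (N \<omega>)" using sets_slab[of "{0}" marks] sets_N[OF \<omega>] by auto
    then have "AE q in N \<omega>. q \<notin> {0} \<times> marks" using zero by (intro AE_not_in) (simp add: null_sets_def)
    then show "AE q in N \<omega>. indicator ({0..?t} \<times> marks) q *\<^sub>R past_jump \<omega> q = ?I q *\<^sub>R (?S q *\<^sub>R past_jump \<omega> q)"
    proof eventually_elim
      case (elim q)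
      then show ?case using IS[of q] by (cases q) (auto simp: indicator_def)
    qed
    show "(\<lambda>q. ?I q *\<^sub>R (?S q *\<^sub>R past_jump \<omega> q)) \<in> borel_measurable (N \<omega>)" using iIP by auto
    \<comment> \<open>Measurability of the integrand on the closed interval: time 0 is split off,
      where by convention the left limits are the initial values.\<close>
    have "indicator ({0..?t} \<times> marks) q *\<^sub>R past_jump \<omega> q = ?I q *\<^sub>R (?S q *\<^sub>R past_jump \<omega> q) + indicator ({0} \<times> marks) q *\<^sub>R g (X 0 \<omega>) (\<alpha> 0 \<omega>) (snd q)" for q
      using IS[of q] h by (cases q) (auto simp: indicator_def past_jump_def left_limit_def left_state_def)
    moreover have "(\<lambda>q. ?I q *\<^sub>R (?S q *\<^sub>R past_jump \<omega> q) + indicator ({0} \<times> marks) q *\<^sub>R g (X 0 \<omega>) (\<alpha> 0 \<omega>) (snd q)) \<in> borel_measurable (N \<omega>)"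
    proof -
      have "(\<lambda>q. g (X 0 \<omega>) (\<alpha> 0 \<omega>) (snd q)) \<in> borel_measurable (N \<omega>)"
        unfolding measurable_N[OF \<omega>] by (rule measurable_compose[OF snd_prm g_meas])
      then show ?thesis
        by (rule borel_measurable_add[OF borel_measurable_integrable[OF iIP] borel_measurable_scaleR[OF borel_measurable_indicator[OF Z]]])
    qed
    ultimately show "(\<lambda>q. indicator ({0..?t} \<times> marks) q *\<^sub>R past_jump \<omega> q) \<in> borel_measurable (N \<omega>)" by simp
  qed
  have "ennreal (norm ((\<integral>q. ?I q *\<^sub>R (?S q *\<^sub>R grid_jump T p (Suc p) \<omega> q) \<partial>N \<omega>) - (\<integral>q. ?I q *\<^sub>R (?S q *\<^sub>R past_jump \<omega> q) \<partial>N \<omega>)))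
    = ennreal (norm (\<integral>q. ?I q *\<^sub>R (?S q *\<^sub>R grid_jump T p (Suc p) \<omega> q) - ?I q *\<^sub>R (?S q *\<^sub>R past_jump \<omega> q) \<partial>N \<omega>))"
    using iIG iIP by simp
  also have "\<dots> \<le> (\<integral>\<^sup>+q. ennreal (norm (?I q *\<^sub>R (?S q *\<^sub>R grid_jump T p (Suc p) \<omega> q) - ?I q *\<^sub>R (?S q *\<^sub>R past_jump \<omega> q))) \<partial>N \<omega>)"
    using iIG iIP by (intro integral_norm_bound_ennreal Bochner_Integration.integrable_diff)
  also have "\<dots> \<le> jump_gap T p \<omega>"
    unfolding jump_gap_def
  proof (rule nn_integral_mono, rule ennreal_leI)
    fix q
    show "norm (?I q *\<^sub>R (?S q *\<^sub>R grid_jump T p (Suc p) \<omega> q) - ?I q *\<^sub>R (?S q *\<^sub>R past_jump \<omega> q)) \<le> norm (?S q *\<^sub>R grid_jump T p (Suc p) \<omega> q - ?S q *\<^sub>R past_jump \<omega> q)"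
      by (cases "q \<in> {0<..?t} \<times> marks") auto
  qed
  finally show ?thesis unfolding 1 2 .
qed

lemma no_jump_at_zero: "AE \<omega> in M. emeasure (N \<omega>) ({0} \<times> marks) = 0"
proof -
  interpret nu: finite_measure \<nu> by (rule finite_marks)
  have Z: "{0} \<times> marks \<in> sets (prm_intensity \<nu>)" by (rule sets_slab) auto
  have S: "{0} \<in> sets (restrict_space lborel {0::real..})" by (auto simp: sets_restrict_space image_iff intro!: bexI[of _ "{0}"])
  have "emeasure (prm_intensity \<nu>) ({0} \<times> marks) = emeasure (restrict_space lborel {0::real..}) {0} * emeasure \<nu> marks"
    unfolding prm_intensity_def using S by (intro nu.emeasure_pair_measure_Times) auto
  also have "emeasure (restrict_space lborel {0::real..}) {0} = 0" by (subst emeasure_restrict_space) auto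
  finally have "emeasure (prm_intensity \<nu>) ({0} \<times> marks) = ennreal 0" by simp
  from count_mean[OF Z this] have "(\<integral>\<^sup>+\<omega>. emeasure (N \<omega>) ({0} \<times> marks) \<partial>M) = 0" by simp
  then show ?thesis using N_measurable[OF Z] by (simp add: nn_integral_0_iff_AE)
qed

text \<open>The remainder without the stochastic integral is small along almost every path,
  uniformly in k. The stochastic integral is compared for each k separately, so the result is
  uniform in k as a bound on probabilities and not on a maximum.\<close>

lemma approx:
  assumes T: "0 < T" and e: "0 < e"
  shows "\<forall>\<^sub>F p in sequentially. \<forall>k\<le>Suc p. prob {\<omega>\<in>space M. e < norm (euler T p k \<omega> - X (real k * mesh T p) \<omega>)} \<le> e"
proof -
  define tt where "tt p k = real k * mesh T p" for p k
  have tt0: "0 \<le> tt p k" for p k using mesh_pos[OF T, of p] by (simp add: tt_def)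
  define P where "P p k J \<longleftrightarrow> has_ito_integral M F w (\<lambda>s \<omega>. \<sigma> (X s \<omega>) (\<alpha> s \<omega>)) (tt p k) J \<and>
        (AE \<omega> in M. X (tt p k) \<omega> = x + (LINT s:{0..tt p k}|lborel. b (X s \<omega>) (\<alpha> s \<omega>)) + J \<omega> +
           (LINT q:({0..tt p k} \<times> marks)|N \<omega>. past_jump \<omega> q))" for p k J
  define J where "J p k = (SOME J. P p k J)" for p k
  have PJ: "P p k (J p k)" for p k
  proof -
    have "\<exists>J. P p k J" unfolding P_def past_jump_def by (rule equation[OF tt0])
    then show ?thesis unfolding J_def by (rule someI_ex)
  qed
  have J: "has_ito_integral M F w (\<lambda>s \<omega>. \<sigma> (X s \<omega>) (\<alpha> s \<omega>)) (tt p k) (J p k)" for p k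
    using PJ[of p k] unfolding P_def by (rule conjunct1)
  have eq: "AE \<omega> in M. X (tt p k) \<omega> = x + (LINT s:{0..tt p k}|lborel. b (X s \<omega>) (\<alpha> s \<omega>)) + J p k \<omega> +
           (LINT q:({0..tt p k} \<times> marks)|N \<omega>. past_jump \<omega> q)" for p k
    using PJ[of p k] unfolding P_def by (rule conjunct2)
  have JM: "J p k \<in> borel_measurable M" for p k using J[of p k] by (simp add: has_ito_integral_def)
  define W where "W p k \<omega> = (\<Sum>j<k. \<sigma> (fst (grid_state T p j \<omega>)) (snd (grid_state T p j \<omega>)) *v incr (real j * mesh T p) (real j * mesh T p + mesh T p) \<omega>)" for p k \<omega>
  have \<sigma>F: "(\<lambda>\<omega>. \<sigma> (fst (grid_state T p j \<omega>)) (snd (grid_state T p j \<omega>))) \<in> borel_measurable (F (real j * mesh T p))" for p j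
    using grid_state_compose[OF T, of "\<lambda>c \<omega>. \<sigma> (fst c) (snd c)", OF _ order_refl, of j p] by simp
  have WM: "W p k \<in> borel_measurable M" for p k
    unfolding W_def[abs_def] using measurable_F_M[OF \<sigma>F] mesh_pos[OF T, of p]
    by (intro borel_measurable_sum borel_measurable_matrix_vector_mult incr_measurable) auto
  have XM: "X (tt p k) \<in> borel_measurable M" for p k using measurable_F_M[OF X_F[OF tt0] tt0] .
  define R where "R p k \<omega> = euler T p k \<omega> - X (tt p k) \<omega> - (W p k \<omega> - J p k \<omega>)" for p k \<omega>
  have RM: "R p k \<in> borel_measurable M" for p k
    unfolding R_def[abs_def] by (intro borel_measurable_diff euler_M[OF T] XM WM JM)
  define \<Theta> where "\<Theta> p \<omega> = step_gap b 1 T p (Suc p) \<omega> + jump_gap T p \<omega>" for p \<omega>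
  have fin: "AE \<omega> in M. emeasure (N \<omega>) ({0<..T} \<times> marks) < \<infinity>"
    using AE_slab[of 0 T] T by (auto elim!: eventually_mono simp: of_nat_less_top)
  \<comment> \<open>The equation has an exceptional null set for each time; the grid times of all
    meshes are countably many.\<close>
  have "AE \<omega> in M. \<forall>p k. X (tt p k) \<omega> = x + (LINT s:{0..tt p k}|lborel. b (X s \<omega>) (\<alpha> s \<omega>)) + J p k \<omega> +
           (LINT q:({0..tt p k} \<times> marks)|N \<omega>. past_jump \<omega> q)"
    unfolding AE_all_countable using eq by blast
  then have bound: "AE \<omega> in M. \<forall>p. \<forall>k\<le>Suc p. ennreal (norm (R p k \<omega>)) \<le> \<Theta> p \<omega>"
    using fin no_jump_at_zero AE_space
  proof eventually_elim
    case (elim \<omega>)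
    show ?case
    proof (intro allI impI)
      fix p k assume k: "k \<le> Suc p"
      define A where "A = (\<Sum>j<k. mesh T p *\<^sub>R b (fst (grid_state T p j \<omega>)) (snd (grid_state T p j \<omega>))) - (LINT s:{0..tt p k}|lborel. b (X s \<omega>) (\<alpha> s \<omega>))"
      define B where "B = (\<Sum>j<k. jump (g (fst (grid_state T p j \<omega>)) (snd (grid_state T p j \<omega>))) (real j * mesh T p) (real j * mesh T p + mesh T p) \<omega>)
         - (LINT q:({0..tt p k} \<times> marks)|N \<omega>. past_jump \<omega> q)"
      have "R p k \<omega> = A + B"
        unfolding R_def A_def B_def W_def euler_def increment_def elim(1)[rule_format] by (simp add: sum.distrib)
      then have "ennreal (norm (R p k \<omega>)) \<le> ennreal (norm A + norm B)" by (intro ennreal_leI) (simp add: norm_triangle_ineq)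
      also have "\<dots> = ennreal (norm A) + ennreal (norm B)" by simp
      also have "\<dots> \<le> \<Theta> p \<omega>"
        unfolding \<Theta>_def A_def B_def tt_def by (intro add_mono drift_gap jump_sum_gap T k elim)
      finally show "ennreal (norm (R p k \<omega>)) \<le> \<Theta> p \<omega>" .
    qed
  qed
  \<comment> \<open>\<Theta> contains \<open>jump_gap\<close>, whose measurability in \<omega> is
    not established. The maximum of the remainders is measurable and is dominated by
    \<Theta>.\<close>
  define S where "S p \<omega> = (SUP k\<in>{..Suc p}. ennreal (norm (R p k \<omega>)))" for p \<omega>
  have SM: "S p \<in> borel_measurable M" for p
    unfolding S_def[abs_def] using RM by (intro borel_measurable_SUP) auto
  have "AE \<omega> in M. (\<lambda>p. S p \<omega>) \<longlonglongrightarrow> 0"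
    using bound fin AE_space
  proof eventually_elim
    case (elim \<omega>)
    have lim: "(\<lambda>p. \<Theta> p \<omega>) \<longlonglongrightarrow> 0 + 0"
      unfolding \<Theta>_def by (intro tendsto_add step_gap_tendsto jump_gap_tendsto T elim b_cont b_growth) auto
    show ?case
    proof (rule tendsto_sandwich[OF _ _ tendsto_const])
      show "\<forall>\<^sub>F p in sequentially. 0 \<le> S p \<omega>" by simp
      show "\<forall>\<^sub>F p in sequentially. S p \<omega> \<le> \<Theta> p \<omega>"
        using elim(1) by (intro always_eventually) (auto simp: S_def intro!: SUP_least)
      show "(\<lambda>p. \<Theta> p \<omega>) \<longlonglongrightarrow> 0" using lim by simp
    qed
  qed
  from AE_tendsto_zero_imp_prob[OF SM this, of "ennreal (e / 3)"] e
  have "\<forall>\<^sub>F p in sequentially. prob {\<omega>\<in>space M. ennreal (e / 3) < S p \<omega>} < e / 3"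
    by (intro order_tendstoD) auto
  \<comment> \<open>Chosen so that the Lenglart term \<open>4 * \<delta> / (e / 3)\<^sup>2\<close>
    equals e / 3. Of the error e one third goes to the remainder and two thirds to the stochastic
    integral, both in size and in probability.\<close>
  moreover define \<delta> where "\<delta> = (e / 3)\<^sup>2 * e / 12"
  have \<delta>: "0 < \<delta>" "4 * \<delta> / (e / 3)\<^sup>2 = e / 3" using e by (auto simp: \<delta>_def)
  have QM: "step_gap \<sigma> 2 T p k \<in> borel_measurable M" for p k by (rule step_gap_measurable[OF T \<sigma>_cont])
  have "AE \<omega> in M. (\<lambda>p. step_gap \<sigma> 2 T p (Suc p) \<omega>) \<longlonglongrightarrow> 0"
    by (rule AE_I2) (intro step_gap_tendsto T \<sigma>_cont \<sigma>_growth, auto)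
  from AE_tendsto_zero_imp_prob[OF QM this, of "ennreal \<delta>"] \<delta> e
  have "\<forall>\<^sub>F p in sequentially. prob {\<omega>\<in>space M. ennreal \<delta> < step_gap \<sigma> 2 T p (Suc p) \<omega>} < e / 3"
    by (intro order_tendstoD) auto
  ultimately show ?thesis
  proof eventually_elim
    case (elim p)
    show ?case
    proof (intro allI impI)
      fix k assume k: "k \<le> Suc p"
      have it: "prob {\<omega>\<in>space M. 2 * (e / 3) < norm (W p k \<omega> - J p k \<omega>)} \<le> prob {\<omega>\<in>space M. ennreal \<delta> < step_gap \<sigma> 2 T p k \<omega>} + 4 * \<delta> / (e / 3)\<^sup>2"
      proof -
        have sg: "step_gap \<sigma> 2 T p k = (\<lambda>\<omega>. \<integral>\<^sup>+u\<in>{0..tt p k}. ennreal ((norm (partition_value (\<lambda>l. real l * mesh T p) k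
            (\<lambda>l. \<sigma> (fst (grid_state T p l \<omega>)) (snd (grid_state T p l \<omega>))) u - \<sigma> (X u \<omega>) (\<alpha> u \<omega>)))\<^sup>2) \<partial>lborel)"
          by (intro ext) (simp only: step_gap_def tt_def)
        have e3: "0 < e / 3" using e by simp
        show ?thesis
          unfolding sg W_def
          by (rule ito_compare[where H = "\<lambda>s \<omega>. \<sigma> (X s \<omega>) (\<alpha> s \<omega>)" and B = "\<lambda>j \<omega>. \<sigma> (fst (grid_state T p j \<omega>)) (snd (grid_state T p j \<omega>))",
              OF J mesh_pos[OF T] tt_def \<sigma>F composed_path_measurable[where f = \<sigma>, OF \<sigma>_cont] e3 \<delta>(1) QM[of p k, unfolded sg]])
      qed
      have "prob {\<omega>\<in>space M. ennreal \<delta> < step_gap \<sigma> 2 T p k \<omega>} \<le> prob {\<omega>\<in>space M. ennreal \<delta> < step_gap \<sigma> 2 T p (Suc p) \<omega>}"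
        using QM by (intro finite_measure_mono) (auto intro: less_le_trans[OF _ step_gap_mono[OF T k]])
      then have w: "prob {\<omega>\<in>space M. 2 * (e / 3) < norm (W p k \<omega> - J p k \<omega>)} \<le> e / 3 + e / 3"
        using it elim(2) \<delta>(2) by linarith
      have E: "{\<omega>\<in>space M. ennreal (e / 3) < S p \<omega>} \<in> events" "{\<omega>\<in>space M. 2 * (e / 3) < norm (W p k \<omega> - J p k \<omega>)} \<in> events"
        using SM WM JM by measurable
      have "prob {\<omega>\<in>space M. e < norm (euler T p k \<omega> - X (real k * mesh T p) \<omega>)}
        \<le> prob ({\<omega>\<in>space M. ennreal (e / 3) < S p \<omega>} \<union> {\<omega>\<in>space M. 2 * (e / 3) < norm (W p k \<omega> - J p k \<omega>)})"
      proof (rule finite_measure_mono)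
        show "{\<omega>\<in>space M. e < norm (euler T p k \<omega> - X (real k * mesh T p) \<omega>)}
          \<subseteq> {\<omega>\<in>space M. ennreal (e / 3) < S p \<omega>} \<union> {\<omega>\<in>space M. 2 * (e / 3) < norm (W p k \<omega> - J p k \<omega>)}"
        proof
          fix \<omega> assume "\<omega> \<in> {\<omega>\<in>space M. e < norm (euler T p k \<omega> - X (real k * mesh T p) \<omega>)}"
          then have \<omega>: "\<omega> \<in> space M" "e < norm (euler T p k \<omega> - X (real k * mesh T p) \<omega>)" by auto
          have n: "norm (euler T p k \<omega> - X (real k * mesh T p) \<omega>) \<le> norm (R p k \<omega>) + norm (W p k \<omega> - J p k \<omega>)"
            unfolding R_def tt_def using norm_triangle_ineq[of "euler T p k \<omega> - X (real k * mesh T p) \<omega> - (W p k \<omega> - J p k \<omega>)" "W p k \<omega> - J p k \<omega>"] by simp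
          show "\<omega> \<in> {\<omega>\<in>space M. ennreal (e / 3) < S p \<omega>} \<union> {\<omega>\<in>space M. 2 * (e / 3) < norm (W p k \<omega> - J p k \<omega>)}"
          proof (cases "2 * (e / 3) < norm (W p k \<omega> - J p k \<omega>)")
            case False
            then have "e / 3 < norm (R p k \<omega>)" using \<omega>(2) n by linarith
            then have "ennreal (e / 3) < ennreal (norm (R p k \<omega>))" using e by (intro ennreal_lessI) auto
            also have "\<dots> \<le> S p \<omega>" unfolding S_def using k by (intro SUP_upper) auto
            finally show ?thesis using \<omega>(1) by simp
          qed (use \<omega>(1) in simp)
        qed
      qed (use E in auto)
      also have "\<dots> \<le> prob {\<omega>\<in>space M. ennreal (e / 3) < S p \<omega>} + prob {\<omega>\<in>space M. 2 * (e / 3) < norm (W p k \<omega> - J p k \<omega>)}"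
        by (rule measure_Un_le[OF E])
      also have "\<dots> \<le> e" using elim(1) w by linarith
      finally show "prob {\<omega>\<in>space M. e < norm (euler T p k \<omega> - X (real k * mesh T p) \<omega>)} \<le> e" .
    qed
  qed
qed

end

section \<open>Second moments of solutions\<close>

context regime_solution
begin

text \<open>The grid times of all meshes form one countable set, so the exit events lie in a
  measurable event that does not depend on p. These events decrease in n and have empty
  intersection, because each path is bounded.\<close>

lemma exit_small:
  assumes T: "0 < T" and e: "0 < e"
  shows "\<forall>\<^sub>F n in sequentially. \<forall>p. prob {\<omega>\<in>space M. \<exists>j\<le>Suc p. real n < norm (X (real j * mesh T p) \<omega>)} \<le> e"
proof -
  define G where "G = {real j * mesh T p | j p. j \<le> Suc p}"
  have G0: "0 \<le> s" "s \<le> T" if "s \<in> G" for s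
    using that grid_time_le[OF T] mesh_pos[OF T] by (auto simp: G_def less_imp_le)
  have cG: "countable G"
  proof -
    have "G \<subseteq> (\<lambda>(j, p). real j * mesh T p) ` UNIV" by (auto simp: G_def)
    then show ?thesis by (rule countable_subset) simp
  qed
  define A where "A n = (\<Union>s\<in>G. {\<omega>\<in>space M. real n < norm (X s \<omega>)})" for n
  have AM: "A n \<in> events" for n
    unfolding A_def
  proof (intro sets.countable_UN'' cG)
    fix s assume "s \<in> G"
    then have "X s \<in> borel_measurable M" using measurable_F_M[OF X_F] G0(1) by auto
    then show "{\<omega>\<in>space M. real n < norm (X s \<omega>)} \<in> events" by measurable
  qed
  have "decseq A" unfolding decseq_def A_def by (auto intro: le_less_trans)
  then have "(\<lambda>n. prob (A n)) \<longlonglongrightarrow> prob (\<Inter>n. A n)" using AM by (intro finite_Lim_measure_decseq) auto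
  moreover have "(\<Inter>n. A n) = {}"
  proof (rule ccontr)
    assume "(\<Inter>n. A n) \<noteq> {}"
    then obtain \<omega> where \<omega>: "\<And>n. \<omega> \<in> A n" by auto
    then have "\<omega> \<in> space M" using \<omega>[of 0] by (auto simp: A_def)
    then obtain R where R: "\<And>s. 0 \<le> s \<Longrightarrow> s \<le> T \<Longrightarrow> norm (X s \<omega>) \<le> R" using path_bounded T by blast
    obtain n where "R \<le> real n" using real_arch_simple by blast
    then show False using \<omega>[of n] R G0 unfolding A_def by fastforce
  qed
  ultimately have "\<forall>\<^sub>F n in sequentially. prob (A n) < e" using e by (intro order_tendstoD) auto
  then show ?thesis
  proof eventually_elim
    case (elim n)
    show ?case
    proof
      fix p
      have "prob {\<omega>\<in>space M. \<exists>j\<le>Suc p. real n < norm (X (real j * mesh T p) \<omega>)} \<le> prob (A n)"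
        by (rule finite_measure_mono[OF _ AM]) (auto simp: A_def G_def)
      then show "prob {\<omega>\<in>space M. \<exists>j\<le>Suc p. real n < norm (X (real j * mesh T p) \<omega>)} \<le> e" using elim by simp
    qed
  qed
qed

lemma grid_state_dist: "norm (fst (grid_state T p k \<omega>) - X (real k * mesh T p) \<omega>) \<le> real CARD('r) / real (Suc p)"
  unfolding grid_state_def fst_conv by (rule round_vec_dist)

end

lemma (in driving_noise) increment_diff:
  fixes \<phi>1 \<phi>2 :: "'e \<Rightarrow> real^'n"
  assumes \<phi>1: "\<phi>1 \<in> borel_measurable \<nu>" "\<And>\<gamma>. \<gamma> \<in> marks \<Longrightarrow> norm (\<phi>1 \<gamma>) \<le> L1"
    and \<phi>2: "\<phi>2 \<in> borel_measurable \<nu>" "\<And>\<gamma>. \<gamma> \<in> marks \<Longrightarrow> norm (\<phi>2 \<gamma>) \<le> L2"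
    and h: "0 < h" and \<omega>: "\<omega> \<in> space M" and fin: "emeasure (N \<omega>) ({real k * h<..real k * h + h} \<times> marks) < \<infinity>"
  shows "increment h (b1 - c *\<^sub>R b2) (S1 - c *\<^sub>R S2) (\<lambda>\<gamma>. \<phi>1 \<gamma> - c *\<^sub>R \<phi>2 \<gamma>) k \<omega> = increment h b1 S1 \<phi>1 k \<omega> - c *\<^sub>R increment h b2 S2 \<phi>2 k \<omega>"
proof -
  have k0: "0 \<le> real k * h" using h by simp
  note i1 = jump_integrable_N[OF \<phi>1 k0 \<omega> fin] and i2 = jump_integrable_N[OF \<phi>2 k0 \<omega> fin]
  let ?s = "real k * h"
  have "jump (\<lambda>\<gamma>. \<phi>1 \<gamma> - c *\<^sub>R \<phi>2 \<gamma>) ?s (?s + h) \<omega> = (\<integral>q. indicator ({?s<..?s + h} \<times> marks) q *\<^sub>R \<phi>1 (snd q)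
      - c *\<^sub>R (indicator ({?s<..?s + h} \<times> marks) q *\<^sub>R \<phi>2 (snd q)) \<partial>N \<omega>)"
    unfolding jump_def by (intro Bochner_Integration.integral_cong refl) (simp add: scaleR_diff_right mult.commute)
  also have "\<dots> = jump \<phi>1 ?s (?s + h) \<omega> - c *\<^sub>R jump \<phi>2 ?s (?s + h) \<omega>"
    unfolding jump_def integral_scaleR_right[symmetric]
    by (rule Bochner_Integration.integral_diff[OF i1 integrable_scaleR_right[OF i2]])
  finally show ?thesis
    unfolding increment_def by (simp add: matrix_vector_mult_diff_rdistrib scaleR_matrix_vector_assoc[symmetric] algebra_simps)
qed

text \<open>The factor \<open>c\<close> allows treating one solution (\<open>c = 0\<close>) and the difference of two
  solutions (\<open>c = 1\<close>) at once.\<close>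

lemma (in driving_noise) second_moment_bound:
  fixes b :: "real^'r \<Rightarrow> 'm::finite \<Rightarrow> real^'r" and \<sigma> :: "real^'r \<Rightarrow> 'm \<Rightarrow> real^'d^'r"
    and g :: "real^'r \<Rightarrow> 'm \<Rightarrow> 'e \<Rightarrow> real^'r"
  assumes sol1: "regime_solution M F w \<nu> N b \<sigma> g K x X \<alpha>" and sol2: "regime_solution M F w \<nu> N b \<sigma> g K y Y \<beta>"
    and T: "0 < T" and \<theta>: "0 < \<theta>" and C0: "0 \<le> C0" and c: "0 \<le> c" "c \<le> 1"
    and gen: "\<And>x i y j. 2 * ((x - c *\<^sub>R y) \<bullet> (b x i - c *\<^sub>R b y j + (\<integral>\<gamma>. g x i \<gamma> - c *\<^sub>R g y j \<gamma> \<partial>\<nu>)))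
        + (norm (\<sigma> x i - c *\<^sub>R \<sigma> y j))\<^sup>2 + (\<integral>\<gamma>. (norm (g x i \<gamma> - c *\<^sub>R g y j \<gamma>))\<^sup>2 \<partial>\<nu>)
        \<le> - 2 * \<theta> * (norm (x - c *\<^sub>R y))\<^sup>2 + C0"
  shows "integrable M (\<lambda>\<omega>. (norm (X T \<omega> - c *\<^sub>R Y T \<omega>))\<^sup>2)"
    and "expectation (\<lambda>\<omega>. (norm (X T \<omega> - c *\<^sub>R Y T \<omega>))\<^sup>2) \<le> exp (- 2 * \<theta> * T) * (norm (x - c *\<^sub>R y))\<^sup>2 + C0 / (2 * \<theta>)"
proof -
  interpret s1: regime_solution M F w \<nu> N b \<sigma> g K x X \<alpha> by (rule sol1)
  interpret s2: regime_solution M F w \<nu> N b \<sigma> g K y Y \<beta> by (rule sol2)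
  let ?r = "real CARD('r)"
  \<comment> \<open>The abstract state is the pair of rounded grid states of both solutions; the
    coefficients below are the corresponding differences weighted by c.\<close>
  define st where "st p k \<omega> = (s1.grid_state T p k \<omega>, s2.grid_state T p k \<omega>)" for p k \<omega>
  define Dp where "Dp n p = (round_vec p ` {v::real^'r. norm v \<le> real n} \<times> (UNIV :: 'm set))" for n p
  define D where "D n p = Dp n p \<times> Dp n p" for n p
  define z where "z s = fst (fst s) - c *\<^sub>R fst (snd s)" for s :: "((real^'r) \<times> 'm) \<times> ((real^'r) \<times> 'm)"
  define bb where "bb s = b (fst (fst s)) (snd (fst s)) - c *\<^sub>R b (fst (snd s)) (snd (snd s))" for s :: "((real^'r) \<times> 'm) \<times> ((real^'r) \<times> 'm)"
  define SS where "SS s = \<sigma> (fst (fst s)) (snd (fst s)) - c *\<^sub>R \<sigma> (fst (snd s)) (snd (snd s))" for s :: "((real^'r) \<times> 'm) \<times> ((real^'r) \<times> 'm)"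
  define gg where "gg s \<gamma> = g (fst (fst s)) (snd (fst s)) \<gamma> - c *\<^sub>R g (fst (snd s)) (snd (snd s)) \<gamma>" for s :: "((real^'r) \<times> 'm) \<times> ((real^'r) \<times> 'm)" and \<gamma>
  \<comment> \<open>\<open>CARD('r)\<close> allows for the rounding of points in the ball of radius
    n. The scheme is used with \<open>2 * B n\<close>, since each coefficient combines two solutions
    with c at most 1.\<close>
  define B where "B n = (real n + ?r) + K * (1 + (real n + ?r))" for n
  have K0: "0 \<le> K" by (rule s1.K_nonneg)
  have B0: "0 \<le> B n" for n using K0 by (simp add: B_def)
  have Kn: "0 \<le> K * (1 + (real n + ?r))" for n using K0 by simp
  have two: "norm (u - c *\<^sub>R v) \<le> 2 * L" if "norm u \<le> L" "norm v \<le> L" for u v :: "'z::real_normed_vector" and L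
  proof -
    have "c * norm v \<le> 1 * norm v" using c by (intro mult_right_mono) auto
    then show ?thesis using norm_triangle_ineq4[of u "c *\<^sub>R v"] c that by simp
  qed
  have Dp_norm: "norm (fst s) \<le> real n + ?r" if "s \<in> Dp n p" for s n p
  proof -
    obtain v where v: "fst s = round_vec p v" "norm v \<le> real n" using \<open>s \<in> Dp n p\<close> by (auto simp: Dp_def)
    show ?thesis unfolding v(1) using round_vec_norm_le[of p v] v(2) by linarith
  qed
  have mD: "c' \<in> range (round_vec p) \<times> UNIV" if "c' \<in> Dp n p" for c' n p using that by (auto simp: Dp_def)
  have sch: "euler_scheme M F w \<nu> N (T / real (Suc p)) (st p) (D n p) z bb SS gg (2 * B n)" for n p
  proof (unfold_locales)
    show "0 < T / real (Suc p)" using T by simp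
    show "finite (D n p)" unfolding D_def Dp_def by (intro finite_cartesian_product round_vec_finite) auto
    show "0 \<le> 2 * B n" using B0[of n] by simp
  next
    fix k s assume s: "s \<in> D n p"
    have "{\<omega>\<in>space M. st p k \<omega> = s} = {\<omega>\<in>space M. s1.grid_state T p k \<omega> = fst s} \<inter> {\<omega>\<in>space M. s2.grid_state T p k \<omega> = snd s}"
      by (cases s) (auto simp: st_def)
    also have "\<dots> \<in> sets (F (real k * mesh T p))"
      using s by (intro sets.Int s1.grid_state_F s2.grid_state_F T mD[of _ n]) (auto simp: D_def)
    finally show "{\<omega>\<in>space M. st p k \<omega> = s} \<in> sets (F (real k * (T / real (Suc p))))" by (simp add: mesh_def)
  next
    fix s assume s: "s \<in> D n p"
    then have n: "norm (fst (fst s)) \<le> real n + ?r" "norm (fst (snd s)) \<le> real n + ?r"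
      using Dp_norm by (auto simp: D_def)
    show "norm (z s) \<le> 2 * B n" unfolding z_def using n Kn[of n] by (intro two) (auto simp: B_def)
    show "norm (bb s) \<le> 2 * B n" unfolding bb_def using n
      by (intro two order_trans[OF s1.growth_bound(1)[OF n(1)]] order_trans[OF s1.growth_bound(1)[OF n(2)]]) (auto simp: B_def)
    show "norm (SS s) \<le> 2 * B n" unfolding SS_def using n
      by (intro two order_trans[OF s1.growth_bound(2)[OF n(1)]] order_trans[OF s1.growth_bound(2)[OF n(2)]]) (auto simp: B_def)
    show "norm (gg s \<gamma>) \<le> 2 * B n" if "\<gamma> \<in> marks" for \<gamma> unfolding gg_def using n
      by (intro two order_trans[OF s1.growth_bound(3)[OF n(1) that]] order_trans[OF s1.growth_bound(3)[OF n(2) that]]) (auto simp: B_def)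
    show "gg s \<in> borel_measurable \<nu>" unfolding gg_def[abs_def]
      by (intro borel_measurable_diff borel_measurable_scaleR borel_measurable_const s1.g_meas)
  qed
  have gen': "2 * (z s \<bullet> (bb s + (\<integral>\<gamma>. gg s \<gamma> \<partial>\<nu>))) + (norm (SS s))\<^sup>2 + (\<integral>\<gamma>. (norm (gg s \<gamma>))\<^sup>2 \<partial>\<nu>) \<le> - 2 * \<theta> * (norm (z s))\<^sup>2 + C0" for s
    unfolding z_def bb_def SS_def gg_def by (rule gen)
  have round_small: "\<forall>\<^sub>F p in sequentially. 2 * (?r / real (Suc p)) < e" if "0 < e" for e
  proof -
    have "(\<lambda>p. 2 * (?r / real (Suc p))) \<longlonglongrightarrow> 2 * 0" by (intro tendsto_intros LIMSEQ_Suc[OF lim_const_over_n])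
    then show ?thesis using that by (intro order_tendstoD) auto
  qed
  have zdist: "norm (X (real k * mesh T p) \<omega> - c *\<^sub>R Y (real k * mesh T p) \<omega> - z (st p k \<omega>)) \<le> 2 * (?r / real (Suc p))" for p k \<omega>
  proof -
    let ?a = "X (real k * mesh T p) \<omega> - fst (s1.grid_state T p k \<omega>)" and ?d = "Y (real k * mesh T p) \<omega> - fst (s2.grid_state T p k \<omega>)"
    have "X (real k * mesh T p) \<omega> - c *\<^sub>R Y (real k * mesh T p) \<omega> - z (st p k \<omega>) = ?a - c *\<^sub>R ?d"
      by (simp add: z_def st_def algebra_simps)
    also have "norm \<dots> \<le> 2 * (?r / real (Suc p))"
      using s1.grid_state_dist[of T p k \<omega>] s2.grid_state_dist[of T p k \<omega>] by (intro two) (simp_all add: norm_minus_commute)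
    finally show ?thesis .
  qed
  have slabs: "AE \<omega> in M. \<forall>p j. emeasure (N \<omega>) ({real j * mesh T p<..real j * mesh T p + mesh T p} \<times> marks) < \<infinity>"
    unfolding AE_all_countable
  proof (intro allI)
    fix p j
    show "AE \<omega> in M. emeasure (N \<omega>) ({real j * mesh T p<..real j * mesh T p + mesh T p} \<times> marks) < \<infinity>"
      using AE_slab[of "real j * mesh T p" "real j * mesh T p + mesh T p"] mesh_pos[OF T, of p]
      by (auto elim!: eventually_mono simp: of_nat_less_top)
  qed
  have conv: "\<forall>\<^sub>F p in sequentially. \<forall>k\<le>Suc p. prob {\<omega>\<in>space M. (\<forall>j\<le>k. st p j \<omega> \<in> D n p) \<and>
        e < norm (x - c *\<^sub>R y + (\<Sum>j<k. increment (T / real (Suc p)) (bb (st p j \<omega>)) (SS (st p j \<omega>)) (gg (st p j \<omega>)) j \<omega>) - z (st p k \<omega>))} \<le> e"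
    if e: "0 < e" for n e
  proof -
    \<comment> \<open>Two Euler errors and the rounding, each of size e / 4, stay below e; the two
      exceptional events have total probability e / 2.\<close>
    have e4: "0 < e / 4" using e by simp
    show ?thesis
      using s1.approx[OF T e4] s2.approx[OF T e4] round_small[OF e4]
    proof eventually_elim
      case (elim p)
      show ?case
      proof (intro allI impI)
        fix k assume k: "k \<le> Suc p"
        let ?A = "{\<omega>\<in>space M. e / 4 < norm (s1.euler T p k \<omega> - X (real k * mesh T p) \<omega>)}"
        let ?C = "{\<omega>\<in>space M. e / 4 < norm (s2.euler T p k \<omega> - Y (real k * mesh T p) \<omega>)}"
        have t0: "0 \<le> real k * mesh T p" using mesh_pos[OF T, of p] by simp
        have AC: "?A \<in> events" "?C \<in> events"
          using s1.euler_M[OF T] s2.euler_M[OF T] measurable_F_M[OF s1.X_F[OF t0] t0] measurable_F_M[OF s2.X_F[OF t0] t0] by measurable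
        have "prob {\<omega>\<in>space M. (\<forall>j\<le>k. st p j \<omega> \<in> D n p) \<and>
          e < norm (x - c *\<^sub>R y + (\<Sum>j<k. increment (T / real (Suc p)) (bb (st p j \<omega>)) (SS (st p j \<omega>)) (gg (st p j \<omega>)) j \<omega>) - z (st p k \<omega>))} \<le> prob (?A \<union> ?C)"
        proof (rule finite_measure_mono_AE)
          show "AE \<omega> in M. \<omega> \<in> {\<omega>\<in>space M. (\<forall>j\<le>k. st p j \<omega> \<in> D n p) \<and>
            e < norm (x - c *\<^sub>R y + (\<Sum>j<k. increment (T / real (Suc p)) (bb (st p j \<omega>)) (SS (st p j \<omega>)) (gg (st p j \<omega>)) j \<omega>) - z (st p k \<omega>))} \<longrightarrow> \<omega> \<in> ?A \<union> ?C"
            using slabs AE_space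
          proof eventually_elim
            case (elim \<omega>)
            have "increment (mesh T p) (bb (st p j \<omega>)) (SS (st p j \<omega>)) (gg (st p j \<omega>)) j \<omega> =
              increment (mesh T p) (b (fst (s1.grid_state T p j \<omega>)) (snd (s1.grid_state T p j \<omega>))) (\<sigma> (fst (s1.grid_state T p j \<omega>)) (snd (s1.grid_state T p j \<omega>))) (g (fst (s1.grid_state T p j \<omega>)) (snd (s1.grid_state T p j \<omega>))) j \<omega>
              - c *\<^sub>R increment (mesh T p) (b (fst (s2.grid_state T p j \<omega>)) (snd (s2.grid_state T p j \<omega>))) (\<sigma> (fst (s2.grid_state T p j \<omega>)) (snd (s2.grid_state T p j \<omega>))) (g (fst (s2.grid_state T p j \<omega>)) (snd (s2.grid_state T p j \<omega>))) j \<omega>" for j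
              unfolding bb_def SS_def gg_def[abs_def] st_def fst_conv snd_conv
              by (rule increment_diff[OF s1.g_meas s1.g_growth s1.g_meas s1.g_growth mesh_pos[OF T] elim(2)]) (use elim(1) in auto)
            then have eu: "x - c *\<^sub>R y + (\<Sum>j<k. increment (mesh T p) (bb (st p j \<omega>)) (SS (st p j \<omega>)) (gg (st p j \<omega>)) j \<omega>) = s1.euler T p k \<omega> - c *\<^sub>R s2.euler T p k \<omega>"
              by (simp add: s1.euler_def s2.euler_def sum_subtractf scaleR_sum_right[symmetric] scaleR_add_right)
            show ?case
            proof (rule impI, rule ccontr)
              assume a: "\<omega> \<in> {\<omega>\<in>space M. (\<forall>j\<le>k. st p j \<omega> \<in> D n p) \<and>
                e < norm (x - c *\<^sub>R y + (\<Sum>j<k. increment (T / real (Suc p)) (bb (st p j \<omega>)) (SS (st p j \<omega>)) (gg (st p j \<omega>)) j \<omega>) - z (st p k \<omega>))}"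
              assume "\<omega> \<notin> ?A \<union> ?C"
              then have le: "norm (s1.euler T p k \<omega> - X (real k * mesh T p) \<omega>) \<le> e / 4" "norm (s2.euler T p k \<omega> - Y (real k * mesh T p) \<omega>) \<le> e / 4"
                using elim(2) by auto
              let ?a = "s1.euler T p k \<omega> - X (real k * mesh T p) \<omega>" and ?d = "s2.euler T p k \<omega> - Y (real k * mesh T p) \<omega>"
              let ?f = "X (real k * mesh T p) \<omega> - c *\<^sub>R Y (real k * mesh T p) \<omega> - z (st p k \<omega>)"
              have "norm (?a - c *\<^sub>R ?d) \<le> 2 * (e / 4)" by (rule two[OF le])
              moreover have "norm ?f < e / 4" using zdist[of k p \<omega>] \<open>2 * (?r / real (Suc p)) < e / 4\<close> by linarith
              moreover have sum: "s1.euler T p k \<omega> - c *\<^sub>R s2.euler T p k \<omega> - z (st p k \<omega>) = (?a - c *\<^sub>R ?d) + ?f"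
                by (simp add: algebra_simps)
              have "norm (s1.euler T p k \<omega> - c *\<^sub>R s2.euler T p k \<omega> - z (st p k \<omega>)) \<le> norm (?a - c *\<^sub>R ?d) + norm ?f"
                unfolding sum by (rule norm_triangle_ineq)
              moreover have "e < norm (s1.euler T p k \<omega> - c *\<^sub>R s2.euler T p k \<omega> - z (st p k \<omega>))"
                using a unfolding mem_Collect_eq eu[symmetric] mesh_def by blast
              ultimately show False using e by linarith
            qed
          qed
        qed (use AC in auto)
        also have "\<dots> \<le> prob ?A + prob ?C" by (rule measure_Un_le[OF AC])
        also have "\<dots> \<le> e / 4 + e / 4" using elim(1,2) k by (intro add_mono) auto
        finally show "prob {\<omega>\<in>space M. (\<forall>j\<le>k. st p j \<omega> \<in> D n p) \<and>
          e < norm (x - c *\<^sub>R y + (\<Sum>j<k. increment (T / real (Suc p)) (bb (st p j \<omega>)) (SS (st p j \<omega>)) (gg (st p j \<omega>)) j \<omega>) - z (st p k \<omega>))} \<le> e"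
          using e by linarith
      qed
    qed
  qed
  have fin: "\<forall>\<^sub>F p in sequentially. prob {\<omega>\<in>space M. e < norm (X T \<omega> - c *\<^sub>R Y T \<omega> - z (st p (Suc p) \<omega>))} \<le> e" if e: "0 < e" for e
    using round_small[OF e]
  proof eventually_elim
    case (elim p)
    \<comment> \<open>At the final grid time the only error is the rounding, which is deterministic,
      so for large p the event is empty.\<close>
    have empty: "{\<omega>\<in>space M. e < norm (X T \<omega> - c *\<^sub>R Y T \<omega> - z (st p (Suc p) \<omega>))} = {}"
      using zdist[of "Suc p" p] elim unfolding mesh_total by (auto simp: not_less intro: order_trans less_imp_le)
    show ?case unfolding empty using e by simp
  qed
  have zm: "(\<lambda>\<omega>. z (st p k \<omega>)) \<in> borel_measurable M" for p k
  proof -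
    have t0: "0 \<le> real k * mesh T p" using mesh_pos[OF T, of p] by simp
    show ?thesis
      unfolding z_def st_def s1.grid_state_def s2.grid_state_def fst_conv snd_conv
      by (intro borel_measurable_diff borel_measurable_scaleR borel_measurable_const
          measurable_compose[OF measurable_F_M[OF s1.X_F[OF t0] t0] round_vec_measurable]
          measurable_compose[OF measurable_F_M[OF s2.X_F[OF t0] t0] round_vec_measurable])
  qed
  have leave: "\<exists>n. \<forall>p. prob {\<omega>\<in>space M. \<exists>j\<le>Suc p. st p j \<omega> \<notin> D n p} \<le> e" if e: "0 < e" for e
  proof -
    have e2: "0 < e / 2" using e by simp
    from eventually_conj[OF s1.exit_small[OF T e2] s2.exit_small[OF T e2]]
    obtain n where n: "\<And>p. prob {\<omega>\<in>space M. \<exists>j\<le>Suc p. real n < norm (X (real j * mesh T p) \<omega>)} \<le> e / 2"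
      "\<And>p. prob {\<omega>\<in>space M. \<exists>j\<le>Suc p. real n < norm (Y (real j * mesh T p) \<omega>)} \<le> e / 2"
      unfolding eventually_sequentially by blast
    have "prob {\<omega>\<in>space M. \<exists>j\<le>Suc p. st p j \<omega> \<notin> D n p} \<le> e" for p
    proof -
      let ?A = "{\<omega>\<in>space M. \<exists>j\<le>Suc p. real n < norm (X (real j * mesh T p) \<omega>)}" and ?C = "{\<omega>\<in>space M. \<exists>j\<le>Suc p. real n < norm (Y (real j * mesh T p) \<omega>)}"
      have t0: "0 \<le> real j * mesh T p" for j using mesh_pos[OF T, of p] by simp
      have [measurable]: "X (real j * mesh T p) \<in> borel_measurable M" "Y (real j * mesh T p) \<in> borel_measurable M" for j
        using measurable_F_M[OF s1.X_F[OF t0] t0] measurable_F_M[OF s2.X_F[OF t0] t0] by auto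
      have AC: "?A \<in> events" "?C \<in> events" by measurable
      have "prob {\<omega>\<in>space M. \<exists>j\<le>Suc p. st p j \<omega> \<notin> D n p} \<le> prob (?A \<union> ?C)"
      proof (rule finite_measure_mono)
        show "{\<omega>\<in>space M. \<exists>j\<le>Suc p. st p j \<omega> \<notin> D n p} \<subseteq> ?A \<union> ?C"
        proof
          fix \<omega> assume "\<omega> \<in> {\<omega>\<in>space M. \<exists>j\<le>Suc p. st p j \<omega> \<notin> D n p}"
          then obtain j where j: "\<omega> \<in> space M" "j \<le> Suc p" "st p j \<omega> \<notin> D n p" by auto
          have "\<not> (norm (X (real j * mesh T p) \<omega>) \<le> real n \<and> norm (Y (real j * mesh T p) \<omega>) \<le> real n)"
            using j(3) by (auto simp: st_def D_def Dp_def s1.grid_state_def s2.grid_state_def)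
          then show "\<omega> \<in> ?A \<union> ?C" using j(1,2) by (auto simp: not_le)
        qed
      qed (use AC in auto)
      also have "\<dots> \<le> prob ?A + prob ?C" by (rule measure_Un_le[OF AC])
      also have "\<dots> \<le> e" using n[of p] by linarith
      finally show ?thesis .
    qed
    then show ?thesis by blast
  qed
  have ZM: "(\<lambda>\<omega>. X T \<omega> - c *\<^sub>R Y T \<omega>) \<in> borel_measurable M"
    using measurable_F_M[OF s1.X_F, of T] measurable_F_M[OF s2.X_F, of T] T by auto
  note E = energy_limit[where Z = "\<lambda>\<omega>. X T \<omega> - c *\<^sub>R Y T \<omega>" and ?z0.0 = "x - c *\<^sub>R y", OF T \<theta> C0 sch gen' conv fin zm leave ZM]
  show "integrable M (\<lambda>\<omega>. (norm (X T \<omega> - c *\<^sub>R Y T \<omega>))\<^sup>2)" by (rule E(1))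
  show "expectation (\<lambda>\<omega>. (norm (X T \<omega> - c *\<^sub>R Y T \<omega>))\<^sup>2) \<le> exp (- 2 * \<theta> * T) * (norm (x - c *\<^sub>R y))\<^sup>2 + C0 / (2 * \<theta>)" by (rule E(2))
qed

section \<open>The embedded quadratic function\<close>

lemma gradient_inner_self: "gradient (\<lambda>z::real^'n. z \<bullet> z) x = 2 *\<^sub>R x"
proof -
  have "((\<lambda>z. z \<bullet> z) has_derivative (\<lambda>h. x \<bullet> h + h \<bullet> x)) (at x)"
    by (auto intro!: derivative_eq_intros)
  from frechet_derivative_at[OF this] have d: "frechet_derivative (\<lambda>z. z \<bullet> z) (at x) = (\<lambda>h. x \<bullet> h + h \<bullet> x)" by simp
  show ?thesis by (simp add: gradient_def d vec_eq_iff inner_axis inner_axis')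
qed

lemma hessian_inner_self: "hessian (\<lambda>z::real^'n. z \<bullet> z) x = mat 2"
proof -
  have "((\<lambda>y::real^'n. 2 * y $ k) has_derivative (\<lambda>h. 2 * h $ k)) (at x)" for k
    by (rule has_derivative_mult_right[OF bounded_linear_imp_has_derivative[OF bounded_linear_vec_nth]])
  from frechet_derivative_at[OF this]
  have d: "frechet_derivative (\<lambda>y::real^'n. 2 * y $ k) (at x) = (\<lambda>h. 2 * h $ k)" for k by simp
  show ?thesis by (simp add: hessian_def gradient_inner_self d vec_eq_iff mat_def axis_def)
qed

lemma trace_gram_mat:
  fixes D :: "real^'d^'n"
  shows "trace ((D ** transpose D) ** mat c) = c * (norm D)\<^sup>2"
proof -
  have "(A ** mat c) $ i $ i = A $ i $ i * c" for A :: "real^'n^'n" and i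
    by (simp add: matrix_matrix_mult_def mat_def if_distrib cong: if_cong)
  then have "trace ((D ** transpose D) ** mat c) = (\<Sum>i\<in>UNIV. (D ** transpose D) $ i $ i * c)"
    by (simp add: trace_def)
  moreover have "(norm D)\<^sup>2 = (\<Sum>i\<in>UNIV. (D ** transpose D) $ i $ i)"
    by (simp add: power2_norm_eq_inner inner_vec_def matrix_matrix_mult_def transpose_def)
  ultimately show ?thesis by (simp add: sum_distrib_left mult.commute)
qed

text \<open>The entries lie in an arbitrary inner product space, so that embedded vectors with real
  entries and embedded matrices with rows as entries are covered together.\<close>

lemma block_inner:
  fixes u v :: "'a::real_inner^'r" and i j :: "'m::finite"
  shows "(\<chi> p. if fst p = i then u $ snd p else 0) \<bullet> (\<chi> p. if fst p = j then v $ snd p else 0) = (if i = j then u \<bullet> v else 0)"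
proof -
  let ?f = "\<lambda>k s. (if k = i then u $ s else 0) \<bullet> (if k = j then v $ s else 0)"
  have "(\<chi> p. if fst p = i then u $ snd p else 0) \<bullet> (\<chi> p. if fst p = j then v $ snd p else 0) = (\<Sum>p\<in>UNIV. ?f (fst p) (snd p))"
    by (simp add: inner_vec_def)
  also have "\<dots> = (\<Sum>k\<in>UNIV. \<Sum>s\<in>UNIV. ?f k s)"
    by (simp add: sum.cartesian_product case_prod_unfold)
  also have "\<dots> = (\<Sum>k\<in>UNIV. if k = i then (if i = j then u \<bullet> v else 0) else 0)"
    by (intro sum.cong refl) (auto simp: inner_vec_def)
  also have "\<dots> = (if i = j then u \<bullet> v else 0)" by (simp add: sum.delta)
  finally show ?thesis .
qed

lemma embed_inner:
  "embed_vec i u \<bullet> embed_vec j v = (if i = j then u \<bullet> v else 0)"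
  "embed_mat i A \<bullet> embed_mat j B = (if i = j then A \<bullet> B else 0)"
  unfolding embed_vec_def embed_mat_def by (rule block_inner)+

lemma linear_embed_vec: "linear (embed_vec i)"
  by (rule linearI) (auto simp: embed_vec_def vec_eq_iff)

lemma embed_dist_same:
  "(norm (embed_vec i u - embed_vec i v))\<^sup>2 = (norm (u - v))\<^sup>2"
  "(norm (embed_mat i A - embed_mat i B))\<^sup>2 = (norm (A - B))\<^sup>2"
  by (simp_all add: power2_norm_eq_inner inner_diff embed_inner)

lemma embed_dist_other:
  assumes "i \<noteq> j"
  shows "(norm (embed_vec i u - embed_vec j v))\<^sup>2 = (norm u)\<^sup>2 + (norm v)\<^sup>2"
    and "(norm (embed_mat i A - embed_mat j B))\<^sup>2 = (norm A)\<^sup>2 + (norm B)\<^sup>2"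
  using assms by (simp_all add: power2_norm_eq_inner inner_diff embed_inner)

lemma embed_vec_zero [simp]: "embed_vec i 0 = 0"
  by (rule linear_0[OF linear_embed_vec])

lemma norm_embed_vec: "(norm (embed_vec i u))\<^sup>2 = (norm u)\<^sup>2"
  by (simp add: power2_norm_eq_inner embed_inner)

lemma embed_vec_measurable: "embed_vec i \<in> borel_measurable borel"
  by (intro borel_measurable_continuous_onI linear_continuous_on linear_embed_vec[unfolded linear_conv_bounded_linear])

section \<open>Integrals over marks and moment inequalities\<close>

lemma integral_scale_measure:
  fixes f :: "'a \<Rightarrow> 'b::{banach,second_countable_topology}"
  assumes "0 \<le> c" and f: "f \<in> borel_measurable M"
  shows "(\<integral>x. f x \<partial>scale_measure (ennreal c) M) = c *\<^sub>R (\<integral>x. f x \<partial>M)"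
proof -
  have "scale_measure (ennreal c) M = density M (\<lambda>_. ennreal c)"
    by (rule measure_eqI) (auto simp: emeasure_density nn_integral_cmult_indicator)
  then show ?thesis using integral_density[OF f, of "\<lambda>_. c"] assms(1) by simp
qed

text \<open>The last claim integrates |z + f|^2 - |z|^2, the jump part of the generator for the
  quadratic function.\<close>

lemma (in finite_measure) bounded_integrable_power:
  fixes f :: "'a \<Rightarrow> 'b::{banach,second_countable_topology,real_inner}"
  assumes f: "f \<in> borel_measurable M" and L: "\<And>x. x \<in> space M \<Longrightarrow> norm (f x) \<le> L"
  shows "integrable M f" and "integrable M (\<lambda>x. (norm (f x))\<^sup>2)"
    and "norm (\<integral>x. f x \<partial>M) \<le> L * measure M (space M)"
    and "(\<integral>x. 2 * (z \<bullet> f x) + (norm (f x))\<^sup>2 \<partial>M) = 2 * (z \<bullet> (\<integral>x. f x \<partial>M)) + (\<integral>x. (norm (f x))\<^sup>2 \<partial>M)"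
proof -
  show i1: "integrable M f" using f L by (intro integrable_const_bound[where B = L]) auto
  show i2: "integrable M (\<lambda>x. (norm (f x))\<^sup>2)"
    using f L by (intro integrable_const_bound[where B = "L\<^sup>2"]) (auto intro!: power_mono)
  have "norm (\<integral>x. f x \<partial>M) \<le> (\<integral>x. L \<partial>M)"
    using L by (intro order_trans[OF integral_norm_bound] integral_mono integrable_norm i1) auto
  then show "norm (\<integral>x. f x \<partial>M) \<le> L * measure M (space M)" by (simp add: mult.commute)
  show "(\<integral>x. 2 * (z \<bullet> f x) + (norm (f x))\<^sup>2 \<partial>M) = 2 * (z \<bullet> (\<integral>x. f x \<partial>M)) + (\<integral>x. (norm (f x))\<^sup>2 \<partial>M)"
    using i1 i2 by simp
qed

lemma switching_rates_row: "switching_rates q \<Longrightarrow> (\<Sum>k\<in>UNIV. q x i k) = 0"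
  using sum.remove[of UNIV i "q x i"] by (simp add: switching_rates_def)

text \<open>The quadratic function does not see the switching as soon as the distance of the embedded
  points does not depend on the two regimes: this happens if one point is the origin, and if
  there is only one regime.\<close>

lemma coupled_generator_quadratic:
  fixes q :: "real^'r \<Rightarrow> 'm::{finite,linorder} \<Rightarrow> 'm \<Rightarrow> real"
  assumes q: "switching_rates q"
    and const: "\<And>k l::'m. (norm (embed_vec k x - embed_vec l y))\<^sup>2 = (norm (embed_vec i x - embed_vec j y))\<^sup>2"
  shows "coupled_generator b \<sigma> g q lam \<pi> (\<lambda>z. z \<bullet> z) x i y j =
    2 * ((embed_vec i x - embed_vec j y) \<bullet> (embed_vec i (b x i) - embed_vec j (b y j)))
    + (norm (embed_mat i (\<sigma> x i) - embed_mat j (\<sigma> y j)))\<^sup>2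
    + lam * (\<integral>\<gamma>. 2 * ((embed_vec i x - embed_vec j y) \<bullet> (embed_vec i (g x i \<gamma>) - embed_vec j (g y j \<gamma>)))
        + (norm (embed_vec i (g x i \<gamma>) - embed_vec j (g y j \<gamma>)))\<^sup>2 \<partial>\<pi>)"
proof -
  let ?z = "embed_vec i x - embed_vec j y"
  define r where "r = ?z \<bullet> ?z"
  have c: "(embed_vec k x - embed_vec l y) \<bullet> (embed_vec k x - embed_vec l y) = r" for k l :: 'm
    unfolding r_def using const[of k l] by (simp only: power2_norm_eq_inner)
  have s: "(\<Sum>k\<in>UNIV. q v n k * r) = 0" for v n r
    unfolding sum_distrib_right[symmetric] switching_rates_row[OF q] by simp
  have j: "(embed_vec i x + embed_vec i (g x i \<gamma>) - embed_vec j y - embed_vec j (g y j \<gamma>)) \<bullet> (embed_vec i x + embed_vec i (g x i \<gamma>) - embed_vec j y - embed_vec j (g y j \<gamma>)) - r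
    = 2 * (?z \<bullet> (embed_vec i (g x i \<gamma>) - embed_vec j (g y j \<gamma>))) + (norm (embed_vec i (g x i \<gamma>) - embed_vec j (g y j \<gamma>)))\<^sup>2" for \<gamma>
  proof -
    have "(u + a - v - d) \<bullet> (u + a - v - d) - (u - v) \<bullet> (u - v) = 2 * ((u - v) \<bullet> (a - d)) + (norm (a - d))\<^sup>2" for u v a d :: "real^('m \<times> 'r)"
      by (simp add: power2_norm_eq_inner algebra_simps inner_commute)
    then show ?thesis unfolding r_def .
  qed
  show ?thesis
    unfolding coupled_generator_def coupled_L_def Let_def hessian_inner_self gradient_inner_self trace_gram_mat j c s
    by (simp add: inner_commute)
qed

text \<open>Intended for the jump coefficient f and its value h at the origin. The error is linear
  in L and thus linear in the distance from the origin, so that quadratic dissipation can absorb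
  it.\<close>

lemma (in finite_measure) quadratic_perturbation:
  fixes f h :: "'a \<Rightarrow> 'b::{banach,second_countable_topology,real_inner}"
  assumes f: "f \<in> borel_measurable M" "\<And>x. x \<in> space M \<Longrightarrow> norm (f x - h x) \<le> L"
    and h: "h \<in> borel_measurable M" "\<And>x. x \<in> space M \<Longrightarrow> norm (h x) \<le> R"
    and R: "0 \<le> R"
  shows "(\<integral>x. (norm (f x))\<^sup>2 \<partial>M) \<le> (\<integral>x. (norm (f x - h x))\<^sup>2 \<partial>M) + (2 * L * R + R\<^sup>2) * measure M (space M)"
proof -
  have pt: "(norm (f x))\<^sup>2 \<le> (norm (f x - h x))\<^sup>2 + (2 * L * R + R\<^sup>2)" if x: "x \<in> space M" for x
  proof -
    have "(norm (f x))\<^sup>2 = (norm (f x - h x))\<^sup>2 + 2 * ((f x - h x) \<bullet> h x) + (norm (h x))\<^sup>2"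
      by (simp add: power2_norm_eq_inner algebra_simps inner_commute)
    moreover have "(f x - h x) \<bullet> h x \<le> L * R"
      using norm_cauchy_schwarz[of "f x - h x" "h x"] mult_mono[OF f(2)[OF x] h(2)[OF x] order_trans[OF norm_ge_zero f(2)[OF x]]] by simp
    moreover have "(norm (h x))\<^sup>2 \<le> R\<^sup>2" using h(2)[OF x] by (intro power_mono) auto
    ultimately show ?thesis by simp
  qed
  have i1: "integrable M (\<lambda>x. (norm (f x))\<^sup>2)"
  proof (rule bounded_integrable_power(2)[OF f(1), where L = "L + R"])
    show "norm (f x) \<le> L + R" if "x \<in> space M" for x
      using norm_triangle_ineq[of "f x - h x" "h x"] f(2)[OF that] h(2)[OF that] by simp
  qed
  have i2: "integrable M (\<lambda>x. (norm (f x - h x))\<^sup>2)" using f h by (intro bounded_integrable_power(2)[where L = L]) auto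
  have "(\<integral>x. (norm (f x))\<^sup>2 \<partial>M) \<le> (\<integral>x. (norm (f x - h x))\<^sup>2 + (2 * L * R + R\<^sup>2) \<partial>M)"
    using pt i1 i2 by (intro integral_mono) auto
  also have "\<dots> = (\<integral>x. (norm (f x - h x))\<^sup>2 \<partial>M) + (2 * L * R + R\<^sup>2) * measure M (space M)"
    using i2 by (simp add: mult.commute)
  finally show ?thesis .
qed

text \<open>Young's inequality |f| \<le> e / 2 + |f|^2 / (2 e), balanced so that both halves give e
  / 2; it yields integrability at the same time.\<close>

lemma (in prob_space) first_moment_less:
  fixes f :: "'a \<Rightarrow> 'b::{banach,second_countable_topology}"
  assumes f: "f \<in> borel_measurable M" and i: "integrable M (\<lambda>x. (norm (f x))\<^sup>2)"
    and e: "0 < e" and less: "expectation (\<lambda>x. (norm (f x))\<^sup>2) < e\<^sup>2"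
  shows "integrable M (\<lambda>x. norm (f x))" and "expectation (\<lambda>x. norm (f x)) < e"
proof -
  have pt: "norm (f x) \<le> e / 2 + (norm (f x))\<^sup>2 / (2 * e)" for x
  proof -
    have "0 \<le> (norm (f x) - e)\<^sup>2" by simp
    then have "norm (f x) * (2 * e) \<le> e\<^sup>2 + (norm (f x))\<^sup>2" by (simp add: power2_diff)
    then show ?thesis using e by (simp add: field_simps power2_eq_square)
  qed
  have i': "integrable M (\<lambda>x. e / 2 + (norm (f x))\<^sup>2 / (2 * e))" using i by simp
  show i1: "integrable M (\<lambda>x. norm (f x))"
    by (rule Bochner_Integration.integrable_bound[OF i']) (use f pt e in \<open>auto intro!: AE_I2 order_trans[OF _ abs_ge_self]\<close>)
  have "expectation (\<lambda>x. norm (f x)) \<le> expectation (\<lambda>x. e / 2 + (norm (f x))\<^sup>2 / (2 * e))"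
    by (rule integral_mono[OF i1 i' pt])
  also have "\<dots> = e / 2 + expectation (\<lambda>x. (norm (f x))\<^sup>2) / (2 * e)" using i by (simp add: prob_space)
  also have "\<dots> < e / 2 + e\<^sup>2 / (2 * e)" using less e by (intro add_strict_left_mono divide_strict_right_mono) auto
  also have "\<dots> = e" using e by (simp add: power2_eq_square)
  finally show "expectation (\<lambda>x. norm (f x)) < e" .
qed

lemma (in prob_space) second_moment_tail:
  fixes f :: "'a \<Rightarrow> 'b::{banach,second_countable_topology}"
  assumes f: "f \<in> borel_measurable M" and i: "integrable M (\<lambda>x. (norm (f x))\<^sup>2)" and R: "0 < R"
  shows "prob {x\<in>space M. R \<le> norm (f x)} \<le> expectation (\<lambda>x. (norm (f x))\<^sup>2) / R\<^sup>2"
proof -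
  have E: "{x\<in>space M. R \<le> norm (f x)} \<in> events" using f by measurable
  have "prob {x\<in>space M. R \<le> norm (f x)} = expectation (indicator {x\<in>space M. R \<le> norm (f x)})" using E by simp
  also have "\<dots> \<le> expectation (\<lambda>x. (norm (f x))\<^sup>2 / R\<^sup>2)"
  proof (rule integral_mono)
    show "indicator {x\<in>space M. R \<le> norm (f x)} x \<le> (norm (f x))\<^sup>2 / R\<^sup>2" for x
      using R power_mono[of R "norm (f x)" 2] by (auto simp: indicator_def)
  qed (use E i in \<open>auto intro!: integrable_real_indicator simp: less_top[symmetric]\<close>)
  finally show ?thesis by simp
qed

theorem theorem6p6:
  fixes M :: "'w measure" and F :: "real \<Rightarrow> 'w measure"
    and w :: "real \<Rightarrow> 'w \<Rightarrow> real^'d"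
    and N :: "'w \<Rightarrow> (real \<times> (real^'r)) measure" and N1 :: "'w \<Rightarrow> (real \<times> real) measure"
    and \<Gamma> :: "(real^'r) set" and lam :: real and \<pi> :: "(real^'r) measure"
    and b :: "real^'r \<Rightarrow> 'm::{finite,linorder} \<Rightarrow> real^'r"
    and \<sigma> :: "real^'r \<Rightarrow> 'm \<Rightarrow> real^'d^'r"
    and g :: "real^'r \<Rightarrow> 'm \<Rightarrow> real^'r \<Rightarrow> real^'r"
    and q :: "real^'r \<Rightarrow> 'm \<Rightarrow> 'm \<Rightarrow> real"
    and X :: "real^'r \<Rightarrow> 'm \<Rightarrow> real \<Rightarrow> 'w \<Rightarrow> real^'r"
    and \<alpha> :: "real^'r \<Rightarrow> 'm \<Rightarrow> real \<Rightarrow> 'w \<Rightarrow> 'm"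
    and V0 :: "real^'r \<Rightarrow> 'm \<Rightarrow> real"
    and K K0 \<beta> \<beta>' :: real
  assumes space: "filtered_prob_space M F"
    and Gamma: "0 \<notin> \<Gamma>"
    and lam: "0 < lam"
    and pi: "prob_space \<pi>" "sets \<pi> = sets (restrict_space borel \<Gamma>)"
    and brownian: "standard_brownian_motion M F w"
    and poisson: "poisson_random_measure M F (scale_measure (ennreal lam) \<pi>) N"
    and poisson1: "poisson_random_measure M F lborel N1"
    and indep: "independent_noise M w (scale_measure (ennreal lam) \<pi>) N lborel N1"
    and K0: "0 < K0"
    and lipschitz: "\<And>x y i. norm (b x i - b y i) + norm (\<sigma> x i - \<sigma> y i) \<le> K0 * norm (x - y)"
      "\<And>x y i \<gamma>. \<gamma> \<in> \<Gamma> \<Longrightarrow> norm (g x i \<gamma> - g y i \<gamma>) \<le> K0 * norm (x - y)"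
    and growth: "\<And>x i. norm (b x i) \<le> K * (1 + norm x)"
      "\<And>x i. norm (\<sigma> x i) \<le> K * (1 + norm x)"
      "\<And>x i \<gamma>. \<gamma> \<in> \<Gamma> \<Longrightarrow> norm (g x i \<gamma>) \<le> K * (1 + norm x)"
    and g_measurable: "\<And>x i. g x i \<in> borel_measurable (restrict_space borel \<Gamma>)"
    and rates: "switching_rates q"
    and solution: "\<And>x i. regime_switching_solution M F w N N1 \<Gamma> b \<sigma> g q x i (X x i) (\<alpha> x i)"
    and V0_C2: "\<And>i. C2 (\<lambda>x. V0 x i)"
    and V0_nonneg: "\<And>x i. 0 \<le> V0 x i"
    and beta: "0 < \<beta>"
    and V0_generator: "\<And>x i. rs_generator b \<sigma> g q lam \<pi> V0 x i \<le> - \<beta> * V0 x i"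
    and V0_coercive:
      "filterlim (\<lambda>R. INF (x, i)\<in>{x. R \<le> norm x} \<times> UNIV. V0 x i) at_top at_top"
    and beta': "0 < \<beta>'"
    and V_generator: "\<And>x i y j. coupled_generator b \<sigma> g q lam \<pi> (\<lambda>z. z \<bullet> z) x i y j
      \<le> - \<beta>' * ((embed_vec i x - embed_vec j y) \<bullet> (embed_vec i x - embed_vec j y))"
  shows "(\<forall>x i. \<forall>\<epsilon>>0. \<exists>R>0. \<forall>t\<ge>0. measure M {\<omega>\<in>space M. R \<le> norm (X x i t \<omega>)} < \<epsilon>) \<and>
    (\<forall>\<epsilon>>0. \<forall>C. compact C \<longrightarrow> (\<exists>T>0. \<forall>t\<ge>T. \<forall>x0\<in>C. \<forall>y0\<in>C. \<forall>i0 j0.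
      integrable M (\<lambda>\<omega>. norm (embed_vec (\<alpha> x0 i0 t \<omega>) (X x0 i0 t \<omega>)
                             - embed_vec (\<alpha> y0 j0 t \<omega>) (X y0 j0 t \<omega>))) \<and>
      (\<integral>\<omega>. norm (embed_vec (\<alpha> x0 i0 t \<omega>) (X x0 i0 t \<omega>)
                 - embed_vec (\<alpha> y0 j0 t \<omega>) (X y0 j0 t \<omega>)) \<partial>M) < \<epsilon>))"
proof -
  \<comment> \<open>With the intensity absorbed into the mark measure, \<open>lam\<close> times an
    integral over \<pi> becomes an integral over \<nu>, as in the moment estimates.\<close>
  define \<nu> where "\<nu> = scale_measure (ennreal lam) \<pi>"
  interpret pi: prob_space \<pi> by (rule pi(1))
  have sets_\<nu>: "sets \<nu> = sets (restrict_space borel \<Gamma>)" by (simp add: \<nu>_def pi(2))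
  have space_\<pi>: "space \<pi> = \<Gamma>" using sets_eq_imp_space_eq[OF pi(2)] by (simp add: space_restrict_space)
  have space_\<nu>: "space \<nu> = \<Gamma>" using sets_eq_imp_space_eq[OF sets_\<nu>] by (simp add: space_restrict_space)
  have mass_\<nu>: "emeasure \<nu> \<Gamma> = ennreal lam"
    using pi.emeasure_space_1 by (simp add: \<nu>_def space_\<pi>)
  have finite_\<nu>: "finite_measure \<nu>" by (rule finite_measureI) (simp add: space_\<nu> mass_\<nu>)
  interpret nu: finite_measure \<nu> by (rule finite_\<nu>)
  have m\<nu>: "measure \<nu> \<Gamma> = lam" using lam by (simp add: measure_def mass_\<nu>)
  have g_nu: "g x i \<in> borel_measurable \<nu>" for x i
    using g_measurable[of x i] by (simp cong: measurable_cong_sets add: sets_\<nu>)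
  have g_pi: "g x i \<in> borel_measurable \<pi>" for x i
    using g_measurable[of x i] by (simp cong: measurable_cong_sets add: pi(2))
  have driving: "driving_noise M F w \<nu> N"
    using space brownian poisson finite_\<nu>
    by (auto simp: filtered_prob_space_def \<nu>_def intro!: driving_noise.intro driving_noise_axioms.intro)
  interpret driving_noise M F w \<nu> N by (rule driving)
  have b_lip: "norm (b x i - b y i) \<le> K0 * norm (x - y)" and \<sigma>_lip: "norm (\<sigma> x i - \<sigma> y i) \<le> K0 * norm (x - y)" for x y i
    using lipschitz(1)[of x i y] norm_ge_zero[of "b x i - b y i"] norm_ge_zero[of "\<sigma> x i - \<sigma> y i"] by linarith+
  have K: "0 \<le> K" using order_trans[OF norm_ge_zero growth(1)[of 0]] by simp
  have sol: "regime_solution M F w \<nu> N b \<sigma> g K x (X x i) (\<alpha> x i)" for x i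
  proof (intro regime_solution.intro regime_solution_axioms.intro driving)
    note s = solution[of x i, unfolded regime_switching_solution_def]
    have cont: "continuous_on UNIV f" if "\<And>x y. norm (f x - f y) \<le> K0 * norm (x - y)" for f :: "real^'r \<Rightarrow> 'z::real_normed_vector"
      by (rule lipschitz_on_continuous_on[where L = K0]) (use that K0 in \<open>auto intro!: lipschitz_onI simp: dist_norm\<close>)
    show "continuous_on UNIV (\<lambda>x. b x i)" "continuous_on UNIV (\<lambda>x. \<sigma> x i)" for i using b_lip \<sigma>_lip by (auto intro!: cont)
    show "continuous_on UNIV (\<lambda>x. g x i \<gamma>)" if "\<gamma> \<in> marks" for i \<gamma> using lipschitz(2) that by (auto intro!: cont simp: space_\<nu>)
    show "X x i t \<in> borel_measurable (F t)" "\<alpha> x i t \<in> measurable (F t) (count_space UNIV)" if "0 \<le> t" for t using s that by auto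
    show "cadlag (\<lambda>t. X x i t \<omega>)" "cadlag_state (\<lambda>t. \<alpha> x i t \<omega>)" if "\<omega> \<in> space M" for \<omega> using s that by auto
    show "\<exists>J. has_ito_integral M F w (\<lambda>s \<omega>. \<sigma> (X x i s \<omega>) (\<alpha> x i s \<omega>)) t J \<and>
        (AE \<omega> in M. X x i t \<omega> = x + (LINT s:{0..t}|lborel. b (X x i s \<omega>) (\<alpha> x i s \<omega>)) + J \<omega> +
           (LINT p:({0..t} \<times> marks)|N \<omega>. g (left_limit (\<lambda>s. X x i s \<omega>) (fst p)) (left_state (\<lambda>s. \<alpha> x i s \<omega>) (fst p)) (snd p)))" if "0 \<le> t" for t
      unfolding space_\<nu> using s that by blast
  qed (use growth g_nu in \<open>auto simp: space_\<nu>\<close>)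
  have start: "AE \<omega> in M. X x i 0 \<omega> = x" for x i
    using solution[of x i] unfolding regime_switching_solution_def by (auto elim!: eventually_mono)
  have XM: "X x i t \<in> borel_measurable M" if "0 \<le> t" for x i t
    using solution[of x i] that unfolding regime_switching_solution_def by (auto intro: measurable_F_M)
  have \<alpha>M: "\<alpha> x i t \<in> measurable M (count_space UNIV)" if "0 \<le> t" for x i t
    using solution[of x i] that unfolding regime_switching_solution_def by (auto intro: measurable_F_M)

  have jump_same: "lam * (\<integral>\<gamma>. 2 * (z \<bullet> (g x i \<gamma> - g y i \<gamma>)) + (norm (g x i \<gamma> - g y i \<gamma>))\<^sup>2 \<partial>\<pi>)
      = 2 * (z \<bullet> (\<integral>\<gamma>. g x i \<gamma> - g y i \<gamma> \<partial>\<nu>)) + (\<integral>\<gamma>. (norm (g x i \<gamma> - g y i \<gamma>))\<^sup>2 \<partial>\<nu>)" for x y z i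
  proof -
    have m: "(\<lambda>\<gamma>. 2 * (z \<bullet> (g x i \<gamma> - g y i \<gamma>)) + (norm (g x i \<gamma> - g y i \<gamma>))\<^sup>2) \<in> borel_measurable \<pi>"
      using g_pi by measurable
    show ?thesis
      using integral_scale_measure[OF less_imp_le[OF lam] m] g_nu lipschitz(2)
        nu.bounded_integrable_power(4)[of "\<lambda>\<gamma>. g x i \<gamma> - g y i \<gamma>" "K0 * norm (x - y)" z]
      by (simp add: \<nu>_def[symmetric] space_\<nu>)
  qed
  \<comment> \<open>Two points in the same block. The condition \<open>const\<close> holds if y is
    the origin and if there is a single regime; these are its two uses.\<close>
  have gen_same: "2 * ((x - y) \<bullet> (b x i - b y i + (\<integral>\<gamma>. g x i \<gamma> - g y i \<gamma> \<partial>\<nu>))) + (norm (\<sigma> x i - \<sigma> y i))\<^sup>2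
      + (\<integral>\<gamma>. (norm (g x i \<gamma> - g y i \<gamma>))\<^sup>2 \<partial>\<nu>) \<le> - \<beta>' * (norm (x - y))\<^sup>2"
    if const: "\<And>k l::'m. (norm (embed_vec k x - embed_vec l y))\<^sup>2 = (norm (embed_vec i x - embed_vec i y))\<^sup>2" for x y i
  proof -
    have "(embed_vec i x - embed_vec i y) \<bullet> (embed_vec i u - embed_vec i v) = (x - y) \<bullet> (u - v)" for u v
      by (simp add: inner_diff embed_inner)
    then show ?thesis
      using V_generator[of x i y i] unfolding coupled_generator_quadratic[OF rates const] unfolding embed_dist_same power2_norm_eq_inner[symmetric]
      by (simp add: jump_same inner_add_right)
  qed
  \<comment> \<open>The second point is the origin in another block. Blocks are orthogonal, so the
    coefficients at the origin do not meet x in an inner product and enter only through nonnegative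
    squares, which may be dropped from the left side.\<close>
  have gen_origin: "2 * (x \<bullet> (b x i + (\<integral>\<gamma>. g x i \<gamma> \<partial>\<nu>))) + (norm (\<sigma> x i))\<^sup>2 + (\<integral>\<gamma>. (norm (g x i \<gamma>))\<^sup>2 \<partial>\<nu>) \<le> - \<beta>' * (norm x)\<^sup>2"
    if ij: "i \<noteq> j" for x i and j :: 'm
  proof -
    have const: "(norm (embed_vec k x - embed_vec l 0))\<^sup>2 = (norm (embed_vec i x - embed_vec j 0))\<^sup>2" for k l :: 'm
      by (simp add: norm_embed_vec)
    have z: "(embed_vec i x - embed_vec j 0) \<bullet> (embed_vec i u - embed_vec j v) = x \<bullet> u" for u v
      using ij by (simp add: inner_diff_right embed_inner)
    have Kx: "norm (g x i \<gamma>) \<le> K * (1 + norm x)" "norm (g 0 j \<gamma>) \<le> K" if "\<gamma> \<in> marks" for \<gamma>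
      using growth(3)[of \<gamma> x i] growth(3)[of \<gamma> 0 j] that by (auto simp: space_\<nu>)
    have gx: "integrable \<nu> (g x i)" "integrable \<nu> (\<lambda>\<gamma>. (norm (g x i \<gamma>))\<^sup>2)" and g0: "integrable \<nu> (\<lambda>\<gamma>. (norm (g 0 j \<gamma>))\<^sup>2)"
      using nu.bounded_integrable_power(1,2)[OF g_nu Kx(1)] nu.bounded_integrable_power(2)[OF g_nu Kx(2)] by auto
    have m: "(\<lambda>\<gamma>. 2 * (x \<bullet> g x i \<gamma>) + ((norm (g x i \<gamma>))\<^sup>2 + (norm (g 0 j \<gamma>))\<^sup>2)) \<in> borel_measurable \<pi>"
      using g_pi by measurable
    have "2 * (x \<bullet> (\<integral>\<gamma>. g x i \<gamma> \<partial>\<nu>)) + (\<integral>\<gamma>. (norm (g x i \<gamma>))\<^sup>2 \<partial>\<nu>)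
        \<le> (\<integral>\<gamma>. 2 * (x \<bullet> g x i \<gamma>) + ((norm (g x i \<gamma>))\<^sup>2 + (norm (g 0 j \<gamma>))\<^sup>2) \<partial>\<nu>)"
    proof -
      have "(\<integral>\<gamma>. 2 * (x \<bullet> g x i \<gamma>) + (norm (g x i \<gamma>))\<^sup>2 \<partial>\<nu>) \<le> (\<integral>\<gamma>. 2 * (x \<bullet> g x i \<gamma>) + ((norm (g x i \<gamma>))\<^sup>2 + (norm (g 0 j \<gamma>))\<^sup>2) \<partial>\<nu>)"
        using gx g0 by (intro integral_mono) auto
      then show ?thesis using gx by simp
    qed
    also have "\<dots> = lam * (\<integral>\<gamma>. 2 * (x \<bullet> g x i \<gamma>) + ((norm (g x i \<gamma>))\<^sup>2 + (norm (g 0 j \<gamma>))\<^sup>2) \<partial>\<pi>)"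
      unfolding \<nu>_def using integral_scale_measure[OF less_imp_le[OF lam] m] by simp
    finally have J: "2 * (x \<bullet> (\<integral>\<gamma>. g x i \<gamma> \<partial>\<nu>)) + (\<integral>\<gamma>. (norm (g x i \<gamma>))\<^sup>2 \<partial>\<nu>)
        \<le> lam * (\<integral>\<gamma>. 2 * (x \<bullet> g x i \<gamma>) + ((norm (g x i \<gamma>))\<^sup>2 + (norm (g 0 j \<gamma>))\<^sup>2) \<partial>\<pi>)" .
    have "2 * (x \<bullet> b x i) + ((norm (\<sigma> x i))\<^sup>2 + (norm (\<sigma> 0 j))\<^sup>2)
        + lam * (\<integral>\<gamma>. 2 * (x \<bullet> g x i \<gamma>) + ((norm (g x i \<gamma>))\<^sup>2 + (norm (g 0 j \<gamma>))\<^sup>2) \<partial>\<pi>) \<le> - \<beta>' * (norm x)\<^sup>2"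
      using V_generator[of x i 0 j] unfolding coupled_generator_quadratic[OF rates const] unfolding z embed_dist_other[OF ij] power2_norm_eq_inner[symmetric]
      by simp
    moreover have arith: "2 * (a + e) + s + h \<le> c" if "2 * a + (s + s') + q \<le> c" "2 * e + h \<le> q" "0 \<le> s'" for a e s s' h q c :: real
      using that by (simp add: algebra_simps)
    ultimately show ?thesis unfolding inner_add_right by (intro arith[OF _ J zero_le_power2])
  qed

  \<comment> \<open>A is the factor of |x| produced by the coefficients at the origin: the four
    summands come from the drift, the mean jump, the square of the diffusion and the square of the
    jumps. Young's inequality spends \<beta>'/2 of the dissipation on A |x|, leaving \<beta>'/2 = 2
    (\<beta>'/4) and the constant A^2 / (2 \<beta>') in \<open>C0\<close>.\<close>
  define A where "A = 2 * K + 2 * lam * K + 2 * K0 * K + 2 * lam * K0 * K"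
  define C0 where "C0 = A\<^sup>2 / (2 * \<beta>') + K\<^sup>2 + lam * K\<^sup>2"
  have C0: "0 \<le> C0" using beta' lam by (simp add: C0_def)
  have dissipative: "2 * (x \<bullet> (b x i + (\<integral>\<gamma>. g x i \<gamma> \<partial>\<nu>))) + (norm (\<sigma> x i))\<^sup>2 + (\<integral>\<gamma>. (norm (g x i \<gamma>))\<^sup>2 \<partial>\<nu>)
      \<le> - 2 * (\<beta>' / 4) * (norm x)\<^sup>2 + C0" for x i
  proof -
    have S: "2 * (x \<bullet> (b x i - b 0 i + (\<integral>\<gamma>. g x i \<gamma> - g 0 i \<gamma> \<partial>\<nu>))) + (norm (\<sigma> x i - \<sigma> 0 i))\<^sup>2
      + (\<integral>\<gamma>. (norm (g x i \<gamma> - g 0 i \<gamma>))\<^sup>2 \<partial>\<nu>) \<le> - \<beta>' * (norm x)\<^sup>2"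
      using gen_same[of x 0 i] by (simp add: norm_embed_vec)
    have L: "norm (g x i \<gamma> - g 0 i \<gamma>) \<le> K0 * norm x" "norm (g 0 i \<gamma>) \<le> K" "norm (g x i \<gamma>) \<le> K * (1 + norm x)" if "\<gamma> \<in> marks" for \<gamma>
      using lipschitz(2)[of \<gamma> x i 0] growth(3)[of \<gamma> 0 i] growth(3)[of \<gamma> x i] that by (auto simp: space_\<nu>)
    have "(\<integral>\<gamma>. g x i \<gamma> - g 0 i \<gamma> \<partial>\<nu>) = (\<integral>\<gamma>. g x i \<gamma> \<partial>\<nu>) - (\<integral>\<gamma>. g 0 i \<gamma> \<partial>\<nu>)"
      using nu.bounded_integrable_power(1)[OF g_nu L(3)] nu.bounded_integrable_power(1)[OF g_nu L(2)]
      by (rule Bochner_Integration.integral_diff)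
    then have split: "x \<bullet> (b x i - b 0 i + (\<integral>\<gamma>. g x i \<gamma> - g 0 i \<gamma> \<partial>\<nu>))
       = x \<bullet> (b x i + (\<integral>\<gamma>. g x i \<gamma> \<partial>\<nu>)) - x \<bullet> b 0 i - x \<bullet> (\<integral>\<gamma>. g 0 i \<gamma> \<partial>\<nu>)"
      by (simp add: inner_add_right inner_diff_right)
    have b0: "x \<bullet> b 0 i \<le> norm x * K"
      using norm_cauchy_schwarz[of x "b 0 i"] mult_left_mono[OF growth(1)[of 0 i], of "norm x"] by simp
    have "norm (\<integral>\<gamma>. g 0 i \<gamma> \<partial>\<nu>) \<le> K * lam"
      using nu.bounded_integrable_power(3)[OF g_nu L(2)] by (simp add: space_\<nu> m\<nu>)
    from mult_left_mono[OF this, of "norm x"] have g0: "x \<bullet> (\<integral>\<gamma>. g 0 i \<gamma> \<partial>\<nu>) \<le> norm x * (K * lam)"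
      using norm_cauchy_schwarz[of x "\<integral>\<gamma>. g 0 i \<gamma> \<partial>\<nu>"] by simp
    have s0: "(norm (\<sigma> x i))\<^sup>2 \<le> (norm (\<sigma> x i - \<sigma> 0 i))\<^sup>2 + (2 * (K0 * norm x) * K + K\<^sup>2)"
    proof -
      have "(norm (\<sigma> x i))\<^sup>2 = (norm (\<sigma> x i - \<sigma> 0 i))\<^sup>2 + 2 * ((\<sigma> x i - \<sigma> 0 i) \<bullet> \<sigma> 0 i) + (norm (\<sigma> 0 i))\<^sup>2"
        by (simp add: power2_norm_eq_inner algebra_simps inner_commute)
      moreover have "norm (\<sigma> 0 i) \<le> K" using growth(2)[of 0 i] by simp
      moreover have "(\<sigma> x i - \<sigma> 0 i) \<bullet> \<sigma> 0 i \<le> (K0 * norm x) * K"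
        using norm_cauchy_schwarz[of "\<sigma> x i - \<sigma> 0 i" "\<sigma> 0 i"] mult_mono[of "norm (\<sigma> x i - \<sigma> 0 i)" "K0 * norm x" "norm (\<sigma> 0 i)" K]
          \<sigma>_lip[of x i 0] \<open>norm (\<sigma> 0 i) \<le> K\<close> K0 by simp
      moreover have "(norm (\<sigma> 0 i))\<^sup>2 \<le> K\<^sup>2" using \<open>norm (\<sigma> 0 i) \<le> K\<close> by (intro power_mono) auto
      ultimately show ?thesis by simp
    qed
    have j0: "(\<integral>\<gamma>. (norm (g x i \<gamma>))\<^sup>2 \<partial>\<nu>) \<le> (\<integral>\<gamma>. (norm (g x i \<gamma> - g 0 i \<gamma>))\<^sup>2 \<partial>\<nu>) + (2 * (K0 * norm x) * K + K\<^sup>2) * lam"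
      using nu.quadratic_perturbation[OF g_nu L(1) g_nu L(2) K] by (simp add: space_\<nu> m\<nu>)
    have young: "A * norm x \<le> \<beta>' / 2 * (norm x)\<^sup>2 + A\<^sup>2 / (2 * \<beta>')"
    proof -
      have "0 \<le> (\<beta>' * norm x - A)\<^sup>2" by simp
      then have "(A * norm x) * (2 * \<beta>') \<le> \<beta>'\<^sup>2 * (norm x)\<^sup>2 + A\<^sup>2" by (simp add: power2_diff power_mult_distrib mult.commute mult.left_commute)
      then have "A * norm x \<le> (\<beta>'\<^sup>2 * (norm x)\<^sup>2 + A\<^sup>2) / (2 * \<beta>')" using beta' by (simp add: pos_le_divide_eq)
      also have "\<dots> = \<beta>' / 2 * (norm x)\<^sup>2 + A\<^sup>2 / (2 * \<beta>')" using beta' by (simp add: add_divide_distrib power2_eq_square)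
      finally show ?thesis .
    qed
    have "A * norm x + K\<^sup>2 + lam * K\<^sup>2 = 2 * (norm x * K) + 2 * (norm x * (K * lam)) + (2 * (K0 * norm x) * K + K\<^sup>2) + (2 * (K0 * norm x) * K + K\<^sup>2) * lam"
      by (simp add: A_def algebra_simps)
    then show ?thesis using S b0 g0 s0 j0 young unfolding split C0_def by (simp add: algebra_simps)
  qed

  have moment: "integrable M (\<lambda>\<omega>. (norm (X x i t \<omega>))\<^sup>2) \<and> expectation (\<lambda>\<omega>. (norm (X x i t \<omega>))\<^sup>2) \<le> (norm x)\<^sup>2 + C0 / (2 * (\<beta>' / 4))"
    if t: "0 \<le> t" for x i t
  proof (cases "t = 0")
    \<comment> \<open>The moment bound needs a positive horizon for its meshes; at time 0 the
      solution equals its starting point almost surely.\<close>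
    case True
    have AE: "AE \<omega> in M. (norm (X x i t \<omega>))\<^sup>2 = (norm x)\<^sup>2" using start[of x i] True by auto
    have m: "(\<lambda>\<omega>. (norm (X x i t \<omega>))\<^sup>2) \<in> borel_measurable M" using XM[OF t] by measurable
    have "integrable M (\<lambda>\<omega>. (norm (X x i t \<omega>))\<^sup>2)" using integrable_cong_AE[OF m _ AE] by simp
    moreover have "expectation (\<lambda>\<omega>. (norm (X x i t \<omega>))\<^sup>2) = (norm x)\<^sup>2" using integral_cong_AE[OF m _ AE] by (simp add: prob_space)
    ultimately show ?thesis using C0 beta' by simp
  next
    case False
    then have t': "0 < t" using t by simp
    have b4: "0 < \<beta>' / 4" using beta' by simp
    \<comment> \<open>With c = 0 the second solution disappears, so the same solution can stand in
      its place.\<close>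
    note B = second_moment_bound[OF sol[of x i] sol[of x i] t' b4 C0, of 0, simplified, OF dissipative[simplified]]
    have "exp (- (\<beta>' * t / 2)) * (norm x)\<^sup>2 \<le> 1 * (norm x)\<^sup>2" using beta' t by (intro mult_right_mono) auto
    then show ?thesis using B by (simp add: algebra_simps)
  qed

  have tail: "\<exists>R>0. \<forall>t\<ge>0. prob {\<omega>\<in>space M. R \<le> norm (X x i t \<omega>)} < \<epsilon>" if e: "0 < \<epsilon>" for x i \<epsilon>
  proof -
    define B where "B = (norm x)\<^sup>2 + C0 / (2 * (\<beta>' / 4))"
    \<comment> \<open>The summand 1 makes R at least 1, so R^2 \<ge> R in Chebyshev's bound, and
      makes B < R \<epsilon> strict.\<close>
    define R where "R = B / \<epsilon> + 1"
    have B0: "0 \<le> B" using C0 beta' by (simp add: B_def)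
    have R1: "1 \<le> R" using B0 e by (simp add: R_def)
    have Re: "B < R * \<epsilon>" using e by (simp add: R_def field_simps)
    have "prob {\<omega>\<in>space M. R \<le> norm (X x i t \<omega>)} < \<epsilon>" if t: "0 \<le> t" for t
    proof -
      note m = moment[OF t, of x i, folded B_def]
      have "prob {\<omega>\<in>space M. R \<le> norm (X x i t \<omega>)} \<le> expectation (\<lambda>\<omega>. (norm (X x i t \<omega>))\<^sup>2) / R\<^sup>2"
        using m R1 by (intro second_moment_tail XM t) auto
      also have "\<dots> \<le> B / R\<^sup>2" using m by (intro divide_right_mono) auto
      also have "\<dots> \<le> B / R"
        using B0 R1 self_le_power[of R 2] by (intro divide_left_mono) auto
      also have "\<dots> < \<epsilon>" using Re R1 by (simp add: pos_divide_less_eq mult.commute)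
      finally show ?thesis .
    qed
    then show ?thesis using R1 by (intro exI[of _ R]) auto
  qed

  define D where "D x i y j t \<omega> = embed_vec (\<alpha> x i t \<omega>) (X x i t \<omega>) - embed_vec (\<alpha> y j t \<omega>) (X y j t \<omega>)" for x i y j t \<omega>
  have EM: "(\<lambda>\<omega>. embed_vec (\<alpha> x i t \<omega>) (X x i t \<omega>)) \<in> borel_measurable M" if "0 \<le> t" for x i t
    by (rule measurable_compose_countable[where f = "\<lambda>k \<omega>. embed_vec k (X x i t \<omega>)", OF measurable_compose[OF XM[OF that] embed_vec_measurable] \<alpha>M[OF that]])
  have DM: "D x i y j t \<in> borel_measurable M" if "0 \<le> t" for x i y j t
    unfolding D_def[abs_def] by (intro borel_measurable_diff EM that)
  \<comment> \<open>4 R^2 serves both cases: 2 R^2 + 2 R^2 for two decaying solutions and (2 R)^2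
    for the difference of the starting points.\<close>
  have contraction: "integrable M (\<lambda>\<omega>. (norm (D x i y j t \<omega>))\<^sup>2) \<and> expectation (\<lambda>\<omega>. (norm (D x i y j t \<omega>))\<^sup>2) \<le> exp (- \<beta>' * t) * (4 * R\<^sup>2)"
    if t: "0 < t" and R: "norm x \<le> R" "norm y \<le> R" for x y i j t R
  proof -
    have b2: "0 < \<beta>' / 2" using beta' by simp
    have xR: "(norm x)\<^sup>2 \<le> R\<^sup>2" "(norm y)\<^sup>2 \<le> R\<^sup>2" using R by (auto intro!: power_mono)
    show ?thesis
    proof (cases "\<exists>k l::'m. k \<noteq> l")
      case True
      \<comment> \<open>Each regime has another one as a partner, so \<open>gen_origin\<close>
        applies in every regime and the moment bound holds with \<open>C0 = 0\<close>.\<close>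
      then have "\<exists>l. k \<noteq> l" for k :: 'm by metis
      then have org: "2 * (x \<bullet> (b x i + (\<integral>\<gamma>. g x i \<gamma> \<partial>\<nu>))) + (norm (\<sigma> x i))\<^sup>2 + (\<integral>\<gamma>. (norm (g x i \<gamma>))\<^sup>2 \<partial>\<nu>) \<le> - (\<beta>' * (norm x)\<^sup>2)" for x i
        using gen_origin[of i _ x] by fastforce
      have B: "integrable M (\<lambda>\<omega>. (norm (X v k t \<omega>))\<^sup>2)" "expectation (\<lambda>\<omega>. (norm (X v k t \<omega>))\<^sup>2) \<le> exp (- (\<beta>' * t)) * (norm v)\<^sup>2" for v k
        using second_moment_bound[OF sol[of v k] sol[of v k] t b2 order_refl, of 0, simplified, OF org] by auto
      have pt: "(norm (D x i y j t \<omega>))\<^sup>2 \<le> 2 * (norm (X x i t \<omega>))\<^sup>2 + 2 * (norm (X y j t \<omega>))\<^sup>2" for \<omega>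
      proof -
        have "(norm (u - v))\<^sup>2 \<le> 2 * (norm u)\<^sup>2 + 2 * (norm v)\<^sup>2" for u v :: "real^('m \<times> 'r)"
          using zero_le_power2[of "norm (u + v)"] by (simp add: power2_norm_eq_inner algebra_simps inner_commute)
        from this[of "embed_vec (\<alpha> x i t \<omega>) (X x i t \<omega>)" "embed_vec (\<alpha> y j t \<omega>) (X y j t \<omega>)"] show ?thesis
          by (simp only: D_def norm_embed_vec)
      qed
      have i2: "integrable M (\<lambda>\<omega>. 2 * (norm (X x i t \<omega>))\<^sup>2 + 2 * (norm (X y j t \<omega>))\<^sup>2)" using B(1) by simp
      have i1: "integrable M (\<lambda>\<omega>. (norm (D x i y j t \<omega>))\<^sup>2)"
        by (rule Bochner_Integration.integrable_bound[OF i2]) (use pt DM[of t x i y j] t in \<open>auto intro!: AE_I2 order_trans[OF _ abs_ge_self]\<close>)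
      have "expectation (\<lambda>\<omega>. (norm (D x i y j t \<omega>))\<^sup>2) \<le> expectation (\<lambda>\<omega>. 2 * (norm (X x i t \<omega>))\<^sup>2 + 2 * (norm (X y j t \<omega>))\<^sup>2)"
        by (rule integral_mono[OF i1 i2 pt])
      also have "\<dots> = 2 * expectation (\<lambda>\<omega>. (norm (X x i t \<omega>))\<^sup>2) + 2 * expectation (\<lambda>\<omega>. (norm (X y j t \<omega>))\<^sup>2)" using B(1) by simp
      also have "\<dots> \<le> 2 * (exp (- (\<beta>' * t)) * R\<^sup>2) + 2 * (exp (- (\<beta>' * t)) * R\<^sup>2)"
        using B(2)[of x i] B(2)[of y j] mult_left_mono[OF xR(1), of "exp (- (\<beta>' * t))"] mult_left_mono[OF xR(2), of "exp (- (\<beta>' * t))"] exp_ge_zero[of "- (\<beta>' * t)"] by linarith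
      finally show ?thesis using i1 by (simp add: ac_simps)
    next
      case False
      then have one: "k = l" for k l :: 'm by blast
      have gen: "2 * ((u - v) \<bullet> (b u k - b v l + (\<integral>\<gamma>. g u k \<gamma> - g v l \<gamma> \<partial>\<nu>))) + (norm (\<sigma> u k - \<sigma> v l))\<^sup>2
        + (\<integral>\<gamma>. (norm (g u k \<gamma> - g v l \<gamma>))\<^sup>2 \<partial>\<nu>) \<le> - (\<beta>' * (norm (u - v))\<^sup>2)" for u v k l
      proof -
        have "(norm (embed_vec k' u - embed_vec l' v))\<^sup>2 = (norm (embed_vec l u - embed_vec l v))\<^sup>2" for k' l' :: 'm
          unfolding one[of k' l] one[of l' l] ..
        from gen_same[OF this] show ?thesis unfolding one[of k l] by simp
      qed
      \<comment> \<open>With c = 1 the bound concerns the difference of the two solutions; with a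
        single regime this is also the difference of the embedded processes up to an
        isometry.\<close>
      note B = second_moment_bound[OF sol[of x i] sol[of y j] t b2 order_refl, of 1, simplified, OF gen]
      have nD: "(norm (D x i y j t \<omega>))\<^sup>2 = (norm (X x i t \<omega> - X y j t \<omega>))\<^sup>2" for \<omega>
        unfolding D_def one[of "\<alpha> x i t \<omega>" "\<alpha> y j t \<omega>"] by (rule embed_dist_same)
      have "norm (x - y) \<le> 2 * R" using norm_triangle_ineq4[of x y] R by simp
      then have "(norm (x - y))\<^sup>2 \<le> (2 * R)\<^sup>2" by (intro power_mono) auto
      then have "exp (- (\<beta>' * t)) * (norm (x - y))\<^sup>2 \<le> exp (- \<beta>' * t) * (4 * R\<^sup>2)"
        by (simp add: power_mult_distrib)
      then show ?thesis using B unfolding nD by (intro conjI order_trans[OF B(2)])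
    qed
  qed
  have coupling: "\<exists>T>0. \<forall>t\<ge>T. \<forall>x\<in>C. \<forall>y\<in>C. \<forall>i j. integrable M (\<lambda>\<omega>. norm (D x i y j t \<omega>)) \<and> expectation (\<lambda>\<omega>. norm (D x i y j t \<omega>)) < \<epsilon>"
    if e: "0 < \<epsilon>" and C: "compact C" for \<epsilon> and C :: "(real^'r) set"
  proof -
    obtain R where R: "\<And>x. x \<in> C \<Longrightarrow> norm x \<le> R" using compact_imp_bounded[OF C] unfolding bounded_iff by blast
    \<comment> \<open>The exponential is compared with its exponent: \<beta>' t \<le> exp (\<beta>'
      t) reduces the claim to 4 R^2 < \<epsilon>^2 \<beta>' T. The summand 1 makes this strict and T
      positive.\<close>
    define T where "T = 4 * R\<^sup>2 / (\<beta>' * \<epsilon>\<^sup>2) + 1"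
    have T0: "0 < T" using beta' e by (simp add: T_def add_nonneg_pos)
    have small: "exp (- \<beta>' * t) * (4 * R\<^sup>2) < \<epsilon>\<^sup>2" if "T \<le> t" for t
    proof -
      have "4 * R\<^sup>2 < \<epsilon>\<^sup>2 * (\<beta>' * T)" using beta' e by (simp add: T_def field_simps)
      also have "\<dots> \<le> \<epsilon>\<^sup>2 * exp (\<beta>' * t)"
      proof (rule mult_left_mono)
        have "\<beta>' * T \<le> \<beta>' * t" using that beta' by (intro mult_left_mono) auto
        then show "\<beta>' * T \<le> exp (\<beta>' * t)" using exp_ge_add_one_self[of "\<beta>' * t"] by linarith
      qed simp
      finally have "exp (- \<beta>' * t) * (4 * R\<^sup>2) < exp (- \<beta>' * t) * (\<epsilon>\<^sup>2 * exp (\<beta>' * t))" by (intro mult_strict_left_mono) auto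
      also have "\<dots> = \<epsilon>\<^sup>2" by (simp add: exp_minus)
      finally show ?thesis .
    qed
    have "integrable M (\<lambda>\<omega>. norm (D x i y j t \<omega>)) \<and> expectation (\<lambda>\<omega>. norm (D x i y j t \<omega>)) < \<epsilon>"
      if "T \<le> t" "x \<in> C" "y \<in> C" for t x y i j
    proof -
      have t: "0 < t" using that(1) T0 by simp
      note c = contraction[OF t R[OF that(2)] R[OF that(3)], of i j]
      have "expectation (\<lambda>\<omega>. (norm (D x i y j t \<omega>))\<^sup>2) < \<epsilon>\<^sup>2" using c small[OF that(1)] by linarith
      with first_moment_less[OF DM[OF less_imp_le[OF t]] conjunct1[OF c] e] show ?thesis by blast
    qed
    then show ?thesis using T0 by blast
  qed
  show ?thesis using tail coupling unfolding D_def by blast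
qed

end
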